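(* Let $P$ be a set of $m$ points and $C$ a set of $n$ circles in $\mathbb{R}^3$, so that no plane or sphere contains more than $q$ circles of $C$. Then $$ I(P,C) = O\left( m^{3/7}n^{6/7} + m^{2/3}n^{1/3}q^{1/3} + m^{6/11}n^{5/11}q^{4/11}\log^{2/11}(m^3/q) + m + n \right) . $$
   Context: $I(P,C)$ denotes the number of incidences, i.e., of pairs $(p,\gamma)\in P\times C$ with $p\in\gamma$. Here $q\ge 1$ and the constant of proportionality is absolute. The factor $\log(m^3/q)$ is to be read as $\log(\max(2,m^3/q))$. *)

theory Defs
  imports "HOL-Analysis.Analysis"
begin

definition is_plane :: "(real^3) set \<Rightarrow> bool" where
  "is_plane S \<longleftrightarrow> affine S \<and> aff_dim S = 2"

definition is_sphere :: "(real^3) set \<Rightarrow> bool" where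
  "is_sphere S \<longleftrightarrow> (\<exists>c r. r > 0 \<and> S = sphere c r)"

definition is_circle :: "(real^3) set \<Rightarrow> bool" where
  "is_circle \<gamma> \<longleftrightarrow> (\<exists>S c r. is_plane S \<and> c \<in> S \<and> r > 0 \<and> \<gamma> = S \<inter> sphere c r)"

definition incidences :: "(real^3) set \<Rightarrow> (real^3) set set \<Rightarrow> nat" where
  "incidences P C = card {(p, \<gamma>) \<in> P \<times> C. p \<in> \<gamma>}"

(* The logarithm is natural; a change of base only affects the implied constant.
   Truncating its argument at 2 keeps the factor positive when m^3 / q is small. *)
definition incidence_bound :: "real \<Rightarrow> real \<Rightarrow> real \<Rightarrow> real" where
  "incidence_bound m n q =
     m powr (3/7) * n powr (6/7)
     + m powr (2/3) * n powr (1/3) * q powr (1/3)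
     + m powr (6/11) * n powr (5/11) * q powr (4/11) * (ln (max 2 (m^3 / q))) powr (2/11)
     + m + n"

end

(* Polynomial partitioning comes from a discrete ham sandwich theorem, hence from the oddness of the
degree of odd maps of spheres. Three points determine a circle, so the cells of a partitioning polynomial f
account for the circles that are not contained in the zero set of f. For a point p on a circle inside the zero
set, compare the orders to which f vanishes at p and along the circle in a generic direction: they differ
O(deg f) times per circle, and otherwise the circle lies on the zero set of a derivative g of f that depends
on p only and has nonzero gradient at p. Expanding along circles to fourth order shows that at most 22 of them
pass through p inside this surface, unless p is umbilic, in which case all of them lie on one osculating
plane or sphere. That plane or sphere is the same for all umbilic points of a circle with many of them, as a
Wronskian vanishes too often. There remain incidences in distinct planes and spheres, with at most q
circles each and with disjoint sets of points and of circles. Inversion turns them into incidences with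
circles in the plane. There, consecutive points on a circle span arcs, and two arcs with the same end points
form a lens; lenses reverse cyclic orders, and the argument of Marcus and Tardos for pseudo-circles bounds their
number, applied to the cells of a partition of the space of circles. Hoelder's inequality sums the planar bounds. *)

theory Submission
  imports Defs "HOL-Homology.Homology" "HOL-Computational_Algebra.Computational_Algebra" "HOL-Real_Asymp.Real_Asymp"
begin

text \<open>No algebraic geometry of components enters: a polynomial is only ever restricted to a
  line or to a rationally parametrised circle, where it has one variable and its roots can be
  counted. The obstacle is that a partitioning polynomial may have multiple factors, so that its
  gradient vanishes along whole circles. Iterated derivatives in one fixed direction take the place
  of a square-free part; the device returns in the plane and, a third time, for lines in the
  three-dimensional space of planar circles. The constant 22 is 2 times 11: eliminating the geodesic
  curvature leaves a form of degree 10 in the direction, one direction is lost by dehomogenising,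
  and each direction admits at most two curvatures. In space, degree D costs D n + m + m^3/D^6,
  balanced at D^7 = m^3/n. In the plane two degrees are free, D for points and r for circles;
  balancing n D, r m^2/D^2 and the lens term n (n/r^3)^(1/2) log yields m^(2/3) n^(2/3) + m^(6/11)
  n^(9/11) log^(2/11). At most q circles per surface absorb the powers of n that are too high for
  Hoelder's inequality.\<close>

notation scaleR (infixr "*R" 75)

lemmas ring_sq = algebra_simps power2_eq_square
lemmas field_sq = field_simps power2_eq_square

abbreviation flags :: "'a set => 'a set set => ('a\<times>'a set) set" where
 "flags P C \<equiv> {(p, g) \<in> P\<times>C. p \<in> g}"

abbreviation surface_flags :: "(real^3) set => (real^3) set set => ((real^3)\<times>(real^3) set) set => (real^3 => (real^3) set) => ((real^3) set => (real^3) set) => bool" where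
 "surface_flags P C I s t \<equiv> \<forall>p g. (p, g) \<in> I --> p \<in> P \<and> g \<in> C \<and> p \<in> g \<and> s p = t g \<and> (is_plane (t g) \<or> is_sphere (t g)) \<and> g \<subseteq> t g"

abbreviation path_invariant :: "('a::topological_space => real) => ('a => 'b) => bool" where
 "path_invariant F z \<equiv> \<forall>g a b. a \<le> b \<and> continuous_on {a..b::real} g \<and> (\<forall>t\<in>{a..b}. F (g t) ~= 0) --> z (g a) = z (g b)"

abbreviation small_cells :: "real => nat => 'a set => ('a => real) => ('a => 'b) => bool" where
 "small_cells D k S F z \<equiv> \<forall>p. F p ~= 0 --> D^k * card {q\<in>S. z q = z p} \<le> 2 * card S"

section \<open>Degrees of odd piecewise linear maps of spheres\<close>

text \<open>Coordinates beyond \<open>j\<close> are set to 0 because \<open>nsphere j\<close> lives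
  in the full product space of all real sequences.\<close>

definition radial :: "nat => ((nat => real) => nat => real) => (nat => real) => nat => real" where
 "radial j g x = (\<lambda>i. if i \<le> j then g x i/sqrt (\<Sum>l\<le>j. (g x l)\<^sup>2) else 0)"

lemma sum_squares_pos:
 fixes y :: "nat => real"
 assumes "\<exists>i\<le>j. y i ~= 0"
 shows "(\<Sum>l\<le>j. (y l)\<^sup>2) > 0"
proof -
 obtain i where "i \<le> j" "y i ~= 0" using assms by blast
 then show ?thesis by (intro sum_pos2[of _ i]) auto
qed

lemma nsphere_nonzero:
 assumes "x \<in> topspace (nsphere j)"
 shows "\<exists>i\<le>j. x i ~= 0"
proof (rule ccontr)
 assume "\<not> ?thesis"
 then have "(\<Sum>i\<le>j. (x i)\<^sup>2) = 0" by simp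
 then show False using assms by (simp add: nsphere)
qed

lemma continuous_map_radial:
 assumes "!!i. i \<le> j ==> continuous_map X euclideanreal (\<lambda>x. g x i)"
  and nz: "!!x. x \<in> topspace X ==> \<exists>i\<le>j. g x i ~= 0"
 shows "continuous_map X (nsphere j) (\<lambda>x i. if i \<le> j then g x i/sqrt (\<Sum>l\<le>j. (g x l)\<^sup>2) else 0)"
proof -
 let ?A = "\<lambda>x. \<Sum>l\<le>j. (g x l)\<^sup>2"
 have pos: "(?A x) > 0" if "x \<in> topspace X" for x using sum_squares_pos[OF nz[OF that]] .
 have c: "continuous_map X euclideanreal (\<lambda>x. sqrt (?A x))" using assms(1) by (intro continuous_intros) auto
 have c1: "continuous_map X euclideanreal (\<lambda>x. if i \<le> j then g x i/sqrt (?A x) else 0)" for i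
 proof (cases "i \<le> j")
  case True
  then show ?thesis using assms(1)[OF True] c pos by (auto intro!: continuous_map_real_divide simp: less_imp_neq[symmetric])
 qed simp
 have "(\<Sum>i\<le>j. (if i \<le> j then g x i/sqrt (?A x) else 0)\<^sup>2) = 1" if "x \<in> topspace X" for x
 proof -
  have "(\<Sum>i\<le>j. (if i \<le> j then g x i/sqrt (?A x) else 0)\<^sup>2) = (\<Sum>i\<le>j. (g x i)\<^sup>2/(?A x))"
   using pos[OF that] by (intro sum.cong) (auto simp: power_divide)
  also have "... = 1" using pos[OF that] by (simp flip: sum_divide_distrib)
  finally show ?thesis .
 qed
 then show ?thesis unfolding nsphere continuous_map_in_subtopology using c1 by (auto simp: continuous_map_componentwise_UNIV)
qed

lemma radial_homotopy:
 assumes c: "!!i. i \<le> j ==> continuous_map (prod_topology (top_of_set {0..1}) (nsphere j)) euclideanreal (\<lambda>z. H (fst z) (snd z) i)"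
  and nz: "!!t x. [|0 \<le> t; t \<le> 1; x \<in> topspace (nsphere j)|] ==> \<exists>i\<le>j. H t x i ~= (0::real)"
 shows "Brouwer_degree2 j (radial j (H (0::real))) = Brouwer_degree2 j (radial j (H 1))"
proof (rule Brouwer_degree2_homotopic)
 have "continuous_map (prod_topology (top_of_set {0..1}) (nsphere j)) (nsphere j)
   (\<lambda>z. radial j (H (fst z)) (snd z))"
  unfolding radial_def
  by (rule continuous_map_radial[where g = "\<lambda>z. H (fst z) (snd z)"]) (use c nz in auto)
 then show "homotopic_with (\<lambda>x. True) (nsphere j) (nsphere j) (radial j (H 0)) (radial j (H 1))" unfolding homotopic_with_def
  by (intro exI[of _ "\<lambda>z. radial j (H (fst z)) (snd z)"]) auto
qed

text \<open>A substitute for piecewise linearity that forgets the pieces and records only the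
  finitely many candidate forms. It suffices to place the image of a hyperplane inside finitely many
  hyperplanes, and it is stable under \<open>min\<close>, \<open>max\<close> and absolute values.
  Continuity is stated separately.\<close>

definition finsel :: "nat => ((nat => real) => real) => bool" where
 "finsel n f \<longleftrightarrow> (\<exists>C. finite C \<and> (\<forall>x. \<exists>c\<in>C. f x = (\<Sum>i<n. c i*x i)))"

lemma finsel_linear: "finsel n (\<lambda>x. \<Sum>i<n. c i*x i)"
 unfolding finsel_def by (rule exI[of _ "{c}"]) auto

lemma finsel_0: "finsel n (\<lambda>x. 0)"
 using finsel_linear[of n "\<lambda>_. 0"] by simp

lemma finsel_coord: "i < n ==> finsel n (\<lambda>x. x i)"
 using finsel_linear[of n "\<lambda>l. if l = i then 1 else 0"] by (simp add: if_distrib[of "\<lambda>u. u * _"] cong: if_cong)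

lemma finsel_comb:
 assumes "finsel n f" "finsel n g"
 shows "finsel n (\<lambda>x. a*f x + b*g x)"
proof -
 obtain C D where C: "finite C" "\<forall>x. \<exists>c\<in>C. f x = (\<Sum>i<n. c i*x i)"
  and D: "finite D" "\<forall>x. \<exists>c\<in>D. g x = (\<Sum>i<n. c i*x i)"
  using assms unfolding finsel_def by blast
 let ?A = "\<lambda>(c,d) i. a * c i + b*d i"
 show ?thesis unfolding finsel_def
 proof (intro exI conjI allI)
  show "finite (?A ` (C\<times>D))" using C D by auto
  fix x
  obtain c d where "c \<in> C" "f x = (\<Sum>i<n. c i*x i)" "d \<in> D" "g x = (\<Sum>i<n. d i*x i)"
   using C D by blast
  then show "\<exists>e\<in>?A ` (C\<times>D). a*f x + b*g x = (\<Sum>i<n. e i*x i)" by (intro bexI[of _ "\<lambda>i. a * c i + b*d i"])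
    (auto simp: sum.distrib sum_distrib_left algebra_simps intro!: image_eqI[of _ _ "(c,d)"])
 qed
qed

lemma finsel_choice:
 assumes "finsel n f" "finsel n g" "!!x. h x = f x \<or> h x = g x"
 shows "finsel n h"
proof -
 obtain C D where "finite C" "\<forall>x. \<exists>c\<in>C. f x = (\<Sum>i<n. c i*x i)"
  and "finite D" "\<forall>x. \<exists>c\<in>D. g x = (\<Sum>i<n. c i*x i)"
  using assms unfolding finsel_def by blast
 then show ?thesis unfolding finsel_def using assms(3) by (intro exI[of _ "C\<union>D"]) (metis Un_iff finite_Un)
qed

lemma finsel_sum:
 assumes "finite A" "!!a. a \<in> A ==> finsel n (f a)"
 shows "finsel n (\<lambda>x. \<Sum>a\<in>A. f a x)"
 using assms
proof (induction A rule: finite_induct)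
 case (insert a A)
 then show ?case using finsel_comb[of n "f a" "\<lambda>x. \<Sum>a\<in>A. f a x" 1 1] by simp
qed (simp add: finsel_0)

text \<open>Elimination of the last unknown by a pivot equation \<open>e\<close>. It supplies a
  vector normal to the image of the equator under each choice of linear forms.\<close>

lemma underdetermined_system:
 fixes E :: "'e => nat => real"
 assumes "finite F" "card F < n"
 shows "\<exists>N. (\<exists>i<n. N i ~= 0) \<and> (\<forall>e\<in>F. (\<Sum>i<n. N i*E e i) = 0)"
 using assms
proof (induction n arbitrary: F E)
 case 0
 then show ?case by (elim less_zeroE)
next
 case (Suc n)
 show ?case
 proof (cases "\<forall>e\<in>F. E e n = 0")
  case True
  then show ?thesis by (intro exI[of _ "\<lambda>i. if i = n then 1 else 0"]) (auto simp: if_distrib[of "\<lambda>u. u * _"] cong: if_cong)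
 next
  case False
  then obtain e where e: "e \<in> F" "E e n ~= 0" by blast
  define E' where "E' f i = E f i - E f n/E e n*E e i" for f i
  have "card (F - {e}) < n" "finite (F - {e})" using Suc.prems e card_Suc_Diff1[of F e] by (auto simp del: card_Diff_insert)
  from Suc.IH[OF this(2,1), of E'] obtain N where N: "\<exists>i<n. N i ~= 0" "\<forall>f\<in>F - {e}. (\<Sum>i<n. N i*E' f i) = 0" by blast
  define s where "s = (\<Sum>i<n. N i*E e i)"
  define m where "m i = (if i = n then - s/E e n else N i)" for i
  let ?A = "\<lambda>f. \<Sum>i<Suc n. m i*E f i"
  have sum: "(?A f) = (\<Sum>i<n. N i*E f i) - s/E e n*E f n" for f by (simp add: m_def)
  have "(?A f) = 0" if "f \<in> F" for f
  proof (cases "f = e")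
   case True
   then show ?thesis using e(2) by (simp only: sum) (simp add: s_def)
  next
   case False
   then have "0 = (\<Sum>i<n. N i*E' f i)" using N that by auto
   also have "... = (\<Sum>i<n. N i*E f i) - E f n/E e n * s" by (simp add: E'_def s_def algebra_simps sum_subtractf sum_distrib_left)
   finally show ?thesis by (simp only: sum) (simp add: field_simps)
  qed
  then have A: "\<forall>f\<in>F. (?A f) = 0" ..
  obtain i where "i < n" "N i ~= 0" using N(1) by blast
  then have "i < Suc n \<and> m i ~= 0" by (simp add: m_def)
  then have "\<exists>i<Suc n. m i ~= 0" ..
  then show ?thesis using A by (intro exI[of _ m] conjI)
 qed
qed

text \<open>A hyperplane meets the moment curve \<open>(1, t, ..., t^j)\<close> in finitely many
  points; dividing by \<open>t^j\<close> normalises the last coordinate.\<close>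

lemma vector_avoiding_hyperplanes:
 fixes V :: "(nat => real) set"
 assumes "finite V" "!!n. n \<in> V ==> \<exists>i\<le>j. n i ~= 0"
 shows "\<exists>a. a j = 1 \<and> (\<forall>n\<in>V. (\<Sum>i\<le>j. n i * a i) ~= 0)"
proof -
 let ?B = "insert 0 (\<Union>n\<in>V. {t. (\<Sum>i\<le>j. n i*t^i) = 0})"
 have "finite {t. (\<Sum>i\<le>j. n i*t^i) = 0}" if "n \<in> V" for n using polyfun_finite_roots[of n j] assms(2)[OF that] by blast
 then have "finite ?B" using assms(1) by blast
 then obtain t where t: "t \<notin> ?B" using ex_new_if_finite[OF infinite_UNIV_char_0] by blast
 have "(\<Sum>i\<le>j. n i*(t^i/t^j)) = (\<Sum>i\<le>j. n i*t^i)/t^j" for n by (simp add: sum_divide_distrib)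
 then show ?thesis using t by (intro exI[of _ "\<lambda>i. t^i/t^j"]) auto
qed

text \<open>Induction on the dimension. The degree step is available only for maps that preserve the
  equator, so \<open>g\<close> is deformed to such a map: the image of the equator lies in finitely
  many hyperplanes and misses the line of some vector \<open>a\<close>. Projecting along
  \<open>a\<close> therefore leaves a nowhere vanishing map on the equator in one coordinate less,
  and damping the last coordinate makes the equator invariant.\<close>

theorem odd_Brouwer_degree2_radial:
 assumes "!!i. i \<le> j ==> continuous_map (powertop_real UNIV) euclideanreal (\<lambda>x. g x i)"
  and "!!i. i \<le> j ==> finsel (Suc j) (\<lambda>x. g x i)"
  and "!!x i. i \<le> j ==> g (\<lambda>l. - x l) i = - g x i"
  and "!!x. \<exists>i\<le>j. x i ~= 0 ==> \<exists>i\<le>j. g x i ~= 0"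
 shows "odd (Brouwer_degree2 j (radial j g))"
 using assms
proof (induction j arbitrary: g)
 case 0
 let ?e = "\<lambda>i::nat. if i = 0 then 1 else (0::real)"
 have top: "x = ?e \<or> x = (\<lambda>i. - ?e i)" if "x \<in> topspace (nsphere 0)" for x
 proof -
  have "(x 0)\<^sup>2 = 1" "\<forall>i>0. x i = 0" using that by (auto simp: nsphere)
  then have "x 0 = 1 \<or> x 0 = -1" by (simp add: power2_eq_1_iff)
  then show ?thesis using \<open>\<forall>i>0. x i = 0\<close> by (auto simp: fun_eq_iff)
 qed
 have nz: "g ?e 0 ~= 0" using "0.prems"(4)[of ?e] by auto
 have odd: "g (\<lambda>i. - ?e i) 0 = - g ?e 0" using "0.prems"(3)[of 0 ?e] by simp
 show ?case
 proof (cases "g ?e 0 > 0")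
  case True
  have "radial 0 g x = id x" if "x \<in> topspace (nsphere 0)" for x using top[OF that] using True odd by (auto simp: radial_def)
  then have "Brouwer_degree2 0 (radial 0 g) = Brouwer_degree2 0 id" by (rule Brouwer_degree2_eq)
  then show ?thesis by simp
 next
  case False
  then have neg: "g ?e 0 < 0" using nz by simp
  have "radial 0 g x = (\<lambda>i. if i = 0 then - x i else x i)" if "x \<in> topspace (nsphere 0)" for x using top[OF that]
   using neg odd by (auto simp: radial_def)
  then have "Brouwer_degree2 0 (radial 0 g) = Brouwer_degree2 0 (\<lambda>x i. if i = 0 then - x i else x i)" by (rule Brouwer_degree2_eq)
  then show ?thesis by (simp add: Brouwer_degree2_reflection)
 qed
next
 case (Suc k)
 let ?j = "Suc k"
 have "\<forall>i\<in>{..?j}. \<exists>C. finite C \<and> (\<forall>x. \<exists>c\<in>C. g x i = (\<Sum>l<Suc ?j. c l*x l))"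
  using Suc.prems(2) unfolding finsel_def by auto
 from bchoice[OF this] obtain C where
  C': "\<forall>i\<in>{..?j}. finite (C i) \<and> (\<forall>x. \<exists>c\<in>C i. g x i = (\<Sum>l<Suc ?j. c l*x l))" ..
 then have C: "!!i. i \<le> ?j ==> finite (C i)"
   "!!i x. i \<le> ?j ==> \<exists>c\<in>C i. g x i = (\<Sum>l<Suc ?j. c l*x l)"
  by (meson atMost_iff)+
 \<comment> \<open>An element of \<open>D\<close> picks one candidate form per coordinate. On the
   equator only \<open>?j\<close> variables survive, against \<open>?j + 1\<close> unknowns, so
   every choice has a normal vector \<open>N c\<close>.\<close>
 define D where "D = Pi\<^sub>E {..?j} C"
 have finD: "finite D" unfolding D_def using C by (intro finite_PiE) auto
 have "\<exists>N. (\<exists>i<Suc ?j. N i ~= 0) \<and> (\<forall>l\<in>{..<?j}. (\<Sum>i<Suc ?j. N i * c i l) = 0)" for c :: "nat => nat => real"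
  by (rule underdetermined_system) auto
 then have "\<forall>c :: nat => nat => real. \<exists>N. (\<exists>i<Suc ?j. N i ~= 0) \<and> (\<forall>l\<in>{..<?j}. (\<Sum>i<Suc ?j. N i * c i l) = 0)"
  by blast
 from choice[OF this] obtain N where N': "\<forall>c :: nat => nat => real. (\<exists>i<Suc ?j. N c i ~= 0) \<and> (\<forall>l\<in>{..<?j}. (\<Sum>i<Suc ?j. N c i * c i l) = 0)" ..
 have N: "\<exists>i<Suc ?j. N c i ~= 0" "l < ?j ==> (\<Sum>i<Suc ?j. N c i * c i l) = 0" for c :: "nat => nat => real" and l
  using spec[OF N', of c] by (blast, blast)
 have "\<exists>i\<le>?j. m i ~= 0" if "m \<in> N ` D" for m using that N(1) by (auto simp: less_Suc_eq_le)
 from vector_avoiding_hyperplanes[OF finite_imageI[OF finD] this]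
 obtain a where a: "a ?j = 1" "!!c. c \<in> D ==> (\<Sum>i\<le>?j. N c i * a i) ~= 0" by blast
 have perp: "\<exists>c\<in>D. (\<Sum>i\<le>?j. N c i*g x i) = 0" if "x ?j = 0" for x
 proof -
  have "\<forall>i\<in>{..?j}. \<exists>c\<in>C i. g x i = (\<Sum>l<Suc ?j. c l*x l)" using C(2) by auto
  from bchoice[OF this[unfolded Bex_def]] obtain c' where
   c': "!!i. i \<le> ?j ==> c' i \<in> C i" "!!i. i \<le> ?j ==> g x i = (\<Sum>l<Suc ?j. c' i l*x l)" by auto
  define c where "c = restrict c' {..?j}"
  have c: "c \<in> D" "!!i. i \<le> ?j ==> g x i = (\<Sum>l<?j. c i l*x l)" using c' that by (auto simp: c_def D_def)
  have "(\<Sum>i\<le>?j. N c i*g x i) = (\<Sum>i\<le>?j. \<Sum>l<?j. N c i * c i l*x l)"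
   using c(2) by (intro sum.cong) (auto simp: sum_distrib_left mult.assoc algebra_simps)
  also have "... = (\<Sum>l<?j. \<Sum>i\<le>?j. N c i * c i l*x l)" by (rule sum.swap)
  also have "... = (\<Sum>l<?j. (\<Sum>i<Suc ?j. N c i * c i l)*x l)"
   by (simp add: sum_distrib_right sum_distrib_left lessThan_Suc_atMost algebra_simps)
  also have "... = 0" using N(2)[of _ c] by (intro sum.neutral) (auto simp del: sum.lessThan_Suc)
  finally show ?thesis using c(1) by blast
 qed
 \<comment> \<open>Projection along \<open>a\<close>. As \<open>a ?j = 1\<close>, vanishing of all
   coordinates below \<open>?j\<close> means that \<open>g x\<close> is the multiple
   \<open>g x ?j\<close> of \<open>a\<close>, which the normal vectors exclude on the
   equator.\<close>
 define h where "h x i = (if i < ?j then g x i - a i*g x ?j else g x i)" for x i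
 have h_eq: "g x i = g x ?j * a i" if "\<forall>i<?j. h x i = 0" "i \<le> ?j" for x i
 proof (cases "i = ?j")
  case False
  then have "h x i = 0" using that by simp
  then show ?thesis using False that by (simp add: h_def)
 qed (use a(1) in simp)
 have equator: "\<exists>i<?j. h x i ~= 0" if xj: "x ?j = 0" and xn: "\<exists>i\<le>?j. x i ~= 0" for x
 proof (rule ccontr)
  assume "\<not> ?thesis"
  then have n: "\<forall>i<?j. h x i = 0" by blast
  obtain c where c: "c \<in> D" "(\<Sum>i\<le>?j. N c i*g x i) = 0" by (rule bexE[OF perp[of x, OF xj]])
  have "(\<Sum>i\<le>?j. N c i*g x i) = g x ?j*(\<Sum>i\<le>?j. N c i * a i)" unfolding sum_distrib_left
  proof (intro sum.cong refl)
   fix i assume "i \<in> {..?j}"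
   then have "g x i = g x ?j * a i" by (intro h_eq[OF n]) simp
   then show "N c i*g x i = g x ?j*(N c i * a i)" by (metis mult.left_commute)
  qed
  then have z: "g x ?j = 0" using c(2) a(2)[OF c(1)] by (metis mult_eq_0_iff)
  have "g x i = 0" if "i \<le> ?j" for i using h_eq[OF n that] z by (metis mult_zero_left)
  then show False using Suc.prems(4)[OF xn] by blast
 qed
 have g_sph: "continuous_map (prod_topology (top_of_set {0..1}) (nsphere ?j)) euclideanreal (\<lambda>z. g (snd z) i)"
  if "i \<le> ?j" for i
 proof -
  have "continuous_map (nsphere ?j) euclideanreal (\<lambda>x. g x i)"
   unfolding nsphere by (rule continuous_map_from_subtopology[OF Suc.prems(1)[OF that]])
  from continuous_map_compose[OF continuous_map_snd this] show ?thesis by (simp add: o_def)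
 qed
 have fst_sph: "continuous_map (prod_topology (top_of_set {0..1}) (nsphere ?j)) euclideanreal fst"
  by (rule continuous_map_into_fulltopology[OF continuous_map_fst])
 have coord_sph: "continuous_map (prod_topology (top_of_set {0..1}) (nsphere ?j)) euclideanreal (\<lambda>z. snd z i)" for i
  using continuous_map_compose[OF continuous_map_snd continuous_map_nsphere_projection[of ?j i]] by (simp add: o_def)
 have h_sph: "continuous_map (prod_topology (top_of_set {0..1}) (nsphere ?j)) euclideanreal (\<lambda>z. h (snd z) i)"
  if "i \<le> ?j" for i
  using that unfolding h_def by (cases "i < ?j") (auto intro!: continuous_intros g_sph)
 define H1 where "H1 t x i = (if i < ?j then g x i - t * a i*g x ?j else g x i)" for t x i
 have "Brouwer_degree2 ?j (radial ?j (H1 0)) = Brouwer_degree2 ?j (radial ?j (H1 1))"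
 proof (rule radial_homotopy)
  fix i assume "i \<le> ?j"
  then show "continuous_map (prod_topology (top_of_set {0..1}) (nsphere ?j)) euclideanreal (\<lambda>z. H1 (fst z) (snd z) i)"
   unfolding H1_def by (cases "i < ?j") (auto intro!: continuous_intros g_sph fst_sph)
 next
  fix t :: real and x assume x: "x \<in> topspace (nsphere ?j)"
  show "\<exists>i\<le>?j. H1 t x i ~= 0"
  proof (rule ccontr)
   assume "\<not> ?thesis"
   then have n: "H1 t x i = 0" if "i \<le> ?j" for i using that by blast
   then have "g x ?j = 0" using n[of ?j] by (simp add: H1_def)
   then have "g x i = 0" if "i \<le> ?j" for i using n[OF that] that by (cases "i = ?j") (auto simp: H1_def)
   then show False using Suc.prems(4)[OF nsphere_nonzero[OF x]] by blast
  qed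
 qed
 moreover have "H1 0 = g" "H1 1 = h" by (auto simp: fun_eq_iff H1_def h_def)
 ultimately have deg1: "Brouwer_degree2 ?j (radial ?j g) = Brouwer_degree2 ?j (radial ?j h)" by simp
 \<comment> \<open>The absolute value of the last coordinate is even, so oddness survives, and it is
   zero on the equator, which is thereby mapped into itself.\<close>
 define H2 where "H2 t x i = (if i < ?j then h x i else ((1 - t) + t*\<bar>x ?j\<bar>)*h x i)" for t x i
 have H2_nz: "\<exists>i\<le>?j. H2 t x i ~= 0" if "0 \<le> t" "t \<le> 1" "x \<in> topspace (nsphere ?j)" for t x
 proof (rule ccontr)
  assume "\<not> ?thesis"
  then have n: "H2 t x i = 0" if "i \<le> ?j" for i using that by blast
  have 1: "h x i = 0" if "i < ?j" for i using n[of i] that by (simp add: H2_def)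
  then have xj: "x ?j ~= 0" using equator nsphere_nonzero[OF that(3)] by blast
  have "(1 - t) + t*\<bar>x ?j\<bar> ~= 0" using that xj by (smt (verit) mult_nonneg_nonneg mult_pos_pos)
  then have hj: "h x ?j = 0" using n[of ?j] by (simp add: H2_def)
  then have "g x i = 0" if "i \<le> ?j" for i using h_eq[of x i] 1 that hj by (metis h_def less_irrefl mult_zero_left)
  then show False using Suc.prems(4)[OF nsphere_nonzero[OF that(3)]] by blast
 qed
 have H2_cont: "continuous_map (prod_topology (top_of_set {0..1}) (nsphere ?j)) euclideanreal (\<lambda>z. H2 (fst z) (snd z) i)"
  if "i \<le> ?j" for i
  using that unfolding H2_def
  by (cases "i < ?j") (auto intro!: continuous_intros h_sph fst_sph coord_sph)
 have "Brouwer_degree2 ?j (radial ?j (H2 0)) = Brouwer_degree2 ?j (radial ?j (H2 1))" by (rule radial_homotopy) (use H2_nz H2_cont in auto)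
 moreover have "H2 0 = h" by (auto simp: fun_eq_iff H2_def)
 ultimately have deg2: "Brouwer_degree2 ?j (radial ?j h) = Brouwer_degree2 ?j (radial ?j (H2 1))" by simp
 define F where "F = H2 1"
 have hodd: "h (\<lambda>l. - x l) i = - h x i" if "i \<le> ?j" for x i using that Suc.prems(3)[of i x] Suc.prems(3)[of ?j x] by (auto simp: h_def)
 have Fodd: "F (\<lambda>l. - x l) i = - F x i" if "i \<le> ?j" for x i using that hodd[of i x] by (auto simp: F_def H2_def)
 have F_cont: "continuous_map (nsphere ?j) euclideanreal (\<lambda>x. F x i)" if "i \<le> ?j" for i
 proof -
  have "continuous_map (nsphere ?j) (prod_topology (top_of_set {0..1}) (nsphere ?j)) (\<lambda>x. (1::real, x))"
   by (auto simp: continuous_map_pairwise o_def)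
  from continuous_map_compose[OF this H2_cont[OF that]] show ?thesis by (simp add: o_def F_def)
 qed
 have F_nz: "\<exists>i\<le>?j. F x i ~= 0" if "x \<in> topspace (nsphere ?j)" for x using H2_nz[of 1 x] that by (simp add: F_def)
 have radF: "continuous_map (nsphere ?j) (nsphere ?j) (radial ?j F)"
  using continuous_map_radial[of ?j "nsphere ?j" F] F_cont F_nz by (simp add: radial_def[abs_def])
 have sub: "x \<in> topspace (nsphere ?j) \<and> x ?j = 0" if "x \<in> topspace (nsphere k)" for x
  using that subtopology_nsphere_equator[of k] by (metis (mono_tags, lifting) IntD1 IntD2 mem_Collect_eq topspace_subtopology)
 have step: "even (Brouwer_degree2 ?j (radial ?j F) - Brouwer_degree2 (?j - Suc 0) (radial ?j F))"
 proof (rule Borsuk_odd_mapping_degree_step[OF radF])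
  show "(radial ?j F \<circ> (\<lambda>x i. - x i)) u = ((\<lambda>x i. - x i) \<circ> radial ?j F) u" for u by (auto simp: fun_eq_iff radial_def Fodd)
  show "radial ?j F \<in> topspace (nsphere (?j - Suc 0)) \<rightarrow> topspace (nsphere (?j - Suc 0))"
   using sub radF topspace_nsphere_minus1 by (fastforce simp: continuous_map_def radial_def F_def H2_def)
 qed
 define g2 where "g2 x i = h (x(?j := 0)) i" for x i
 have "radial ?j F x = radial k g2 x" if "x \<in> topspace (nsphere k)" for x
 proof -
  have "x(?j := 0) = x" using sub[OF that] by auto
  then have 1: "F x i = g2 x i" if "i < ?j" for i using that by (simp add: F_def H2_def g2_def)
  have 2: "F x ?j = 0" using sub[OF that] by (simp add: F_def H2_def)
  have 3: "(\<Sum>l\<le>?j. (F x l)\<^sup>2) = (\<Sum>l\<le>k. (g2 x l)\<^sup>2)" using 1 2 by simp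
  show ?thesis unfolding radial_def 3 using 1 2 by (auto simp: fun_eq_iff le_Suc_eq)
 qed
 then have "Brouwer_degree2 k (radial ?j F) = Brouwer_degree2 k (radial k g2)" by (rule Brouwer_degree2_eq)
 moreover have "odd (Brouwer_degree2 k (radial k g2))"
 proof (rule Suc.IH)
  fix i assume i: "i \<le> k"
  have c0: "continuous_map (powertop_real UNIV) (powertop_real UNIV) (\<lambda>x. x(?j := 0::real))"
   unfolding continuous_map_componentwise_UNIV by (auto intro: continuous_map_product_projection)
  have "continuous_map (powertop_real UNIV) euclideanreal (\<lambda>x. h x i)" unfolding h_def using i Suc.prems(1) by (auto intro!: continuous_intros)
  from continuous_map_compose[OF c0 this]
  show "continuous_map (powertop_real UNIV) euclideanreal (\<lambda>x. g2 x i)" by (simp add: o_def g2_def)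
  have "finsel (Suc ?j) (\<lambda>x. 1*g x i + (- a i)*g x ?j)" by (rule finsel_comb) (use i Suc.prems(2) in auto)
  then have "finsel (Suc ?j) (\<lambda>x. h x i)" using i by (simp add: h_def)
  then obtain C where "finite C" "\<forall>x. \<exists>c\<in>C. h x i = (\<Sum>l<Suc ?j. c l*x l)" unfolding finsel_def by blast
  moreover have "(\<Sum>l<Suc ?j. c l*(x(?j := 0)) l) = (\<Sum>l<?j. c l*x l)" for c x :: "nat => real" by simp
  ultimately show "finsel (Suc k) (\<lambda>x. g2 x i)" unfolding finsel_def g2_def by metis
  fix x :: "nat => real"
  have "(\<lambda>l. - x l)(?j := 0) = (\<lambda>l. - (x(?j := 0)) l)" by auto
  then show "g2 (\<lambda>l. - x l) i = - g2 x i" unfolding g2_def using hodd[of i "x(?j := 0)"] i by (metis le_Suc_eq)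
 next
  fix x :: "nat => real" assume "\<exists>i\<le>k. x i ~= 0"
  then obtain i where "i \<le> k" "x i ~= 0" by blast
  then have "\<exists>i\<le>?j. (x(?j := 0)) i ~= 0" by (intro exI[of _ i]) auto
  then show "\<exists>i\<le>k. g2 x i ~= 0" using equator[of "x(?j := 0)"] by (auto simp: g2_def less_Suc_eq_le)
 qed
 ultimately show ?case using step deg1 deg2 by (auto simp: F_def)
qed

text \<open>Borsuk-Ulam: without a zero, padding by a coordinate 0 would give a self-map of the
  n-sphere that misses a pole. Its degree would be 0 and odd at once.\<close>

corollary odd_finsel_map_has_zero:
 fixes g :: "(nat => real) => nat => real"
 assumes cont: "!!i. i < n ==> continuous_map (powertop_real UNIV) euclideanreal (\<lambda>x. g x i)"
  and sel: "!!i. i < n ==> finsel (Suc n) (\<lambda>x. g x i)"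
  and odd: "!!x i. i < n ==> g (\<lambda>l. - x l) i = - g x i"
 shows "\<exists>x. (\<exists>i\<le>n. x i ~= 0) \<and> (\<forall>i<n. g x i = 0)"
proof (rule ccontr)
 assume neg: "\<not> ?thesis"
 define G where "G x i = (if i < n then g x i else 0)" for x i
 have nz: "\<exists>i\<le>n. G x i ~= 0" if nx: "\<exists>i\<le>n. x i ~= 0" for x
 proof -
  have "\<not> (\<forall>i<n. g x i = 0)" using neg nx by blast
  then obtain i where "i < n" "g x i ~= 0" by blast
  then show ?thesis by (intro exI[of _ i]) (simp add: G_def)
 qed
 have cG: "continuous_map (powertop_real UNIV) euclideanreal (\<lambda>x. G x i)" if "i \<le> n" for i
  using cont[of i] that by (cases "i < n") (auto simp: G_def)
 let ?A = "\<lambda>i. if i = n then 1 else 0"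
 have "odd (Brouwer_degree2 n (radial n G))"
 proof (rule odd_Brouwer_degree2_radial)
  show "finsel (Suc n) (\<lambda>x. G x i)" if "i \<le> n" for i using sel[of i] that finsel_0 by (cases "i < n") (auto simp: G_def)
 qed (use cG odd nz in \<open>auto simp: G_def\<close>)
 moreover have "Brouwer_degree2 n (radial n G) = 0"
 proof (rule Brouwer_degree2_nonsurjective)
  have "continuous_map (nsphere n) euclideanreal (\<lambda>x. G x i)" if "i \<le> n" for i
   unfolding nsphere by (rule continuous_map_from_subtopology[OF cG[OF that]])
  then show "continuous_map (nsphere n) (nsphere n) (radial n G)"
   using continuous_map_radial[of n "nsphere n" G] nz nsphere_nonzero by (simp add: radial_def[abs_def])
  have e: "?A \<in> topspace (nsphere n)" by (simp add: nsphere power2_eq_square if_distrib[of "\<lambda>x. x * _"] cong: if_cong)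
  have z: "radial n G x n = 0" for x by (simp add: radial_def G_def)
  show "radial n G ` topspace (nsphere n) ~= topspace (nsphere n)"
  proof
   assume "radial n G ` topspace (nsphere n) = topspace (nsphere n)"
   with e obtain x where "?A = radial n G x" by blast
   from fun_cong[OF this, of n] show False by (simp add: z)
  qed
 qed
 ultimately show False by simp
qed

section \<open>Polynomial partitioning\<close>

text \<open>Real polynomial functions of degree at most the first argument.\<close>

inductive rpd :: "nat => ('a::euclidean_space => real) => bool" where
 rpd_const: "rpd d (\<lambda>_. c)"
| rpd_inner: "1 \<le> d ==> rpd d (\<lambda>x. x\<bullet>u)"
| rpd_add: "rpd d f ==> rpd d g ==> rpd d (\<lambda>x. f x + g x)"
| rpd_mult: "rpd d f ==> rpd e g ==> d + e \<le> k ==> rpd k (\<lambda>x. f x*g x)"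

lemma rpd_mono: "rpd d f ==> d \<le> e ==> rpd e f"
proof (induction arbitrary: e rule: rpd.induct)
 case (rpd_mult d f e g k e')
 then have "d + e \<le> e'" by simp
 then show ?case by (rule rpd.rpd_mult[OF rpd_mult.hyps(1,2)])
qed (auto intro: rpd.intros)

lemma rpd_mult': "rpd d f ==> rpd e g ==> rpd (d + e) (\<lambda>x. f x*g x)"
 by (rule rpd_mult) auto

lemma rpd_continuous: "rpd d f ==> continuous_on A f"
 by (induction rule: rpd.induct) (auto intro!: continuous_intros)

lemma rpd_cmult: "rpd d f ==> rpd d (\<lambda>x. c*f x)"
 using rpd_mult'[OF rpd_const[of 0 c]] by simp

lemma rpd_sum: "finite A ==> (!!a. a \<in> A ==> rpd d (f a)) ==> rpd d (\<lambda>x. \<Sum>a\<in>A. f a x)"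
 by (induction A rule: finite_induct) (auto intro: rpd.intros)

lemma rpd_prod: "finite A ==> (!!a. a \<in> A ==> rpd (d a) (f a)) ==> rpd (\<Sum>a\<in>A. d a) (\<lambda>x. \<Prod>a\<in>A. f a x)"
proof (induction A rule: finite_induct)
 case (insert a A)
 then show ?case using rpd_mult' by fastforce
qed (simp add: rpd_const)

lemma rpd_power: "rpd d f ==> rpd (n*d) (\<lambda>x. f x^n)"
 by (induction n) (auto intro: rpd_const rpd_mult')

lemma rpd_line:
 assumes "rpd d f"
 shows "\<exists>q. degree q \<le> d \<and> (\<forall>t. f (p + t *R u) = poly q t)"
 using assms
proof (induction rule: rpd.induct)
 case (rpd_const d c)
 then show ?case by (intro exI[of _ "[:c:]"]) auto
next
 case (rpd_inner d w)
 then show ?case by (intro exI[of _ "[:p\<bullet>w, u\<bullet>w:]"]) (auto simp: inner_add_left)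
next
 case (rpd_add d f g)
 then obtain q r where "degree q \<le> d" "degree r \<le> d" "\<forall>t. f (p + t *R u) = poly q t" "\<forall>t. g (p + t *R u) = poly r t" by blast
 then show ?case by (intro exI[of _ "q + r"]) (auto intro: degree_add_le)
next
 case (rpd_mult d f e g k)
 then obtain q r where "degree q \<le> d" "degree r \<le> e" "\<forall>t. f (p + t *R u) = poly q t" "\<forall>t. g (p + t *R u) = poly r t" by blast
 then show ?case using rpd_mult.hyps(3) by (intro exI[of _ "q*r"]) (auto intro: order_trans[OF degree_mult_le])
qed

lemma rpd_nonzero_prod:
 assumes "rpd d f" "rpd e g" "f x ~= 0" "g y ~= 0"
 shows "\<exists>z. f z ~= 0 \<and> g z ~= 0"
proof -
 obtain q r where q: "\<forall>t. f (x + t *R (y - x)) = poly q t" and r: "\<forall>t. g (x + t *R (y - x)) = poly r t"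
  using rpd_line[OF assms(1)] rpd_line[OF assms(2)] by metis
 have "poly q 0 ~= 0" "poly r 1 ~= 0" using assms(3,4) q[rule_format, of 0] r[rule_format, of 1] by auto
 then have "q*r ~= 0" by auto
 then obtain t where "poly (q*r) t ~= 0" by (metis poly_0 poly_eq_poly_eq_iff ext)
 then show ?thesis using q r by (metis mult_eq_0_iff poly_mult)
qed

lemma rpd_nonzero_prod_finite:
 assumes "finite A" "!!a. a \<in> A ==> rpd (d a) (f a)" "!!a. a \<in> A ==> \<exists>x. f a x ~= 0"
 shows "\<exists>z. \<forall>a\<in>A. f a z ~= 0"
 using assms
proof (induction A rule: finite_induct)
 case (insert a A)
 then obtain z where z: "\<forall>a\<in>A. f a z ~= 0" by blast
 obtain x where "f a x ~= 0" using insert by blast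
 moreover have "(\<Prod>a\<in>A. f a z) ~= 0" using z insert by auto
 moreover have "rpd (\<Sum>a\<in>A. d a) (\<lambda>x. \<Prod>a\<in>A. f a x)" by (rule rpd_prod) (use insert in auto)
 moreover have "rpd (d a) (f a)" using insert by auto
 ultimately obtain w where "f a w ~= 0" "(\<Prod>a\<in>A. f a w) ~= 0"
  using rpd_nonzero_prod[of "d a" "f a" "\<Sum>a\<in>A. d a" "\<lambda>x. \<Prod>a\<in>A. f a x" x z] by auto
 then show ?case using insert by (intro exI[of _ w]) auto
qed simp

section \<open>Clipping and the discrete ham sandwich theorem\<close>

definition clip :: "real => real => real" where
 "clip e t = max (- e) (min e t)"

text \<open>Elements with value at least \<open>e\<close> contribute \<open>e\<close> each and all
  others at least \<open>- e\<close>, so a sum of zero forbids a majority of the former.\<close>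

lemma clip_balance:
 assumes "finite S" "e > 0" "(\<Sum>p\<in>S. clip e (f p)) = 0"
 shows "2 * card {p\<in>S. f p \<ge> e} \<le> card S"
proof -
 let ?A = "{p\<in>S. f p \<ge> e}"
 have "0 = (\<Sum>p\<in>?A. clip e (f p)) + (\<Sum>p\<in>S - ?A. clip e (f p))"
  using assms(1,3) sum.subset_diff[of ?A S "\<lambda>p. clip e (f p)"] by simp
 moreover have "(\<Sum>p\<in>?A. clip e (f p)) = real (card ?A)*e"
  using assms(2) by (subst sum.cong[OF refl, of _ _ "\<lambda>_. e"]) (auto simp: clip_def)
 moreover have "(\<Sum>p\<in>S - ?A. clip e (f p)) \<ge> (\<Sum>p\<in>S - ?A. - e)" by (intro sum_mono) (auto simp: clip_def)
 ultimately have "real (card ?A)*e \<le> real (card (S - ?A))*e" by simp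
 then have "card ?A \<le> card (S - ?A)" using assms(2) by simp
 moreover have "card S = card ?A + card (S - ?A)" using assms(1) by (simp add: card_Diff_subset card_mono)
 ultimately show ?thesis by simp
qed

lemma clip_minus: "e \<ge> 0 ==> clip e (- t) = - clip e t"
 by (auto simp: clip_def max_def min_def)

lemma compact_coefficient_box:
 "compact (Pi\<^sub>E UNIV (\<lambda>l::nat. if l \<le> N then {-1..1} else {0::real}))"
proof -
 have "compactin (product_topology (\<lambda>_. euclideanreal) UNIV) (Pi\<^sub>E UNIV (\<lambda>l::nat. if l \<le> N then {-1..1} else {0::real}))"
  by (auto simp: compactin_PiE)
 then show ?thesis by (simp add: euclidean_product_topology)
qed

text \<open>Counting signs is not continuous, so values are clipped first. The clipping height is
  \<open>e\<close> times the l1 norm of the coefficients and not \<open>e\<close> itself: only then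
  are the clipped sums selected from finitely many linear forms, as the Borsuk-Ulam corollary
  demands. Afterwards \<open>e\<close> tends to 0.\<close>

theorem discrete_ham_sandwich:
 fixes d :: "nat => 'a => real" and S :: "nat => 'a set"
 assumes fin: "!!i. i < N ==> finite (S i)"
 shows "\<exists>a. (\<exists>l\<le>N. a l ~= 0) \<and> (\<forall>i<N. 2 * card {p\<in>S i. (\<Sum>l\<le>N. a l*d l p) > 0} \<le> card (S i)
   \<and> 2 * card {p\<in>S i. (\<Sum>l\<le>N. a l*d l p) < 0} \<le> card (S i))"
proof -
 define f where "f a p = (\<Sum>l\<le>N. a l*d l p)" for a :: "nat => real" and p
 define nrm where "nrm a = (\<Sum>l\<le>N. \<bar>a l\<bar>)" for a :: "nat => real"
 define box where "box = Pi\<^sub>E UNIV (\<lambda>l::nat. if l \<le> N then {-1..1} else {0::real})"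
 have f_minus: "f (\<lambda>l. - a l) p = - f a p" for a p by (simp add: f_def sum_negf)
 have f_scale: "f (\<lambda>l. c * a l) p = c*f a p" for c a p by (simp add: f_def sum_distrib_left mult.assoc)
 have approx: "\<exists>a\<in>box. nrm a = 1 \<and> (\<forall>i<N. 2 * card {p\<in>S i. f a p \<ge> e} \<le> card (S i)
   \<and> 2 * card {p\<in>S i. - f a p \<ge> e} \<le> card (S i))" if e: "e > 0" for e
 proof -
  define g where "g a i = (\<Sum>p\<in>S i. clip (e*nrm a) (f a p))" for a i
  have sel_f: "finsel (Suc N) (\<lambda>a. f a p)" for p
   using finsel_linear[of "Suc N" "\<lambda>l. d l p"] by (simp add: f_def lessThan_Suc_atMost mult.commute)
  have sel_abs: "finsel (Suc N) (\<lambda>a. \<bar>a l\<bar>)" if "l \<le> N" for l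
  proof (rule finsel_choice)
   show "finsel (Suc N) (\<lambda>a. a l)" using that by (intro finsel_coord) auto
   from finsel_comb[OF this this, of "-1" 0] show "finsel (Suc N) (\<lambda>a. - a l)" by simp
  qed (auto simp: abs_if)
  have sel_nrm: "finsel (Suc N) (\<lambda>a. c*nrm a)" for c
  proof -
   have "finsel (Suc N) nrm" unfolding nrm_def using sel_abs by (intro finsel_sum) auto
   from finsel_comb[OF this this, of c 0] show ?thesis by simp
  qed
  have sel_min: "finsel (Suc N) (\<lambda>a. min (e*nrm a) (f a p))" for p by (rule finsel_choice[OF sel_nrm[of e] sel_f[of p]]) (auto simp: min_def)
  have sel_g: "finsel (Suc N) (\<lambda>a. g a i)" if "i < N" for i unfolding g_def clip_def
  proof (intro finsel_sum fin[OF that])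
   fix p
   show "finsel (Suc N) (\<lambda>a. max (- (e*nrm a)) (min (e*nrm a) (f a p)))"
    by (rule finsel_choice[OF sel_nrm[of "-e"] sel_min[of p]]) (auto simp: max_def)
  qed
  have coord: "continuous_on UNIV (\<lambda>a::nat => real. a l)" for l by (rule continuous_on_product_coordinates)
  have "continuous_map (powertop_real UNIV) euclideanreal (\<lambda>a. g a i)" for i
   unfolding euclidean_product_topology continuous_map_iff_continuous2 g_def clip_def nrm_def f_def
   by (intro continuous_intros coord)
  moreover have "g (\<lambda>l. - a l) i = - g a i" for a i
  proof -
   have "nrm a \<ge> 0" by (simp add: nrm_def sum_nonneg)
   then show ?thesis using e clip_minus f_minus sum_negf by (fastforce simp: nrm_def g_def)
  qed
  ultimately obtain a where a: "\<exists>l\<le>N. a l ~= 0" "\<forall>i<N. g a i = 0" using odd_finsel_map_has_zero[of N g] sel_g by blast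
  from a(1) have pos: "nrm a > 0" unfolding nrm_def by (auto intro: sum_pos2)
  define b where "b l = (if l \<le> N then a l/nrm a else 0)" for l
  have fb: "f b p = f a p/nrm a" for p using f_scale[of "1/nrm a" a p] by (simp add: f_def b_def)
  have nb: "nrm b = 1" using pos by (simp add: nrm_def b_def flip: sum_divide_distrib)
  have "\<bar>b l\<bar> \<le> 1" if "l \<le> N" for l unfolding nb[symmetric] nrm_def using that by (intro member_le_sum) auto
  then have "b \<in> box" unfolding box_def by (auto simp: abs_le_iff) (auto simp: b_def)
  moreover have "2 * card {p\<in>S i. f b p \<ge> e} \<le> card (S i)" "2 * card {p\<in>S i. - f b p \<ge> e} \<le> card (S i)" if "i < N" for i
  proof -
   have z: "(\<Sum>p\<in>S i. clip (e*nrm a) (f a p)) = 0" using a(2) that by (simp add: g_def)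
   have "2 * card {p\<in>S i. f a p \<ge> e*nrm a} \<le> card (S i)" by (rule clip_balance[OF fin[OF that] _ z]) (use e pos in simp)
   then show "2 * card {p\<in>S i. f b p \<ge> e} \<le> card (S i)" using pos by (simp add: fb field_simps)
   have "(\<Sum>p\<in>S i. clip (e*nrm a) (- f a p)) = 0" using z e pos by (simp add: clip_minus sum_negf)
   then have "2 * card {p\<in>S i. - f a p \<ge> e*nrm a} \<le> card (S i)" by (intro clip_balance[OF fin[OF that]]) (use e pos in simp)
   then show "2 * card {p\<in>S i. - f b p \<ge> e} \<le> card (S i)" using pos by (simp add: fb field_simps)
  qed
  ultimately show ?thesis using nb by blast
 qed
 have "\<forall>n::nat. \<exists>a. a \<in> box \<and> nrm a = 1 \<and> (\<forall>i<N. 2 * card {p\<in>S i. f a p \<ge> inverse (real (Suc n))} \<le> card (S i)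
   \<and> 2 * card {p\<in>S i. - f a p \<ge> inverse (real (Suc n))} \<le> card (S i))"
  (is "\<forall>n. \<exists>a. ?Q n a")
 proof
  fix n :: nat
  have "inverse (real (Suc n)) > 0" by simp
  from approx[OF this] show "\<exists>a. ?Q n a" unfolding Bex_def .
 qed
 from choice[OF this] obtain A where A': "\<forall>n. ?Q n (A n)" ..
 have A: "A n \<in> box" "nrm (A n) = 1"
  "i < N ==> 2 * card {p\<in>S i. f (A n) p \<ge> inverse (real (Suc n))} \<le> card (S i)"
  "i < N ==> 2 * card {p\<in>S i. - f (A n) p \<ge> inverse (real (Suc n))} \<le> card (S i)" for n i
  using spec[OF A', of n] by simp_all
 \<comment> \<open>Normalisation by \<open>nrm\<close> serves two purposes: the coefficient vectors
   stay in a compact box, and their limit still has norm 1, hence is not zero.\<close>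
 have "seq_compact box" using compact_coefficient_box compact_imp_seq_compact unfolding box_def by blast
 then obtain a r where r: "strict_mono r" and lim: "(A \<circ> r) \<longlonglongrightarrow> a" using seq_compactE[of box A] A(1) by metis
 have coord: "(\<lambda>n. A (r n) l) \<longlonglongrightarrow> a l" for l
  using continuous_on_tendsto_compose[OF continuous_on_product_coordinates[of l] lim] by (simp add: o_def)
 have flim: "(\<lambda>n. f (A (r n)) p) \<longlonglongrightarrow> f a p" for p unfolding f_def by (intro tendsto_intros coord)
 have "(\<lambda>n. nrm (A (r n))) \<longlonglongrightarrow> nrm a" unfolding nrm_def by (intro tendsto_intros coord)
 then have "(\<lambda>n. 1) \<longlonglongrightarrow> nrm a" by (simp add: A(2))
 then have "nrm a = 1" by (simp add: LIMSEQ_const_iff)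
 have nz: "\<exists>l\<le>N. a l ~= 0"
 proof (rule ccontr)
  assume "\<not> ?thesis"
  then have "nrm a = 0" by (simp add: nrm_def)
  then show False using \<open>nrm a = 1\<close> by simp
 qed
 let ?A = "\<lambda>n. real (Suc (r n))"
 have rinv: "(\<lambda>n. inverse (?A n)) \<longlonglongrightarrow> 0" using LIMSEQ_subseq_LIMSEQ[OF LIMSEQ_inverse_real_of_nat r] by (simp add: o_def)
 \<comment> \<open>Strict positivity at the limit beats the shrinking threshold eventually, and
   uniformly because \<open>S i\<close> is finite.\<close>
 have fin_ev: "\<forall>\<^sub>F n in sequentially. \<forall>p\<in>{p\<in>S i. s*f a p > 0}. s*f (A (r n)) p \<ge> inverse (?A n)"
  if "i < N" for i s
 proof (rule eventually_ball_finite)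
  show "\<forall>p\<in>{p\<in>S i. s*f a p > 0}. \<forall>\<^sub>F n in sequentially. s*f (A (r n)) p \<ge> inverse (?A n)"
  proof
   fix p assume "p \<in> {p\<in>S i. s*f a p > 0}"
   moreover have "(\<lambda>n. s*f (A (r n)) p - inverse (?A n)) \<longlonglongrightarrow> s*f a p - 0" by (intro tendsto_intros flim rinv)
   ultimately have "\<forall>\<^sub>F n in sequentially. s*f (A (r n)) p - inverse (?A n) > 0" by (intro order_tendstoD) auto
   then show "\<forall>\<^sub>F n in sequentially. s*f (A (r n)) p \<ge> inverse (?A n)" by eventually_elim simp
  qed
 qed (use fin[OF that] in simp)
 have half: "2 * card {p\<in>S i. s*f a p > 0} \<le> card (S i)" if i: "i < N" and s: "s = 1 \<or> s = -1" for i s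
 proof -
  obtain n where n: "\<forall>p\<in>{p\<in>S i. s*f a p > 0}. s*f (A (r n)) p \<ge> inverse (?A n)"
   using eventually_happens'[OF _ fin_ev[OF i, of s]] by auto
  have "card {p\<in>S i. s*f a p > 0} \<le> card {p\<in>S i. s*f (A (r n)) p \<ge> inverse (?A n)}" using n fin[OF i] by (intro card_mono) auto
  moreover have "2 * card {p\<in>S i. s*f (A (r n)) p \<ge> inverse (?A n)} \<le> card (S i)" using s A(3)[OF i, of "r n"] A(4)[OF i, of "r n"] by auto
  ultimately show ?thesis by simp
 qed
 show ?thesis
 proof (intro exI[of _ a] conjI allI impI)
  show "\<exists>l\<le>N. a l ~= 0" by (rule nz)
  fix i assume i: "i < N"
  show "2 * card {p\<in>S i. (\<Sum>l\<le>N. a l*d l p) > 0} \<le> card (S i)" using half[OF i, of 1] by (simp add: f_def)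
  show "2 * card {p\<in>S i. (\<Sum>l\<le>N. a l*d l p) < 0} \<le> card (S i)" using half[OF i, of "-1"] by (simp add: f_def)
 qed
qed

section \<open>Bisecting polynomials and the partition\<close>

lemma base_digits_sum:
 fixes l b k :: nat
 assumes "l < b^k"
 shows "(\<Sum>t<k. b^t*((l div b^t) mod b)) = l"
 using assms
proof (induction k arbitrary: l)
 case (Suc k)
 have b: "b > 0" using Suc.prems by (cases b) auto
 let ?B = "\<Sum>t<k. b^t*((l div b^Suc t) mod b)"
 have "l div b < b^k" using Suc.prems b by (simp add: less_mult_imp_div_less mult.commute)
 from Suc.IH[OF this] have IH: "?B = l div b" by (simp add: div_mult2_eq)
 let ?A = "\<Sum>t<k. b^Suc t*((l div b^Suc t) mod b)"
 have "?A = b*?B" by (simp only: sum_distrib_left power_Suc mult.assoc)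
 then have "?A = b*(l div b)" unfolding IH .
 then show ?case by (simp only: sum.lessThan_Suc_shift) simp
qed simp

text \<open>Kronecker substitution \<open>L t x = s ^ (b ^ t)\<close> turns the \<open>l\<close>-th monomial into \<open>s ^ l\<close>.\<close>

lemma monomials_independent:
 fixes L :: "nat => 'a => real"
 assumes surj: "!!y. \<exists>x. \<forall>t<k. L t x = y t" and N: "N < b^k" and a: "\<exists>l\<le>N. a l ~= 0"
 shows "\<exists>x. (\<Sum>l\<le>N. a l*(\<Prod>t<k. L t x^((l div b^t) mod b))) ~= 0"
proof -
 have "finite {s. (\<Sum>l\<le>N. a l * s^l) = 0}" using a by (simp add: polyfun_finite_roots)
 then obtain s where s: "(\<Sum>l\<le>N. a l * s^l) ~= 0" using ex_new_if_finite[OF infinite_UNIV_char_0] by blast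
 obtain x where x: "\<forall>t<k. L t x = s^(b^t)" using surj[of "\<lambda>t. s^(b^t)"] ..
 let ?A = "\<lambda>l. \<Prod>t<k. L t x^((l div b^t) mod b)"
 have "(?A l) = s^l" if "l \<le> N" for l
 proof -
  have "(?A l) = (\<Prod>t<k. s^(b^t*((l div b^t) mod b)))" using x by (intro prod.cong) (auto simp: power_mult)
  also have "... = s^(\<Sum>t<k. b^t*((l div b^t) mod b))" by (simp add: power_sum)
  also have "... = s^l" using base_digits_sum[of l b k] N that by simp
  finally show ?thesis .
 qed
 then have "(\<Sum>l\<le>N. a l*(?A l)) = (\<Sum>l\<le>N. a l * s^l)" by (intro sum.cong) auto
 then show ?thesis using s by (intro exI[of _ x]) simp
qed

text \<open>The monomials with all \<open>k\<close> exponents at most \<open>e\<close> number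
  \<open>(e + 1)^k\<close>, which exceeds \<open>N\<close>, and have degree at most
  \<open>k*e\<close>. The exponents of the \<open>l\<close>-th monomial are the digits of
  \<open>l\<close> in base \<open>e + 1\<close>.\<close>

lemma bisecting_polynomial:
 fixes u :: "nat => 'a::euclidean_space" and S :: "nat => 'a set"
 assumes surj: "!!y. \<exists>x. \<forall>t<k. x\<bullet>u t = y t" and N: "N \<le> e^k" "0 < k" "0 < e"
  and fin: "!!i. i < N ==> finite (S i)"
 shows "\<exists>f. rpd (k*e) f \<and> (\<exists>x. f x ~= 0) \<and> (\<forall>i<N. 2 * card {p\<in>S i. f p > 0} \<le> card (S i)
   \<and> 2 * card {p\<in>S i. f p < 0} \<le> card (S i))"
proof -
 define F where "F l x = (\<Prod>t<k. (x\<bullet>u t)^((l div (e + 1)^t) mod (e + 1)))" for l x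
 obtain a where a': "(\<exists>l\<le>N. a l ~= 0) \<and> (\<forall>i<N. 2 * card {p\<in>S i. (\<Sum>l\<le>N. a l*F l p) > 0} \<le> card (S i)
   \<and> 2 * card {p\<in>S i. (\<Sum>l\<le>N. a l*F l p) < 0} \<le> card (S i))"
  using discrete_ham_sandwich[of N S F, OF fin] ..
 note a = conjunct1[OF a'] conjunct2[OF a']
 have "rpd (k*e) (F l)" for l
 proof -
  have "rpd (\<Sum>t<k. e) (F l)" unfolding F_def
  proof (rule rpd_prod)
   fix t
   let ?A = "(l div (e + 1)^t) mod (e + 1)"
   have "rpd (?A*1) (\<lambda>x. (x\<bullet>u t)^?A)" by (intro rpd_power rpd_inner) simp
   moreover have "?A*1 \<le> e" by (metis Suc_eq_plus1 less_Suc_eq_le mod_less_divisor mult.right_neutral zero_less_Suc)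
   ultimately show "rpd e (\<lambda>x. (x\<bullet>u t)^?A)" by (rule rpd_mono)
  qed simp
  then show ?thesis by simp
 qed
 then have "rpd (k*e) (\<lambda>x. \<Sum>l\<le>N. a l*F l x)" by (intro rpd_sum rpd_cmult) auto
 moreover have "N < (e + 1)^k" using N by (meson le_less_trans less_add_one power_strict_mono zero_le)
 then have "\<exists>x. (\<Sum>l\<le>N. a l*F l x) ~= 0"
  using monomials_independent[of k "\<lambda>t x. x\<bullet>u t" N "e + 1" a] surj a(1) by (simp add: F_def)
 ultimately show ?thesis using a(2) by (intro exI[of _ "\<lambda>x. \<Sum>l\<le>N. a l*F l x"]) simp
qed

text \<open>Round \<open>J\<close> bisects all \<open>2^J\<close> sign classes by one polynomial.
  Points on a zero set belong to no class, so the bound is claimed only around points where all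
  factors are non-zero.\<close>

lemma iterated_bisection:
 fixes u :: "nat => 'a::euclidean_space" and e :: "nat => nat" and S :: "'a set"
 assumes surj: "!!y. \<exists>x. \<forall>t<k. x\<bullet>u t = y t" and k: "0 < k" and e: "!!j. 0 < e j" "!!j. 2^j \<le> e j^k"
  and S: "finite S"
 shows "\<exists>f. (\<forall>j<J. rpd (k*e j) (f j) \<and> (\<exists>x. f j x ~= 0)) \<and>
  (\<forall>p. (\<forall>j<J. f j p ~= 0) --> 2^J * card {q\<in>S. \<forall>j<J. sgn (f j q) = sgn (f j p)} \<le> card S)"
proof (induction J)
 case (Suc J)
 then obtain f where f': "(\<forall>j<J. rpd (k*e j) (f j) \<and> (\<exists>x. f j x ~= 0)) \<and>
  (\<forall>p. (\<forall>j<J. f j p ~= 0) --> 2^J * card {q\<in>S. \<forall>j<J. sgn (f j q) = sgn (f j p)} \<le> card S)" ..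
 then have f: "rpd (k*e j) (f j)" "\<exists>x. f j x ~= 0" if "j < J" for j using conjunct1[OF f', rule_format, OF that] by simp_all
 have f3: "2^J * card {q\<in>S. \<forall>j<J. sgn (f j q) = sgn (f j p)} \<le> card S"
  if "!!j. j < J ==> f j p ~= 0" for p
  by (rule conjunct2[OF f', THEN spec, THEN mp]) (use that in blast)
 define s where "s = ({..<J} \<rightarrow>\<^sub>E {1, -1::real})"
 have "card s = 2^J" by (simp add: s_def card_PiE numeral_2_eq_2)
 moreover have "finite s" by (simp add: s_def finite_PiE)
 ultimately obtain h where h: "bij_betw h {0..<2^J :: nat} s" using ex_bij_betw_nat_finite by metis
 define T where "T i = {q\<in>S. \<forall>j<J. sgn (f j q) = h i j}" for i
 have finT: "finite (T i)" for i using S by (simp add: T_def)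
 obtain g where g': "rpd (k*e J) g \<and> (\<exists>x. g x ~= 0) \<and> (\<forall>i<2^J. 2 * card {p\<in>T i. g p > 0} \<le> card (T i)
   \<and> 2 * card {p\<in>T i. g p < 0} \<le> card (T i))"
  using bisecting_polynomial[OF surj e(2)[of J] k e(1)[of J], of T, OF finT] ..
 have g: "rpd (k*e J) g" "\<exists>x. g x ~= 0"
  "i < 2^J ==> 2 * card {p\<in>T i. g p > 0} \<le> card (T i)"
  "i < 2^J ==> 2 * card {p\<in>T i. g p < 0} \<le> card (T i)" for i
  using g' by simp_all
 show ?case
 proof (intro exI[of _ "f(J := g)"] conjI allI impI)
  fix j assume "j < Suc J"
  then show "rpd (k*e j) ((f(J := g)) j)" "\<exists>x. (f(J := g)) j x ~= 0" using f(1,2) g(1,2) by (auto simp: less_Suc_eq)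
 next
  fix p assume p: "\<forall>j<Suc J. (f(J := g)) j p ~= 0"
  have gp: "g p ~= 0" using p[rule_format, of J] by simp
  have fp: "f j p ~= 0" if "j < J" for j using p[rule_format, of j] that by simp
  let ?C = "\<lambda>j\<in>{..<J}. sgn (f j p)"
  have "?C \<in> s" using fp by (auto simp: s_def sgn_if)
  then have "?C \<in> h ` {0..<2^J}" using h by (simp add: bij_betw_def)
  then obtain i where i: "i < 2^J" "h i = ?C" by auto
  have Ti: "T i = {q\<in>S. \<forall>j<J. sgn (f j q) = sgn (f j p)}" by (simp add: T_def i(2))
  let ?A = "{q\<in>T i. sgn (g q) = sgn (g p)}"
  let ?B = "{q\<in>S. \<forall>j<Suc J. sgn ((f(J := g)) j q) = sgn ((f(J := g)) j p)}"
  have "2 * card ?A \<le> card (T i)"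
  proof (cases "g p > 0")
   case True
   then have "?A = {q\<in>T i. g q > 0}" by (auto simp: sgn_if split: if_splits)
   then show ?thesis using g(3)[OF i(1)] by simp
  next
   case False
   then have "?A = {q\<in>T i. g q < 0}" using gp by (auto simp: sgn_if split: if_splits)
   then show ?thesis using g(4)[OF i(1)] by simp
  qed
  moreover have "?B = ?A" unfolding Ti by (auto simp: less_Suc_eq)
  moreover have "2^J * card (T i) \<le> card S" unfolding Ti by (rule f3) (rule fp)
  moreover have "2^Suc J * c = 2^J*(2 * c)" for c :: nat by simp
  ultimately show "2^Suc J * card ?B \<le> card S" by (metis (no_types, lifting) le_trans mult_le_mono2)
 qed
qed (auto intro!: card_mono S)

lemma sgn_constant_on_interval:
 fixes h :: "real => real"
 assumes "a \<le> b" "continuous_on {a..b} h" "!!t. t \<in> {a..b} ==> h t ~= 0"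
 shows "sgn (h a) = sgn (h b)"
proof (rule ccontr)
 assume "sgn (h a) ~= sgn (h b)"
 then have "h a < 0 \<and> h b > 0 \<or> h b < 0 \<and> h a > 0" using assms(3)[of a] assms(3)[of b] assms(1) by (auto simp: sgn_if split: if_splits)
 then have "\<exists>t. a \<le> t \<and> t \<le> b \<and> h t = 0" using IVT'[of h a 0 b] IVT2'[of h b 0 a] assms(1,2) by fastforce
 then show False using assms(3) by auto
qed

text \<open>Cells are recorded by sign vectors \<open>z\<close>. That \<open>z\<close> cannot change
  along a path avoiding the zero set takes the place of counting connected components. Round
  \<open>j\<close> costs a degree of order \<open>2 powr (j/k)\<close>, and the geometric series is
  dominated by its last term.\<close>

theorem polynomial_partition:
 fixes u :: "nat => 'a::euclidean_space"
 assumes surj: "!!y. \<exists>x. \<forall>t<k. x\<bullet>u t = y t" and k: "0 < k"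
 shows "\<exists>C>0. \<forall>S D. finite S \<and> D \<ge> (1::real) --> (\<exists>F (z :: 'a => nat => real) d. rpd d F \<and> real d \<le> C*D \<and> (\<exists>x. F x ~= 0) \<and>
   (small_cells D k S F z) \<and>
   (path_invariant F z))"
proof -
 define q where "q = 2 powr (1/real k)"
 have q: "q > 1" unfolding q_def using k by simp
 have qj: "q^j = 2 powr (real j/real k)" for j unfolding q_def by (simp add: powr_power)
 have qk: "q^k = 2" using k by (simp add: qj)
 define e where "e j = nat \<lceil>q^j\<rceil>" for j
 have e_ge: "real (e j) \<ge> q^j" for j unfolding e_def by linarith
 have q1: "q^j \<ge> 1" for j using q by simp
 have e_le: "real (e j) \<le> 2*q^j" for j using q1[of j] of_nat_ceiling[of "q^j"] unfolding e_def by linarith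
 have e0: "0 < e j" for j using e_ge[of j] q1[of j] by linarith
 have ek: "2^j \<le> e j^k" for j
 proof -
  have "(2::real)^j = (q^j)^k" by (simp only: qk[symmetric] power_mult[symmetric] mult.commute)
  also have "... \<le> real (e j)^k" using e_ge[of j] q1[of j] by (intro power_mono) auto
  finally show ?thesis by (metis of_nat_le_iff of_nat_numeral of_nat_power)
 qed
 define C where "C = 2*real k/(q - 1)"
 have "\<exists>F (z :: 'a => nat => real) d. rpd d F \<and> real d \<le> C*D \<and> (\<exists>x. F x ~= 0) \<and>
   (small_cells D k S F z) \<and>
   (path_invariant F z)"
  if S: "finite S" and D: "D \<ge> 1" for S and D :: real
 proof -
  \<comment> \<open>The largest number of rounds with \<open>q^J \<le> D\<close>. Since
    \<open>D < q^(J + 1)\<close> and \<open>q^k = 2\<close>, \<open>D^k\<close> is at most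
    \<open>2*2^J\<close>, which is the factor 2 in \<open>small_cells\<close>.\<close>
  define J where "J = nat \<lfloor>log q D\<rfloor>"
  have "log q D \<ge> 0" using q D by simp
  then have J: "real J \<le> log q D" "log q D < real J + 1" unfolding J_def by linarith+
  have Dq: "q powr log q D = D" using q D by simp
  have "q powr real J \<le> q powr log q D" using J(1) q by (intro powr_mono) auto
  moreover have pw: "q powr real i = q^i" for i by (rule powr_realpow) (use q in simp)
  ultimately have qJ1: "q^J \<le> D" by (simp only: Dq pw)
  have "q powr log q D < q powr real (J + 1)" using J(2) q by (intro powr_less_mono) auto
  then have "D < q^(J + 1)" by (simp only: Dq pw)
  note qJ = qJ1 this
  obtain f where f': "(\<forall>j<J. rpd (k*e j) (f j) \<and> (\<exists>x. f j x ~= 0)) \<and>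
   (\<forall>p. (\<forall>j<J. f j p ~= 0) --> 2^J * card {q\<in>S. \<forall>j<J. sgn (f j q) = sgn (f j p)} \<le> card S)"
   by (rule exE[OF iterated_bisection[OF surj k e0 ek S, of J]])
  then have f: "rpd (k*e j) (f j)" "\<exists>x. f j x ~= 0" if "j < J" for j using conjunct1[OF f', rule_format, OF that] by simp_all
  have f3: "2^J * card {q\<in>S. \<forall>j<J. sgn (f j q) = sgn (f j p)} \<le> card S"
   if "!!j. j < J ==> f j p ~= 0" for p
   by (rule conjunct2[OF f', THEN spec, THEN mp]) (use that in blast)
  define F where "F x = (\<Prod>j<J. f j x)" for x
  define z where "z p = (\<lambda>j. if j < J then sgn (f j p) else 0)" for p
  define d where "d = (\<Sum>j<J. k*e j)"
  have 1: "rpd d F" unfolding d_def F_def by (rule rpd_prod) (use f(1) in auto)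
  have "real d \<le> (\<Sum>j<J. real k*(2*q^j))"
   unfolding d_def of_nat_sum by (intro sum_mono) (use e_le in \<open>auto intro!: mult_left_mono\<close>)
  also have "... = 2*real k*(\<Sum>j<J. q^j)" by (simp add: sum_distrib_left mult_ac)
  also have "... = C*(q^J - 1)" using q by (simp add: C_def geometric_sum)
  also have "... \<le> C*D" using q qJ(1) by (intro mult_left_mono) (auto simp: C_def)
  finally have 2: "real d \<le> C*D" .
  have 3: "\<exists>x. F x ~= 0" using rpd_nonzero_prod_finite[of "{..<J}" "\<lambda>j. k*e j" f] f(1,2) by (auto simp: F_def)
  have 4: "D^k * card {q\<in>S. z q = z p} \<le> 2 * card S" if "F p ~= 0" for p
  proof -
   let ?A = "{q\<in>S. z q = z p}"
   have "z q' = z p \<longleftrightarrow> (\<forall>j<J. sgn (f j q') = sgn (f j p))" for q' by (auto simp: z_def fun_eq_iff)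
   then have "2^J * card ?A \<le> card S" using f3[of p] that by (auto simp: F_def)
   then have "real (2^J * card ?A) \<le> real (card S)" by (simp only: of_nat_le_iff)
   then have c: "2^J*real (card ?A) \<le> real (card S)" by simp
   have "D^k \<le> (q^(J + 1))^k" using qJ(2) D by (intro power_mono) auto
   also have "... = (q^k)^(J + 1)" by (simp only: power_mult[symmetric] mult.commute)
   also have "... = 2*2^J" by (simp add: qk)
   finally have "D^k * card ?A \<le> 2*2^J*real (card ?A)" by (intro mult_right_mono) auto
   then show ?thesis using c by linarith
  qed
  have 5: "z (g a) = z (g b)"
   if g: "a \<le> b" "continuous_on {a..b::real} g" "\<forall>t\<in>{a..b}. F (g t) ~= 0" for g a b
  proof -
   have "sgn (f j (g a)) = sgn (f j (g b))" if "j < J" for j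
   proof (rule sgn_constant_on_interval[OF g(1), of "\<lambda>t. f j (g t)"])
    show "continuous_on {a..b} (\<lambda>t. f j (g t))" by (rule continuous_on_compose2[OF rpd_continuous[OF f(1)[OF that], of UNIV] g(2)]) auto
    show "f j (g t) ~= 0" if "t \<in> {a..b}" for t using g(3) that \<open>j < J\<close> by (auto simp: F_def)
   qed
   then show ?thesis by (auto simp: z_def)
  qed
  show ?thesis using 1 2 3 4 5 by blast
 qed
 moreover have "C > 0" using q k by (simp add: C_def)
 ultimately show ?thesis by blast
qed

section \<open>Directional derivatives and circles\<close>

definition dd :: "'a::euclidean_space => ('a => real) => 'a => real" where
 "dd u f x = frechet_derivative f (at x) u"

lemma rpd_derivative:
 assumes "rpd d f"
 shows "\<exists>f'. (\<forall>x. (f has_derivative f' x) (at x)) \<and> (\<forall>u. rpd d (\<lambda>x. f' x u))"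
 using assms
proof (induction rule: rpd.induct)
 case (rpd_const d c)
 then show ?case by (intro exI[of _ "\<lambda>x u. 0"]) (auto intro: rpd.rpd_const)
next
 case (rpd_inner d w)
 have "((\<lambda>x. x\<bullet>w) has_derivative (\<lambda>u. u\<bullet>w)) (at x)" for x :: 'a
  by (rule bounded_linear_imp_has_derivative[OF bounded_linear_inner_left])
 then show ?case by (intro exI[of _ "\<lambda>x u. u\<bullet>w"]) (auto intro: rpd.rpd_const)
next
 case (rpd_add d f g)
 then obtain f' g' where fg: "\<forall>x. (f has_derivative f' x) (at x)" "\<forall>u. rpd d (\<lambda>x. f' x u)"
   "\<forall>x. (g has_derivative g' x) (at x)" "\<forall>u. rpd d (\<lambda>x. g' x u)" by blast
 then show ?case by (intro exI[of _ "\<lambda>x u. f' x u + g' x u"]) (auto intro: rpd.rpd_add has_derivative_add)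
next
 case (rpd_mult d f e g k)
 then obtain f' g' where fg: "!!x. (f has_derivative f' x) (at x)" "!!u. rpd d (\<lambda>x. f' x u)"
   "!!x. (g has_derivative g' x) (at x)" "!!u. rpd e (\<lambda>x. g' x u)" by blast
 have "((\<lambda>x. f x*g x) has_derivative (\<lambda>u. f x*g' x u + f' x u*g x)) (at x)" for x by (rule has_derivative_mult[OF fg(1,3)])
 moreover have "rpd k (\<lambda>x. f x*g' x u + f' x u*g x)" for u using rpd_mult fg by (intro rpd.rpd_add; intro rpd.rpd_mult[of d _ e]) auto
 ultimately show ?case by (intro exI[of _ "\<lambda>x u. f x*g' x u + f' x u*g x"]) auto
qed

lemma dd_eq:
 assumes "(f has_derivative f') (at x)"
 shows "dd u f x = f' u"
 unfolding dd_def using frechet_derivative_at[OF assms] by simp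

lemma rpd_has_derivative:
 assumes "rpd d f"
 shows "(f has_derivative (\<lambda>u. dd u f x)) (at x)"
proof -
 obtain f' where f': "!!x. (f has_derivative f' x) (at x)" using rpd_derivative[OF assms] by blast
 have "(\<lambda>u. dd u f x) = f' x" using dd_eq[OF f'] by auto
 then show ?thesis using f' by simp
qed

lemma rpd_dd:
 assumes "rpd d f"
 shows "rpd d (dd u f)"
proof -
 obtain f' where f': "!!x. (f has_derivative f' x) (at x)" "!!u. rpd d (\<lambda>x. f' x u)"
  using rpd_derivative[OF assms] by blast
 have "dd u f = (\<lambda>x. f' x u)" using dd_eq[OF f'(1)] by auto
 then show ?thesis using f'(2) by simp
qed

lemma rpd_ddn: "rpd d f ==> rpd d ((dd u ^^ n) f)"
 by (induction n) (auto intro: rpd_dd)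

lemma dd_lincomb:
 assumes "rpd d f"
 shows "dd (a *R u + b *R v) f x = a*dd u f x + b*dd v f x"
proof -
 have "linear (\<lambda>u. dd u f x)" by (rule has_derivative_linear[OF rpd_has_derivative[OF assms]])
 from linear_add[OF this] linear_scale[OF this] show ?thesis by simp
qed

lemma dd_cmult: "rpd d f ==> dd u (\<lambda>x. c*f x) = (\<lambda>x. c*dd u f x)"
 by (auto intro!: dd_eq has_derivative_mult_right rpd_has_derivative)

lemma dd_add: "rpd d f ==> rpd e g ==> dd u (\<lambda>x. f x + g x) = (\<lambda>x. dd u f x + dd u g x)"
 by (rule ext, rule dd_eq[OF has_derivative_add[OF rpd_has_derivative rpd_has_derivative]])

lemma dd_mult: "rpd d f ==> rpd e g ==> dd u (\<lambda>x. f x*g x) = (\<lambda>x. f x*dd u g x + dd u f x*g x)"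
 by (rule ext, rule dd_eq[OF has_derivative_mult[OF rpd_has_derivative rpd_has_derivative]])

lemma dd_const: "dd u (\<lambda>x. c) = (\<lambda>x. 0)"
 by (rule ext, rule dd_eq) simp

lemma dd_inner: "dd u (\<lambda>x. x\<bullet>w) = (\<lambda>x. u\<bullet>w)"
 by (rule ext, rule dd_eq, rule bounded_linear_imp_has_derivative[OF bounded_linear_inner_left])

lemma dd_lincomb_fun:
 assumes "rpd d f"
 shows "dd (a *R u + b *R v) f = (\<lambda>x. a*dd u f x + b*dd v f x)"
 using dd_lincomb[OF assms] by auto

lemma dd_commute:
 assumes "rpd d f"
 shows "dd u (dd v f) = dd v (dd u f)"
 using assms
proof (induction rule: rpd.induct)
 case (rpd_add d f g)
 have "dd u (dd v (\<lambda>x. f x + g x)) = (\<lambda>x. dd u (dd v f) x + dd u (dd v g) x)" for u v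
  unfolding dd_add[OF rpd_add.hyps] by (rule dd_add[OF rpd_dd[OF rpd_add.hyps(1)] rpd_dd[OF rpd_add.hyps(2)]])
 then show ?case using rpd_add.IH by simp
next
 case (rpd_mult d f e g k)
 note f = rpd_mult.hyps(1) and g = rpd_mult.hyps(2)
 have "dd u (dd v (\<lambda>x. f x*g x)) = (\<lambda>x. (f x*dd u (dd v g) x + dd u f x*dd v g x)
   + (dd v f x*dd u g x + dd u (dd v f) x*g x))" for u v
  unfolding dd_mult[OF f g] dd_add[OF rpd_mult'[OF f rpd_dd[OF g]] rpd_mult'[OF rpd_dd[OF f] g]]
   dd_mult[OF f rpd_dd[OF g]] dd_mult[OF rpd_dd[OF f] g] ..
 then show ?case using rpd_mult.IH by (simp add: algebra_simps)
qed (simp_all add: dd_const dd_inner)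

lemma dd_line:
 assumes "rpd d f"
 shows "((\<lambda>t. f (p + t *R u)) has_real_derivative dd u f (p + t *R u)) (at t)"
proof -
 have 1: "((\<lambda>t. p + t *R u) has_derivative (\<lambda>h. h *R u)) (at t)" by (auto intro!: derivative_eq_intros)
 have "((\<lambda>t. f (p + t *R u)) has_derivative (\<lambda>h. dd (h *R u) f (p + t *R u))) (at t)"
  by (rule has_derivative_compose[OF 1 rpd_has_derivative[OF assms]])
 moreover have "dd (h *R u) f (p + t *R u) = h*dd u f (p + t *R u)" for h using dd_lincomb[OF assms, of h u 0 u] by simp
 ultimately show ?thesis by (simp add: has_field_derivative_def mult_commute_abs)
qed

lemma poly_ddn_line:
 assumes "rpd d f" "!!t. f (p + t *R u) = poly q t"
 shows "(dd u ^^ n) f (p + t *R u) = poly ((pderiv ^^ n) q) t"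
proof (induction n arbitrary: t)
 case (Suc n)
 let ?A = "\<lambda>t. (dd u ^^ n) f (p + t *R u)"
 have "(?A has_real_derivative dd u ((dd u ^^ n) f) (p + t *R u)) (at t)" using dd_line[OF rpd_ddn[OF assms(1)]] by blast
 moreover have "(?A has_real_derivative poly (pderiv ((pderiv ^^ n) q)) t) (at t)" unfolding Suc.IH by (rule poly_DERIV)
 ultimately show ?case by (auto dest: DERIV_unique)
qed (use assms(2) in simp)

lemma rpd_line_taylor:
 assumes "rpd d f"
 shows "f (p + t *R u) = (\<Sum>n\<le>d. (dd u ^^ n) f p/fact n*t^n)"
proof -
 obtain q where q: "degree q \<le> d" "!!t. f (p + t *R u) = poly q t"
  using rpd_line[OF assms, of p u] by blast
 have c: "poly.coeff q n = (dd u ^^ n) f p/fact n" for n using poly_ddn_line[OF assms q(2), of n 0]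
  by (simp add: poly_0_coeff_0 coeff_higher_pderiv field_simps flip: pochhammer_fact)
 have "poly q t = (\<Sum>n\<le>degree q. poly.coeff q n*t^n)" by (simp add: poly_altdef)
 also have "... = (\<Sum>n\<le>d. poly.coeff q n*t^n)" using q(1) by (intro sum.mono_neutral_left) (auto simp: coeff_eq_0)
 finally show ?thesis unfolding q(2) c .
qed

lemma some_ddn_nonzero:
 assumes "rpd d f" "f (p + u) ~= 0"
 shows "\<exists>n. (dd u ^^ n) f p ~= 0"
proof (rule ccontr)
 assume "\<not> ?thesis"
 then have "f (p + 1 *R u) = 0" unfolding rpd_line_taylor[OF assms(1)] by simp
 then show False using assms(2) by simp
qed

text \<open>A finite product of translates of a non-zero polynomial is non-zero. A single direction
  for all points makes orders of vanishing at different points, and along circles through them,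
  comparable.\<close>

lemma avoiding_direction:
 assumes "rpd d f" "f x ~= 0" "finite Q"
 shows "\<exists>u. \<forall>p\<in>Q. f (p + u) ~= 0"
proof -
 have sh: "rpd d (\<lambda>u. f (p + u))" for p using assms(1)
 proof (induction rule: rpd.induct)
  case (rpd_inner d w)
  then show ?case unfolding inner_add_left by (intro rpd.rpd_add rpd.rpd_const rpd.rpd_inner)
 qed (auto intro: rpd.intros)
 have "\<exists>u. f (p + u) ~= 0" for p using assms(2) by (intro exI[of _ "x - p"]) simp
 then show ?thesis using rpd_nonzero_prod_finite[of Q "\<lambda>_. d" "\<lambda>p u. f (p + u)"] assms(3) sh by blast
qed

text \<open>A rational parametrisation of \<open>circ p v w\<close>, missing the antipode of \<open>p\<close>.\<close>

definition cpar :: "'a::euclidean_space => 'a => 'a => real => 'a" where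
 "cpar p v w s = p + (s/(1 + (w\<bullet>w) * s\<^sup>2)) *R v + (s\<^sup>2/(1 + (w\<bullet>w) * s\<^sup>2)) *R w"

text \<open>The circle through \<open>p\<close> with unit tangent vector \<open>v\<close> and curvature vector \<open>2 w\<close>.\<close>

definition circ :: "'a::euclidean_space => 'a => 'a => 'a set" where
 "circ p v w = {p + A *R v + b *R w |A b. A\<^sup>2 + (w\<bullet>w) * b\<^sup>2 = b}"

section \<open>Polynomials restricted to parametrised circles\<close>

lemma cpar_denom_pos: "1 + (w\<bullet>w) * s\<^sup>2 > 0"
 by (smt (verit) inner_ge_zero mult_nonneg_nonneg zero_le_power2)

lemma cpar_0 [simp]: "cpar p v w 0 = p"
 by (simp add: cpar_def)

lemma cpar_in_circ: "cpar p v w s \<in> circ p v w"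
proof -
 let ?q = "1 + (w\<bullet>w) * s\<^sup>2"
 have q: "?q ~= 0" using cpar_denom_pos[of w s] by simp
 have "(s/?q)\<^sup>2 + (w\<bullet>w)*(s\<^sup>2/?q)\<^sup>2 = s\<^sup>2*?q/?q\<^sup>2" by (simp add: power_divide add_divide_distrib ring_sq)
 also have "... = s\<^sup>2/?q" using q by (simp add: power2_eq_square)
 finally show ?thesis unfolding circ_def cpar_def by blast
qed

lemma circ_param:
 assumes "x \<in> circ p v w" "w ~= 0"
 shows "x = p + (1/(w\<bullet>w)) *R w \<or> (\<exists>s. x = cpar p v w s)"
proof -
 obtain a B where x: "x = p + a *R v + B *R w" and ab: "a\<^sup>2 + (w\<bullet>w)*B\<^sup>2 = B"
  using assms(1) unfolding circ_def by blast
 have W: "w\<bullet>w > 0" using assms(2) by simp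
 show ?thesis
 proof (cases "a = 0")
  case True
  then have "B = 0 \<or> B = 1/(w\<bullet>w)" using ab W by (simp add: field_sq)
  then show ?thesis using x True by (auto intro: exI[of _ 0])
 next
  case False
  then have b: "B > 0" using ab W by (smt (verit) mult_nonneg_nonneg zero_eq_power2 zero_le_power2)
  let ?s = "B/a"
  have "1 + (w\<bullet>w)*?s\<^sup>2 = B/a\<^sup>2" using False ab by (simp add: field_sq)
  then have "cpar p v w ?s = x" unfolding cpar_def x using b False by (simp add: field_sq)
  then show ?thesis by metis
 qed
qed

lemma cpar_inner:
 "(cpar p v w s\<bullet>u)*(1 + (w\<bullet>w) * s\<^sup>2)
   = (p\<bullet>u)*(1 + (w\<bullet>w) * s\<^sup>2) + s*(v\<bullet>u) + s\<^sup>2*(w\<bullet>u)"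
proof -
 define q where "q = 1 + (w\<bullet>w) * s\<^sup>2"
 have "q ~= 0" using cpar_denom_pos[of w s] by (simp add: q_def)
 then have "(cpar p v w s\<bullet>u)*q = (p\<bullet>u)*q + s*(v\<bullet>u) + s\<^sup>2*(w\<bullet>u)"
  unfolding cpar_def q_def[symmetric] by (simp add: inner_add_left distrib_right)
 then show ?thesis by (simp add: q_def)
qed

lemma cpar_inj:
 assumes "norm v = 1" "v\<bullet>w = 0" "w ~= 0" "cpar p v w s = cpar p v w t"
 shows "s = t"
proof -
 let ?qs = "1 + (w\<bullet>w) * s\<^sup>2" and ?qt = "1 + (w\<bullet>w)*t\<^sup>2"
 have v: "v\<bullet>v = 1" using assms(1) by (simp add: dot_square_norm)
 have "(cpar p v w s - p)\<bullet>v = (cpar p v w t - p)\<bullet>v" "(cpar p v w s - p)\<bullet>w = (cpar p v w t - p)\<bullet>w"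
  using assms(4) by auto
 then have e1: "s/?qs = t/?qt" and "(w\<bullet>w)*(s\<^sup>2/?qs) = (w\<bullet>w)*(t\<^sup>2/?qt)"
  using assms(2) v by (auto simp: cpar_def inner_add_left inner_commute[of w v] mult.commute)
 then have "s\<^sup>2/?qs = t\<^sup>2/?qt" using assms(3) by (simp del: times_divide_eq_right)
 moreover have "s\<^sup>2/?qs = s*(s/?qs)" "t\<^sup>2/?qt = t*(t/?qt)" by (simp_all add: power2_eq_square)
 ultimately have "s = t \<or> s/?qs = 0" using e1 by auto
 then show ?thesis using e1 cpar_denom_pos[of w s] cpar_denom_pos[of w t] by auto
qed

lemma poly_cpar_denom: "poly ([:1, 0, W:]^e) s = (1 + W * s\<^sup>2)^(e::nat)" for W :: real
 by (simp add: poly_power power2_eq_square mult_ac)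

text \<open>Each factor of degree one costs one power of the denominator
  \<open>1 + (w\<bullet>w) * s^2\<close> and contributes degree two. This is the only form of
  Bezout's bound in the proof.\<close>

lemma rpd_cpar:
 assumes "rpd d f"
 shows "\<exists>q. degree q \<le> 2*d \<and> (\<forall>s. f (cpar p v w s)*(1 + (w\<bullet>w) * s\<^sup>2)^d = poly q s)"
 using assms
proof (induction rule: rpd.induct)
 case (rpd_const d c)
 let ?A = "[:c:] * [:1, 0, w\<bullet>w:]^d"
 have "degree ([:1, 0, w\<bullet>w:]^d) \<le> 2*d" by (rule order_trans[OF degree_power_le]) simp
 then have "degree ?A \<le> 2*d" using degree_mult_le[of "[:c:]" "[:1, 0, w\<bullet>w:]^d"] by simp
 moreover have "c*(1 + (w\<bullet>w) * s\<^sup>2)^d = poly ?A s" for s by (simp only: poly_mult poly_cpar_denom) simp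
 ultimately show ?case by blast
next
 case (rpd_inner d u)
 then obtain e where d: "d = Suc e" by (cases d) auto
 let ?Q = "[:1, 0, w\<bullet>w:]" and ?L = "[:p\<bullet>u, v\<bullet>u, (w\<bullet>w)*(p\<bullet>u) + w\<bullet>u:]"
 have "degree (?L*?Q^e) \<le> degree ?L + degree (?Q^e)" by (rule degree_mult_le)
 moreover have "degree ?L \<le> 2" by simp
 moreover have "degree (?Q^e) \<le> 2*e" by (rule order_trans[OF degree_power_le]) simp
 ultimately have "degree (?L*?Q^e) \<le> 2*d" by (simp add: d)
 moreover have "(cpar p v w s\<bullet>u)*(1 + (w\<bullet>w) * s\<^sup>2)^d = poly (?L*?Q^e) s" for s
 proof -
  have "(cpar p v w s\<bullet>u)*(1 + (w\<bullet>w) * s\<^sup>2) = poly ?L s" unfolding cpar_inner by (simp add: ring_sq)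
  then show ?thesis by (simp only: d power_Suc mult.assoc[symmetric] poly_mult poly_cpar_denom)
 qed
 ultimately show ?case by (intro exI[of _ "?L*?Q^e"]) blast
next
 case (rpd_add d f g)
 then obtain q r where "degree q \<le> 2*d" "degree r \<le> 2*d"
  "\<forall>s. f (cpar p v w s)*(1 + (w\<bullet>w) * s\<^sup>2)^d = poly q s"
  "\<forall>s. g (cpar p v w s)*(1 + (w\<bullet>w) * s\<^sup>2)^d = poly r s" by blast
 then show ?case by (intro exI[of _ "q + r"]) (auto intro: degree_add_le simp: algebra_simps)
next
 case (rpd_mult d f e g k)
 then obtain q r where qr: "degree q \<le> 2*d" "degree r \<le> 2*e"
  "\<forall>s. f (cpar p v w s)*(1 + (w\<bullet>w) * s\<^sup>2)^d = poly q s"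
  "\<forall>s. g (cpar p v w s)*(1 + (w\<bullet>w) * s\<^sup>2)^e = poly r s" by blast
 obtain h where k: "k = d + e + h" using rpd_mult.hyps(3) le_Suc_ex by blast
 let ?Q = "[:1, 0, w\<bullet>w:]"
 have "degree (?Q^h) \<le> 2*h" by (rule order_trans[OF degree_power_le]) simp
 then have "degree (q*r*?Q^h) \<le> 2*k" using qr(1,2) degree_mult_le[of "q*r" "?Q^h"] degree_mult_le[of q r] by (simp add: k)
 moreover have "f (cpar p v w s)*g (cpar p v w s)*(1 + (w\<bullet>w) * s\<^sup>2)^k = poly (q*r*?Q^h) s" for s
 proof -
  have "f (cpar p v w s)*g (cpar p v w s)*(1 + (w\<bullet>w) * s\<^sup>2)^k
   = (f (cpar p v w s)*(1 + (w\<bullet>w) * s\<^sup>2)^d)*(g (cpar p v w s)*(1 + (w\<bullet>w) * s\<^sup>2)^e)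
    * (1 + (w\<bullet>w) * s\<^sup>2)^h"
   by (simp add: k power_add mult_ac)
  then show ?thesis by (simp only: qr(3,4) poly_mult poly_cpar_denom)
 qed
 ultimately show ?case by blast
qed

text \<open>The additional 1 counts the antipode of \<open>p\<close>, the only point without a
  parameter.\<close>

lemma card_zeros_on_circ:
 assumes "rpd d f" "w ~= 0" "x \<in> circ p v w" "f x ~= 0"
 shows "finite {y \<in> circ p v w. f y = 0}" (is ?Q) "card {y \<in> circ p v w. f y = 0} \<le> 2*d + 1" (is ?P)
proof -
 obtain q where q: "degree q \<le> 2*d" "!!s. f (cpar p v w s)*(1 + (w\<bullet>w) * s\<^sup>2)^d = poly q s"
  using rpd_cpar[OF assms(1), of p v w] by blast
 have qz: "f (cpar p v w s) = 0 \<longleftrightarrow> poly q s = 0" for s using cpar_denom_pos[of w s] by (simp flip: q(2))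
 let ?i = "p + (1/(w\<bullet>w)) *R w"
 let ?C = "{s. poly q s = 0}"
 have main: "finite {y \<in> circ p v w. f y = 0} \<and> card {y \<in> circ p v w. f y = 0} \<le> 2*d + 1"
 proof (cases "q = 0")
  case True
  then have "f (cpar p v w s) = 0" for s using qz by simp
  then have x: "x = ?i" using circ_param[OF assms(3,2)] assms(4) by auto
  \<comment> \<open>\<open>f\<close> is continuous, so it vanishes at the point with parameter infinity as well\<close>
  let ?D = "w\<bullet>w"
  have "((\<lambda>s. cpar p v w s) \<longlongrightarrow> ?i) at_top"
  proof -
   have W: "w\<bullet>w > 0" using assms(2) by simp
   then have "((\<lambda>s::real. s/(1 + ?D * s\<^sup>2)) \<longlongrightarrow> 0) at_top" (is "?A") by real_asymp
   moreover have "((\<lambda>s::real. s\<^sup>2/(1 + ?D * s\<^sup>2)) \<longlongrightarrow> inverse ?D) at_top"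
    (is "?B") using W by real_asymp
   ultimately have AB: ?A ?B by blast+
   have "((\<lambda>s. cpar p v w s) \<longlongrightarrow> p + 0 *R v + inverse ?D *R w) at_top" unfolding cpar_def
    by (rule tendsto_add[OF tendsto_add[OF tendsto_const tendsto_scaleR[OF AB(1) tendsto_const]] tendsto_scaleR[OF AB(2) tendsto_const]])
   then show ?thesis by (simp add: inverse_eq_divide)
  qed
  moreover have "isCont f ?i" using rpd_continuous[OF assms(1), of UNIV] by (simp add: continuous_on_eq_continuous_at)
  ultimately have "((\<lambda>s. f (cpar p v w s)) \<longlongrightarrow> f ?i) at_top" by (rule isCont_tendsto_compose[rotated])
  then have "f ?i = 0" using \<open>!!s. f (cpar p v w s) = 0\<close> by (simp add: tendsto_const_iff)
  then show ?thesis using assms(4) x by simp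
 next
  case False
  have fin: "finite ?C" using poly_roots_finite[OF False] .
  have sub: "{y \<in> circ p v w. f y = 0} \<subseteq> insert ?i (cpar p v w ` ?C)"
  proof
   fix y assume "y \<in> {y \<in> circ p v w. f y = 0}"
   then show "y \<in> insert ?i (cpar p v w ` ?C)" using circ_param[of y p v w] assms(2) qz by auto
  qed
  have "card (insert ?i (cpar p v w ` ?C)) \<le> Suc (card ?C)" using card_image_le[OF fin, of "cpar p v w"] fin by (simp add: card_insert_if)
  also have "... \<le> 2*d + 1" using card_poly_roots_bound[OF False] q(1) by simp
  finally show ?thesis using card_mono[OF _ sub] finite_subset[OF sub] fin by (meson finite_imageI finite_insert le_trans)
 qed
 show ?Q using main by (rule conjunct1)
 show ?P using main by (rule conjunct2)
qed

section \<open>Contact of a circle with a zero set up to fourth order\<close>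

lemma coeff_zero_of_high_order:
 assumes "!!s. s ~= 0 ==> poly P s = s^n*h s" "isCont h 0"
 shows "i < n ==> poly.coeff P i = (0::real)"
 using assms(1)
proof (induction n arbitrary: P i)
 case (Suc n)
 have "isCont (poly P) 0" by simp
 then have "(poly P \<longlongrightarrow> poly P 0) (at 0)" by (simp add: isCont_def)
 moreover have "((\<lambda>s. s^Suc n*h s) \<longlongrightarrow> 0^Suc n*h 0) (at 0)" using assms(2) by (intro tendsto_intros) (simp add: isCont_def)
 then have "((\<lambda>s. s^Suc n*h s) \<longlongrightarrow> 0) (at 0)" by simp
 then have "(poly P \<longlongrightarrow> 0) (at 0)" by (rule Lim_transform_eventually) (auto simp: eventually_at_filter Suc.prems(2))
 ultimately have P0: "poly P 0 = 0" by (intro LIM_unique)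
 obtain a P' where P: "P = pCons a P'" by (cases P)
 have a: "a = 0" using P0 by (simp add: P)
 have "poly P' s = s^n*h s" if "s ~= 0" for s using Suc.prems(2)[OF that] that by (simp add: P a)
 from Suc.IH[OF _ this] show ?case using Suc.prems(1) by (cases i) (auto simp: P a)
qed simp

text \<open>The operator \<open>(D_v + s D_w)^n\<close> expanded in powers of \<open>s\<close> and
  evaluated at \<open>p\<close>: the direction of the Taylor expansion below itself moves with
  \<open>s\<close>.\<close>

primrec dpoly :: "'a::euclidean_space => 'a => 'a => nat => ('a => real) => real poly" where
 "dpoly p v w 0 f = [:f p:]"
| "dpoly p v w (Suc n) f = dpoly p v w n (dd v f) + pCons 0 (dpoly p v w n (dd w f))"

lemma ddn_lincomb:
 assumes "rpd d f" "rpd e g"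
 shows "(dd u ^^ n) (\<lambda>x. f x + c*g x) = (\<lambda>x. (dd u ^^ n) f x + c*(dd u ^^ n) g x)"
proof (induction n)
 case (Suc n)
 have "dd u (\<lambda>x. (dd u ^^ n) f x + c*(dd u ^^ n) g x) = (\<lambda>x. dd u ((dd u ^^ n) f) x + c*dd u ((dd u ^^ n) g) x)"
  unfolding dd_add[OF rpd_ddn[OF assms(1)] rpd_cmult[OF rpd_ddn[OF assms(2)]]] dd_cmult[OF rpd_ddn[OF assms(2)]] ..
 then show ?case by (simp add: Suc.IH)
qed simp

lemma poly_dpoly:
 assumes "rpd d f"
 shows "(dd (v + s *R w) ^^ n) f p = poly (dpoly p v w n f) s"
 using assms
proof (induction n arbitrary: f)
 case (Suc n)
 let ?A = "v + s *R w"
 have "dd ?A f = (\<lambda>x. dd v f x + s*dd w f x)" using dd_lincomb_fun[OF Suc.prems, of 1 v s w] by simp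
 then have "(dd ?A ^^ Suc n) f p = (dd ?A ^^ n) (dd v f) p + s*(dd ?A ^^ n) (dd w f) p"
  by (simp add: funpow_Suc_right ddn_lincomb[OF rpd_dd[OF Suc.prems] rpd_dd[OF Suc.prems]] del: funpow.simps)
 then show ?case by (simp add: Suc.IH[OF rpd_dd[OF Suc.prems]])
qed simp

text \<open>With \<open>q = 1 + (w\<bullet>w) * s^2\<close>, the point \<open>cpar p v w s\<close>
  is \<open>p\<close> moved by \<open>s/q\<close> times \<open>v + s *R w\<close>. Taylor's formula
  in this direction, multiplied by \<open>q^4\<close>, is a polynomial in \<open>s\<close> up to a
  multiple of \<open>s^5\<close>, so its coefficients of degree 1 to 4 vanish; these are the four
  equations.\<close>

lemma circle_contact_equations:
 assumes g: "rpd d g" and z: "!!s. g (cpar p v w s) = 0"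
 shows "dd v g p = 0" "2*dd w g p + dd v (dd v g) p = 0"
  "6*dd v (dd w g) p + dd v (dd v (dd v g)) p = 0" (is ?Q)
  "-12*(w\<bullet>w)*dd v (dd v g) p + 12*dd w (dd w g) p + 12*dd v (dd v (dd w g)) p + dd v (dd v (dd v (dd v g))) p = 0" (is ?P)
proof -
 \<comment> \<open>Taking at least 5 lets the Taylor sum split after \<open>j = 4\<close> whatever
   the degree is.\<close>
 define D where "D = d + 5"
 have gD: "rpd D g" using rpd_mono[OF g] by (simp add: D_def)
 define W where "W = w\<bullet>w"
 define Q where "Q = [:1, 0, W:]"
 define q where "q s = 1 + W * s\<^sup>2" for s
 define R where "R j = dpoly p v w j g" for j
 have q: "q s ~= 0" for s using cpar_denom_pos[of w s] by (simp add: q_def W_def)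
 have Qq: "poly Q s = q s" for s by (simp add: Q_def q_def power2_eq_square mult_ac)
 have sum: "(\<Sum>j\<le>D. poly (R j) s/fact j*(s/q s)^j) = 0" for s
 proof -
  have "cpar p v w s = p + (s/q s) *R (v + s *R w)" by (simp add: cpar_def q_def W_def scaleR_add_right power2_eq_square)
  then have "g (p + (s/q s) *R (v + s *R w)) = 0" using z[of s] by simp
  then show ?thesis unfolding rpd_line_taylor[OF gD] poly_dpoly[OF g] by (simp add: R_def)
 qed
 \<comment> \<open>The terms up to \<open>j = 4\<close>, made polynomial by the factor
   \<open>q^4\<close>. The remaining terms are rational in \<open>s\<close>; with \<open>s^5\<close>
   taken out they form \<open>h\<close>, which is continuous at 0.\<close>
 define P where "P = (\<Sum>j\<le>4. Polynomial.smult (1/fact j) (R j * [:0, 1:]^j*Q^(4 - j)))"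
 let ?C = "\<lambda>s. \<Sum>j\<in>{5..D}. poly (R j) s/fact j * s^(j - 5)/q s^j"
 define h where "h s = - (?C s)*q s^4" for s
 have P: "poly P s = s^5*h s" for s
 proof -
  let ?B = "\<Sum>j\<in>{5..D}. poly (R j) s/fact j*(s/q s)^j"
  have "{..D} = {..4}\<union>{5..D}" by (auto simp: D_def)
  then have "(\<Sum>j\<le>D. poly (R j) s/fact j*(s/q s)^j)
   = (\<Sum>j\<le>4. poly (R j) s/fact j*(s/q s)^j) + (\<Sum>j\<in>{5..D}. poly (R j) s/fact j*(s/q s)^j)"
   by (simp only:) (rule sum.union_disjoint; auto)
  then have "(\<Sum>j\<le>4. poly (R j) s/fact j*(s/q s)^j) = - ?B" using sum[of s] by linarith
  then have "(\<Sum>j\<le>4. poly (R j) s/fact j*(s/q s)^j)*q s^4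
   = - (\<Sum>j\<in>{5..D}. poly (R j) s/fact j*(s/q s)^j)*q s^4" by (rule arg_cong)
  moreover have "(\<Sum>j\<le>4. poly (R j) s/fact j*(s/q s)^j)*q s^4 = poly P s" unfolding P_def poly_sum sum_distrib_right
  proof (intro sum.cong refl)
   fix j :: nat assume "j \<in> {..4}"
   then have "q s^4 = q s^j*q s^(4 - j)" by (simp flip: power_add)
   then show "poly (R j) s/fact j*(s/q s)^j*q s^4 = poly (Polynomial.smult (1/fact j) (R j * [:0, 1:]^j*Q^(4 - j))) s"
    using q[of s] by (simp add: poly_power Qq power_divide)
  qed
  moreover have "?B = s^5*(?C s)" unfolding sum_distrib_left
  proof (intro sum.cong refl)
   fix j assume "j \<in> {5..D}"
   then have "s^j = s^5 * s^(j - 5)" by (simp flip: power_add)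
   then show "poly (R j) s/fact j*(s/q s)^j = s^5*(poly (R j) s/fact j * s^(j - 5)/q s^j)" by (simp add: power_divide)
  qed
  ultimately show ?thesis by (simp add: h_def)
 qed
 have "isCont h 0" unfolding h_def using q unfolding q_def by (intro continuous_intros) auto
 then have c: "i < 5 ==> poly.coeff P i = 0" for i by (rule coeff_zero_of_high_order[OF P])
 let ?A = "dd v (dd v g)"
 have R: "R 0 = [:g p:]" "R 1 = [:dd v g p, dd w g p:]"
  "R 2 = [:dd v (dd v g) p, 2*dd v (dd w g) p, dd w (dd w g) p:]"
  "R 3 = [:dd v ?A p, 3*dd v (dd v (dd w g)) p, 3*dd v (dd w (dd w g)) p, dd w (dd w (dd w g)) p:]"
  "\<exists>T. R 4 = pCons (dd v (dd v ?A) p) T"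
  by (simp_all add: R_def numeral_eq_Suc dd_commute[OF g, of w v] dd_commute[OF rpd_dd[OF g], of w v])
 obtain T where R4: "R 4 = pCons (dd v (dd v ?A) p) T" using R(5) by blast
 have "g p = 0" using z[of 0] by simp
 have "{..4::nat} = {0, 1, 2, 3, 4}" by auto
 then have PP: "P = R 1 * [:0, 1:]*Q^3 + Polynomial.smult (1/2) (R 2 * [:0, 1:]^2*Q^2)
  + Polynomial.smult (1/6) (R 3 * [:0, 1:]^3*Q) + Polynomial.smult (1/24) (R 4 * [:0, 1:]^4)"
  using \<open>g p = 0\<close> by (simp add: P_def R(1) fact_numeral)
 have Q2: "Q^2 = [:1, 0, 2*W, 0, W*W:]" by (simp add: Q_def power2_eq_square)
 have Q3: "Q^3 = [:1, 0, 3*W, 0, 3*(W*W), 0, W*(W*W):]" by (simp add: Q_def power3_eq_cube)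
 have X: "A * [:0, 1:] = pCons 0 A" "A * [:0, 1:]^2 = pCons 0 (pCons 0 A)"
  "A * [:0, 1:]^3 = pCons 0 (pCons 0 (pCons 0 A))" "A * [:0, 1:]^4 = pCons 0 (pCons 0 (pCons 0 (pCons 0 A)))"
  for A :: "real poly" by (simp_all add: numeral_eq_Suc)
 have "poly.coeff P 1 = 0" "poly.coeff P 2 = 0" "poly.coeff P 3 = 0" "poly.coeff P 4 = 0" using c by simp_all
 moreover have "poly.coeff P 1 = dd v g p" "poly.coeff P 2 = dd w g p + dd v (dd v g) p/2"
  "poly.coeff P 3 = 3*W*dd v g p + dd v (dd w g) p + dd v ?A p/6"
  "poly.coeff P 4 = 3*W*dd w g p + W*dd v (dd v g) p + dd w (dd w g) p/2 + dd v (dd v (dd w g)) p/2 + dd v (dd v ?A) p/24"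
  unfolding PP R R4 X Q2 Q3 Q_def by (simp_all add: coeff_pCons eval_nat_numeral)
 ultimately have e: "dd v g p = 0" "dd w g p + dd v (dd v g) p/2 = 0"
  "3*W*dd v g p + dd v (dd w g) p + dd v ?A p/6 = 0"
  "3*W*dd w g p + W*dd v (dd v g) p + dd w (dd w g) p/2 + dd v (dd v (dd w g)) p/2 + dd v (dd v ?A) p/24 = 0"
  by simp_all
 then show "dd v g p = 0" "2*dd w g p + dd v (dd v g) p = 0"
  ?Q by simp_all
 \<comment> \<open>The fourth equation is 24 times the coefficient of \<open>s^4\<close>, where the
   second equation replaces \<open>dd w g p\<close> in the term with \<open>w\<bullet>w\<close>;
   this turns 72 and 24 into the single factor -12.\<close>
 have "dd v (dd v g) p = - 2*dd w g p" using e(2) by simp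
 then show ?P using e(4) by (simp add: W_def algebra_simps)
qed

section \<open>Circles through a point of a surface\<close>

lemma finite_card_le_two_quadratic:
 fixes A B C :: real
 assumes "A ~= 0"
 shows "finite {x. A*x\<^sup>2 + B*x + C = 0}" (is ?Q) "card {x. A*x\<^sup>2 + B*x + C = 0} \<le> 2" (is ?P)
proof -
 have e: "{x. A*x\<^sup>2 + B*x + C = 0} = {x. poly [:C, B, A:] x = 0}" by (simp add: ring_sq)
 show ?Q unfolding e using assms by (intro poly_roots_finite) simp
 show ?P unfolding e using card_poly_roots_bound[of "[:C, B, A:]"] assms by simp
qed

text \<open>In direction \<open>(c, s)\<close> of the tangent plane, the third order contact condition \<open>E3\<close> determines the
 geodesic curvature (the third argument) of an osculating circle; inserting it into the fourth order condition \<open>E4\<close>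
 gives a form of degree 10 in \<open>(c, s)\<close> whose value at \<open>(1, \<i>)\<close> is non-zero off umbilic points.\<close>

lemma few_contact_circles:
 fixes a v h g13 g23 g33 g111 g112 g122 g222 g113 g123 g223 g1111 g1112 g1122 g1222 g2222 :: real
 defines "V \<equiv> \<lambda>c s. a * c\<^sup>2 + 2 * v * c * s + h * s\<^sup>2"
  and "b \<equiv> \<lambda>c s. v * (c\<^sup>2 - s\<^sup>2) + (h - a) * c * s"
  and "JJ \<equiv> \<lambda>c s. a * s\<^sup>2 - 2 * v * c * s + h * c\<^sup>2"
  and "B3 \<equiv> \<lambda>c s. g13 * c + g23 * s"
  and "J3 \<equiv> \<lambda>c s. g23 * c - g13 * s"
  and "T \<equiv> \<lambda>c s. g111 * c^3 + 3*g112 * c\<^sup>2 * s + 3*g122 * c * s\<^sup>2 + g222 * s^3"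
  and "Y \<equiv> \<lambda>c s. - g111 * c\<^sup>2 * s + g112*(c^3 - 2 * c * s\<^sup>2) + g122*(2 * c\<^sup>2 * s - s^3) + g222 * s\<^sup>2 * c"
  and "Z \<equiv> \<lambda>c s. g113 * c\<^sup>2 + 2*g123 * c * s + g223 * s\<^sup>2"
  and "U \<equiv> \<lambda>c s. g1111 * c^4 + 4*g1112 * c^3 * s + 6*g1122 * c\<^sup>2 * s\<^sup>2 + 4*g1222 * c * s^3 + g2222 * s^4"
 defines "E3 \<equiv> \<lambda>c s G. 6*(G * b c s - V c s/2*B3 c s) + T c s = 0"
  and "E4 \<equiv> \<lambda>c s G. - 12*(G\<^sup>2 + (V c s/2)\<^sup>2)*V c s
   + 12*(G\<^sup>2*JJ c s - G*V c s*J3 c s + (V c s/2)\<^sup>2*g33) + 12*(G*Y c s - V c s/2*Z c s) + U c s = 0"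
 assumes nonumb: "v ~= 0 \<or> a ~= h"
 shows "\<exists>Sol. finite Sol \<and> card Sol \<le> 22 \<and>
  (\<forall>c s G. c\<^sup>2 + s\<^sup>2 = 1 \<and> (c > 0 \<or> c = 0 \<and> s = 1) \<and> E3 c s G \<and> E4 c s G --> ((c, s), G) \<in> Sol)"
proof -
 define q where "q c s = T c s/6 - V c s/2*B3 c s" for c s
 \<comment> \<open>What \<open>E4\<close>, multiplied by the square of \<open>b\<close>, becomes
   when \<open>E3\<close> replaces \<open>G * b\<close> by \<open>- q\<close>. \<open>R\<close> is
   homogeneous of degree 8, while the term on the other side of \<open>elim\<close>, three times
   \<open>b^2 V^3\<close>, has degree 10.\<close>
 define R where "R c s = 12*(q c s)\<^sup>2*(JJ c s - V c s) - b c s*q c s*(12*Y c s - 12*V c s*J3 c s)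
  + (b c s)\<^sup>2*(3*(V c s)\<^sup>2*g33 - 6*V c s*Z c s + U c s)" for c s
 have elim: "R c s = 3*(b c s)\<^sup>2*(V c s)^3" if "E3 c s G" "E4 c s G" for c s G
 proof -
  have 1: "G * b c s = - q c s" using that(1) unfolding E3_def q_def by (simp add: field_simps)
  have "0 = (b c s)\<^sup>2*(- 12*(G\<^sup>2 + (V c s/2)\<^sup>2)*V c s
   + 12*(G\<^sup>2*JJ c s - G*V c s*J3 c s + (V c s/2)\<^sup>2*g33) + 12*(G*Y c s - V c s/2*Z c s) + U c s)"
   using that(2) by (simp add: E4_def)
  also have "... = 12*(G * b c s)\<^sup>2*(JJ c s - V c s) + b c s*(G * b c s)*(12*Y c s - 12*V c s*J3 c s)
   + (b c s)\<^sup>2*(3*(V c s)\<^sup>2*g33 - 6*V c s*Z c s + U c s) - 3*(b c s)\<^sup>2*(V c s)^3"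
   by (simp add: field_sq power3_eq_cube)
  finally show ?thesis unfolding 1 by (simp add: R_def)
 qed
 have hom: "V c (c*t) = c\<^sup>2*V 1 t" "b c (c*t) = c\<^sup>2 * b 1 t" "R c (c*t) = c^8 * R 1 t" for c t
 proof -
  let ?B = "c*t"
  show V: "V c ?B = c\<^sup>2*V 1 t" by (simp add: V_def ring_sq)
  show b: "b c ?B = c\<^sup>2 * b 1 t" by (simp add: b_def ring_sq)
  have JJ: "JJ c ?B = c\<^sup>2*JJ 1 t" by (simp add: JJ_def ring_sq)
  have B3: "B3 c ?B = c*B3 1 t" by (simp add: B3_def algebra_simps)
  have J3: "J3 c ?B = c*J3 1 t" by (simp add: J3_def algebra_simps)
  have T: "T c ?B = c^3*T 1 t" by (simp add: T_def ring_sq power3_eq_cube)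
  have Y: "Y c ?B = c^3*Y 1 t" by (simp add: Y_def ring_sq power3_eq_cube)
  have Z: "Z c ?B = c\<^sup>2*Z 1 t" by (simp add: Z_def ring_sq)
  have U: "U c ?B = c^4*U 1 t" by (simp add: U_def ring_sq power3_eq_cube power4_eq_xxxx)
  have q: "q c ?B = c^3*q 1 t" unfolding q_def T V B3 by (simp add: ring_sq power3_eq_cube)
  show "R c ?B = c^8 * R 1 t"
  proof -
   have "12*(c^3*q')\<^sup>2*(c\<^sup>2*J' - c\<^sup>2*V') - c\<^sup>2 * b'*(c^3*q') *
     (12*(c^3*Y') - 12*(c\<^sup>2*V')*(c*j)) +
     (c\<^sup>2 * b')\<^sup>2*(3*(c\<^sup>2*V')\<^sup>2*g33 - 6*(c\<^sup>2*V')*(c\<^sup>2*Z') + c^4*U') =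
    c^8*(12*q'\<^sup>2*(J' - V') - b'*q'*(12*Y' - 12*V'*j) +
     b'\<^sup>2*(3*V'\<^sup>2*g33 - 6*V'*Z' + U'))" for q' J' V' b' Y' j Z' U'
    by (simp add: eval_nat_numeral algebra_simps)
   then show ?thesis unfolding R_def V b JJ J3 Y Z U q .
  qed
 qed
 define pV :: "complex poly" where "pV = [:of_real a, 2 * of_real v, of_real h:]"
 let ?F = "h - a"
 define pb :: "complex poly" where "pb = [:of_real v, of_real ?F, - of_real v:]"
 define pe :: "complex poly" where "pe = [:of_real ?F, - 4 * of_real v, - of_real ?F:]"
 define pB :: "complex poly" where "pB = [:of_real g13, of_real g23:]"
 define pJ :: "complex poly" where "pJ = [:of_real g23, - of_real g13:]"
 define pT :: "complex poly" where "pT = [:of_real g111, 3 * of_real g112, 3 * of_real g122, of_real g222:]"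
 define pY :: "complex poly" where "pY = [:of_real g112, of_real (2*g122 - g111), of_real (g222 - 2*g112), - of_real g122:]"
 define pZ :: "complex poly" where "pZ = [:of_real g113, 2 * of_real g123, of_real g223:]"
 define pU :: "complex poly" where "pU = [:of_real g1111, 4 * of_real g1112, 6 * of_real g1122, 4 * of_real g1222, of_real g2222:]"
 define pq where "pq = [:1/6:]*pT - [:1/2:]*pV*pB"
 define X where "X = [:12:]*(pq*pq)*pe - pb*pq*([:12:]*pY - [:12:]*pV*pJ)
     + pb*pb*([:3 * of_real g33:]*(pV*pV) - [:6:]*pV*pZ + pU)"
 \<comment> \<open>On the unit circle the part of degree 8 may be multiplied by
   \<open>c^2 + s^2\<close>; the result, homogeneous of degree 10, is dehomogenised at
   \<open>c = 1\<close>. At the imaginary unit the factor \<open>1 + t^2\<close> vanishes, only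
   \<open>b^2 V^3\<close> is left, and it is non-zero off umbilic points.\<close>
 define Hp where "Hp = [:1, 0, 1:]*X - [:3:]*(pb*pb)*(pV*pV*pV)"
 note pdefs = pV_def pb_def pe_def pB_def pJ_def pT_def pY_def pZ_def pU_def
 have ev: "poly pV (of_real t) = of_real (V 1 t)" "poly pb (of_real t) = of_real (b 1 t)"
  "poly pe (of_real t) = of_real (JJ 1 t - V 1 t)" "poly pB (of_real t) = of_real (B3 1 t)"
  "poly pJ (of_real t) = of_real (J3 1 t)" "poly pT (of_real t) = of_real (T 1 t)"
  "poly pY (of_real t) = of_real (Y 1 t)" "poly pZ (of_real t) = of_real (Z 1 t)"
  "poly pU (of_real t) = of_real (U 1 t)" for t
  unfolding pdefs V_def b_def JJ_def B3_def J3_def T_def Y_def Z_def U_def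
  by (simp_all add: ring_sq power3_eq_cube power4_eq_xxxx)
 have evq: "poly pq (of_real t) = of_real (q 1 t)" for t by (simp add: pq_def q_def ev)
 have evX: "poly X (of_real t) = of_real (R 1 t)" for t by (simp add: X_def R_def evq ev power2_eq_square mult_ac)
 have Hp_real: "poly Hp (of_real t) = of_real ((1 + t\<^sup>2) * R 1 t - 3*(b 1 t)\<^sup>2*(V 1 t)^3)" for t
  by (simp add: Hp_def evX ev power2_eq_square power3_eq_cube distrib_right)
 have "poly Hp \<i> ~= 0"
 proof -
  let ?V = "of_real (a - h) + 2 * of_real v * \<i>" and ?b = "2 * of_real v + of_real (h - a)*\<i>"
  have "poly pV \<i> = ?V" "poly pb \<i> = ?b" unfolding pdefs by (simp_all add: algebra_simps)
  then have "poly Hp \<i> = - 3*(?b*?b)*(?V*?V*?V)" by (simp add: Hp_def)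
  moreover have "?V ~= 0" "?b ~= 0" using nonumb by (auto simp: complex_eq_iff)
  ultimately show ?thesis by simp
 qed
 then have Hp0: "Hp ~= 0" by auto
 let ?C = "[:3 * of_real g33:]*(pV*pV) - [:6:]*pV*pZ + pU"
 have degHp: "degree Hp \<le> 10"
 proof -
  have d: "degree (A*B) \<le> m + n" if "degree A \<le> m" "degree B \<le> n" for A B :: "complex poly" and m n
   using degree_mult_le[of A B] that by linarith
  have c: "degree ([:z:]*B) \<le> n" if "degree B \<le> n" for z :: complex and B n using d[of "[:z:]" 0 B n] that by simp
  have g: "degree pV \<le> 2" "degree pb \<le> 2" "degree pe \<le> 2" "degree pB \<le> 1" "degree pJ \<le> 1"
   "degree pT \<le> 3" "degree pY \<le> 3" "degree pZ \<le> 2" "degree pU \<le> 4"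
   unfolding pdefs by simp_all
  have VB: "degree (pV*pB) \<le> 3" "degree (pV*pJ) \<le> 3" "degree (pV*pV) \<le> 4" "degree (pV*pZ) \<le> 4"
   "degree (pb*pb) \<le> 4"
   using d[OF g(1) g(4)] d[OF g(1) g(5)] d[OF g(1) g(1)] d[OF g(1) g(8)] d[OF g(2) g(2)] by simp_all
  have gq: "degree pq \<le> 3" unfolding pq_def mult.assoc by (intro degree_diff_le c g VB)
  have "degree (pq*pq) \<le> 6" "degree (pb*pq) \<le> 5" using d[OF gq gq] d[OF g(2) gq] by simp_all
  note qq = this
  have "degree ([:12:]*(pq*pq)*pe) \<le> 8" using d[OF c[OF qq(1), of 12] g(3)] by simp
  moreover have "degree ([:12:]*pY - [:12:]*pV*pJ) \<le> 3" unfolding mult.assoc by (intro degree_diff_le c g VB)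
  from d[OF qq(2) this] have "degree (pb*pq*([:12:]*pY - [:12:]*pV*pJ)) \<le> 8" by simp
  moreover have "degree ?C \<le> 4" unfolding mult.assoc by (intro degree_add_le degree_diff_le c g VB)
  from d[OF VB(5) this] have "degree (pb*pb*?C) \<le> 8" by simp
  ultimately have "degree X \<le> 8" unfolding X_def by (intro degree_add_le degree_diff_le)
  then have "degree ([:1, 0, 1:]*X) \<le> 2 + 8" by (intro d) auto
  moreover have "degree ([:3:]*(pb*pb)*(pV*pV*pV)) \<le> 4 + (4 + 2)" by (intro d c VB g)
  ultimately show ?thesis unfolding Hp_def by (intro degree_diff_le) auto
 qed
 let ?A = "{t. poly Hp (of_real t) = 0}"
 \<comment> \<open>The direction \<open>(0, 1)\<close> has no slope and is the eleventh.\<close>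
 define dirs where "dirs = insert (0, 1) ((\<lambda>t. (1/sqrt (1 + t\<^sup>2), t/sqrt (1 + t\<^sup>2))) ` ?A)"
 have finH: "finite {t::real. poly Hp (of_real t) = 0}" and cardH: "card {t::real. poly Hp (of_real t) = 0} \<le> 10"
 proof -
  have inj: "inj_on complex_of_real ?A" by (simp add: inj_on_def)
  have sub: "complex_of_real ` ?A \<subseteq> {z. poly Hp z = 0}" by auto
  have "finite (complex_of_real ` ?A)" using finite_subset[OF sub poly_roots_finite[OF Hp0]] .
  then show "finite {t::real. poly Hp (of_real t) = 0}" using finite_imageD[OF _ inj] by blast
  have "card {t::real. poly Hp (of_real t) = 0} = card (complex_of_real ` ?A)" using card_image[OF inj] by simp
  also have "... \<le> card {z. poly Hp z = 0}" by (rule card_mono[OF poly_roots_finite[OF Hp0] sub])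
  also have "... \<le> 10" using card_poly_roots_bound[OF Hp0] degHp by simp
  finally show "card {t::real. poly Hp (of_real t) = 0} \<le> 10" .
 qed
 have fin_dirs: "finite dirs" unfolding dirs_def using finH by simp
 have card_dirs: "card dirs \<le> 11"
  unfolding dirs_def using card_image_le[OF finH, of "\<lambda>t. (1/sqrt (1 + t\<^sup>2), t/sqrt (1 + t\<^sup>2))"] cardH finH
  by (simp add: card_insert_if)
 define f where "f c s = {G. E3 c s G \<and> E4 c s G}" for c s
 have Gam: "finite (f c s) \<and> card (f c s) \<le> 2" if cs: "c\<^sup>2 + s\<^sup>2 = 1" for c s
 proof (cases "b c s = 0")
  case False
  have "f c s \<subseteq> {- q c s/b c s}" using False by (auto simp: f_def E3_def q_def field_simps)
  from finite_subset[OF this] card_mono[OF _ this] show ?thesis by simp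
 next
  case True
  \<comment> \<open>If \<open>b\<close> vanishes then \<open>E3\<close> says nothing about
    \<open>G\<close>, but \<open>E4\<close> is then a genuine quadratic equation: \<open>b\<close>
    and the leading coefficient \<open>12*(JJ - V)\<close> have no common zero, because this sum of
    squares is constant on the unit circle.\<close>
  have "(2 * b c s)\<^sup>2 + (JJ c s - V c s)\<^sup>2 = (4 * v\<^sup>2 + ?F\<^sup>2)*(c\<^sup>2 + s\<^sup>2)\<^sup>2"
   unfolding b_def JJ_def V_def by (simp add: ring_sq)
  also have "... ~= 0" using nonumb cs by (auto simp: add_nonneg_eq_0_iff)
  finally have e: "12*(JJ c s - V c s) ~= 0" using True by simp
  have sub: "f c s \<subseteq> {x. (12*(JJ c s - V c s))*x\<^sup>2 + (12*Y c s - 12*V c s*J3 c s)*x +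
   (- 12*(V c s/2)\<^sup>2*V c s + 12*(V c s/2)\<^sup>2*g33 - 6*V c s*Z c s + U c s) = 0}"
   by (auto simp: f_def E4_def algebra_simps)
  show ?thesis using finite_card_le_two_quadratic[OF e] finite_subset[OF sub] card_mono[OF _ sub] le_trans by blast
 qed
 define Sol where "Sol = (SIGMA d:{d\<in>dirs. (fst d)\<^sup>2 + (snd d)\<^sup>2 = 1}. f (fst d) (snd d))"
 let ?D = "{d\<in>dirs. (fst d)\<^sup>2 + (snd d)\<^sup>2 = 1}"
 have "finite Sol" unfolding Sol_def using fin_dirs Gam by (intro finite_SigmaI) auto
 moreover have "card Sol \<le> 22"
 proof -
  have "card Sol = (\<Sum>d\<in>?D. card (f (fst d) (snd d)))" unfolding Sol_def using fin_dirs Gam by (intro card_SigmaI) auto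
  also have "... \<le> (\<Sum>d\<in>?D. 2)" using Gam by (intro sum_mono) auto
  also have "... \<le> 2 * card dirs" using card_mono[OF fin_dirs, of ?D] by simp
  finally show ?thesis using card_dirs by simp
 qed
 moreover have "((c, s), G) \<in> Sol"
  if cs: "c\<^sup>2 + s\<^sup>2 = 1" and pos: "c > 0 \<or> c = 0 \<and> s = 1" and E: "E3 c s G" "E4 c s G" for c s G
 proof -
  have "(c, s) \<in> dirs"
  proof (cases "c = 0")
   case False
   define t where "t = s / c"
   have s: "s = c*t" using False by (simp add: t_def)
   let ?E = "1 + t\<^sup>2"
   have c1: "c\<^sup>2*?E = 1" using cs by (simp add: s algebra_simps power_mult_distrib)
   have "c^8 * R 1 t = 3*(c\<^sup>2 * b 1 t)\<^sup>2*(c\<^sup>2*V 1 t)^3" using elim[OF E] unfolding s hom .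
   also have "... = c^8*(3 * c\<^sup>2*(b 1 t)\<^sup>2*(V 1 t)^3)" by (simp add: eval_nat_numeral algebra_simps)
   finally have "R 1 t = 3 * c\<^sup>2*(b 1 t)\<^sup>2*(V 1 t)^3" using False by simp
   then have "?E * R 1 t = (c\<^sup>2*?E)*(3*(b 1 t)\<^sup>2*(V 1 t)^3)" by simp
   then have "poly Hp (of_real t) = 0" unfolding Hp_real c1 by simp
   moreover have "sqrt ?E = 1 / c"
   proof (rule real_sqrt_unique)
    show "(1 / c)\<^sup>2 = 1 + t\<^sup>2" using c1 False by (simp add: field_simps)
   qed (use pos False in simp)
   ultimately show ?thesis unfolding dirs_def using False by (auto intro!: image_eqI[of _ _ t] simp: t_def)
  qed (use pos in \<open>auto simp: dirs_def\<close>)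
  then show ?thesis using cs E by (simp add: Sol_def f_def)
 qed
 ultimately show ?thesis by (intro exI[of _ Sol]) blast
qed

lemma gradient_exists:
 assumes "rpd d g"
 shows "\<exists>N. \<forall>h. dd h g p = h\<bullet>N"
proof (intro exI allI)
 fix h
 have lin: "linear (\<lambda>u. dd u g p)" by (rule has_derivative_linear[OF rpd_has_derivative[OF assms]])
 let ?A = "\<Sum>b\<in>Basis. dd b g p *R b"
 have "dd h g p = dd (\<Sum>b\<in>Basis. (h\<bullet>b) *R b) g p" by (simp add: euclidean_representation)
 also have "... = (\<Sum>b\<in>Basis. (h\<bullet>b)*dd b g p)"
  using linear_sum[OF lin, of "\<lambda>b. (h\<bullet>b) *R b" Basis] linear_scale[OF lin] by simp
 also have "... = h\<bullet>?A" by (simp add: inner_sum_right mult.commute)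
 finally show "dd h g p = h\<bullet>?A" .
qed

lemma circ_minus: "circ p (- v) w = circ p v w"
proof -
 have "circ p (- v) w \<subseteq> circ p v w" for v unfolding circ_def
 proof clarify
  fix a b :: real assume "a\<^sup>2 + (w\<bullet>w) * b\<^sup>2 = b"
  then show "\<exists>a' b'. p + a *R - v + b *R w = p + a' *R v + b' *R w \<and> a'\<^sup>2 + (w\<bullet>w) * b'\<^sup>2 = b'"
   by (intro exI[of _ "- a"] exI[of _ b]) simp
 qed
 from this[of v] this[of "- v"] show ?thesis by auto
qed

lemma cpar_minus: "cpar p (- v) w s = cpar p v w (- s)"
 by (simp add: cpar_def)

definition flat_circ :: "('a::euclidean_space => real) => 'a => 'a => 'a => bool" where
 "flat_circ g p v w \<longleftrightarrow> norm v = 1 \<and> v\<bullet>w = 0 \<and> w ~= 0 \<and> (\<forall>s. g (cpar p v w s) = 0)"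

text \<open>The first contact equation makes \<open>v\<close> tangent to the surface and the second
  fixes the normal component of \<open>w\<close> by the second fundamental form \<open>V\<close>, as
  in Meusnier's theorem. A circle is thus given by its direction \<open>(c, s)\<close> and the
  tangential component \<open>G\<close> of \<open>w\<close>, for which the other two equations are
  the conditions of \<open>few_contact_circles\<close>.\<close>

lemma contact_in_frame:
 fixes g :: "'a::euclidean_space => real"
 assumes g: "rpd d g"
  and frame: "norm e1 = 1" "norm e2 = 1" "norm e3 = 1" "e1\<bullet>e2 = 0" "e1\<bullet>e3 = 0" "e2\<bullet>e3 = 0"
   "!!x. x = (x\<bullet>e1) *R e1 + (x\<bullet>e2) *R e2 + (x\<bullet>e3) *R e3"
  and N: "dd e1 g p = 0" "dd e2 g p = 0" "dd e3 g p = 1"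
  and vw: "flat_circ g p v w"
 defines "a \<equiv> dd e1 (dd e1 g) p" and "f \<equiv> dd e1 (dd e2 g) p" and "e \<equiv> dd e2 (dd e2 g) p"
  and "q2 \<equiv> \<lambda>x y. dd x (dd y g) p" and "q3 \<equiv> \<lambda>x y z. dd x (dd y (dd z g)) p" and "q4 \<equiv> \<lambda>x y z u. dd x (dd y (dd z (dd u g))) p"
  and "c \<equiv> v\<bullet>e1" and "s \<equiv> v\<bullet>e2" and "G \<equiv> (w\<bullet>e2)*(v\<bullet>e1) - (w\<bullet>e1)*(v\<bullet>e2)"
 defines "V \<equiv> a * c\<^sup>2 + 2*f * c * s + e * s\<^sup>2"
 shows "v = c *R e1 + s *R e2" "c\<^sup>2 + s\<^sup>2 = 1"
  "w = G *R (- s *R e1 + c *R e2) + (- V/2) *R e3"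
  "6*(G*(f*(c\<^sup>2 - s\<^sup>2) + (e - a) * c * s) - V/2*(q2 e1 e3 * c + q2 e2 e3 * s))
   + (q3 e1 e1 e1 * c^3 + 3*q3 e1 e1 e2 * c\<^sup>2 * s + 3*q3 e1 e2 e2 * c * s\<^sup>2 + q3 e2 e2 e2 * s^3) = 0" (is "?E3")
  "- 12*(G\<^sup>2 + (V/2)\<^sup>2)*V
   + 12*(G\<^sup>2*(a * s\<^sup>2 - 2*f * c * s + e * c\<^sup>2) - G*V*(q2 e2 e3 * c - q2 e1 e3 * s)
    + (V/2)\<^sup>2*q2 e3 e3)
   + 12*(G*(- q3 e1 e1 e1 * c\<^sup>2 * s + q3 e1 e1 e2*(c^3 - 2 * c * s\<^sup>2) + q3 e1 e2 e2*(2 * c\<^sup>2 * s - s^3) + q3 e2 e2 e2 * s\<^sup>2 * c)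
    - V/2*(q3 e1 e1 e3 * c\<^sup>2 + 2*q3 e1 e2 e3 * c * s + q3 e2 e2 e3 * s\<^sup>2))
   + (q4 e1 e1 e1 e1 * c^4 + 4*q4 e1 e1 e1 e2 * c^3 * s + 6*q4 e1 e1 e2 e2 * c\<^sup>2 * s\<^sup>2
    + 4*q4 e1 e2 e2 e2 * c * s^3 + q4 e2 e2 e2 e2 * s^4) = 0" (is "?E4")
proof -
 note r0 = g and r1 = rpd_dd[OF g] and r2 = rpd_dd[OF rpd_dd[OF g]] and r3 = rpd_dd[OF rpd_dd[OF rpd_dd[OF g]]]
 have vn: "norm v = 1" "v\<bullet>w = 0" "w ~= 0" and z: "!!t. g (cpar p v w t) = 0" using vw by (auto simp: flat_circ_def)
 note eqs = circle_contact_equations[OF g z]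
 have ddx: "dd x F y = (x\<bullet>e1)*dd e1 F y + (x\<bullet>e2)*dd e2 F y + (x\<bullet>e3)*dd e3 F y" if "rpd d F" for x F y
 proof -
  let ?C = "(x\<bullet>e1) *R e1 + (x\<bullet>e2) *R e2"
  have "dd (1 *R ?C + (x\<bullet>e3) *R e3) F y = 1*dd ?C F y + (x\<bullet>e3)*dd e3 F y" by (rule dd_lincomb[OF that])
  then show ?thesis unfolding dd_lincomb[OF that] scaleR_one frame(7)[of x, symmetric] by simp
 qed
 have v3: "v\<bullet>e3 = 0" using eqs(1) ddx[OF g, of v p] N by simp
 show vv: "v = c *R e1 + s *R e2" using frame(7)[of v] v3 by (simp add: c_def s_def)
 have ee: "e1\<bullet>e1 = 1" "e2\<bullet>e2 = 1" "e3\<bullet>e3 = 1" using frame by (simp_all add: dot_square_norm)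
 have "v\<bullet>v = c\<^sup>2 + s\<^sup>2" unfolding vv using ee frame by (simp add: inner_add inner_commute[of e2 e1] power2_eq_square)
 then show cs: "c\<^sup>2 + s\<^sup>2 = 1" using vn(1) by (simp add: dot_square_norm)
 let ?A = "w\<bullet>e2"
 let ?B = "w\<bullet>e1"
 have "c*?B + s*?A = 0" using vn(2) unfolding vv by (simp add: inner_add_left inner_commute[of w e1] inner_commute[of w e2])
 then have sw: "s*?A = - (c*?B)" by simp
 let ?D = "c\<^sup>2 + s\<^sup>2"
 have "- G * s = ?B * s\<^sup>2 - c*(s*?A)" unfolding G_def c_def[symmetric] s_def[symmetric] by (simp add: ring_sq)
 also have "... = ?B*?D" unfolding sw by (simp add: ring_sq)
 finally have w1: "w\<bullet>e1 = - G * s" using cs by simp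
 have "G * c = ?A * c\<^sup>2 - s*(c*?B)" unfolding G_def c_def[symmetric] s_def[symmetric] by (simp add: ring_sq)
 also have "c*?B = - (s*?A)" using sw by simp
 also have "?A * c\<^sup>2 - s * - (s*?A) = ?A*?D" by (simp add: ring_sq)
 finally have w2: "w\<bullet>e2 = G * c" using cs by simp
 define K where "K = w\<bullet>e3"
 let ?E = "- s *R e1 + c *R e2"
 have w: "w = G *R ?E + K *R e3" using frame(7)[of w] by (simp add: w1 w2 K_def algebra_simps)
 have WW: "w\<bullet>w = G\<^sup>2 + K\<^sup>2"
 proof -
  have "w\<bullet>w = G\<^sup>2*?D + K\<^sup>2" unfolding w
   using ee frame by (simp add: inner_add inner_diff inner_commute[of e2 e1] inner_commute[of e3 e1] inner_commute[of e3 e2] ring_sq)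
  then show ?thesis using cs by simp
 qed
 have dv: "dd v F = (\<lambda>y. c*dd e1 F y + s*dd e2 F y)" if "rpd d F" for F unfolding vv by (rule dd_lincomb_fun[OF that])
 have dw: "dd w F = (\<lambda>y. G*(c*dd e2 F y - s*dd e1 F y) + K*dd e3 F y)" if "rpd d F" for F
  using ddx[OF that, of w] by (auto simp: w1 w2 K_def algebra_simps)
 have lin: "dd u (\<lambda>y. x1*F1 y + x2*F2 y) = (\<lambda>y. x1*dd u F1 y + x2*dd u F2 y)" if "rpd d F1" "rpd d F2" for u x1 x2 F1 F2
  unfolding dd_add[OF rpd_cmult[OF that(1)] rpd_cmult[OF that(2)]] dd_cmult[OF that(1)] dd_cmult[OF that(2)] ..
 note comm = dd_commute[OF r0, of e2 e1] dd_commute[OF r0, of e3 e1] dd_commute[OF r0, of e3 e2]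
  dd_commute[OF r1, of e2 e1] dd_commute[OF r1, of e3 e1] dd_commute[OF r1, of e3 e2] dd_commute[OF r2, of e2 e1]
 note L = lin[OF r1 r1] lin[OF r2 r2] lin[OF r3 r3]
 have Vf: "dd v (dd v F) = (\<lambda>y. c\<^sup>2*dd e1 (dd e1 F) y + 2 * c * s*dd e1 (dd e2 F) y + s\<^sup>2*dd e2 (dd e2 F) y)" if F: "rpd d F" for F
  unfolding dv[OF rpd_dd[OF F]] unfolding dv[OF F] lin[OF rpd_dd[OF F] rpd_dd[OF F]] dd_commute[OF F, of e2 e1]
  by (auto simp: ring_sq)
 have V: "dd v (dd v g) p = V" unfolding Vf[OF g] V_def a_def f_def e_def by (simp add: algebra_simps)
 have "dd w g p = K" using ddx[OF g, of w p] N by (simp add: K_def)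
 then have k: "K = - V/2" using eqs(2) V by simp
 show "w = G *R ?E + (- V/2) *R e3" using w unfolding k .
 have vw: "dd v (dd w g) p = G*(f*(c\<^sup>2 - s\<^sup>2) + (e - a) * c * s) + K*(q2 e1 e3 * c + q2 e2 e3 * s)"
  unfolding q2_def dd_commute[OF g, of v w] dw[OF r1] unfolding dv[OF g] L comm a_def f_def e_def
  by (simp add: ring_sq)
 have vvv: "dd v (dd v (dd v g)) p = q3 e1 e1 e1 * c^3 + 3*q3 e1 e1 e2 * c\<^sup>2 * s + 3*q3 e1 e2 e2 * c * s\<^sup>2 + q3 e2 e2 e2 * s^3"
  unfolding q3_def Vf[OF r1] unfolding dv[OF g] L comm by (simp add: ring_sq power3_eq_cube)
 show ?E3
 proof -
  have id: "6*(G * b + K*B) + T = 6*(G * b - V/2*B) + T" for b B T unfolding k by simp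
  show ?thesis by (rule trans[OF id[symmetric] eqs(3)[unfolded vw vvv]])
 qed
 have ww: "dd w (dd w g) p = G\<^sup>2*(a * s\<^sup>2 - 2*f * c * s + e * c\<^sup>2) + 2*G*K*(q2 e2 e3 * c - q2 e1 e3 * s) + K\<^sup>2*q2 e3 e3"
 proof -
  have dw': "dd w F = (\<lambda>y. 1*(G * c*dd e2 F y + (- G * s)*dd e1 F y) + K*dd e3 F y)" if "rpd d F" for F
   unfolding dw[OF that] by (auto simp: algebra_simps)
  have lin3: "dd u (\<lambda>y. 1*(x1*F1 y + x2*F2 y) + x3*F3 y) = (\<lambda>y. 1*(x1*dd u F1 y + x2*dd u F2 y) + x3*dd u F3 y)"
   if "rpd d F1" "rpd d F2" "rpd d F3" for u x1 x2 x3 F1 F2 F3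
   unfolding lin[OF rpd_add[OF rpd_cmult[OF that(1)] rpd_cmult[OF that(2)]] that(3)] lin[OF that(1,2)] ..
  show ?thesis unfolding q2_def dw'[OF r1] unfolding dw'[OF g] lin3[OF r1 r1 r1] comm a_def f_def e_def by (simp add: ring_sq)
 qed
 have lin4: "dd u (\<lambda>y. c\<^sup>2*F1 y + 2 * c * s*F2 y + s\<^sup>2*F3 y) = (\<lambda>y. c\<^sup>2*dd u F1 y + 2 * c * s*dd u F2 y + s\<^sup>2*dd u F3 y)"
  if "rpd d F1" "rpd d F2" "rpd d F3" for u F1 F2 F3
  using lin[OF rpd_add[OF rpd_cmult[OF that(1), of "c\<^sup>2"] rpd_cmult[OF that(2), of "2 * c * s"]] that(3), of u 1 "s\<^sup>2"] lin[OF that(1,2), of u "c\<^sup>2" "2 * c * s"] by simp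
 have vvw: "dd v (dd v (dd w g)) p = G*(- q3 e1 e1 e1 * c\<^sup>2 * s + q3 e1 e1 e2*(c^3 - 2 * c * s\<^sup>2) + q3 e1 e2 e2*(2 * c\<^sup>2 * s - s^3) + q3 e2 e2 e2 * s\<^sup>2 * c)
    + K*(q3 e1 e1 e3 * c\<^sup>2 + 2*q3 e1 e2 e3 * c * s + q3 e2 e2 e3 * s\<^sup>2)"
 proof -
  have "dd v (dd v (dd w g)) = dd w (dd v (dd v g))" using dd_commute[OF g, of v w] dd_commute[OF r1, of v w] by metis
  then show ?thesis unfolding q3_def Vf[OF g] dw[OF rpd_dd[OF rpd_dd[OF g]]]
   by (simp only: dw[OF r2] dw[OF rpd_add[OF rpd_add[OF rpd_cmult[OF r2] rpd_cmult[OF r2]] rpd_cmult[OF r2]]] lin4[OF r2 r2 r2] comm)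
    (simp add: ring_sq power3_eq_cube)
 qed
 have vvvv: "dd v (dd v (dd v (dd v g))) p = q4 e1 e1 e1 e1 * c^4 + 4*q4 e1 e1 e1 e2 * c^3 * s + 6*q4 e1 e1 e2 e2 * c\<^sup>2 * s\<^sup>2
    + 4*q4 e1 e2 e2 e2 * c * s^3 + q4 e2 e2 e2 e2 * s^4"
  unfolding q4_def Vf[OF r2] unfolding Vf[OF g] lin4[OF r2 r2 r2] lin4[OF r3 r3 r3] comm
  by (simp add: ring_sq power3_eq_cube power4_eq_xxxx)
 show ?E4
 proof -
  have id: "-12*(G\<^sup>2 + K\<^sup>2)*V + 12*(G\<^sup>2*J + 2*G*K*j + K\<^sup>2*h) + 12*(G*Y + K*Z) + U
    = - 12*(G\<^sup>2 + (V/2)\<^sup>2)*V + 12*(G\<^sup>2*J - G*V*j + (V/2)\<^sup>2*h) + 12*(G*Y - V/2*Z) + U" for J j h Y Z U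
   unfolding k by (simp add: ring_sq)
  show ?thesis by (rule trans[OF id[symmetric] eqs(4)[unfolded WW V ww vvw vvvv]])
 qed
qed

lemma orthonormal_frame:
 fixes e3 :: "real^3"
 assumes "norm e3 = 1"
 shows "\<exists>e1 e2. norm e1 = 1 \<and> norm e2 = 1 \<and> e1\<bullet>e2 = 0 \<and> e1\<bullet>e3 = 0 \<and> e2\<bullet>e3 = 0 \<and>
  (\<forall>x. x = (x\<bullet>e1) *R e1 + (x\<bullet>e2) *R e2 + (x\<bullet>e3) *R e3)"
proof -
 define S where "S = {x. e3\<bullet>x = 0}"
 have "e3 ~= 0" using assms by auto
 then have dimS: "dim S = 2" by (simp add: S_def dim_hyperplane)
 have sub: "subspace S" by (simp add: S_def subspace_hyperplane)
 obtain B where B: "B \<subseteq> S" "pairwise orthogonal B" "!!x. x \<in> B ==> norm x = 1" "independent B" "card B = dim S" "span B = S"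
  by (rule orthonormal_basis_subspace[OF sub]) (rule that)
 obtain e1 e2 where e: "B = {e1, e2}" "e1 ~= e2" using B(5) dimS by (auto simp: card_2_iff)
 have n: "norm e1 = 1" "norm e2 = 1" using B(3) e by auto
 have o: "e1\<bullet>e2 = 0" using B(2) e by (auto simp: pairwise_def orthogonal_def)
 have o3: "e1\<bullet>e3 = 0" "e2\<bullet>e3 = 0" using B(1) e by (auto simp: S_def inner_commute)
 have ee: "e1\<bullet>e1 = 1" "e2\<bullet>e2 = 1" "e3\<bullet>e3 = 1" using n assms by (simp_all add: dot_square_norm)
 have "x = (x\<bullet>e1) *R e1 + (x\<bullet>e2) *R e2 + (x\<bullet>e3) *R e3" for x
 proof -
  define y where "y = x - (x\<bullet>e3) *R e3"
  have "y \<in> S" using ee by (simp add: y_def S_def inner_diff_right inner_commute)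
  then have "y \<in> span {e1, e2}" using B(6) e by simp
  then obtain a b where y: "y = a *R e1 + b *R e2" by (auto simp: span_insert span_singleton algebra_simps)
  have "y\<bullet>e1 = a" "y\<bullet>e2 = b" using ee o by (simp_all add: y inner_add_left inner_commute[of e2 e1])
  moreover have "y\<bullet>e1 = x\<bullet>e1" "y\<bullet>e2 = x\<bullet>e2" using o3 by (simp_all add: y_def inner_diff_left inner_commute[of e3])
  ultimately have "x - (x\<bullet>e3) *R e3 = (x\<bullet>e1) *R e1 + (x\<bullet>e2) *R e2" using y y_def by simp
  then show ?thesis by (simp add: algebra_simps)
 qed
 then show ?thesis using n o o3 by blast
qed

lemma flat_circ_minus: "flat_circ g p (- v) w \<longleftrightarrow> flat_circ g p v w"
proof -
 have "flat_circ g p v w ==> flat_circ g p (- v) w" for v by (auto simp: flat_circ_def cpar_minus)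
 from this[of v] this[of "- v"] show ?thesis by auto
qed

text \<open>Where the second fundamental form is a multiple of the identity, all vectors
  \<open>w\<close> have the same normal component. Every flat circle through \<open>p\<close> then
  satisfies one and the same equation, that of a plane if \<open>M = 0\<close> and of a sphere
  otherwise.\<close>

theorem umbilic_of_many_circles:
 fixes g :: "real^3 => real"
 assumes g: "rpd d g" and nz: "dd h0 g p ~= 0"
  and many: "\<not> (finite {circ p v w |v w. flat_circ g p v w} \<and> card {circ p v w |v w. flat_circ g p v w} \<le> 22)"
 shows "!!h y. [|dd h g p = 0; dd y g p = 0; h\<bullet>y = 0|] ==> dd h (dd y g) p = 0"
  and "\<exists>M. \<forall>v w. flat_circ g p v w --> circ p v w \<subseteq> {y. dd (y - p) g p = M*((y - p)\<bullet>(y - p))}" (is ?P)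
proof -
 obtain N where N: "!!h. dd h g p = h\<bullet>N" using gradient_exists[OF g, of p] by blast
 have "N ~= 0" using nz N by auto
 define G where "G = norm N"
 have G: "G > 0" using \<open>N ~= 0\<close> by (simp add: G_def)
 define e3 where "e3 = (1/G) *R N"
 have e3: "norm e3 = 1" using G by (simp add: e3_def G_def)
 obtain e1 e2 where fr: "norm e1 = 1" "norm e2 = 1" "e1\<bullet>e2 = 0" "e1\<bullet>e3 = 0" "e2\<bullet>e3 = 0"
  "!!x. x = (x\<bullet>e1) *R e1 + (x\<bullet>e2) *R e2 + (x\<bullet>e3) *R e3"
  using orthonormal_frame[OF e3] by blast
 have ee: "e1\<bullet>e1 = 1" "e2\<bullet>e2 = 1" "e3\<bullet>e3 = 1" using fr e3 by (simp_all add: dot_square_norm)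
 define f where "f x = (1/G)*g x" for x
 have f: "rpd d f" unfolding f_def by (rule rpd_cmult[OF g])
 have ddf: "dd u f = (\<lambda>x. (1/G)*dd u g x)" for u unfolding f_def by (rule dd_cmult[OF g])
 have ddf2: "dd u (dd u' f) = (\<lambda>x. (1/G)*dd u (dd u' g) x)" for u u' unfolding ddf by (rule dd_cmult[OF rpd_dd[OF g]])
 have Nf: "dd u f p = u\<bullet>e3" for u using G by (simp add: ddf N e3_def)
 have flat: "flat_circ f p v w \<longleftrightarrow> flat_circ g p v w" for v w using G by (simp add: flat_circ_def f_def)
 define a \<beta> \<epsilon> where "a = dd e1 (dd e1 f) p" "\<beta> = dd e1 (dd e2 f) p" "\<epsilon> = dd e2 (dd e2 f) p"
 have N1: "dd e1 f p = 0" "dd e2 f p = 0" "dd e3 f p = 1" using fr ee by (simp_all add: Nf)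
 note C = contact_in_frame[OF f fr(1,2) e3 fr(3,4,5,6) N1, folded a_\<beta>_\<epsilon>_def]
 have umb: "\<beta> = 0 \<and> a = \<epsilon>"
 proof (rule ccontr)
  assume "\<not> ?thesis"
  then have nonumb: "\<beta> ~= 0 \<or> a ~= \<epsilon>" by blast
  \<comment> \<open>\<open>?pos\<close> selects one of the tangents \<open>v\<close> and
    \<open>- v\<close>, which describe the same circle.\<close>
  let ?h = "\<lambda>x y. dd x (dd y f) p" and ?k = "\<lambda>x y z. dd x (dd y (dd z f)) p" and ?l = "\<lambda>x y z u. dd x (dd y (dd z (dd u f))) p"
  let ?pos = "\<lambda>v. v\<bullet>e1 > 0 \<or> v\<bullet>e1 = 0 \<and> v\<bullet>e2 = 1" and ?t = "\<lambda>v w. ((v\<bullet>e1, v\<bullet>e2), (w\<bullet>e2)*(v\<bullet>e1) - (w\<bullet>e1)*(v\<bullet>e2))"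
  obtain Sol :: "((real\<times>real)\<times>real) set" where Sol: "finite Sol" "card Sol \<le> 22"
   and mem: "!!v w. [|flat_circ f p v w; ?pos v|] ==> ?t v w \<in> Sol"
  proof (rule exE[OF few_contact_circles[OF nonumb, where ?g13.0 = "?h e1 e3" and ?g23.0 = "?h e2 e3" and ?g33.0 = "?h e3 e3"
    and ?g111.0 = "?k e1 e1 e1" and ?g112.0 = "?k e1 e1 e2" and ?g122.0 = "?k e1 e2 e2" and ?g222.0 = "?k e2 e2 e2"
    and ?g113.0 = "?k e1 e1 e3" and ?g123.0 = "?k e1 e2 e3" and ?g223.0 = "?k e2 e2 e3" and ?g1111.0 = "?l e1 e1 e1 e1"
    and ?g1112.0 = "?l e1 e1 e1 e2" and ?g1122.0 = "?l e1 e1 e2 e2" and ?g1222.0 = "?l e1 e2 e2 e2" and ?g2222.0 = "?l e2 e2 e2 e2"]], goal_cases)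
   case (1 Sol)
   note S3 = conjunct2[OF conjunct2[OF 1(2)], THEN spec, THEN spec, THEN spec, THEN mp]
   have "?t v w \<in> Sol" if "flat_circ f p v w" "?pos v" for v w
    by (rule S3, intro conjI) (fact C(2)[OF that(1)] that(2) C(4)[OF that(1)] C(5)[OF that(1)])+
   then show ?case by (rule 1(1)[OF conjunct1[OF 1(2)] conjunct1[OF conjunct2[OF 1(2)]]])
  qed
  define e where "e = (\<lambda>((c, s), m). circ p (c *R e1 + s *R e2)
   (m *R (- s *R e1 + c *R e2) + (- (a * c\<^sup>2 + 2*\<beta> * c * s + \<epsilon> * s\<^sup>2)/2) *R e3))"
  have sub: "{circ p v w |v w. flat_circ g p v w} \<subseteq> e ` Sol"
  proof
   fix X assume "X \<in> {circ p v w |v w. flat_circ g p v w}"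
   then obtain v w where X: "X = circ p v w" and vw: "flat_circ f p v w" using flat by blast
   have pos: "X \<in> e ` Sol" if X: "X = circ p v w" and vw: "flat_circ f p v w"
    and ps: "?pos v" for v w
   proof (rule image_eqI[OF _ mem[OF vw ps]])
    show "X = e (?t v w)" unfolding e_def prod.case using C(1,3)[OF vw] X by (metis (no_types, lifting))
   qed
   have "(v\<bullet>e1)\<^sup>2 + (v\<bullet>e2)\<^sup>2 = 1" using C(2)[OF vw] .
   then have "?pos v \<or> ?pos (- v)" by (auto simp: power2_eq_1_iff linorder_neq_iff)
   then consider "?pos v" | "?pos (- v)" by blast
   then show "X \<in> e ` Sol"
   proof cases
    case 1 then show ?thesis by (rule pos[OF X vw])
   next
    case 2
    have "X = circ p (- v) w" using X by (simp add: circ_minus)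
    then show ?thesis by (rule pos[OF _ _ 2]) (use vw in \<open>simp add: flat_circ_minus\<close>)
   qed
  qed
  have "card {circ p v w |v w. flat_circ g p v w} \<le> card (e ` Sol)" by (rule card_mono[OF finite_imageI[OF Sol(1)] sub])
  also have "... \<le> 22" using card_image_le[OF Sol(1), of e] Sol(2) by linarith
  finally show False using many finite_subset[OF sub finite_imageI[OF Sol(1)]] by blast
 qed
 have ddx: "dd x F y = (x\<bullet>e1)*dd e1 F y + (x\<bullet>e2)*dd e2 F y + (x\<bullet>e3)*dd e3 F y" if "rpd d F" for x F y
 proof -
  let ?A = "(x\<bullet>e1) *R e1 + (x\<bullet>e2) *R e2"
  have "dd (1 *R ?A + (x\<bullet>e3) *R e3) F y = 1*dd ?A F y + (x\<bullet>e3)*dd e3 F y" by (rule dd_lincomb[OF that])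
  then show ?thesis unfolding dd_lincomb[OF that] scaleR_one fr(6)[of x, symmetric] by simp
 qed
 show "dd h (dd y g) p = 0" if hy: "dd h g p = 0" "dd y g p = 0" "h\<bullet>y = 0" for h y
 proof -
  have h3: "h\<bullet>e3 = 0" "y\<bullet>e3 = 0" using hy(1,2) by (simp_all add: N e3_def)
  have "dd e1 (dd y f) p = (y\<bullet>e1) * a" "dd e2 (dd y f) p = (y\<bullet>e2) * a" unfolding dd_commute[OF f, of _ y] ddx[OF rpd_dd[OF f], of y]
   using umb h3 dd_commute[OF f, of e2 e1] by (simp_all add: a_\<beta>_\<epsilon>_def)
  then have "dd h (dd y f) p = a*((h\<bullet>e1)*(y\<bullet>e1) + (h\<bullet>e2)*(y\<bullet>e2))"
   using ddx[OF rpd_dd[OF f], of h y p] h3 by (simp add: algebra_simps)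
  moreover have "h\<bullet>y = (h\<bullet>e1)*(y\<bullet>e1) + (h\<bullet>e2)*(y\<bullet>e2)"
  proof -
   have "h\<bullet>y = ((h\<bullet>e1) *R e1 + (h\<bullet>e2) *R e2)\<bullet>y" using fr(6)[of h] h3 by simp
   then show ?thesis by (simp add: inner_add_left inner_commute[of y])
  qed
  ultimately show ?thesis using hy(3) G by (simp add: ddf2)
 qed
 show ?P
 \<comment> \<open>A point of the circle is \<open>p + j *R v + b *R w\<close> with \<open>b\<close>
   equal to its squared distance from \<open>p\<close>, and \<open>w\<bullet>e3 = - a/2\<close>;
   multiplying by the gradient length \<open>G\<close> gives the constant.\<close>
 proof (intro exI[of _ "- (G * a/2)"] allI impI subsetI CollectI)
  fix v w y assume vw: "flat_circ g p v w" and y: "y \<in> circ p v w"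
  have vw': "flat_circ f p v w" using vw flat by simp
  have v: "norm v = 1" "v\<bullet>w = 0" using vw by (auto simp: flat_circ_def)
  obtain j b where yy: "y = p + j *R v + b *R w" and ab: "j\<^sup>2 + (w\<bullet>w) * b\<^sup>2 = b"
   using y unfolding circ_def by blast
  let ?B = "v\<bullet>e1"
  let ?C = "v\<bullet>e2"
  have cs: "?B\<^sup>2 + ?C\<^sup>2 = 1" using C(2)[OF vw'] .
  have v3: "v\<bullet>e3 = 0" using arg_cong[OF C(1)[OF vw'], of "\<lambda>x. x\<bullet>e3"] fr by (simp add: inner_add_left)
  have "w\<bullet>e3 = - (a*?B\<^sup>2 + 2*\<beta>*?B*?C + \<epsilon>*?C\<^sup>2)/2"
   using arg_cong[OF C(3)[OF vw'], of "\<lambda>x. x\<bullet>e3"] fr ee by (simp add: inner_add_left inner_diff_left)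
  also have "... = - (a*(?B\<^sup>2 + ?C\<^sup>2))/2" using umb by (simp add: algebra_simps)
  finally have w3: "w\<bullet>e3 = - a/2" using cs by simp
  have "dd (y - p) g p = G*((y - p)\<bullet>e3)" using G by (simp add: N e3_def)
  also have "(y - p)\<bullet>e3 = b*(- a/2)" by (simp add: yy inner_add_left v3 w3)
  also have "(y - p)\<bullet>(y - p) = b"
  proof -
   have "v\<bullet>v = 1" using v(1) by (simp add: dot_square_norm)
   then have "(y - p)\<bullet>(y - p) = j\<^sup>2 + (w\<bullet>w) * b\<^sup>2" using v(2)
    by (simp add: yy inner_add inner_commute[of w v] power2_eq_square)
   then show ?thesis using ab by simp
  qed
  then have "b = (y - p)\<bullet>(y - p)" ..
  finally show "dd (y - p) g p = - (G * a/2)*((y - p)\<bullet>(y - p))" by simp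
 qed
qed

section \<open>Osculating spheres along a circle\<close>

lemma dd_sum:
 assumes "finite A" "!!a. a \<in> A ==> rpd d (F a)"
 shows "dd h (\<lambda>x. \<Sum>a\<in>A. F a x) = (\<lambda>x. \<Sum>a\<in>A. dd h (F a) x)"
 using assms
proof (induction A rule: finite_induct)
 case (insert a A)
 have "rpd d (F a)" "rpd d (\<lambda>x. \<Sum>a\<in>A. F a x)" using insert by (auto intro: rpd_sum)
 from dd_add[OF this] show ?case using insert by simp
qed (simp add: dd_const)

lemma dd_Basis:
 assumes "rpd d g"
 shows "dd y g = (\<lambda>x. \<Sum>b\<in>Basis. (y\<bullet>b)*dd b g x)"
proof
 fix x
 have lin: "linear (\<lambda>u. dd u g x)" by (rule has_derivative_linear[OF rpd_has_derivative[OF assms]])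
 let ?A = "\<Sum>b\<in>Basis. (y\<bullet>b)*dd b g x"
 have "dd y g x = dd (\<Sum>b\<in>Basis. (y\<bullet>b) *R b) g x" by (simp add: euclidean_representation)
 also have "... = ?A" using linear_sum[OF lin, of "\<lambda>b. (y\<bullet>b) *R b" Basis] linear_scale[OF lin] by simp
 finally show "dd y g x = ?A" .
qed

lemma rpd_radial_derivative:
 assumes "rpd d g"
 shows "rpd (d + 1) (\<lambda>x. dd (x - o') g x)" (is ?Q)
  and "dd h (\<lambda>x. dd (x - o') g x) x = dd h g x + dd h (dd (x - o') g) x" (is ?P)
proof -
 have L: "rpd 1 (\<lambda>x. (x - o')\<bullet>b)" for b :: 'a
  using rpd_add[OF rpd_inner[of 1 b] rpd_const[of 1 "- (o'\<bullet>b)"]] by (simp add: inner_diff_left)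
 let ?A = "\<lambda>x b. (x - o')\<bullet>b"
 have r: "rpd (d + 1) (\<lambda>x. (?A x b)*dd b g x)" for b by (rule rpd_mult[OF L rpd_dd[OF assms]]) simp
 have e: "(\<lambda>x. dd (x - o') g x) = (\<lambda>x. \<Sum>b\<in>Basis. (?A x b)*dd b g x)" by (rule ext) (rule fun_cong[OF dd_Basis[OF assms]])
 show ?Q unfolding e by (intro rpd_sum r) auto
 have Lh: "dd h (\<lambda>x. (x - o')\<bullet>b) = (\<lambda>x. h\<bullet>b)" for b :: 'a
  using dd_add[OF rpd_inner[of 1 b] rpd_const[of 1 "- (o'\<bullet>b)"], of h] by (simp add: inner_diff_left dd_inner dd_const)
 have "dd h (\<lambda>x. (?A x b)*dd b g x) = (\<lambda>x. (?A x b)*dd h (dd b g) x + (h\<bullet>b)*dd b g x)" for b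
  unfolding dd_mult[OF L rpd_dd[OF assms]] Lh ..
 then have "dd h (\<lambda>x. dd (x - o') g x) x = (\<Sum>b\<in>Basis. (?A x b)*dd h (dd b g) x) + (\<Sum>b\<in>Basis. (h\<bullet>b)*dd b g x)"
  unfolding e dd_sum[OF finite_Basis r] by (simp add: sum.distrib)
 also have "(\<Sum>b\<in>Basis. (h\<bullet>b)*dd b g x) = dd h g x" by (simp add: dd_Basis[OF assms, of h])
 also have "(\<Sum>b\<in>Basis. (?A x b)*dd h (dd b g) x) = dd h (dd (x - o') g) x"
  unfolding dd_commute[OF assms, of h "x - o'"] dd_commute[OF assms, of h] by (simp add: dd_Basis[OF rpd_dd[OF assms], of "x - o'"])
 finally show ?P by simp
qed

definition ctan :: "'a::euclidean_space => 'a => real => 'a" where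
 "ctan v w s = ((1 - (w\<bullet>w) * s\<^sup>2)/(1 + (w\<bullet>w) * s\<^sup>2)\<^sup>2) *R v + (2 * s/(1 + (w\<bullet>w) * s\<^sup>2)\<^sup>2) *R w"

lemma cpar_derivative: "(cpar p v w has_derivative (\<lambda>h. h *R ctan v w s)) (at s)"
proof -
 define W where "W = w\<bullet>w"
 have q: "1 + W * s\<^sup>2 ~= 0" using cpar_denom_pos[of w s] by (simp add: W_def)
 have 1: "((\<lambda>s. s/(1 + W * s\<^sup>2)) has_real_derivative (1 - W * s\<^sup>2)/(1 + W * s\<^sup>2)\<^sup>2) (at s)"
  by (rule derivative_eq_intros refl q)+ (simp add: q field_sq)
 have 2: "((\<lambda>s. s\<^sup>2/(1 + W * s\<^sup>2)) has_real_derivative (2 * s)/(1 + W * s\<^sup>2)\<^sup>2) (at s)"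
  by (rule derivative_eq_intros refl q)+ (simp add: q field_sq)
 have 3: "(cpar p v w has_derivative (\<lambda>h. 0 + ((1 - W * s\<^sup>2)/(1 + W * s\<^sup>2)\<^sup>2*h) *R v + ((2 * s)/(1 + W * s\<^sup>2)\<^sup>2*h) *R w)) (at s)"
  unfolding cpar_def[abs_def] W_def[symmetric]
  by (intro has_derivative_add has_derivative_const has_derivative_scaleR_left 1[unfolded has_field_derivative_def] 2[unfolded has_field_derivative_def])
 show ?thesis by (rule has_derivative_eq_rhs[OF 3]) (auto simp: ctan_def W_def scaleR_add_right mult.commute)
qed

lemma rpd_along_cpar:
 assumes "rpd d F"
 shows "((\<lambda>s. F (cpar p v w s)) has_real_derivative dd (ctan v w s) F (cpar p v w s)) (at s)"
proof -
 have "((\<lambda>s. F (cpar p v w s)) has_derivative (\<lambda>h. dd (h *R ctan v w s) F (cpar p v w s))) (at s)"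
  by (rule has_derivative_compose[OF cpar_derivative rpd_has_derivative[OF assms]])
 moreover have "dd (h *R ctan v w s) F x = h*dd (ctan v w s) F x" for h x using dd_lincomb[OF assms, of h "ctan v w s" 0 "ctan v w s"] by simp
 ultimately show ?thesis by (simp add: has_field_derivative_def mult_commute_abs)
qed

text \<open>Subtracting a multiple of \<open>q\<close> removes from \<open>p\<close> the coefficient
  in degree \<open>degree q\<close>. If the rest \<open>r\<close> were non-zero, the top
  coefficients of \<open>pderiv r*q\<close> and \<open>r*pderiv q\<close> would force its degree to
  be that of \<open>q\<close>, where its coefficient is 0.\<close>

lemma proportional_of_zero_wronskian:
 fixes p q :: "real poly"
 assumes "pderiv p*q = p*pderiv q"
 shows "\<exists>a b. (a ~= 0 \<or> b ~= 0) \<and> Polynomial.smult a p = Polynomial.smult b q"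
proof (cases "q = 0")
 case True
 then show ?thesis by (intro exI[of _ 0] exI[of _ 1]) simp
next
 case q: False
 define c where "c = poly.coeff p (degree q)/lead_coeff q"
 define r where "r = p - Polynomial.smult c q"
 have W: "pderiv r*q = r*pderiv q" using assms by (simp add: r_def pderiv_diff pderiv_smult algebra_simps)
 have rc: "poly.coeff r (degree q) = 0" using q by (simp add: r_def c_def)
 let ?A = "degree r + degree q - 1"
 have "r = 0"
 proof (rule ccontr)
  assume r: "r ~= 0"
  have "poly.coeff (pderiv r*q) ?A = real (degree r)*lead_coeff r*lead_coeff q"
   "poly.coeff (r*pderiv q) ?A = real (degree q)*lead_coeff r*lead_coeff q"
   if "degree r + degree q > 0"
  proof -
   have top: "poly.coeff (pderiv a * b) (degree a + degree b - 1) = real (degree a)*lead_coeff a*lead_coeff b" for a b :: "real poly"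
   proof (cases "degree a = 0")
    case True then show ?thesis using pderiv_eq_0_iff[of a] by simp
   next
    case False
    have e: "degree a + degree b - 1 = degree (pderiv a) + degree b" using False by (simp add: degree_pderiv)
    show ?thesis unfolding e coeff_mult_degree_sum using False by (simp add: degree_pderiv coeff_pderiv)
   qed
   show "poly.coeff (pderiv r*q) ?A = real (degree r)*lead_coeff r*lead_coeff q" by (rule top)
   show "poly.coeff (r*pderiv q) ?A = real (degree q)*lead_coeff r*lead_coeff q" using top[of q r] by (simp add: mult_ac add.commute)
  qed
  then have "degree r = degree q" using W r q by (cases "degree r + degree q = 0") auto
  then show False using rc r by (metis leading_coeff_0_iff)
 qed
 then show ?thesis by (intro exI[of _ 1] exI[of _ c]) (simp add: r_def)
qed

lemma circle_normal_frame:
 fixes v w :: "real^3"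
 assumes "norm v = 1" "v\<bullet>w = 0" "w ~= 0"
 shows "\<exists>n. norm n = 1 \<and> n\<bullet>v = 0 \<and> n\<bullet>w = 0 \<and>
  (\<forall>x. x = (x\<bullet>v) *R v + ((x\<bullet>w)/(w\<bullet>w)) *R w + (x\<bullet>n) *R n)"
proof -
 obtain e1 e2 where e: "norm e1 = 1" "norm e2 = 1" "e1\<bullet>e2 = 0" "e1\<bullet>v = 0" "e2\<bullet>v = 0"
  "!!x. x = (x\<bullet>e1) *R e1 + (x\<bullet>e2) *R e2 + (x\<bullet>v) *R v"
  using orthonormal_frame[OF assms(1)] by blast
 have ee: "e1\<bullet>e1 = 1" "e2\<bullet>e2 = 1" "e2\<bullet>e1 = 0" using e(1-5) by (simp_all add: dot_square_norm inner_commute)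
 define a b where "a = w\<bullet>e1" and "b = w\<bullet>e2"
 have w: "w = a *R e1 + b *R e2" using e(6)[of w] assms(2) by (simp add: a_def b_def inner_commute)
 have W: "w\<bullet>w = a\<^sup>2 + b\<^sup>2" unfolding w using ee e(1-5) by (simp add: inner_add power2_eq_square)
 define r where "r = norm w"
 have r: "r > 0" "r\<^sup>2 = a\<^sup>2 + b\<^sup>2" using assms(3) W by (simp_all add: r_def dot_square_norm)
 let ?B = "a *R e2 - b *R e1"
 define n where "n = (1/r) *R ?B"
 have "?B\<bullet>?B = a\<^sup>2 + b\<^sup>2" using ee e(3) by (simp add: inner_diff power2_eq_square)
 then have "n\<bullet>n = (a\<^sup>2 + b\<^sup>2)/r\<^sup>2" by (simp add: n_def power2_eq_square)
 then have "n\<bullet>n = 1" using r by (metis divide_self_if less_irrefl zero_less_power)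
 then have n1: "norm n = 1" by (simp add: norm_eq_sqrt_inner)
 have nv: "n\<bullet>v = 0" using e(1-5) by (simp add: n_def inner_diff_left)
 have nw: "n\<bullet>w = 0" unfolding n_def w using ee e(1-5) by (simp add: inner_diff_left inner_add_right)
 let ?A = "\<lambda>x. (x\<bullet>w)/(w\<bullet>w)"
 let ?E = "\<lambda>sup. (a\<^sup>2 + b\<^sup>2)/r\<^sup>2"
 have "x = (x\<bullet>v) *R v + (?A x) *R w + (x\<bullet>n) *R n" for x
 proof -
  define x1 x2 where "x1 = x\<bullet>e1" and "x2 = x\<bullet>e2"
  let ?C = "a*x2 - b*x1"
  let ?D = "a*x1 + b*x2"
  let ?F = "x\<bullet>n"
  have "x\<bullet>w = a*x1 + b*x2" by (simp add: w inner_add_right x1_def x2_def)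
  moreover have "x\<bullet>n = ?C/r" by (simp add: n_def inner_diff_right x1_def x2_def)
  ultimately have "(?A x) *R w + ?F *R n = (?D/r\<^sup>2) *R w + (?C/r) *R n" by (simp only: W r(2))
  also have "... = (?D/r\<^sup>2) *R (a *R e1 + b *R e2) + (?C/r\<^sup>2) *R ?B"
   unfolding n_def w by (simp only: scaleR_scaleR power2_eq_square times_divide_times_eq mult_1_right)
  also have "... = (?D/r\<^sup>2 * a - ?C/r\<^sup>2 * b) *R e1 + (?D/r\<^sup>2 * b + ?C/r\<^sup>2 * a) *R e2"
   by (simp only: scaleR_add_left scaleR_add_right scaleR_diff_left scaleR_diff_right scaleR_scaleR) (simp add: algebra_simps)
  also have "?D/r\<^sup>2 * a - ?C/r\<^sup>2 * b = x1*(?E sup)" by (simp add: add_divide_distrib diff_divide_distrib ring_sq)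
  also have "?D/r\<^sup>2 * b + ?C/r\<^sup>2 * a = x2*(?E sup)" by (simp add: add_divide_distrib diff_divide_distrib ring_sq)
  finally have "(?A x) *R w + ?F *R n = (x1*(?E sup)) *R e1 + (x2*(?E sup)) *R e2" .
  moreover have "(a\<^sup>2 + b\<^sup>2)/r\<^sup>2 = 1" using r by (metis divide_self_if less_irrefl zero_less_power)
  ultimately have "(?A x) *R w + ?F *R n = x1 *R e1 + x2 *R e2" by (simp only: mult_1_right)
  then have "(x\<bullet>v) *R v + ((?A x) *R w + ?F *R n) = x1 *R e1 + x2 *R e2 + (x\<bullet>v) *R v" by (simp only: add.commute)
  also have "... = x" unfolding x1_def x2_def by (rule e(6)[of x, symmetric])
  finally show ?thesis by (simp only: add.assoc)
 qed
 then show ?thesis using n1 nv nw by blast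
qed

lemma dd_zero_along_cpar:
 assumes "rpd d F" "!!s. F (cpar p v w s) = 0"
 shows "dd (ctan v w s) F (cpar p v w s) = 0"
proof -
 have "((\<lambda>s. 0) has_real_derivative dd (ctan v w s) F (cpar p v w s)) (at s)"
  using rpd_along_cpar[OF assms(1), of p v w s] unfolding assms(2) .
 from DERIV_unique[OF this DERIV_const] show ?thesis .
qed

lemma circ_antipode_subset:
 assumes "w ~= 0"
 shows "circ p v w \<subseteq> circ (p + (1/(w\<bullet>w)) *R w) v (- w)"
proof
 define W where "W = w\<bullet>w"
 have W: "W > 0" using assms by (simp add: W_def)
 fix x assume "x \<in> circ p v w"
 then obtain a b where x: "x = p + a *R v + b *R w" and ab: "a\<^sup>2 + W * b\<^sup>2 = b" unfolding circ_def W_def by auto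
 have x': "x = p + (1/W) *R w + a *R v + (1/W - b) *R (- w)" unfolding x by (simp add: scaleR_diff_left)
 have "a\<^sup>2 + (- w)\<bullet>(- w)*(1/W - b)\<^sup>2 = 1/W - b" using W ab by (simp add: ring_sq W_def)
 with x' show "x \<in> circ (p + (1/(w\<bullet>w)) *R w) v (- w)" unfolding circ_def W_def[symmetric] mem_Collect_eq by blast
qed

lemma circ_antipode:
 assumes "w ~= 0"
 shows "circ (p + (1/(w\<bullet>w)) *R w) v (- w) = circ p v w"
proof -
 have "circ (p + (1/(w\<bullet>w)) *R w) v (- w) \<subseteq> circ (p + (1/(w\<bullet>w)) *R w + (1/((- w)\<bullet>(- w))) *R (- w)) v (- (- w))"
  by (rule circ_antipode_subset) (use assms in simp)
 then show ?thesis using circ_antipode_subset[OF assms, of p v] by simp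
qed

text \<open>At a point with a parameter the given direction is \<open>ctan\<close> divided by
  \<open>2*(1 - (w\<bullet>w) * b)\<close>. This factor is zero exactly at the antipode of
  \<open>p\<close>, which is treated by parametrising the same circle from there.\<close>

lemma dd_zero_tangent:
 assumes g: "rpd d g" and w: "w ~= 0" and z: "!!x. x \<in> circ p v w ==> g x = 0"
  and ab: "u\<^sup>2 + (w\<bullet>w) * b\<^sup>2 = b" and x: "x = p + u *R v + b *R w"
 shows "dd ((1/2 - (w\<bullet>w) * b) *R v + u *R w) g x = 0"
proof -
 define W where "W = w\<bullet>w"
 have W: "W > 0" using w by (simp add: W_def)
 let ?A = "1 - W * b"
 let ?B = "1/2 - W * b"
 show ?thesis
 proof (cases "b = 1/W")
  case True
  then have a: "u = 0" using ab W by (simp add: W_def[symmetric] power2_eq_square)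
  have "g (cpar (p + (1/(w\<bullet>w)) *R w) v (- w) s) = 0" for s by (rule z) (use cpar_in_circ circ_antipode[OF w] in blast)
  from dd_zero_along_cpar[OF g this, of 0] have "dd v g x = 0" using True by (simp add: ctan_def cpar_0 x a W_def)
  then show ?thesis using a dd_lincomb[OF g, of _ v 0 v] by (simp add: W_def)
 next
  case False
  define s where "s = u/?A"
  have nz: "1 - W * b ~= 0" using False W by (simp add: field_simps)
  have a2: "u\<^sup>2 = b*?A" using ab by (simp add: W_def ring_sq)
  have s2: "s\<^sup>2 = b/?A" unfolding s_def power_divide a2 using nz by (simp add: power2_eq_square)
  define t where "t = 1 - W * b"
  have t: "t ~= 0" "W * b = 1 - t" using nz by (simp_all add: t_def)
  have Ws: "W * s\<^sup>2 = (1 - t)/t" unfolding s2 t_def[symmetric] using t by simp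
  have q: "1 + W * s\<^sup>2 = 1/t" unfolding Ws using t by (simp add: field_simps)
  have xs: "cpar p v w s = x" using q s2 t x by (simp add: s_def cpar_def W_def)
  let ?C = "1 + W * s\<^sup>2"
  have "(1 - W * s\<^sup>2)/?C\<^sup>2 = (1 - (1 - t)/t)*t\<^sup>2" unfolding q unfolding Ws by (simp add: power_one_over)
  also have "... = 2*t*?B" unfolding t(2) using t(1) by (simp add: field_sq)
  finally have t1: "(1 - W * s\<^sup>2)/?C\<^sup>2 = 2*?A*?B" unfolding t_def .
  have "2 * s/?C\<^sup>2 = 2*(s*t)*t" unfolding q by (simp add: power_one_over power2_eq_square)
  also have "s*t = u" unfolding s_def t_def[symmetric] using t by simp
  finally have t2: "2 * s/?C\<^sup>2 = 2*?A*u" by (simp add: t_def)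
  have "ctan v w s = (2*?A*?B) *R v + (2*?A*u) *R w" unfolding ctan_def W_def[symmetric] t1 t2 ..
  then have "dd ((2*?A*?B) *R v + (2*?A*u) *R w) g x = 0" using dd_zero_along_cpar[OF g z[OF cpar_in_circ], of s] xs by simp
  then have "2*?A*(?B*dd v g x + u*dd w g x) = 0" unfolding dd_lincomb[OF g] by (simp add: algebra_simps)
  then show ?thesis unfolding dd_lincomb[OF g] W_def[symmetric] using nz by simp
 qed
qed

lemma circ_center:
 assumes "norm v = 1" "v\<bullet>w = 0" "w ~= 0" "x \<in> circ p v w"
 defines "c \<equiv> p + (1/(2*(w\<bullet>w))) *R w"
 shows "(x - c)\<bullet>(x - c) = 1/(4*(w\<bullet>w))" (is ?P) "c + (c - x) \<in> circ p v w"
proof -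
 define W where "W = w\<bullet>w"
 have W: "W > 0" using assms(3) by (simp add: W_def)
 have vv: "v\<bullet>v = 1" using assms(1) by (simp add: dot_square_norm)
 obtain a b where x: "x = p + a *R v + b *R w" and ab: "a\<^sup>2 + W * b\<^sup>2 = b"
  using assms(4) unfolding circ_def W_def by blast
 have xc: "x - c = a *R v + (b - 1/(2*W)) *R w" by (simp add: x c_def W_def algebra_simps)
 have "(x - c)\<bullet>(x - c) = a\<^sup>2 + (b - 1/(2*W))\<^sup>2*W"
  unfolding xc using vv assms(2) by (simp add: inner_add inner_commute[of w v] W_def power2_eq_square)
 also have "... = (a\<^sup>2 + W * b\<^sup>2) - b + 1/(4*W)" using W by (simp add: field_sq)
 finally show ?P using ab by (simp add: W_def)
 have "c + (c - x) = p + (- a) *R v + (1/W - b) *R w" using W by (simp add: x c_def W_def algebra_simps flip: scaleR_add_left)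
 moreover have "(- a)\<^sup>2 + W*(1/W - b)\<^sup>2 = 1/W - b"
 proof -
  show ?thesis using W ab by (simp add: ring_sq)
 qed
 ultimately show "c + (c - x) \<in> circ p v w" unfolding circ_def W_def by blast
qed

text \<open>The pencil of spheres through the circle with centre \<open>c\<close>, axis
  \<open>n\<close> and squared radius \<open>R\<close>; its plane is the member with
  \<open>a = 0\<close>. Completing the square shows that the other members have positive
  radius.\<close>

lemma plane_or_sphere_through_circle:
 fixes c n :: "real^3"
 assumes "norm n = 1" "R > 0" "a ~= 0 \<or> b ~= 0"
 shows "is_plane {y. a*((y - c)\<bullet>(y - c) - R) + b*((y - c)\<bullet>n) = 0}
  \<or> is_sphere {y. a*((y - c)\<bullet>(y - c) - R) + b*((y - c)\<bullet>n) = 0}"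
proof (cases "a = 0")
 case True
 then have e: "{y. a*((y - c)\<bullet>(y - c) - R) + b*((y - c)\<bullet>n) = 0} = {y. n\<bullet>y = n \<bullet> c}"
  using assms(3) by (auto simp: inner_diff_left inner_commute[of n])
 have "n ~= 0" using assms(1) by auto
 then have "is_plane {y. n\<bullet>y = n \<bullet> c}" unfolding is_plane_def by (simp add: affine_hyperplane aff_dim_hyperplane)
 then show ?thesis unfolding e ..
next
 case False
 define k where "k = b/(2 * a)"
 have b: "b = a*(2*k)" using False by (simp add: k_def)
 have nn: "n\<bullet>n = 1" using assms(1) by (simp add: dot_square_norm)
 let ?A = "c - k *R n"
 let ?C = "\<lambda>y. (y - c)\<bullet>(y - c) - R"
 have "a*(?C y) + b*((y - c)\<bullet>n) = 0 \<longleftrightarrow> y \<in> sphere ?A (sqrt (R + k\<^sup>2))" for y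
 proof -
  let ?B = "(y - c)\<bullet>n"
  have "(z + k *R n)\<bullet>(z + k *R n) = z\<bullet>z + 2*k*(z\<bullet>n) + k\<^sup>2" for z
   using nn by (simp add: inner_add inner_commute[of n z] power2_eq_square distrib_left)
  moreover have "y - ?A = (y - c) + k *R n" by simp
  ultimately have e: "(y - ?A)\<bullet>(y - ?A) = (y - c)\<bullet>(y - c) + 2*k*?B + k\<^sup>2" by (simp only:)
  have sph: "y \<in> sphere z (sqrt t) \<longleftrightarrow> (y - z)\<bullet>(y - z) = t" for z :: "real^3" and t
  proof -
   have "dist z y = sqrt ((y - z)\<bullet>(y - z))" unfolding dist_norm norm_minus_commute[of z y] by (rule norm_eq_sqrt_inner)
   then show ?thesis unfolding mem_sphere by (simp only: real_sqrt_eq_iff)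
  qed
  have "y \<in> sphere ?A (sqrt (R + k\<^sup>2)) \<longleftrightarrow> (y - ?A)\<bullet>(y - ?A) = R + k\<^sup>2" by (rule sph)
  also have "... \<longleftrightarrow> (y - c)\<bullet>(y - c) - R + 2*k*?B = 0" unfolding e by auto
  also have "... \<longleftrightarrow> a*((y - c)\<bullet>(y - c) - R + 2*k*?B) = 0" using False by simp
  also have "a*((y - c)\<bullet>(y - c) - R + 2*k*?B) = a*(?C y) + b*?B" by (simp add: b algebra_simps)
  finally show ?thesis ..
 qed
 then have "{y. a*(?C y) + b*((y - c)\<bullet>n) = 0} = sphere ?A (sqrt (R + k\<^sup>2))" by blast
 moreover have "sqrt (R + k\<^sup>2) > 0" using assms(2) by (simp add: add_pos_nonneg)
 ultimately show ?thesis unfolding is_sphere_def by blast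
qed

text \<open>Along the circle the gradient of \<open>g\<close> is spanned by the axis
  \<open>n\<close> and the radial vector \<open>x - c\<close>, with coefficients given by the
  derivatives \<open>A\<close> and \<open>B\<close>. The vector \<open>B *R n - A *R (x - c)\<close>
  is orthogonal to the gradient and to the circle. At an umbilic point the second derivative in this
  and the circle's tangent direction is zero, which says that the Wronskian of \<open>A\<close> and
  \<open>B\<close> along the circle vanishes there. A Wronskian with too many roots is zero, so the
  ratio of \<open>A\<close> to \<open>B\<close> is constant, and this ratio selects the member of
  the pencil.\<close>

theorem common_osculating_sphere:
 fixes g :: "real^3 => real"
 assumes g: "rpd d g" and vw: "norm v = 1" "v\<bullet>w = 0" "w ~= 0" and z: "!!x. x \<in> circ p v w ==> g x = 0"
  and Q: "Q \<subseteq> circ p v w" "card Q > 4*d + 5"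
  and nz: "!!x. x \<in> Q ==> \<exists>h. dd h g x ~= 0"
  and umb: "!!x h y. [|x \<in> Q; dd h g x = 0; dd y g x = 0; h\<bullet>y = 0|] ==> dd h (dd y g) x = 0"
  and sph: "!!x. x \<in> Q ==> circ p v w \<subseteq> {y. dd (y - x) g x = M x*((y - x)\<bullet>(y - x))}"
 shows "\<exists>S. (is_plane S \<or> is_sphere S) \<and> circ p v w \<subseteq> S \<and> (\<forall>x\<in>Q. {y. dd (y - x) g x = M x*((y - x)\<bullet>(y - x))} = S)"
proof -
 let ?C = "w\<bullet>w"
 obtain n where n: "norm n = 1" "n\<bullet>v = 0" "n\<bullet>w = 0"
  "!!x. x = (x\<bullet>v) *R v + ((x\<bullet>w)/?C) *R w + (x\<bullet>n) *R n"
  using circle_normal_frame[OF vw] by (elim exE conjE) (rule that, assumption+, simp only:)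
 define c where "c = p + (1/(2*?C)) *R w"
 define R where "R = 1/(4*?C)"
 have R: "R > 0" using vw(3) by (simp add: R_def)
 have nn: "n\<bullet>n = 1" using n(1) by (simp add: dot_square_norm)
 have cR: "(x - c)\<bullet>(x - c) = R" and anti: "c + (c - x) \<in> circ p v w" if "x \<in> circ p v w" for x
  using circ_center[OF vw that] by (simp_all add: c_def R_def)
 have nvw: "v\<bullet>n = 0" "w\<bullet>n = 0" using n(2,3) by (simp_all add: inner_commute)
 have xn: "(x - c)\<bullet>n = 0" if "x \<in> circ p v w" for x
 proof -
  from that obtain f l where xe: "x = p + f *R v + l *R w" unfolding circ_def by blast
  show ?thesis using xe nvw by (simp add: ring_sq c_def)
 qed
 define A where "A = dd n g"
 define B where "B x = dd (x - c) g x" for x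
 have rA: "rpd (d + 1) A" unfolding A_def by (rule rpd_mono[OF rpd_dd[OF g]]) simp
 have rB: "rpd (d + 1) B" unfolding B_def by (rule rpd_radial_derivative(1)[OF g])
 define q where "q s = (1 + ?C * s\<^sup>2)^(d + 1)" for s
 let ?D = "\<lambda>s. cpar p v w s"
 obtain pA where pA: "degree pA \<le> 2*(d + 1)" "!!s. A (?D s)*q s = poly pA s"
  using rpd_cpar[OF rA, of p v w] unfolding q_def by blast
 obtain pB where pB: "degree pB \<le> 2*(d + 1)" "!!s. B (?D s)*q s = poly pB s"
  using rpd_cpar[OF rB, of p v w] unfolding q_def by blast
 have q0: "q s ~= 0" for s unfolding q_def using cpar_denom_pos[of w s] by simp
 define Wr where "Wr = pderiv pA*pB - pA*pderiv pB"
 have gz: "g (?D s) = 0" for s by (rule z[OF cpar_in_circ])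
 have Wr0: "poly Wr s = 0" if sQ: "cpar p v w s \<in> Q" for s
 proof -
  let ?x = "cpar p v w s" and ?h = "ctan v w s"
  have hg: "dd ?h g ?x = 0" by (rule dd_zero_along_cpar[OF g gz])
  have "isCont q s" "q differentiable (at s)" unfolding q_def by (auto intro!: continuous_intros derivative_intros)
  then obtain q' where q': "(q has_real_derivative q') (at s)" using real_differentiable_def by blast
  have "((\<lambda>s. A (?D s)*q s) has_real_derivative dd ?h A ?x*q s + q'*A ?x) (at s)" by (rule DERIV_mult[OF rpd_along_cpar[OF rA] q'])
  then have dA: "poly (pderiv pA) s = dd ?h A ?x*q s + q'*A ?x" unfolding pA(2) using DERIV_unique[OF poly_DERIV] by blast
  have "((\<lambda>s. B (?D s)*q s) has_real_derivative dd ?h B ?x*q s + q'*B ?x) (at s)" by (rule DERIV_mult[OF rpd_along_cpar[OF rB] q'])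
  then have dB: "poly (pderiv pB) s = dd ?h B ?x*q s + q'*B ?x" unfolding pB(2) using DERIV_unique[OF poly_DERIV] by blast
  \<comment> \<open>\<open>B\<close> also differentiates the moving radial vector; the extra term is
    \<open>dd ?h g ?x\<close>, zero because \<open>g\<close> vanishes on the circle.\<close>
  have hB: "dd ?h B ?x = dd ?h (dd (?x - c) g) ?x" using rpd_radial_derivative(2)[OF g, of ?h c ?x] hg by (simp add: B_def[abs_def])
  define y where "y = B ?x *R n + (- A ?x) *R (?x - c)"
  have "dd y g ?x = 0" unfolding y_def dd_lincomb[OF g] by (simp add: A_def B_def)
  moreover have "?h\<bullet>y = 0"
  proof -
   have "?h\<bullet>n = 0" by (simp add: ctan_def inner_add_left nvw)
   moreover have "?h\<bullet>(?x - c) = 0"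
   proof -
    define W where "W = w\<bullet>w"
    define t where "t = 1 + W * s\<^sup>2"
    have t: "t ~= 0" "W ~= 0" using cpar_denom_pos[of w s] vw(3) by (auto simp: t_def W_def)
    have vv: "v\<bullet>v = 1" "w\<bullet>v = 0" "w\<bullet>w = W" using vw(1,2) by (simp_all add: dot_square_norm inner_commute W_def)
    have prd: "(k1 *R v + k2 *R w)\<bullet>(k3 *R v + k4 *R w) = k1*k3 + k2*k4*W" for k1 k2 k3 k4 unfolding inner_add by (simp add: vv vw(2))
    have xe: "?x - c = (s/t) *R v + (s\<^sup>2/t - 1/(2*W)) *R w" unfolding cpar_def c_def t_def W_def scaleR_diff_left by simp
    have he: "?h = ((1 - W * s\<^sup>2)/t\<^sup>2) *R v + (2 * s/t\<^sup>2) *R w" by (simp only: ctan_def t_def W_def)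
    have m: "s\<^sup>2/t - 1/(2*W) = - ((1 - W * s\<^sup>2)/(2*W*t))" using t by (simp add: field_simps) (simp add: t_def algebra_simps)
    show ?thesis unfolding xe he prd m using t by (simp add: power2_eq_square)
   qed
   ultimately show ?thesis by (simp add: y_def inner_add_right inner_diff_right)
  qed
  ultimately have "dd ?h (dd y g) ?x = 0" using umb[OF sQ hg] by blast
  moreover have "dd ?h (dd y g) = (\<lambda>x. B ?x*dd ?h (dd n g) x + (- A ?x)*dd ?h (dd (?x - c) g) x)"
   unfolding y_def dd_lincomb_fun[OF g] dd_add[OF rpd_cmult[OF rpd_dd[OF g]] rpd_cmult[OF rpd_dd[OF g]]] dd_cmult[OF rpd_dd[OF g]] ..
  ultimately have "B ?x*dd ?h A ?x = A ?x*dd ?h B ?x" by (simp add: hB A_def)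
  then have "(dd ?h A ?x*q s + q'*A ?x)*(B ?x*q s) = (A ?x*q s)*(dd ?h B ?x*q s + q'*B ?x)" by (simp add: algebra_simps)
  then show ?thesis unfolding Wr_def by (simp add: dA dB flip: pA(2) pB(2))
 qed
 let ?B = "{s. poly Wr s = 0}"
 have "Wr = 0"
 proof (rule ccontr)
  assume W: "Wr ~= 0"
  have "degree (pderiv pA*pB) \<le> 4*d + 4" "degree (pA*pderiv pB) \<le> 4*d + 4"
   using degree_mult_le[of "pderiv pA" pB] degree_mult_le[of pA "pderiv pB"] pA(1) pB(1)
   by (simp_all add: degree_pderiv)
  \<comment> \<open>At most \<open>4*d + 4\<close> roots, and one more point of \<open>Q\<close> may
    be the antipode of \<open>p\<close>, outside the parametrisation.\<close>
  then have degW: "degree Wr \<le> 4*d + 4" unfolding Wr_def by (rule degree_diff_le)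
  let ?i = "p + (1/(w\<bullet>w)) *R w"
  have sub: "Q \<subseteq> insert ?i (cpar p v w ` ?B)"
  proof
   fix x assume x: "x \<in> Q"
   then have "x \<in> circ p v w" using Q(1) by blast
   then consider "x = ?i" | s where "x = cpar p v w s" using circ_param[OF _ vw(3)] by blast
   then show "x \<in> insert ?i (cpar p v w ` ?B)" using Wr0 x by cases auto
  qed
  have fin: "finite ?B" by (rule poly_roots_finite[OF W])
  have "card Q \<le> card (insert ?i (cpar p v w ` ?B))" using fin by (intro card_mono sub) auto
  also have "... \<le> Suc (card ?B)" using card_image_le[OF fin, of "cpar p v w"] fin by (simp add: card_insert_if)
  also have "... \<le> 4*d + 5" using card_poly_roots_bound[OF W] degW by simp
  finally show False using Q(2) by simp
 qed
 then obtain a b where ab: "a ~= 0 \<or> b ~= 0" "Polynomial.smult a pA = Polynomial.smult b pB"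
  using proportional_of_zero_wronskian[of pA pB] by (auto simp: Wr_def)
 let ?E = "{y \<in> circ p v w. a*A y + (- b)*B y = 0}"
 have AB_prop: "a*A x = b*B x" if x: "x \<in> circ p v w" for x
 proof (rule ccontr)
  assume ne: "a*A x ~= b*B x"
  have r: "rpd (d + 1) (\<lambda>x. a*A x + (- b)*B x)" by (intro rpd_add rpd_cmult rA rB)
  have "a*A (?D s) + (- b)*B (?D s) = 0" for s
  proof -
   have "a*(A (?D s)*q s) = b*(B (?D s)*q s)" using arg_cong[OF ab(2), of "\<lambda>p. poly p s"] by (simp add: pA(2) pB(2))
   then show ?thesis using q0[of s] by simp
  qed
  then have "range (cpar p v w) \<subseteq> ?E" using cpar_in_circ by auto
  moreover have "finite ?E" by (rule card_zeros_on_circ(1)[OF r vw(3) x]) (use ne in simp)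
  ultimately have "finite (range (cpar p v w))" by (rule finite_subset)
  moreover have "inj (cpar p v w)" using cpar_inj[OF vw] by (auto intro: injI)
  ultimately show False using finite_imageD infinite_UNIV_char_0 by blast
 qed
 define S where "S = {y. a*((y - c)\<bullet>(y - c) - R) + (2 * R * b)*((y - c)\<bullet>n) = 0}"
 have "a ~= 0 \<or> 2 * R * b ~= 0" using ab(1) R by auto
 then have "is_plane S \<or> is_sphere S" unfolding S_def by (rule plane_or_sphere_through_circle[OF n(1) R])
 moreover have "circ p v w \<subseteq> S" using cR xn by (auto simp: S_def)
 moreover have "{y. dd (y - x) g x = M x*((y - x)\<bullet>(y - x))} = S" if x: "x \<in> Q" for x
 proof -
  have xc: "x \<in> circ p v w" using x Q(1) by blast
  \<comment> \<open>the tangential derivative vanishes, so the gradient is spanned by the normal and the radial direction\<close>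
  have grad: "dd y g x = (y\<bullet>n)*A x + (y\<bullet>(x - c))/R*B x" for y
  proof -
   define W where "W = w\<bullet>w"
   have W: "W > 0" using vw(3) by (simp add: W_def)
   obtain f l where xe: "x = p + f *R v + l *R w" and al: "f\<^sup>2 + ?C*l\<^sup>2 = l"
    using xc unfolding circ_def by auto
   define j where "j = 1/2 - W*l"
   have T: "dd (j *R v + f *R w) g x = 0" unfolding j_def W_def by (rule dd_zero_tangent[OF g vw(3) z al xe])
   have unit: "4*(f\<^sup>2*W) + 4*j\<^sup>2 = 1"
   proof -
    have "4*(f\<^sup>2*W) + 4*j\<^sup>2 = 1 + 4*W*((f\<^sup>2 + W*l\<^sup>2) - l)" by (simp add: j_def field_sq)
    then show ?thesis using al by (simp add: W_def)
   qed
   define y1 y2 where "y1 = y\<bullet>v" and "y2 = (y\<bullet>w)/W"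
   have tW: "j/W = 1/(2*W) - l" using W by (simp add: j_def diff_divide_distrib)
   let ?A = "- (j/W)"
   have xce: "x - c = f *R v + ?A *R w" unfolding tW by (simp add: xe c_def W_def algebra_simps)
   have yxc: "y\<bullet>(x - c) = f*y1 - j*y2" unfolding xce y1_def y2_def by (simp add: inner_add_right inner_diff_right)
   define K where "K = 4*(j*y1 + W*f*y2)"
   define k where "k = 4*W*(f*y1 - j*y2)"
   have c1: "y1 = k*f + K*j"
   proof -
    have "k*f + K*j = y1*(4*(f\<^sup>2*W) + 4*j\<^sup>2)" by (simp add: k_def K_def ring_sq)
    then show ?thesis unfolding unit by simp
   qed
   have c2: "y2 = k*?A + K*f"
   proof -
    have "k*(j/W) = 4*(f*y1 - j*y2)*j" using W by (simp add: k_def)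
    then have "k*?A + K*f = y2*(4*(f\<^sup>2*W) + 4*j\<^sup>2)" by (simp add: K_def ring_sq)
    then show ?thesis unfolding unit by simp
   qed
   have lin: "linear (\<lambda>u. dd u g x)" by (rule has_derivative_linear[OF rpd_has_derivative[OF g]])
   note L = linear_add[OF lin] linear_scale[OF lin]
   have regroup: "(k * a1 + K * a2)*e1 + (k * a3 + K * a1)*e2 = k*(a1*e1 + a3*e2) + K*(a2*e1 + a1*e2)"
    for a1 a2 a3 e1 e2 by (simp add: algebra_simps)
   let ?F = "j*dd v g x + f*dd w g x"
   have "y = y1 *R v + y2 *R w + (y\<bullet>n) *R n" unfolding y1_def y2_def W_def by (rule n(4))
   from arg_cong[OF this, of "\<lambda>u. dd u g x"] have "dd y g x = y1*dd v g x + y2*dd w g x + (y\<bullet>n)*A x"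
    by (simp only: L A_def real_scaleR_def)
   also have "y1*dd v g x + y2*dd w g x = k*(f*dd v g x + ?A*dd w g x) + K*?F"
   proof -
    have "y1*dd v g x + y2*dd w g x = (k*f + K*j)*dd v g x + (k*?A + K*f)*dd w g x" by (simp only: c1[symmetric] c2[symmetric])
    also have "... = k*(f*dd v g x + ?A*dd w g x) + K*?F" by (rule regroup[of f j "dd v g x" "- (j/W)" "dd w g x"])
    finally show ?thesis .
   qed
   also have "j*dd v g x + f*dd w g x = 0" using T by (simp add: L)
   also have "f*dd v g x + ?A*dd w g x = B x" unfolding B_def xce by (simp only: L real_scaleR_def)
   finally have "dd y g x = k*B x + (y\<bullet>n)*A x" by simp
   moreover have "(y\<bullet>(x - c))/R = k" unfolding yxc k_def R_def W_def by simp
   ultimately show ?thesis by simp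
  qed
  have AB: "A x ~= 0 \<or> B x ~= 0" using nz[OF x] grad by fastforce
  \<comment> \<open>The osculating equation at \<open>x\<close>, tested at the opposite point of the
    circle, determines \<open>M x\<close> from \<open>B x\<close>.\<close>
  have "dd (c + (c - x) - x) g x = M x*((c + (c - x) - x)\<bullet>(c + (c - x) - x))" using sph[OF x] anti[OF xc] by blast
  moreover have e: "c + (c - x) - x = (- 2) *R (x - c)" by (simp add: algebra_simps scaleR_2)
  ultimately have mu: "M x*(4 * R) = - 2*B x" using xn[OF xc] cR[OF xc] R unfolding grad e by simp
  have rel: "a*A x = b*B x" by (rule AB_prop[OF xc])
  have eqv: "B x*X + A x*Y = 0 \<longleftrightarrow> a*X + b*Y = 0" for X Y
  proof (cases "a = 0")
   case True
   then show ?thesis using ab(1) rel AB by simp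
  next
   case False
   then have "B x ~= 0" using rel AB by auto
   moreover have "a*(B x*X + A x*Y) = B x*(a*X + b*Y)" by (simp only: distrib_left mult.assoc[symmetric] rel) (simp add: algebra_simps)
   ultimately show ?thesis using False by (metis mult_eq_0_iff)
  qed
  have "dd (y - x) g x = M x*((y - x)\<bullet>(y - x)) \<longleftrightarrow> y \<in> S" for y
  proof -
   define N where "N = (y - x)\<bullet>(y - x)"
   define T where "T = (y - x)\<bullet>(x - c)"
   have yn: "(y - x)\<bullet>n = (y - c)\<bullet>n" using xn[OF xc] by (simp add: inner_diff_left)
   have "(y - c)\<bullet>(y - c) = ((y - x) + (x - c))\<bullet>((y - x) + (x - c))" by simp
   also have "... = N + 2*T + R" unfolding inner_add cR[OF xc] N_def T_def by (simp only: inner_commute[of "x - c"] mult_2 add_ac)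
   finally have yc: "(y - c)\<bullet>(y - c) - R = N + 2*T" by simp
   have mu': "M x = - B x/(2 * R)" using mu R by (simp add: field_simps)
   have "dd (y - x) g x = M x*((y - x)\<bullet>(y - x)) \<longleftrightarrow> (y - c)\<bullet>n*A x + T/R*B x = - B x/(2 * R)*N"
    unfolding grad yn mu' N_def T_def ..
   also have "... \<longleftrightarrow> B x*(N + 2*T) + A x*(2 * R*((y - c)\<bullet>n)) = 0"
   proof -
    define u where "u = (y - c)\<bullet>n"
    have "B x*(N + 2*T) + A x*(2 * R*u) = 2 * R*(u*A x + T/R*B x - (- B x/(2 * R)*N))" using R by (simp add: field_simps)
    then show ?thesis using R unfolding u_def[symmetric] by (simp add: eq_neg_iff_add_eq_0)
   qed
   also have "... \<longleftrightarrow> a*(N + 2*T) + b*(2 * R*((y - c)\<bullet>n)) = 0" by (rule eqv)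
   also have "... \<longleftrightarrow> y \<in> S" unfolding S_def mem_Collect_eq yc by (simp only: mult_ac)
   finally show ?thesis .
  qed
  then show ?thesis by blast
 qed
 ultimately show ?thesis by blast
qed

section \<open>Circles in space\<close>

lemma plane_frame:
 assumes "is_plane S" "p \<in> S"
 obtains b1 b2 where "norm b1 = 1" "norm b2 = 1" "b1\<bullet>b2 = 0"
  "S = {p + s *R b1 + t *R b2 |s t. True}"
proof -
 define T where "T = (\<lambda>x. x - p) ` S"
 have S: "affine S" "aff_dim S = 2" using assms(1) by (auto simp: is_plane_def)
 have T: "subspace T" unfolding T_def by (rule affine_diffs_subspace_subtract[OF S(1) assms(2)])
 have "p \<in> affine hull S" using assms(2) by (rule hull_inc)
 from aff_dim_eq_dim_subtract[OF this] have d: "dim T = 2" using S(2) by (simp add: T_def)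
 obtain B where B: "B \<subseteq> T" "pairwise orthogonal B" "!!x. x \<in> B ==> norm x = 1" "card B = dim T" "span B = T"
  using orthonormal_basis_subspace[OF T] by metis
 obtain b1 b2 where b: "B = {b1, b2}" "b1 ~= b2" using B(4) d card_2_iff[of B] by auto
 let ?A = "\<lambda>x. \<exists>s t. x = p + s *R b1 + t *R b2"
 have "b1\<bullet>b2 = 0" using B(2) b by (simp add: pairwise_insert orthogonal_def)
 moreover have "x \<in> S \<longleftrightarrow> (?A x)" for x
 proof -
  have "x \<in> S \<longleftrightarrow> x - p \<in> span {b1, b2}" using B(5) b(1) by (auto simp: T_def image_iff)
  also have "... \<longleftrightarrow> (\<exists>s t. x - p = s *R b1 + t *R b2)" by (simp add: span_breakdown_eq algebra_simps)
  also have "... \<longleftrightarrow> (?A x)" by (simp add: algebra_simps)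
  finally show ?thesis .
 qed
 then have "S = {p + s *R b1 + t *R b2 |s t. True}" by auto
 moreover have "norm b1 = 1" "norm b2 = 1" using B(3) b by auto
 ultimately show ?thesis using that by blast
qed

lemma circle_through_point:
 assumes "is_circle g" "p \<in> g"
 obtains v w where "norm v = 1" "v\<bullet>w = 0" "w ~= 0" "g = circ p v w"
proof -
 obtain S c r where S: "is_plane S" "c \<in> S" "r > 0" "g = S\<inter>sphere c r"
  using assms(1) unfolding is_circle_def by blast
 have p: "p \<in> S" "dist c p = r" using assms(2) S(4) by auto
 obtain b1 b2 where b: "norm b1 = 1" "norm b2 = 1" "b1\<bullet>b2 = 0" and Sb: "S = {p + s *R b1 + t *R b2 |s t. True}"
  using plane_frame[OF S(1) p(1)] .
 have bb: "b1\<bullet>b1 = 1" "b2\<bullet>b2 = 1" "b2\<bullet>b1 = 0" using b by (simp_all add: dot_square_norm inner_commute)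
 have ip: "(k1 *R b1 + k2 *R b2)\<bullet>(k3 *R b1 + k4 *R b2) = k1*k3 + k2*k4" for k1 k2 k3 k4 unfolding inner_add by (simp add: bb b(3))
 obtain s t where "c = p + s *R b1 + t *R b2" using S(2) Sb by blast
 then have c: "c = p + (s *R b1 + t *R b2)" by (simp add: add.assoc)
 have "r\<^sup>2 = (c - p)\<bullet>(c - p)" using p(2) by (simp add: dist_norm flip: power2_norm_eq_inner)
 also have "... = s\<^sup>2 + t\<^sup>2" using ip[of s t s t] by (simp add: c power2_eq_square)
 finally have r: "r\<^sup>2 = s\<^sup>2 + t\<^sup>2" .
 \<comment> \<open>\<open>v\<close> is \<open>c - p\<close> turned by a right angle in the plane and
   normalised; \<open>w\<close> is \<open>c - p\<close> divided by \<open>2*r^2\<close>, so that the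
   curvature vector \<open>2 w\<close> has length \<open>1/r\<close>.\<close>
 define v where "v = (- t/r) *R b1 + (s/r) *R b2"
 let ?C = "\<lambda>sup. 2*r\<^sup>2"
 define w where "w = (s/(?C sup)) *R b1 + (t/(?C sup)) *R b2"
 have r0: "r ~= 0" using S(3) by simp
 let ?A = "\<lambda>sup. s\<^sup>2 + t\<^sup>2"
 have "v\<bullet>v = (?A sup)/r\<^sup>2" unfolding v_def ip by (simp add: power2_eq_square add_divide_distrib)
 also have "... = 1" unfolding r[symmetric] using r0 by simp
 finally have v: "norm v = 1" by (simp add: norm_eq_sqrt_inner)
 have vw: "v\<bullet>w = 0" unfolding v_def w_def ip by simp
 have W: "w\<bullet>w = 1/(4*r\<^sup>2)"
 proof -
  have "w\<bullet>w = (?A sup)/(4*(r\<^sup>2*r\<^sup>2))" unfolding w_def ip by (simp add: power2_eq_square add_divide_distrib)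
  moreover have "x/(4*(x*x)) = 1/(4*x)" if "x ~= 0" for x :: real using that by (simp add: field_simps)
  ultimately show ?thesis unfolding r[symmetric] using r0 by (metis power_not_zero)
 qed
 then have w: "w ~= 0" using r0 by auto
 have pt: "p + u *R v + e *R w = p + (u*(- t/r) + e*(s/(?C sup))) *R b1 + (u*(s/r) + e*(t/(?C sup))) *R b2" for u e
  unfolding v_def w_def by (simp only: scaleR_add_left scaleR_add_right scaleR_scaleR add_ac)
 have dst: "dist c (p + x *R b1 + y *R b2) = r \<longleftrightarrow> x\<^sup>2 + y\<^sup>2 = 2*(s*x + t*y)" for x y
 proof -
  let ?B = "p + x *R b1 + y *R b2"
  let ?D = "(s - x) *R b1 + (t - y) *R b2"
  have "dist c ?B = r \<longleftrightarrow> (dist c ?B)\<^sup>2 = r\<^sup>2" using S(3) by (simp add: power2_eq_iff_nonneg)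
  also have "(dist c ?B)\<^sup>2 = ?D\<bullet>?D" unfolding dist_norm power2_norm_eq_inner c by (simp add: scaleR_diff_left algebra_simps)
  also have "... = (s - x)\<^sup>2 + (t - y)\<^sup>2" unfolding ip by (simp add: power2_eq_square)
  also have "... = r\<^sup>2 \<longleftrightarrow> x\<^sup>2 + y\<^sup>2 = 2*(s*x + t*y)" unfolding r by (auto simp: ring_sq)
  finally show ?thesis .
 qed
 have "x \<in> g \<longleftrightarrow> x \<in> circ p v w" for x
 proof
  assume "x \<in> g"
  then obtain a b where x: "x = p + a *R b1 + b *R b2" and d: "dist c x = r" using S(4) Sb by auto
  let ?E = "s * a + t * b"
  have eq: "a\<^sup>2 + b\<^sup>2 = 2*?E" using d unfolding x dst .
  define u e where "u = (s * b - t * a)/r" and "e = 2*?E"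
  have e1: "u*(- t/r) + e*(s/(?C sup)) = a"
  proof -
   have "u*(- t/r) + e*(s/(?C sup)) = a*(?A sup)/r\<^sup>2" by (simp add: u_def e_def ring_sq add_divide_distrib diff_divide_distrib)
   then show ?thesis unfolding r[symmetric] using r0 by simp
  qed
  have e2: "u*(s/r) + e*(t/(?C sup)) = b"
  proof -
   have "u*(s/r) + e*(t/(?C sup)) = b*(?A sup)/r\<^sup>2" by (simp add: u_def e_def ring_sq add_divide_distrib diff_divide_distrib)
   then show ?thesis unfolding r[symmetric] using r0 by simp
  qed
  have "u\<^sup>2 + (w\<bullet>w)*e\<^sup>2 = ((s * b - t * a)\<^sup>2 + ?E\<^sup>2)/r\<^sup>2"
   unfolding W u_def e_def power_mult_distrib power_divide by (simp add: add_divide_distrib)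
  also have "(s * b - t * a)\<^sup>2 + ?E\<^sup>2 = (a\<^sup>2 + b\<^sup>2)*(?A sup)" by (simp add: ring_sq)
  also have ".../r\<^sup>2 = e" unfolding r[symmetric] eq e_def using r0 by simp
  finally have "u\<^sup>2 + (w\<bullet>w)*e\<^sup>2 = e" .
  moreover have "x = p + u *R v + e *R w" unfolding pt e1 e2 x ..
  ultimately show "x \<in> circ p v w" unfolding circ_def by blast
 next
  assume "x \<in> circ p v w"
  then obtain u e where x: "x = p + u *R v + e *R w" and eq: "u\<^sup>2 + (w\<bullet>w)*e\<^sup>2 = e" unfolding circ_def by blast
  define a b where "a = u*(- t/r) + e*(s/(?C sup))" and "b = u*(s/r) + e*(t/(?C sup))"
  have xa: "x = p + a *R b1 + b *R b2" unfolding x pt a_def b_def ..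
  have sq: "a\<^sup>2 + b\<^sup>2 = e"
  proof -
   have "a\<^sup>2 + b\<^sup>2 = (u\<^sup>2 + e\<^sup>2/(4*r\<^sup>2))*((?A sup)/r\<^sup>2)"
    unfolding a_def b_def by (simp add: ring_sq add_divide_distrib diff_divide_distrib)
   moreover have "(?A sup)/r\<^sup>2 = 1" unfolding r[symmetric] using r0 by simp
   ultimately show ?thesis using eq by (simp add: W)
  qed
  have "2*(s * a + t * b) = e*((?A sup)/r\<^sup>2)" unfolding a_def b_def by (simp add: ring_sq add_divide_distrib diff_divide_distrib)
  also have "... = e" unfolding r[symmetric] using r0 by simp
  finally have "dist c x = r" unfolding xa dst using sq by simp
  then show "x \<in> g" using S(4) Sb xa by auto
 qed
 then have "g = circ p v w" by blast
 then show ?thesis using that[OF v vw w] by blast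
qed

text \<open>Inversion at \<open>p\<close> turns the circle into the line through \<open>w\<close>
  with direction \<open>v\<close>.\<close>

lemma circ_inversion:
 assumes "norm v = 1" "v\<bullet>w = 0" "x \<in> circ p v w" "x ~= p"
 shows "\<exists>t. x - p = ((x - p)\<bullet>(x - p)) *R (w + t *R v)"
proof -
 obtain a b where x: "x = p + a *R v + b *R w" and eq: "a\<^sup>2 + (w\<bullet>w) * b\<^sup>2 = b"
  using assms(3) unfolding circ_def by blast
 have xp: "x - p = a *R v + b *R w" by (simp add: x)
 have vv: "v\<bullet>v = 1" "w\<bullet>v = 0" using assms(1,2) by (simp_all add: dot_square_norm inner_commute)
 have n: "(x - p)\<bullet>(x - p) = b" unfolding xp inner_add using eq by (simp add: vv assms(2) power2_eq_square mult.commute)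
 have "b ~= 0" using n assms(4) by auto
 then show ?thesis unfolding n unfolding xp by (intro exI[of _ "a/b"]) (simp add: scaleR_add_right add.commute)
qed

text \<open>After inversion at \<open>p\<close> both circles are lines through the two image points.
  The line determines \<open>v\<close> up to sign, and \<open>w\<close> as its foot of the
  perpendicular from the origin.\<close>

lemma circ_eq_of_three_points:
 fixes p :: "'a::euclidean_space"
 assumes 1: "norm v = 1" "v\<bullet>w = 0" and 2: "norm v' = 1" "v'\<bullet>w' = 0"
  and xy: "x \<in> circ p v w" "y \<in> circ p v w" "x \<in> circ p v' w'" "y \<in> circ p v' w'" "x ~= p" "y ~= p" "x ~= y"
 shows "circ p v w = circ p v' w'"
proof -
 define X Y where "X = inverse ((x - p)\<bullet>(x - p)) *R (x - p)" and "Y = inverse ((y - p)\<bullet>(y - p)) *R (y - p)"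
 have inv: "\<exists>t. inverse ((z - p)\<bullet>(z - p)) *R (z - p) = w0 + t *R v0"
  if H: "norm v0 = 1" "v0\<bullet>w0 = 0" "z \<in> circ p v0 w0" "z ~= p" for z v0 w0
 proof -
  obtain t where t: "z - p = ((z - p)\<bullet>(z - p)) *R (w0 + t *R v0)" using circ_inversion[OF H] ..
  define N where "N = (z - p)\<bullet>(z - p)"
  have "N ~= 0" using H(4) by (simp add: N_def)
  moreover have "z - p = N *R (w0 + t *R v0)" using t unfolding N_def[symmetric] .
  ultimately have "inverse N *R (z - p) = w0 + t *R v0" by simp
  then show ?thesis unfolding N_def ..
 qed
 obtain t s where ts: "X = w + t *R v" "Y = w + s *R v"
  using inv[OF 1 xy(1,5)] inv[OF 1 xy(2,6)] unfolding X_def Y_def by blast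
 obtain t' s' where ts': "X = w' + t' *R v'" "Y = w' + s' *R v'"
  using inv[OF 2 xy(3,5)] inv[OF 2 xy(4,6)] unfolding X_def Y_def by blast
 have "X ~= Y"
 proof
  assume XY: "X = Y"
  have inv_inv: "z - p = inverse (Z\<bullet>Z) *R Z" if "Z = inverse ((z - p)\<bullet>(z - p)) *R (z - p)" "z ~= p" for z Z
  proof -
   define N where "N = (z - p)\<bullet>(z - p)"
   have N: "N ~= 0" using that(2) by (simp add: N_def)
   have Z: "Z = inverse N *R (z - p)" using that(1) by (simp add: N_def)
   show ?thesis using Z N by (simp add: N_def)
  qed
  have "x - p = y - p" using inv_inv[OF X_def xy(5)] inv_inv[OF Y_def xy(6)] XY by simp
  then show False using xy(7) by simp
 qed
 then have "t ~= s" "t' ~= s'" using ts ts' by auto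
 have d: "(t - s) *R v = (t' - s') *R v'"
 proof -
  have "X - Y = (t - s) *R v" unfolding ts by (simp add: scaleR_diff_left)
  moreover have "X - Y = (t' - s') *R v'" unfolding ts' by (simp add: scaleR_diff_left)
  ultimately show ?thesis by simp
 qed
 define k where "k = (t - s)/(t' - s')"
 have "v' = k *R v"
 proof -
  have "(t' - s') *R (k *R v) = (t' - s') *R v'" unfolding d[symmetric] k_def using \<open>t' ~= s'\<close> by simp
  then show ?thesis using \<open>t' ~= s'\<close> by (metis eq_iff_diff_eq_0 scaleR_cancel_left)
 qed
 then have "\<bar>k\<bar> = 1" using 1(1) 2(1) by simp
 have "w' - w = (t - t'*k) *R v" using ts(1) ts'(1) \<open>v' = k *R v\<close> by (simp add: algebra_simps)
 moreover have "(w' - w)\<bullet>v = 0"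
 proof -
  have "k*(v\<bullet>w') = 0" using 2(2) unfolding \<open>v' = k *R v\<close> by simp
  then have "v\<bullet>w' = 0" using \<open>\<bar>k\<bar> = 1\<close> by auto
  then show ?thesis using 1(2) by (simp add: inner_commute[of _ v] inner_diff_right)
 qed
 ultimately have "t - t'*k = 0" using 1(1) by (auto simp: dot_square_norm)
 then have "w' = w" using \<open>w' - w = (t - t' * k) *R v\<close> by simp
 moreover have "v' = v \<or> v' = - v" using \<open>v' = k *R v\<close> \<open>\<bar>k\<bar> = 1\<close> by (auto simp: abs_if split: if_splits)
 ultimately show ?thesis using circ_minus[of p v w] by auto
qed

lemma circles_share_two_points:
 assumes "is_circle g" "is_circle g'" "p \<in> g" "x \<in> g" "y \<in> g" "p \<in> g'" "x \<in> g'" "y \<in> g'"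
  "x ~= p" "y ~= p" "x ~= y"
 shows "g = g'"
proof -
 obtain v w where 1: "norm v = 1" "v\<bullet>w = 0" "w ~= 0" "g = circ p v w" using circle_through_point[OF assms(1,3)] .
 obtain v' w' where 2: "norm v' = 1" "v'\<bullet>w' = 0" "w' ~= 0" "g' = circ p v' w'" using circle_through_point[OF assms(2,6)] .
 show ?thesis using circ_eq_of_three_points[OF 1(1,2) 2(1,2), of x p y] assms unfolding 1(4) 2(4) by blast
qed

section \<open>Reduction to incidences inside planes and spheres\<close>

lemma card_union_fibres_le:
 assumes "finite C" "!!g. g \<in> C ==> finite (F g) \<and> card (F g) \<le> k"
 shows "finite {(p, g). g \<in> C \<and> p \<in> F g}" (is ?Q) "card {(p, g). g \<in> C \<and> p \<in> F g} \<le> k * card C" (is ?P)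
proof -
 let ?A = "{(p, g). g \<in> C \<and> p \<in> F g}"
 have e: "?A = prod.swap ` Sigma C F" by (auto simp: image_iff)
 have fin: "finite (Sigma C F)" using assms by auto
 show ?Q unfolding e using fin by simp
 have "card ?A \<le> card (Sigma C F)" unfolding e by (rule card_image_le[OF fin])
 also have "... = (\<Sum>g\<in>C. card (F g))" using assms by simp
 also have "... \<le> (\<Sum>g\<in>C. k)" using assms by (intro sum_mono) auto
 finally show ?P by (simp add: mult.commute)
qed

lemma card_union_fibres_le':
 assumes "finite P" "!!p. p \<in> P ==> finite (F p) \<and> card (F p) \<le> k"
 shows "finite {(p, g). p \<in> P \<and> g \<in> F p}" (is ?Q) "card {(p, g). p \<in> P \<and> g \<in> F p} \<le> k * card P" (is ?P)
proof -
 let ?A = "{(p, g). p \<in> P \<and> g \<in> F p}"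
 have e: "?A = Sigma P F" by auto
 show ?Q unfolding e using assms by auto
 have "card ?A = (\<Sum>p\<in>P. card (F p))" unfolding e using assms by simp
 also have "... \<le> (\<Sum>p\<in>P. k)" using assms by (intro sum_mono) auto
 finally show ?P by (simp add: mult.commute)
qed

lemma card_zeros_on_circle:
 assumes "rpd d f" "is_circle g" "\<not> g \<subseteq> {x. f x = 0}"
 shows "finite {y \<in> g. f y = 0}" "card {y \<in> g. f y = 0} \<le> 2*d + 1" (is ?P)
proof -
 obtain x where x: "x \<in> g" "f x ~= 0" using assms(3) by blast
 obtain v w where c: "norm v = 1" "v\<bullet>w = 0" "w ~= 0" "g = circ x v w" using circle_through_point[OF assms(2) x(1)] .
 from card_zeros_on_circ[OF assms(1) c(3) x(1)[unfolded c(4)] x(2)]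
 show "finite {y \<in> g. f y = 0}" ?P unfolding c(4) by auto
qed

text \<open>Three kinds of incidences are given up: \<open>B1\<close>, where the order of vanishing
  jumps, \<open>2*D + 1\<close> per circle; \<open>B2\<close>, at points with few flat circles, 22
  per point; and \<open>B3\<close>, on circles that retain at most \<open>4*D + 5\<close> points,
  the threshold of \<open>common_osculating_sphere\<close>. Each remaining point has an osculating
  plane or sphere \<open>b p\<close>, which agrees along each remaining circle.\<close>

theorem surface_incidences:
 fixes f :: "real^3 => real"
 assumes f: "rpd D f" "f x0 ~= 0" and P: "finite P" and C: "finite C" "!!a. a \<in> C ==> is_circle a"
  and z: "!!a x. [|a \<in> C; x \<in> a|] ==> f x = 0"
 obtains Inc b t where "!!p a. (p, a) \<in> Inc ==> p \<in> P \<and> a \<in> C \<and> p \<in> a \<and> b p = t a \<and> (is_plane (t a) \<or> is_sphere (t a)) \<and> a \<subseteq> t a"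
  "card ((flags P C) - Inc) \<le> (6*D + 6) * card C + 22 * card P"
proof -
 obtain u where u: "!!p. p \<in> P ==> f (p + u) ~= 0" using avoiding_direction[OF f P] by blast
 have ex: "\<exists>n. (dd u ^^ n) f p ~= 0" if "p \<in> P" for p using some_ddn_nonzero[OF f(1) u[OF that]] .
 \<comment> \<open>Orders of vanishing in direction \<open>u\<close>, at a point and along a circle.
   For \<open>p\<close> on \<open>a\<close> the order \<open>jc a\<close> is at most
   \<open>jp p\<close>, and a strict inequality makes \<open>p\<close> one of few zeros on
   \<open>a\<close> of a derivative that is not identically zero there.\<close>
 define jp where "jp p = (LEAST n. (dd u ^^ n) f p ~= 0)" for p
 define jc where "jc a = (LEAST n. \<exists>x\<in>a. (dd u ^^ n) f x ~= 0)" for a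
 have jp: "(dd u ^^ jp p) f p ~= 0" if "p \<in> P" for p unfolding jp_def by (rule LeastI_ex[OF ex[OF that]])
 have jc: "\<exists>x\<in>a. (dd u ^^ jc a) f x ~= 0" if "p \<in> P" "p \<in> a" for p a
  unfolding jc_def by (rule LeastI_ex) (use ex[OF that(1)] that(2) in blast)
 have jc_less: "(dd u ^^ n) f x = 0" if "n < jc a" "x \<in> a" for n x a using not_less_Least[OF that(1)[unfolded jc_def]] that(2) by blast
 let ?C = "\<lambda>a. {p \<in> P\<inter>a. (dd u ^^ jc a) f p = 0}"
 define B1 where "B1 = {(p, a). a \<in> C \<and> p \<in> (?C a)}"
 have b1: "finite (?C a) \<and> card (?C a) \<le> 2*D + 1" if g: "a \<in> C" for a
 proof (cases "P\<inter>a = {}")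
  case False
  then obtain p where p: "p \<in> P" "p \<in> a" by blast
  have ns: "\<not> a \<subseteq> {x. (dd u ^^ jc a) f x = 0}" using jc[OF p] by blast
  note k = card_zeros_on_circle[OF rpd_ddn[OF f(1)] C(2)[OF g] ns]
  have s: "(?C a) \<subseteq> {y \<in> a. (dd u ^^ jc a) f y = 0}" by blast
  show ?thesis using finite_subset[OF s k(1)] card_mono[OF k(1) s] k(2) by linarith
 qed auto
 have B1: "finite B1" "card B1 \<le> (2*D + 1) * card C" unfolding B1_def by (rule card_union_fibres_le[OF C(1) b1], assumption)+
 \<comment> \<open>The last derivative that still vanishes: if both orders agree, it is zero on the
   whole circle but has non-zero derivative at \<open>p\<close>. It depends on the point alone, so
   all such circles through \<open>p\<close> lie in one surface, smooth at \<open>p\<close>.\<close>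
 define G where "G n = (dd u ^^ (n - 1)) f" for n
 have rG: "rpd D (G n)" for n unfolding G_def by (rule rpd_ddn[OF f(1)])
 have eqj: "jc a = jp p" "jp p \<ge> 1" if H: "p \<in> P" "a \<in> C" "p \<in> a" "(p, a) \<notin> B1" for p a
 proof -
  have nz: "(dd u ^^ jc a) f p ~= 0" using H by (auto simp: B1_def)
  have "jp p \<le> jc a" unfolding jp_def by (rule Least_le[of "\<lambda>n. (dd u ^^ n) f p ~= 0", OF nz])
  moreover have "\<not> jp p < jc a" using jc_less[of "jp p" a p] jp[OF H(1)] H(3) by blast
  ultimately show e: "jc a = jp p" by simp
  show "jp p \<ge> 1"
  proof (rule ccontr)
   assume "\<not> jp p \<ge> 1"
   then have "jp p = 0" by simp
   then show False using nz z[OF H(2,3)] e by simp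
  qed
 qed
 have Gz: "G (jp p) x = 0" if H: "p \<in> P" "a \<in> C" "p \<in> a" "(p, a) \<notin> B1" "x \<in> a" for p a x
  unfolding G_def by (rule jc_less[of _ a]) (use eqj[OF H(1-4)] H(5) in auto)
 have Gnz: "dd u (G (jp p)) p ~= 0" if H: "p \<in> P" "a \<in> C" "p \<in> a" "(p, a) \<notin> B1" for p a
 proof -
  have "dd u (G (jp p)) = (dd u ^^ Suc (jp p - 1)) f" by (simp add: G_def)
  also have "Suc (jp p - 1) = jp p" using eqj(2)[OF H] by simp
  finally show ?thesis using jp[OF H(1)] by simp
 qed
 define FC where "FC p = {circ p v w |v w. flat_circ (G (jp p)) p v w}" for p
 have inFC: "\<exists>v w. a = circ p v w \<and> flat_circ (G (jp p)) p v w"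
  if H: "p \<in> P" "a \<in> C" "p \<in> a" "(p, a) \<notin> B1" for p a
 proof -
  obtain v w where c: "norm v = 1" "v\<bullet>w = 0" "w ~= 0" "a = circ p v w" using circle_through_point[OF C(2)[OF H(2)] H(3)] .
  have "G (jp p) (cpar p v w s) = 0" for s by (rule Gz[OF H]) (simp add: c(4) cpar_in_circ)
  then show ?thesis using c by (auto simp: flat_circ_def)
 qed
 define few where "few p \<longleftrightarrow> finite (FC p) \<and> card (FC p) \<le> 22" for p
 let ?D = "{p \<in> P. few p}"
 define B2 where "B2 = {(p, a). p \<in> ?D \<and> a \<in> FC p}"
 have B2: "finite B2" "card B2 \<le> 22 * card P"
 proof -
  have fe: "finite (FC p) \<and> card (FC p) \<le> 22" if "p \<in> ?D" for p using that by (simp add: few_def)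
  have fp: "finite ?D" using P by simp
  show "finite B2" unfolding B2_def by (rule card_union_fibres_le'(1)[OF fp fe])
  have "card B2 \<le> 22 * card ?D" unfolding B2_def by (rule card_union_fibres_le'(2)[OF fp fe])
  also have "... \<le> 22 * card P" using P by (intro mult_left_mono card_mono) auto
  finally show "card B2 \<le> 22 * card P" .
 qed
 \<comment> \<open>The choice is meaningful at points with many flat circles, where
   \<open>umbilic_of_many_circles\<close> provides a value.\<close>
 define M where "M p = (SOME m. \<forall>v w. flat_circ (G (jp p)) p v w --> circ p v w \<subseteq> {y. dd (y - p) (G (jp p)) p = m*((y - p)\<bullet>(y - p))})" for p
 let ?F = "\<lambda>p. {y. dd (y - p) (G (jp p)) p = M p*((y - p)\<bullet>(y - p))}"
 define b where "b p = (?F p)" for p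
 define Q where "Q a = {p \<in> P\<inter>a. (p, a) \<notin> B1 \<and> (p, a) \<notin> B2}" for a
 let ?A = "{a \<in> C. card (Q a) \<le> 4*D + 5}"
 define B3 where "B3 = {(p, a). a \<in> ?A \<and> p \<in> Q a}"
 have B3: "finite B3" "card B3 \<le> (4*D + 5) * card C"
 proof -
  have fe: "finite (Q a) \<and> card (Q a) \<le> 4*D + 5" if "a \<in> ?A" for a using that P by (simp add: Q_def)
  have fp: "finite ?A" using C(1) by simp
  show "finite B3" unfolding B3_def by (rule card_union_fibres_le(1)[OF fp fe])
  have "card B3 \<le> (4*D + 5) * card ?A" unfolding B3_def by (rule card_union_fibres_le(2)[OF fp fe])
  also have "... \<le> (4*D + 5) * card C" using C(1) by (intro mult_left_mono card_mono) auto
  finally show "card B3 \<le> (4*D + 5) * card C" .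
 qed
 have heavy: "\<exists>S. (is_plane S \<or> is_sphere S) \<and> a \<subseteq> S \<and> (\<forall>p\<in>Q a. b p = S)"
  if g: "a \<in> C" "\<not> card (Q a) \<le> 4*D + 5" for a
 proof -
  have "Q a ~= {}" using g(2) by auto
  then obtain q where q: "q \<in> Q a" by blast
  obtain v w where c: "norm v = 1" "v\<bullet>w = 0" "w ~= 0" "a = circ q v w"
   using circle_through_point[OF C(2)[OF g(1)], of q] q by (auto simp: Q_def)
  have QH: "p \<in> P" "p \<in> a" "(p, a) \<notin> B1" "\<not> few p" if "p \<in> Q a" for p
   using that inFC[of p a] g(1) by (auto simp: Q_def B2_def FC_def)
  have jeq: "jp p = jc a" if "p \<in> Q a" for p using eqj(1)[OF QH(1)[OF that] g(1) QH(2,3)[OF that]] by simp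
  have umb: "!!h y. [|dd h (G (jp p)) p = 0; dd y (G (jp p)) p = 0; h\<bullet>y = 0|] ==> dd h (dd y (G (jp p))) p = 0"
   and mu: "\<exists>m. \<forall>v w. flat_circ (G (jp p)) p v w --> circ p v w \<subseteq> {y. dd (y - p) (G (jp p)) p = m*((y - p)\<bullet>(y - p))}"
   if p: "p \<in> Q a" for p
   by (fact umbilic_of_many_circles(1)[OF rG Gnz[OF QH(1)[OF p] g(1) QH(2,3)[OF p]] QH(4)[OF p, unfolded few_def FC_def]],
     fact umbilic_of_many_circles(2)[OF rG Gnz[OF QH(1)[OF p] g(1) QH(2,3)[OF p]] QH(4)[OF p, unfolded few_def FC_def]])
  have sub: "a \<subseteq> b p" if p: "p \<in> Q a" for p
  proof -
   from inFC[OF QH(1)[OF p] g(1) QH(2,3)[OF p]]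
   obtain v w where vw: "a = circ p v w \<and> flat_circ (G (jp p)) p v w" by (elim exE) (rule that)
   have "\<forall>v w. flat_circ (G (jp p)) p v w --> circ p v w \<subseteq> (?F p)" unfolding M_def by (rule someI_ex[OF mu[OF p]])
   from this[rule_format, OF conjunct2[OF vw]] show ?thesis unfolding b_def conjunct1[OF vw, symmetric] .
  qed
  let ?B = "\<lambda>x. {y. dd (y - x) (G (jc a)) x = M x*((y - x)\<bullet>(y - x))}"
  let ?E = "G (jc a)"
  have "\<exists>S. (is_plane S \<or> is_sphere S) \<and> circ q v w \<subseteq> S \<and> (\<forall>x\<in>Q a. (?B x) = S)"
  proof (rule common_osculating_sphere[OF rG c(1-3)])
   show "!!x. x \<in> circ q v w ==> G (jc a) x = 0" using Gz[OF QH(1)[OF q] g(1) QH(2,3)[OF q]] unfolding jeq[OF q] c(4) .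
   show "Q a \<subseteq> circ q v w" using c(4) by (auto simp: Q_def)
   show "card (Q a) > 4*D + 5" using g(2) by simp
   show "\<exists>h. dd h ?E x ~= 0" if x: "x \<in> Q a" for x using Gnz[OF QH(1)[OF x] g(1) QH(2,3)[OF x]] unfolding jeq[OF x] by blast
   show "dd h (dd y ?E) x = 0" if "x \<in> Q a" "dd h ?E x = 0" "dd y ?E x = 0" "h\<bullet>y = 0" for x h y
    using umb[OF that(1), unfolded jeq[OF that(1)], OF that(2-4)] .
   show "circ q v w \<subseteq> (?B x)" if x: "x \<in> Q a" for x using sub[OF x] unfolding b_def jeq[OF x] c(4) .
  qed
  then obtain S where S: "(is_plane S \<or> is_sphere S) \<and> a \<subseteq> S \<and> (\<forall>x\<in>Q a. (?B x) = S)" unfolding c(4)[symmetric] ..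
  have "b p = S" if p: "p \<in> Q a" for p using bspec[OF conjunct2[OF conjunct2[OF S]] p] unfolding b_def jeq[OF p] .
  then show ?thesis using S by (intro exI[of _ S]) simp
 qed
 define t where "t a = (SOME S. (is_plane S \<or> is_sphere S) \<and> a \<subseteq> S \<and> (\<forall>p\<in>Q a. b p = S))" for a
 define Inc where "Inc = (flags P C) - (B1\<union>B2\<union>B3)"
 show ?thesis
 proof (rule that[of Inc b t])
  fix p a assume i: "(p, a) \<in> Inc"
  then have h: "p \<in> P" "a \<in> C" "p \<in> a" "p \<in> Q a" "\<not> card (Q a) \<le> 4*D + 5" by (auto simp: Inc_def Q_def B3_def)
  show "p \<in> P \<and> a \<in> C \<and> p \<in> a \<and> b p = t a \<and> (is_plane (t a) \<or> is_sphere (t a)) \<and> a \<subseteq> t a"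
   using someI_ex[OF heavy[OF h(2,5)]] h(1-4) unfolding t_def[symmetric] by simp
 next
  have "(flags P C) - Inc \<subseteq> B1\<union>B2\<union>B3" by (auto simp: Inc_def)
  then have "card ((flags P C) - Inc) \<le> card (B1\<union>B2\<union>B3)" using B1(1) B2(1) B3(1) by (intro card_mono) auto
  also have "... \<le> card B1 + card B2 + card B3" using card_Un_le[of "B1\<union>B2" B3] card_Un_le[of B1 B2] by linarith
  finally show "card ((flags P C) - Inc) \<le> (6*D + 6) * card C + 22 * card P" using B1(2) B2(2) B3(2) by (simp add: algebra_simps)
 qed
qed

section \<open>Circles crossing the cells of a partition\<close>

lemma zeros_along_cpar:
 assumes F: "rpd d F" and c: "norm v = 1" "v\<bullet>w = 0" "w ~= 0" and x: "x \<in> circ p v w" "F x ~= 0"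
 shows "finite {s. F (cpar p v w s) = 0}" "card {s. F (cpar p v w s) = 0} \<le> 2*d + 1" (is ?P)
proof -
 define Z where "Z = {s. F (cpar p v w s) = 0}"
 note k = card_zeros_on_circ[OF F c(3) x]
 have inj: "inj (cpar p v w)" using cpar_inj[OF c] by (auto intro: injI)
 have sub: "cpar p v w ` Z \<subseteq> {y \<in> circ p v w. F y = 0}" by (auto simp: Z_def cpar_in_circ)
 show "finite {s. F (cpar p v w s) = 0}" using finite_subset[OF sub k(1)] finite_imageD inj inj_on_subset unfolding Z_def by blast
 show ?P unfolding Z_def[symmetric] using card_mono[OF k(1) sub] k(2) card_image[of "cpar p v w" Z] inj inj_on_subset by (metis le_trans subset_UNIV)
qed

lemma continuous_on_cpar: "continuous_on S (cpar p v w)"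
 by (rule continuous_at_imp_continuous_on) (use has_derivative_continuous[OF cpar_derivative] in blast)

text \<open>The label can change only at a zero, so it is a function of the number
  \<open>r s\<close> of zeros below the parameter.\<close>

lemma cells_on_path:
 fixes d :: "'a::topological_space => 'b" and f :: "real => 'a"
 assumes finZ: "finite {s. F (f s) = 0}" and cont: "!!S. continuous_on S f"
  and d: "\<forall>g a b. a \<le> b \<and> continuous_on {a..b::real} g \<and> (\<forall>t\<in>{a..b}. F (g t) ~= (0::real)) --> d (g a) = d (g b)"
 shows "finite ((\<lambda>s. d (f s)) ` {s. F (f s) ~= 0})" (is ?Q) "card ((\<lambda>s. d (f s)) ` {s. F (f s) ~= 0}) \<le> card {s. F (f s) = 0} + 1" (is ?P)
proof -
 define Z where "Z = {s. F (f s) = 0}"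
 note finZ' = finZ[folded Z_def]
 define r where "r s = card {z\<in>Z. z < s}" for s
 have mono: "d (f s) = d (f t)" if st: "s \<le> t" "s \<notin> Z" "t \<notin> Z" "r s = r t" for s t
 proof (rule d[rule_format, of s t f], intro conjI st(1) cont ballI)
  fix u assume u: "u \<in> {s..t}"
  show "F (f u) ~= 0"
  proof
   assume "F (f u) = 0"
   then have uZ: "u \<in> Z" by (simp add: Z_def)
   then have "u ~= t" using st by auto
   then have "u \<in> {z\<in>Z. z < t}" "u \<notin> {z\<in>Z. z < s}" using u uZ by simp_all
   moreover have "{z\<in>Z. z < s} \<subseteq> {z\<in>Z. z < t}" using st(1) by (simp add: subset_iff)
   ultimately have "{z\<in>Z. z < s} \<subset> {z\<in>Z. z < t}" by blast
   from psubset_card_mono[OF _ this] finZ' st(4) show False by (simp add: r_def)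
  qed
 qed
 have eq: "d (f s) = d (f t)" if "s \<notin> Z" "t \<notin> Z" "r s = r t" for s t
 proof (cases "s \<le> t")
  case True then show ?thesis using mono[OF True that] by simp
 next
  case False
  then have "t \<le> s" by simp
  from mono[OF this that(2,1) that(3)[symmetric]] show ?thesis by (rule sym)
 qed
 define h where "h i = d (f (SOME s. s \<notin> Z \<and> r s = i))" for i
 have hr: "d (f s) = h (r s)" if s: "s \<notin> Z" for s
 proof -
  have "(SOME t. t \<notin> Z \<and> r t = r s) \<notin> Z \<and> r (SOME t. t \<notin> Z \<and> r t = r s) = r s" by (rule someI[of _ s]) (use s in simp)
  from eq[OF s conjunct1[OF this] conjunct2[OF this, symmetric]] show ?thesis unfolding h_def .
 qed
 have sub: "(\<lambda>s. d (f s)) ` {s. F (f s) ~= 0} \<subseteq> h ` {..card Z}"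
 proof (rule image_subsetI)
  fix s assume "s \<in> {s. F (f s) ~= 0}"
  then have "d (f s) = h (r s)" using hr by (simp add: Z_def)
  moreover have "r s \<in> {..card Z}" unfolding r_def atMost_iff by (rule card_mono[OF finZ']) blast
  ultimately show "d (f s) \<in> h ` {..card Z}" by (simp only: imageI)
 qed
 have fin: "finite (h ` {..card Z})" by simp
 have "card (h ` {..card Z}) \<le> card {..card Z}" by (rule card_image_le) simp
 then have c: "card (h ` {..card Z}) \<le> card {s. F (f s) = 0} + 1" unfolding Z_def by simp
 show ?Q ?P by (rule finite_subset[OF sub fin], rule order_trans[OF card_mono[OF fin sub] c])
qed

text \<open>At most \<open>2*d + 1\<close> zeros leave \<open>2*d + 2\<close> intervals, and the
  antipode of \<open>p\<close> may contribute one more label.\<close>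

lemma cells_on_circ:
 fixes z :: "'a::euclidean_space => 'b"
 assumes F: "rpd d F" and c: "norm v = 1" "v\<bullet>w = 0" "w ~= 0" and x: "x \<in> circ p v w" "F x ~= 0"
  and z: "path_invariant F z"
 shows "finite (z ` {y \<in> circ p v w. F y ~= 0})" (is ?Q) "card (z ` {y \<in> circ p v w. F y ~= 0}) \<le> 2*d + 3" (is ?P)
proof -
 note Z = zeros_along_cpar[OF F c x]
 note P = cells_on_path[OF Z(1) continuous_on_cpar z]
 let ?i = "p + (1/(w\<bullet>w)) *R w"
 let ?A = "(\<lambda>s. z (cpar p v w s)) ` {s. F (cpar p v w s) ~= 0}"
 have sub: "z ` {y \<in> circ p v w. F y ~= 0} \<subseteq> insert (z ?i) ?A"
 proof (rule image_subsetI)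
  fix y assume "y \<in> {y \<in> circ p v w. F y ~= 0}"
  then have y: "y \<in> circ p v w" "F y ~= 0" by auto
  from circ_param[OF y(1) c(3)] consider "y = ?i" | s where "y = cpar p v w s" by blast
  then show "z y \<in> insert (z ?i) ?A" using y(2) by auto
 qed
 have fin: "finite (insert (z ?i) ?A)" using P(1) by simp
 have c: "card (insert (z ?i) ?A) \<le> 2*d + 3" using P(1) card_insert_if P(2) Z(2) by fastforce
 show ?Q ?P by (rule finite_subset[OF sub fin], rule order_trans[OF card_mono[OF fin sub] c])
qed

text \<open>Classes with at most two elements are paid for by their labels; an element of a larger
  class starts a triple.\<close>

lemma card_le_groups_and_triples:
 assumes "finite A"
 shows "card A \<le> 2 * card (Z ` A) + card {(x, y, z). x \<in> A \<and> y \<in> A \<and> z \<in> A \<and> x ~= y \<and> x ~= z \<and> y ~= z \<and> Z y = Z x \<and> Z z = Z x}"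
  (is "_ \<le> _ + card ?T")
proof -
 define G where "G k = {x\<in>A. Z x = k}" for k
 have fin: "finite (G k)" for k unfolding G_def by (rule finite_subset[OF _ assms]) (rule Collect_restrict)
 have finT: "finite ?T" by (rule finite_subset[of _ "A\<times>A\<times>A"]) (simp_all add: subset_iff assms)
 have "A \<subseteq> (\<Union>k\<in>{k \<in> Z ` A. card (G k) \<le> 2}. G k)\<union>fst ` ?T"
 proof
  fix x assume x: "x \<in> A"
  show "x \<in> (\<Union>k\<in>{k \<in> Z ` A. card (G k) \<le> 2}. G k)\<union>fst ` ?T"
  proof (cases "card (G (Z x)) \<le> 2")
   case True then show ?thesis using x by (auto simp: G_def)
  next
   case False
   have "card (G (Z x) - {x}) \<ge> 2" using x False by (simp add: G_def)
   then obtain B where B: "B \<subseteq> G (Z x) - {x}" "card B = 2" using obtain_subset_with_card_n by metis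
   then obtain y z where yz: "B = {y, z} \<and> y ~= z" unfolding card_2_iff by blast
   then have "(x, y, z) \<in> ?T" using B(1) x by (simp add: G_def) metis
   from imageI[OF this, of fst] show ?thesis by simp
  qed
 qed
 then have "card A \<le> card ((\<Union>k\<in>{k \<in> Z ` A. card (G k) \<le> 2}. G k)\<union>fst ` ?T)"
  using assms fin finT by (intro card_mono) auto
 also have "... \<le> card (\<Union>k\<in>{k \<in> Z ` A. card (G k) \<le> 2}. G k) + card (fst ` ?T)" by (rule card_Un_le)
 also have "card (\<Union>k\<in>{k \<in> Z ` A. card (G k) \<le> 2}. G k) \<le> (\<Sum>k\<in>{k \<in> Z ` A. card (G k) \<le> 2}. card (G k))"
  using assms by (intro card_UN_le) auto
 also have "... \<le> (\<Sum>k\<in>{k \<in> Z ` A. card (G k) \<le> 2}. 2)" by (intro sum_mono) auto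
 also have "... = 2 * card {k \<in> Z ` A. card (G k) \<le> 2}" by simp
 also have "... \<le> 2 * card (Z ` A)" using assms by (intro mult_left_mono card_mono) auto
 also have "card (fst ` ?T) \<le> card ?T" by (rule card_image_le[OF finT])
 finally show ?thesis by simp
qed

lemma card_same_class_triples:
 assumes P: "finite P" and c: "!!p. p \<in> P ==> real (card {q\<in>P. Z q = Z p}) \<le> c"
 shows "finite {(x, y, z). x \<in> P \<and> y \<in> P \<and> z \<in> P \<and> Z y = Z x \<and> Z z = Z x}" (is ?Q)
  "real (card {(x, y, z). x \<in> P \<and> y \<in> P \<and> z \<in> P \<and> Z y = Z x \<and> Z z = Z x}) \<le> real (card P) * c\<^sup>2" (is ?P)
proof -
 define G where "G p = {q\<in>P. Z q = Z p}" for p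
 have e: "{(x, y, z). x \<in> P \<and> y \<in> P \<and> z \<in> P \<and> Z y = Z x \<and> Z z = Z x} = (SIGMA x:P. G x\<times>G x)" by (auto simp: G_def)
 have fin: "finite (G p)" for p using P by (simp add: G_def)
 show ?Q unfolding e using P fin by simp
 have "real (card (SIGMA x:P. G x\<times>G x)) = (\<Sum>x\<in>P. real (card (G x))*real (card (G x)))" using P fin by simp
 also have "... \<le> (\<Sum>x\<in>P. c * c)" using c unfolding G_def by (intro sum_mono mult_mono) (auto intro: order_trans[OF of_nat_0_le_iff])
 finally show ?P unfolding e by (simp add: power2_eq_square)
qed

text \<open>Three points lie on at most one common circle, so the triples inside cells, at most
  \<open>c^2\<close> per first point, are shared out among the circles without overlap. A circle
  pays in addition \<open>2*d + 1\<close> for points on the zero set and twice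
  \<open>2*d + 3\<close> for cells in which it has at most two points.\<close>

lemma cell_incidences:
 fixes F :: "real^3 => real"
 assumes F: "rpd d F" and P: "finite P" and C: "finite C" "!!G. G \<in> C ==> is_circle G"
  and nz: "!!G. G \<in> C ==> \<not> G \<subseteq> {x. F x = 0}"
  and Z: "path_invariant F Z"
  and c: "c \<ge> 0" "!!p. F p ~= 0 ==> real (card {q\<in>P. Z q = Z p}) \<le> c"
 shows "real (card (flags P C)) \<le> (6*real d + 7)*real (card C) + real (card P) * c\<^sup>2"
proof -
 define P' where "P' = {p\<in>P. F p ~= 0}"
 define T where "T G = {(x, y, z). x \<in> P'\<inter>G \<and> y \<in> P'\<inter>G \<and> z \<in> P'\<inter>G \<and> x ~= y \<and> x ~= z \<and> y ~= z \<and> Z y = Z x \<and> Z z = Z x}" for G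
 have finP': "finite P'" using P by (simp add: P'_def)
 have one: "card (P\<inter>G) \<le> (6*d + 7) + card (T G)" if g: "G \<in> C" for G
 proof -
  obtain x where x: "x \<in> G" "F x ~= 0" using nz[OF g] by blast
  obtain v w where v: "norm v = 1" "v\<bullet>w = 0" "w ~= 0" "G = circ x v w" using circle_through_point[OF C(2)[OF g] x(1)] .
  note k = card_zeros_on_circle[OF F C(2)[OF g] nz[OF g]]
  note l = cells_on_circ[OF F v(1-3) x(1)[unfolded v(4)] x(2) Z, folded v(4)]
  let ?B = "P'\<inter>G"
  have "card (P\<inter>G) \<le> card ({y \<in> G. F y = 0}\<union>?B)" using k(1) finP' by (intro card_mono) (auto simp: P'_def)
  also have "... \<le> card {y \<in> G. F y = 0} + card ?B" by (rule card_Un_le)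
  also have "card ?B \<le> 2 * card (Z ` ?B) + card (T G)" unfolding T_def using finP' by (intro card_le_groups_and_triples) simp
  also have "card (Z ` ?B) \<le> card (Z ` {y \<in> G. F y ~= 0})" by (intro card_mono l(1)) (auto simp: P'_def)
  finally show ?thesis using k(2) l(2) by linarith
 qed
 have finT: "finite (T G)" for G by (rule finite_subset[of _ "P'\<times>P'\<times>P'"]) (use finP' in \<open>auto simp: T_def\<close>)
 let ?A = "\<Sum>G\<in>C. card (T G)"
 have "T G\<inter>T G' = {}" if "G \<in> C" "G' \<in> C" "G ~= G'" for G G'
 proof (rule ccontr)
  assume "T G\<inter>T G' ~= {}"
  then obtain x y z where "(x, y, z) \<in> T G" "(x, y, z) \<in> T G'" by auto
  then show False using circles_share_two_points[OF C(2)[OF that(1)] C(2)[OF that(2)], of x y z] that(3) by (auto simp: T_def)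
 qed
 then have "?A = card (\<Union>G\<in>C. T G)" using C(1) finT by (subst card_UN_disjoint) auto
 also have "real ... \<le> real (card {(x, y, z). x \<in> P' \<and> y \<in> P' \<and> z \<in> P' \<and> Z y = Z x \<and> Z z = Z x})"
 proof -
  have cl: "real (card {q\<in>P'. Z q = Z p}) \<le> c" if "p \<in> P'" for p
  proof -
   have "card {q\<in>P'. Z q = Z p} \<le> card {q\<in>P. Z q = Z p}" using P by (intro card_mono) (auto simp: P'_def)
   then show ?thesis using c(2)[of p] that by (simp add: P'_def)
  qed
  show ?thesis unfolding of_nat_le_iff by (rule card_mono[OF card_same_class_triples(1)[OF finP' cl]]) (auto simp: T_def)
 qed
 also have "... \<le> real (card P') * c\<^sup>2"
 proof (rule card_same_class_triples(2)[OF finP'])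
  fix p assume "p \<in> P'"
  have "card {q\<in>P'. Z q = Z p} \<le> card {q\<in>P. Z q = Z p}" using P by (intro card_mono) (auto simp: P'_def)
  then show "real (card {q\<in>P'. Z q = Z p}) \<le> c" using c(2)[of p] \<open>p \<in> P'\<close> by (simp add: P'_def)
 qed
 also have "... \<le> real (card P) * c\<^sup>2" using P by (intro mult_right_mono) (auto simp: P'_def intro: card_mono)
 finally have T: "real ?A \<le> real (card P) * c\<^sup>2" .
 have e: "(flags P C) = prod.swap ` (SIGMA G:C. P\<inter>G)" by (auto simp: image_iff)
 have "card (flags P C) \<le> card (SIGMA G:C. P\<inter>G)" unfolding e using C(1) P by (intro card_image_le) auto
 also have "... = (\<Sum>G\<in>C. card (P\<inter>G))" using C(1) P by simp
 also have "... \<le> (\<Sum>G\<in>C. (6*d + 7) + card (T G))" by (intro sum_mono one)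
 also have "... = (6*d + 7) * card C + ?A" by (simp add: sum.distrib mult.commute)
 finally have "real (card (flags P C)) \<le> real ((6*d + 7) * card C + ?A)" by (simp only: of_nat_le_iff)
 then show ?thesis using T by (simp add: algebra_simps)
qed

theorem space_reduction:
 obtains K :: real where "K > 0" "!!P C D. [|finite P; finite C; !!g. g \<in> C ==> is_circle g; D \<ge> (1::real)|] ==>
  \<exists>Inc s T. (surface_flags P C Inc s T) \<and>
   real (card ((flags P C) - Inc)) \<le> K*(D*real (card C) + real (card P) + real (card P)^3/D^6)"
proof -
 have surj: "\<exists>x::real^3. \<forall>t<3. x\<bullet>axis (of_nat t) 1 = y t" for y :: "nat => real"
 proof -
  have "\<forall>t<3. (y 0 *R axis 0 1 + y 1 *R axis 1 1 + y 2 *R axis 2 1 :: real^3)\<bullet>axis (of_nat t) 1 = y t"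
   by (auto simp: less_Suc_eq numeral_3_eq_3 inner_add_left inner_axis_axis numeral_2_eq_2)
  then show ?thesis by blast
 qed
 from polynomial_partition[OF surj]
 obtain A where A: "A > 0 \<and> (\<forall>S D. finite S \<and> D \<ge> (1::real) --> (\<exists>F (z :: real^3 => nat => real) d. rpd d F \<and> real d \<le> A*D \<and> (\<exists>x. F x ~= 0) \<and>
   (small_cells D 3 S F z) \<and>
   (path_invariant F z)))"
  by (elim meta_mp[elim_format] exE) auto
 define K where "K = 12*A + 40"
 show ?thesis
 proof (rule that[of K])
  show "K > 0" using A by (simp add: K_def)
  fix P :: "(real^3) set" and C D assume P: "finite P" and C: "finite C" "!!g. g \<in> C ==> is_circle g" and D: "D \<ge> (1::real)"
  from conjunct2[OF A, rule_format, OF conjI[OF P D]]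
  obtain F and z :: "real^3 => nat => real" and d where F: "rpd d F \<and> real d \<le> A*D \<and> (\<exists>x. F x ~= 0) \<and>
   (small_cells D 3 P F z) \<and>
   (path_invariant F z)" by (elim exE) (rule that)
  note F1 = conjunct1[OF F] and F2 = conjunct1[OF conjunct2[OF F]] and F3 = conjunct1[OF conjunct2[OF conjunct2[OF F]]]
   and F4 = conjunct1[OF conjunct2[OF conjunct2[OF conjunct2[OF F]]]] and F5 = conjunct2[OF conjunct2[OF conjunct2[OF conjunct2[OF F]]]]
  obtain x0 where x0: "F x0 ~= 0" using F3 ..
  define C1 where "C1 = {g\<in>C. g \<subseteq> {x. F x = 0}}"
  define C2 where "C2 = C - C1"
  have CC: "finite C1" "finite C2" "C1 \<subseteq> C" "C2 \<subseteq> C" "card C = card C1 + card C2"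
   using C(1) by (auto simp: C1_def C2_def card_Diff_subset card_mono)
  define n m where "n = real (card C)" and "m = real (card P)"
  have hC1: "!!g. g \<in> C1 ==> is_circle g" "!!g x. g \<in> C1 ==> x \<in> g ==> F x = 0" using C(2) by (auto simp: C1_def)
  have "\<exists>Inc s T. (surface_flags P C1 Inc s T) \<and>
   card ((flags P C1) - Inc) \<le> (6*d + 6) * card C1 + 22 * card P"
  proof (rule surface_incidences[OF F1 x0 P CC(1)])
   fix g assume "g \<in> C1"
   then show "is_circle g" by (rule hC1(1))
  next
   fix g x assume "g \<in> C1" "x \<in> g"
   then show "F x = 0" by (rule hC1(2))
  next
   fix Inc s T
   assume "!!p g. (p, g) \<in> Inc ==> p \<in> P \<and> g \<in> C1 \<and> p \<in> g \<and> s p = T g \<and> (is_plane (T g) \<or> is_sphere (T g)) \<and> g \<subseteq> T g"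
    "card ((flags P C1) - Inc) \<le> (6*d + 6) * card C1 + 22 * card P"
   then show "\<exists>Inc s T. (surface_flags P C1 Inc s T) \<and>
    card ((flags P C1) - Inc) \<le> (6*d + 6) * card C1 + 22 * card P"
    by (intro exI[of _ Inc] exI[of _ s] exI[of _ T]) (rule conjI, simp, simp)
  qed
  then obtain Inc s T where I0: "(surface_flags P C1 Inc s T) \<and>
   card ((flags P C1) - Inc) \<le> (6*d + 6) * card C1 + 22 * card P"
   by (elim exE) (rule that)
  note I = conjunct1[OF I0, rule_format] conjunct2[OF I0]
  \<comment> \<open>The cell size that \<open>small_cells\<close> grants for three dimensions;
    \<open>m * c^2\<close> becomes four times \<open>m^3/D^6\<close>.\<close>
  define c where "c = 2*m/D^3"
  have D0: "D > 0" "D^3 > 0" using D by auto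
  let ?A = "flags P C2"
  let ?B = "6*real d + 7"
  have J: "real (card ?A) \<le> ?B*real (card C2) + real (card P) * c\<^sup>2"
  proof (rule cell_incidences[OF F1 P CC(2) _ _ F5])
   show "!!g. g \<in> C2 ==> is_circle g" "!!g. g \<in> C2 ==> \<not> g \<subseteq> {x. F x = 0}" using C(2) by (auto simp: C2_def C1_def)
   show "c \<ge> 0" using D0 by (simp add: c_def m_def)
   show "real (card {q \<in> P. z q = z p}) \<le> c" if "F p ~= 0" for p using F4[rule_format, OF that] D0 by (simp add: c_def m_def field_simps)
  qed
  let ?C = "(6*d + 6) * card C1 + 22 * card P"
  let ?D = "(flags P C) - Inc"
  have "card ?D \<le> card (((flags P C1) - Inc)\<union>?A)"
  proof (rule card_mono)
   show "finite (((flags P C1) - Inc)\<union>?A)" by (rule finite_subset[of _ "P\<times>C1\<union>P\<times>C2"]) (blast, simp add: P CC(1,2))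
   show "(flags P C) - Inc \<subseteq> ((flags P C1) - Inc)\<union>?A" unfolding C2_def by blast
  qed
  also have "... \<le> card ((flags P C1) - Inc) + card ?A" by (rule card_Un_le)
  also have "... \<le> ?C + card ?A" by (rule add_right_mono[OF I(2)])
  finally have "real (card ?D) \<le> real (?C + card ?A)" unfolding of_nat_le_iff .
  also have "... = (6*real d + 6)*real (card C1) + 22*m + real (card ?A)" by (simp add: m_def)
  also have "... \<le> (6*real d + 6)*real (card C1) + 22*m + (?B*real (card C2) + m * c\<^sup>2)" using J unfolding m_def by (rule add_left_mono)
  also have "... \<le> ?B*n + 22*m + m * c\<^sup>2" using CC(5) by (simp add: ring_sq n_def)
  also have "?B*n \<le> (K*D)*n"
  proof (rule mult_right_mono)
   show "6*real d + 7 \<le> K*D" using F2 D by (simp add: ring_sq K_def)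
  qed (simp add: n_def)
  also have "m * c\<^sup>2 = 4*(m^3/D^6)"
   by (simp add: c_def power_divide power_mult_distrib power2_eq_square[of m] power3_eq_cube[of m] flip: power_mult)
  also have "K*D*n + 22*m + 4*(m^3/D^6) \<le> K*D*n + K*m + K*(m^3/D^6)"
   using A D0 by (intro add_mono mult_right_mono order_refl) (auto simp: K_def m_def)
  finally have "real (card ?D) \<le> K*(D*n + m + m^3/D^6)" by (simp add: algebra_simps)
  then show "\<exists>Inc s T. (surface_flags P C Inc s T) \<and>
   real (card ((flags P C) - Inc)) \<le> K*(D*real (card C) + real (card P) + real (card P)^3/D^6)"
   unfolding n_def m_def using I(1) CC(3) by (intro exI[of _ Inc] exI[of _ s] exI[of _ T]) blast
 qed
qed

section \<open>Orientation reversal in lenses\<close>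

text \<open>A circle equation with leading coefficient \<open>k\<close>, read as an affine form on
  the lift of the plane to a paraboloid. \<open>N\<close> stands for the squared norm but is kept
  free, since midpoints of lifted chords lie off the paraboloid.\<close>

definition qev :: "real\<times>real\<times>real\<times>real => real\<times>real\<times>real => real" where
 "qev = (\<lambda>(k, b1, b2, c) (N, x, y). k*N + b1*x + b2*y + c)"

definition orient :: "real\<times>real => real\<times>real => real\<times>real => real" where
 "orient = (\<lambda>(x1, y1) (x2, y2) (x3, y3). (x2 - x1)*(y3 - y1) - (x3 - x1)*(y2 - y1))"

definition det3 :: "real\<times>real\<times>real => real\<times>real\<times>real => real\<times>real\<times>real => real" where
 "det3 = (\<lambda>(a1, a2, a3) (b1, b2, b3) (c1, c2, c3).
   a1*(b2 * c3 - b3 * c2) - a2*(b1 * c3 - b3 * c1) + a3*(b1 * c2 - b2 * c1))"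

text \<open>Multiplicativity of determinants: \<open>orient\<close> is the determinant with rows
  \<open>(x, y, 1)\<close>.\<close>

lemma det3_mult:
 "det3 (h11, h12, h13) (h21, h22, h23) (h31, h32, h33) * orient (x1, y1) (x2, y2) (x3, y3) =
  det3 (h11*x1 + h12*y1 + h13, h21*x1 + h22*y1 + h23, h31*x1 + h32*y1 + h33)
    (h11*x2 + h12*y2 + h13, h21*x2 + h22*y2 + h23, h31*x2 + h32*y2 + h33)
    (h11*x3 + h12*y3 + h13, h21*x3 + h22*y3 + h23, h31*x3 + h32*y3 + h33)"
 unfolding det3_def orient_def by (simp add: algebra_simps)

lemma zero_diagonal_det_neg:
 assumes "a2 < 0" "a3 < 0" "b1 < 0" "b3 < 0" "c1 < 0" "c2 < (0::real)"
 shows "det3 (0, a2, a3) (b1, 0, b3) (c1, c2, 0) < 0"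
proof -
 have "(b3 * c1) * a2 < 0" "(b1 * c2) * a3 < 0" using assms by (simp_all add: mult_neg_neg mult_pos_neg)
 then show ?thesis by (simp add: det3_def algebra_simps)
qed

text \<open>Cramer's rule together with the matrix determinant lemma, by which a perturbation of
  rank one multiplies the determinant by a linear expression in the coordinates \<open>t1\<close>,
  \<open>t2\<close>, \<open>t3\<close>.\<close>

lemma cramer3:
 assumes "det3 (h11, h12, h13) (h21, h22, h23) (h31, h32, h33) ~= 0"
 obtains t1 t2 t3 where "l1 = t1*h11 + t2*h21 + t3*h31" "l2 = t1*h12 + t2*h22 + t3*h32"
  "l3 = t1*h13 + t2*h23 + t3*h33"
  "det3 (h11 - k1*l1, h12 - k1*l2, h13 - k1*l3) (h21 - k2*l1, h22 - k2*l2, h23 - k2*l3) (h31 - k3*l1, h32 - k3*l2, h33 - k3*l3)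
   = det3 (h11, h12, h13) (h21, h22, h23) (h31, h32, h33)*(1 - (k1*t1 + k2*t2 + k3*t3))"
proof -
 let ?A = "(h11, h12, h13)"
 let ?B = "(h21, h22, h23)"
 let ?C = "(h31, h32, h33)"
 define D where "D = det3 ?A ?B ?C"
 define d1 d2 d3 where "d1 = det3 (l1, l2, l3) ?B ?C"
  and "d2 = det3 ?A (l1, l2, l3) ?C" and "d3 = det3 ?A ?B (l1, l2, l3)"
 have D: "D ~= 0" using assms by (simp add: D_def)
 have 1: "D*l1 = d1*h11 + d2*h21 + d3*h31" "D*l2 = d1*h12 + d2*h22 + d3*h32" "D*l3 = d1*h13 + d2*h23 + d3*h33"
  unfolding D_def d1_def d2_def d3_def det3_def by (simp_all add: algebra_simps)
 have e: "det3 (h11 - k1*l1, h12 - k1*l2, h13 - k1*l3) (h21 - k2*l1, h22 - k2*l2, h23 - k2*l3) (h31 - k3*l1, h32 - k3*l2, h33 - k3*l3)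
  = D - (k1*d1 + k2*d2 + k3*d3)"
  unfolding D_def d1_def d2_def d3_def det3_def by (simp add: algebra_simps)
 have dv: "x = a/D" if "D*x = a" for x a using that D by (simp add: field_simps)
 show ?thesis
 proof (rule that[of "d1/D" "d2/D" "d3/D"])
  show "l1 = d1/D*h11 + d2/D*h21 + d3/D*h31" using dv[OF 1(1)] by (simp add: add_divide_distrib)
  show "l2 = d1/D*h12 + d2/D*h22 + d3/D*h32" using dv[OF 1(2)] by (simp add: add_divide_distrib)
  show "l3 = d1/D*h13 + d2/D*h23 + d3/D*h33" using dv[OF 1(3)] by (simp add: add_divide_distrib)
  show "det3 (h11 - k1*l1, h12 - k1*l2, h13 - k1*l3) (h21 - k2*l1, h22 - k2*l2, h23 - k2*l3) (h31 - k3*l1, h32 - k3*l2, h33 - k3*l3) = det3 ?A ?B ?C*(1 - (k1*(d1/D) + k2*(d2/D) + k3*(d3/D)))" using D e by (simp add: ring_sq D_def)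
 qed
qed

text \<open>Against negative coefficients, the negative values say that of any two of
  \<open>l1\<close>, \<open>l2\<close>, \<open>l3\<close> one is positive, and the positive values
  that one is negative. Three numbers cannot do both.\<close>

lemma no_positive_relation:
 fixes l1 l2 l3 :: real
 assumes a: "a12 < 0" "a13 < 0" "a21 < 0" "a23 < 0" "a31 < 0" "a32 < 0"
  and b: "b12 < 0" "b13 < 0" "b21 < 0" "b23 < 0" "b31 < 0" "b32 < 0"
  and u: "u1 < 0" "u2 < 0" "u3 < 0" "u1 = l2 * a12 + l3 * a13" "u2 = l1 * a21 + l3 * a23" "u3 = l1 * a31 + l2 * a32"
  and v: "v1 > 0" "v2 > 0" "v3 > 0" "v1 = l2 * b12 + l3 * b13" "v2 = l1 * b21 + l3 * b23" "v3 = l1 * b31 + l2 * b32"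
 shows False
proof -
 have A: "x > 0 \<or> y > 0" if "x * c + y*d < 0" "c < 0" "d < 0" for x y c d :: real
  using that by (metis add_nonneg_nonneg mult_nonpos_nonpos not_less less_imp_le)
 have B: "x < 0 \<or> y < 0" if "x * c + y*d > 0" "c < 0" "d < 0" for x y c d :: real
  using that by (metis add_nonpos_nonpos mult_nonneg_nonpos not_less less_imp_le)
 have "l2 > 0 \<or> l3 > 0" "l1 > 0 \<or> l3 > 0" "l1 > 0 \<or> l2 > 0" using A u a by metis+
 moreover have "l2 < 0 \<or> l3 < 0" "l1 < 0 \<or> l3 < 0" "l1 < 0 \<or> l2 < 0" using B v b by metis+
 ultimately show False by linarith
qed

text \<open>\<open>Ga\<close> and \<open>Gb\<close> are two circles that form lenses with the same
  three circles \<open>Gi\<close>, at \<open>mi\<close> and at \<open>ni\<close>. Subtracting the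
  multiple of \<open>Ga\<close> that cancels the quadratic part turns the \<open>Gi\<close> into
  linear forms whose matrix at the \<open>mi\<close> has zero diagonal and negative entries
  elsewhere; hence its determinant \<open>HA\<close> and the orientation of the \<open>mi\<close>
  have opposite signs. The same holds for \<open>Gb\<close>, the \<open>ni\<close> and
  \<open>HB\<close>. The two determinants differ by a factor \<open>W\<close>, which also appears in
  the relation \<open>rel\<close> between the five circles, and there its sign can be read
  off.\<close>

theorem lens_reversal:
 fixes ka kb :: real
 assumes k: "\<bar>ka\<bar> = 1" "\<bar>kb\<bar> = 1"
  and Ga: "Ga = (ka, a1, a2, a3)" and Gb: "Gb = (kb, b1, b2, b3)"
  and G: "G1 = (k1, g11, g12, g13)" "G2 = (k2, g21, g22, g23)" "G3 = (k3, g31, g32, g33)"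
  and m: "m1 = (M1, x1, y1)" "m2 = (M2, x2, y2)" "m3 = (M3, x3, y3)"
  and n: "n1 = (N1, u1, v1)" "n2 = (N2, u2, v2)" "n3 = (N3, u3, v3)"
  and a0: "qev Ga m1 = 0" "qev Ga m2 = 0" "qev Ga m3 = 0" and b0: "qev Gb n1 = 0" "qev Gb n2 = 0" "qev Gb n3 = 0"
  and d0: "qev G1 m1 = 0" "qev G2 m2 = 0" "qev G3 m3 = 0" "qev G1 n1 = 0" "qev G2 n2 = 0" "qev G3 n3 = 0"
  and om: "qev G2 m1 < 0" "qev G3 m1 < 0" "qev G1 m2 < 0" "qev G3 m2 < 0" "qev G1 m3 < 0" "qev G2 m3 < 0"
  and on: "qev G2 n1 < 0" "qev G3 n1 < 0" "qev G1 n2 < 0" "qev G3 n2 < 0" "qev G1 n3 < 0" "qev G2 n3 < 0"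
  and ab: "qev Ga n1 < 0" "qev Ga n2 < 0" "qev Ga n3 < 0" and ba: "qev Gb m1 < 0" "qev Gb m2 < 0" "qev Gb m3 < 0"
 shows "(ka * orient (x1, y1) (x2, y2) (x3, y3))*(kb * orient (u1, v1) (u2, v2) (u3, v3)) < 0"
proof -
 have kk: "ka*ka = 1" "kb*kb = 1" using k by (auto simp: abs_if split: if_splits)
 have key: "det3 (h1 - k1*(q*p1), h2 - k1*(q*p2), h3 - k1*(q*p3)) (h4 - k2*(q*p1), h5 - k2*(q*p2), h6 - k2*(q*p3))
   (h7 - k3*(q*p1), h8 - k3*(q*p2), h9 - k3*(q*p3)) * orient (z1, w1) (z2, w2) (z3, w3) < 0"
  if q: "q*q = 1" and z: "qev (q, p1, p2, p3) (Z1, z1, w1) = 0" "qev (q, p1, p2, p3) (Z2, z2, w2) = 0" "qev (q, p1, p2, p3) (Z3, z3, w3) = 0"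
   and d: "qev (k1, h1, h2, h3) (Z1, z1, w1) = 0" "qev (k2, h4, h5, h6) (Z2, z2, w2) = 0" "qev (k3, h7, h8, h9) (Z3, z3, w3) = 0"
   and ng: "qev (k2, h4, h5, h6) (Z1, z1, w1) < 0" "qev (k3, h7, h8, h9) (Z1, z1, w1) < 0" "qev (k1, h1, h2, h3) (Z2, z2, w2) < 0"
   "qev (k3, h7, h8, h9) (Z2, z2, w2) < 0" "qev (k1, h1, h2, h3) (Z3, z3, w3) < 0" "qev (k2, h4, h5, h6) (Z3, z3, w3) < 0"
  for q p1 p2 p3 h1 h2 h3 h4 h5 h6 h7 h8 h9 z1 z2 z3 w1 w2 w3 Z1 Z2 Z3
 proof -
  have e: "(h - kj*(q*p1))*z + (h' - kj*(q*p2))*w + (h'' - kj*(q*p3)) = qev (kj, h, h', h'') (Z, z, w)"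
   if H: "qev (q, p1, p2, p3) (Z, z, w) = 0" for h h' h'' kj z w Z
  proof -
   have "kj*q*(q*Z + p1*z + p2*w + p3) = 0" using H by (simp add: qev_def)
   then have "kj*(q*q)*Z + kj*q*(p1*z + p2*w + p3) = 0" by (simp add: algebra_simps)
   then show ?thesis unfolding q by (simp add: qev_def algebra_simps)
  qed
  show ?thesis unfolding det3_mult e[OF z(1)] e[OF z(2)] e[OF z(3)] d by (rule zero_diagonal_det_neg[OF ng])
 qed
 note KA = key[OF kk(1) a0[unfolded Ga m] d0(1-3)[unfolded G m] om[unfolded G m]]
 note KB = key[OF kk(2) b0[unfolded Gb n] d0(4-6)[unfolded G n] on[unfolded G n]]
 define p1 p2 p3 where "p1 = kb * b1 - ka * a1" and "p2 = kb * b2 - ka * a2" and "p3 = kb * b3 - ka * a3"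
 define HA where "HA = det3 (g11 - k1*(ka * a1), g12 - k1*(ka * a2), g13 - k1*(ka * a3))
  (g21 - k2*(ka * a1), g22 - k2*(ka * a2), g23 - k2*(ka * a3)) (g31 - k3*(ka * a1), g32 - k3*(ka * a2), g33 - k3*(ka * a3))"
 define HB where "HB = det3 (g11 - k1*(kb * b1), g12 - k1*(kb * b2), g13 - k1*(kb * b3))
  (g21 - k2*(kb * b1), g22 - k2*(kb * b2), g23 - k2*(kb * b3)) (g31 - k3*(kb * b1), g32 - k3*(kb * b2), g33 - k3*(kb * b3))"
 have HA: "HA * orient (x1, y1) (x2, y2) (x3, y3) < 0" unfolding HA_def by (rule KA)
 have HB: "HB * orient (u1, v1) (u2, v2) (u3, v3) < 0" unfolding HB_def by (rule KB)
 have HA0: "HA ~= 0" using HA by auto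
 obtain t1 t2 t3 where t: "p1 = t1*(g11 - k1*(ka * a1)) + t2*(g21 - k2*(ka * a1)) + t3*(g31 - k3*(ka * a1))"
  "p2 = t1*(g12 - k1*(ka * a2)) + t2*(g22 - k2*(ka * a2)) + t3*(g32 - k3*(ka * a2))"
  "p3 = t1*(g13 - k1*(ka * a3)) + t2*(g23 - k2*(ka * a3)) + t3*(g33 - k3*(ka * a3))"
  and dt: "det3 (g11 - k1*(ka * a1) - k1*p1, g12 - k1*(ka * a2) - k1*p2, g13 - k1*(ka * a3) - k1*p3)
   (g21 - k2*(ka * a1) - k2*p1, g22 - k2*(ka * a2) - k2*p2, g23 - k2*(ka * a3) - k2*p3)
   (g31 - k3*(ka * a1) - k3*p1, g32 - k3*(ka * a2) - k3*p2, g33 - k3*(ka * a3) - k3*p3)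
   = HA*(1 - (k1*t1 + k2*t2 + k3*t3))"
  unfolding HA_def by (rule cramer3[OF HA0[unfolded HA_def]])
 define W where "W = 1 - (k1*t1 + k2*t2 + k3*t3)"
 have s: "g - k*(ka * a) - k*(kb * b - ka * a) = g - k*(kb * b)" for g k a b :: real by (simp add: algebra_simps)
 have HBA: "HB = HA*W" using dt unfolding p1_def p2_def p3_def s HB_def[symmetric] W_def .
 have rel: "kb*qev Gb z = ka*W*qev Ga z + (t1*qev G1 z + t2*qev G2 z + t3*qev G3 z)" for z
 proof -
  obtain Z zx zy where z: "z = (Z, zx, zy)" by (metis prod_cases3)
  have eb: "kb * b1 = ka * a1 + p1" "kb * b2 = ka * a2 + p2" "kb * b3 = ka * a3 + p3" by (simp_all add: p1_def p2_def p3_def)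
  have "kb*qev Gb z = kb*kb*Z + (kb * b1)*zx + (kb * b2)*zy + kb * b3" by (simp add: Gb z qev_def algebra_simps)
  also have "... = Z + (ka * a1 + p1)*zx + (ka * a2 + p2)*zy + (ka * a3 + p3)" unfolding kk(2) eb by simp
  finally have 1: "kb*qev Gb z = Z + (ka * a1 + p1)*zx + (ka * a2 + p2)*zy + (ka * a3 + p3)" .
  have 2: "ka*W*qev Ga z = W*Z + ka*W*(a1*zx + a2*zy + a3)" using Ga z kk(1) by (simp add: ring_sq qev_def)
  show ?thesis unfolding 1 2 unfolding t G z qev_def W_def by (simp add: algebra_simps)
 qed
 let ?A = "ka*kb*W"
 \<comment> \<open>A positive value would make one linear combination of the three forms
   \<open>Gi\<close> negative at all \<open>mi\<close>, where \<open>Ga\<close> is 0 and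
   \<open>Gb\<close> negative, but positive at all \<open>ni\<close>, where the roles are
   exchanged.\<close>
 have "\<not> ka*kb*W > 0"
 proof
  assume pos: "ka*kb*W > 0"
  have rel': "qev Gb z = ?A*qev Ga z + (kb*t1*qev G1 z + kb*t2*qev G2 z + kb*t3*qev G3 z)" for z
  proof -
   have "qev Gb z = kb*(kb*qev Gb z)" using kk(2) by (simp flip: mult.assoc)
   also have "... = kb*(ka*W*qev Ga z + (t1*qev G1 z + t2*qev G2 z + t3*qev G3 z))" unfolding rel ..
   finally show ?thesis by (simp add: algebra_simps)
  qed
  have ng: "- ?A*qev Ga z > 0" if "qev Ga z < 0" for z using pos that by (simp add: mult_pos_neg)
  show False
  proof (rule no_positive_relation[OF om on ba])
   show "qev Gb m1 = kb*t2*qev G2 m1 + kb*t3*qev G3 m1" using rel'[of m1] a0 d0 by simp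
   show "qev Gb m2 = kb*t1*qev G1 m2 + kb*t3*qev G3 m2" using rel'[of m2] a0 d0 by simp
   show "qev Gb m3 = kb*t1*qev G1 m3 + kb*t2*qev G2 m3" using rel'[of m3] a0 d0 by simp
   show "- ?A*qev Ga n1 > 0" "- ?A*qev Ga n2 > 0" "- ?A*qev Ga n3 > 0" by (intro ng ab)+
   show "- ?A*qev Ga n1 = kb*t2*qev G2 n1 + kb*t3*qev G3 n1" using rel'[of n1] b0 d0 by simp
   show "- ?A*qev Ga n2 = kb*t1*qev G1 n2 + kb*t3*qev G3 n2" using rel'[of n2] b0 d0 by simp
   show "- ?A*qev Ga n3 = kb*t1*qev G1 n3 + kb*t2*qev G2 n3" using rel'[of n3] b0 d0 by simp
  qed
 qed
 moreover have "ka*kb*W ~= 0" using HB HBA k by auto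
 ultimately have neg: "ka*kb*W < 0" by (metis linorder_less_linear)
 let ?B = "orient (x1, y1) (x2, y2) (x3, y3) * orient (u1, v1) (u2, v2) (u3, v3)"
 have "0 < (HA * orient (x1, y1) (x2, y2) (x3, y3))*(HB * orient (u1, v1) (u2, v2) (u3, v3))" by (rule mult_neg_neg[OF HA HB])
 also have "... = HA\<^sup>2*(W*?B)" unfolding HBA by (simp add: power2_eq_square)
 finally have pos: "W*?B > 0" by (simp add: zero_less_mult_iff)
 have "?A*(W*?B) < 0" by (rule mult_neg_pos[OF neg pos])
 then have "W\<^sup>2*((ka * orient (x1, y1) (x2, y2) (x3, y3))*(kb * orient (u1, v1) (u2, v2) (u3, v3))) < 0" by (simp add: power2_eq_square mult_ac)
 then show ?thesis by (simp add: mult_less_0_iff)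
qed

section \<open>Twisted orders\<close>

definition order_sign :: "('x => nat) => 'x => 'x => real" where
 "order_sign p x y = (if p x < p y then 1 else - 1)"

text \<open>Two linear orders obtained by cutting open a cyclic order and its reversal: pairs inside
  the same of two arcs are reversed, pairs from different arcs keep their order. The colour
  \<open>\<eta>\<close> tells the two arcs apart.\<close>

locale twisted_pair =
 fixes S :: "'x set" and p q :: "'x => nat" and \<eta> :: "'x => bool"
 assumes fin: "finite S" and inj: "inj_on p S"
  and twist: "!!x y. [|x \<in> S; y \<in> S; x ~= y|] ==> ((p x < p y) = (q x < q y)) = (\<eta> x ~= \<eta> y)"
begin

definition code :: "nat => 'x => nat\<times>nat" where
 "code l x = (p x div 2^l, q x div 2^l)"

definition block :: "nat => nat\<times>nat => 'x set" where
 "block l c = {x\<in>S. code l x = c}"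

definition bad :: "nat => nat\<times>nat => bool" where
 "bad l c \<longleftrightarrow> (\<exists>x\<in>block l c. \<exists>y\<in>block l c. \<eta> x \<and> \<not> \<eta> y)"

definition bad_sum :: "nat => real" where
 "bad_sum l = (\<Sum>c\<in>code l ` S. if bad l c then real (card (block l c)) else 0)"

text \<open>Counts ordered pairs of distinct elements sharing a one-coloured block. On all of them
  the two orders disagree.\<close>

definition good_sum :: "nat => real" where
 "good_sum l = (\<Sum>c\<in>code l ` S. if bad l c then 0 else real (card (block l c))^2 - real (card (block l c)))"

lemma fin_block: "finite (block l c)"
 unfolding block_def using fin by simp

text \<open>The four instances of \<open>twist\<close> close a cycle
  \<open>q x2 \<le> q x1 < q y2 \<le> q y1 < q x2\<close>.\<close>

lemma separated_false:
 assumes x: "x1 \<in> S" "y1 \<in> S" "x2 \<in> S" "y2 \<in> S" "\<eta> x1" "\<not> \<eta> y1" "\<eta> x2" "\<not> \<eta> y2"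
  and "p x1 < p x2" "p x1 < p y2" "p y1 < p x2" "p y1 < p y2"
 shows False
proof -
 have ne: "x1 ~= x2" "x1 ~= y2" "y1 ~= x2" "y1 ~= y2" using assms(9-12) by auto
 have "\<not> q x1 < q x2" using twist[OF x(1,3) ne(1)] assms by simp
 moreover have "q x1 < q y2" using twist[OF x(1,4) ne(2)] assms by simp
 moreover have "q y1 < q x2" using twist[OF x(2,3) ne(3)] assms by simp
 moreover have "\<not> q y1 < q y2" using twist[OF x(2,4) ne(4)] assms by simp
 ultimately show False by linarith
qed

lemma separated_false':
 assumes x: "x1 \<in> S" "y1 \<in> S" "x2 \<in> S" "y2 \<in> S" "\<eta> x1" "\<not> \<eta> y1" "\<eta> x2" "\<not> \<eta> y2"
  and "q x1 < q x2" "q x1 < q y2" "q y1 < q x2" "q y1 < q y2"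
 shows False
proof -
 have ne: "x1 ~= x2" "x1 ~= y2" "y1 ~= x2" "y1 ~= y2" using assms(9-12) by auto
 have "\<not> p x1 < p x2" using twist[OF x(1,3) ne(1)] assms by simp
 moreover have "p x1 < p y2" using twist[OF x(1,4) ne(2)] assms by simp
 moreover have "p y1 < p x2" using twist[OF x(2,3) ne(3)] assms by simp
 moreover have "\<not> p y1 < p y2" using twist[OF x(2,4) ne(4)] assms by simp
 ultimately show False by linarith
qed

lemma div_less_imp_less: "a div 2^l < b div 2^l ==> a < (b::nat)"
 by (metis div_le_mono not_le)

text \<open>Different blocks of one level are separated in \<open>p\<close> or in \<open>q\<close>,
  and two separated pairs of both colours give the contradictory cycle above. So a level loses
  control in one block only.\<close>

lemma bad_unique:
 assumes "bad l c" "bad l c'"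
 shows "c = c'"
proof -
 obtain x1 y1 where 1: "x1 \<in> block l c" "y1 \<in> block l c" "\<eta> x1" "\<not> \<eta> y1" using assms(1) unfolding bad_def by blast
 obtain x2 y2 where 2: "x2 \<in> block l c'" "y2 \<in> block l c'" "\<eta> x2" "\<not> \<eta> y2" using assms(2) unfolding bad_def by blast
 have S: "x1 \<in> S" "y1 \<in> S" "x2 \<in> S" "y2 \<in> S" using 1 2 by (simp_all add: block_def)
 have c: "p x1 div 2^l = fst c" "p y1 div 2^l = fst c" "q x1 div 2^l = snd c" "q y1 div 2^l = snd c"
  "p x2 div 2^l = fst c'" "p y2 div 2^l = fst c'" "q x2 div 2^l = snd c'" "q y2 div 2^l = snd c'"
  using 1 2 by (auto simp: block_def code_def)
 have "\<not> fst c < fst c'" using separated_false[OF S 1(3,4) 2(3,4)] c div_less_imp_less by metis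
 moreover have "\<not> fst c' < fst c" using separated_false[OF S(3,4,1,2) 2(3,4) 1(3,4)] c div_less_imp_less by metis
 moreover have "\<not> snd c < snd c'" using separated_false'[OF S 1(3,4) 2(3,4)] c div_less_imp_less by metis
 moreover have "\<not> snd c' < snd c" using separated_false'[OF S(3,4,1,2) 2(3,4) 1(3,4)] c div_less_imp_less by metis
 ultimately show ?thesis by (simp add: prod_eq_iff)
qed

lemma bad_sum_0: "bad_sum 0 = 0"
proof -
 have "\<not> bad 0 c" for c
 proof
  assume "bad 0 c"
  then obtain x y where xy: "x \<in> block 0 c" "y \<in> block 0 c" "\<eta> x" "\<not> \<eta> y" unfolding bad_def by blast
  then have "x = y" using inj by (auto simp: block_def code_def inj_on_def)
  then show False using xy by simp
 qed
 then show ?thesis by (simp add: bad_sum_def)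
qed

lemma good_sum_nonneg: "good_sum l \<ge> 0" and bad_sum_nonneg: "bad_sum l \<ge> 0"
proof -
 have "real k^2 - real k \<ge> 0" for k :: nat by (cases k) (auto simp: ring_sq)
 then show "good_sum l \<ge> 0" unfolding good_sum_def by (intro sum_nonneg) auto
 show "bad_sum l \<ge> 0" unfolding bad_sum_def by (intro sum_nonneg) auto
qed

lemma card_block_le:
 assumes "M > 0"
 shows "real (card (block l c)) \<le> (if bad l c then real (card (block l c)) else 0) + (M + 1)
   + (if bad l c then 0 else real (card (block l c))^2 - real (card (block l c)))/M"
proof (cases "bad l c")
 case False
 define k where "k = real (card (block l c))"
 have "k \<le> M + 1 + (k^2 - k)/M"
 proof (cases "k \<le> M + 1")
  case True
  have "k^2 - k \<ge> 0" unfolding k_def by (cases "card (block l c)") (auto simp: ring_sq)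
  then show ?thesis using True assms by (simp add: add_increasing2)
 next
  case False
  then have "k*M \<le> k*(k - 1)" using assms by (intro mult_left_mono) auto
  then have "k \<le> (k^2 - k)/M" using assms by (simp add: field_sq)
  then show ?thesis using assms by simp
 qed
 then show ?thesis using False by (simp add: k_def)
qed (use assms in simp)

text \<open>The only bad block of level \<open>Suc l\<close> consists of at most four blocks of
  level \<open>l\<close>. One of these that is good with \<open>k\<close> elements is bounded by
  \<open>M + 1 + (k^2 - k)/M\<close>, which charges large blocks to \<open>good_sum\<close>.\<close>

lemma bad_sum_Suc:
 assumes M: "M > 0"
 shows "bad_sum (Suc l) \<le> bad_sum l + 4*(M + 1) + good_sum l/M"
proof (cases "\<exists>c\<in>code (Suc l) ` S. bad (Suc l) c")
 case False
 then have "bad_sum (Suc l) = 0" unfolding bad_sum_def by (intro sum.neutral) auto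
 then show ?thesis using M good_sum_nonneg[of l] bad_sum_nonneg[of l] by (simp add: add_nonneg_nonneg)
next
 case True
 then obtain c where c: "c \<in> code (Suc l) ` S" "bad (Suc l) c" by blast
 have "bad_sum (Suc l) = (\<Sum>c'\<in>code (Suc l) ` S. if c' = c then real (card (block (Suc l) c)) else 0)" unfolding bad_sum_def
 proof (rule sum.cong[OF refl])
  fix c'
  show "(if bad (Suc l) c' then real (card (block (Suc l) c')) else 0) = (if c' = c then real (card (block (Suc l) c)) else 0)"
   using bad_unique c(2) by simp
 qed
 also have "... = real (card (block (Suc l) c))" using c(1) fin by simp
 finally have 1: "bad_sum (Suc l) = real (card (block (Suc l) c))" .
 define H where "H = {e \<in> code l ` S. fst e div 2 = fst c \<and> snd e div 2 = snd c}"
 have finH: "finite H" using fin by (simp add: H_def)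
 have Hsub: "H \<subseteq> {2*fst c, 2*fst c + 1}\<times>{2 * snd c, 2 * snd c + 1}"
 proof
  fix e assume "e \<in> H"
  then have "fst e div 2 = fst c" "snd e div 2 = snd c" by (simp_all add: H_def)
  then have "fst e \<in> {2*fst c, 2*fst c + 1}" "snd e \<in> {2 * snd c, 2 * snd c + 1}" by auto
  then show "e \<in> {2*fst c, 2*fst c + 1}\<times>{2 * snd c, 2 * snd c + 1}" unfolding mem_Times_iff by (rule conjI)
 qed
 have "card H \<le> card ({2*fst c, 2*fst c + 1}\<times>{2 * snd c, 2 * snd c + 1})" by (rule card_mono[OF _ Hsub]) simp
 then have cardH: "card H \<le> 4" by (simp add: card_cartesian_product)
 have cs: "code (Suc l) x = (fst (code l x) div 2, snd (code l x) div 2)" for x by (simp only: code_def power_Suc2 div_mult2_eq fst_conv snd_conv)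
 have "block (Suc l) c \<subseteq> (\<Union>e\<in>H. block l e)"
 proof
  fix x assume x: "x \<in> block (Suc l) c"
  then have xS: "x \<in> S" "code (Suc l) x = c" by (simp_all add: block_def)
  have "code l x \<in> H" using xS cs[of x] by (auto simp: H_def)
  moreover have "x \<in> block l (code l x)" using xS by (simp add: block_def)
  ultimately show "x \<in> (\<Union>e\<in>H. block l e)" by (rule UN_I)
 qed
 then have "card (block (Suc l) c) \<le> card (\<Union>e\<in>H. block l e)" using finH fin_block by (intro card_mono) auto
 also have "... \<le> (\<Sum>e\<in>H. card (block l e))" by (rule card_UN_le[OF finH])
 finally have "real (card (block (Suc l) c)) \<le> (\<Sum>e\<in>H. real (card (block l e)))" by (metis of_nat_le_iff of_nat_sum)
 also have "... \<le> (\<Sum>e\<in>H. (if bad l e then real (card (block l e)) else 0) + (M + 1)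
   + (if bad l e then 0 else real (card (block l e))^2 - real (card (block l e)))/M)"
  by (intro sum_mono card_block_le M)
 also have "... = (\<Sum>e\<in>H. if bad l e then real (card (block l e)) else 0) + real (card H)*(M + 1)
   + (\<Sum>e\<in>H. if bad l e then 0 else real (card (block l e))^2 - real (card (block l e)))/M"
  by (simp add: sum.distrib sum_divide_distrib)
 also have "... \<le> bad_sum l + 4*(M + 1) + good_sum l/M"
 proof -
  have HS: "H \<subseteq> code l ` S" by (auto simp: H_def)
  have fS: "finite (code l ` S)" using fin by simp
  let ?A = "\<lambda>bad block. \<Sum>e\<in>H. if bad l e then 0 else real (card (block l e))^2 - real (card (block l e))"
  have "(\<Sum>e\<in>H. if bad l e then real (card (block l e)) else 0) \<le> bad_sum l" unfolding bad_sum_def by (rule sum_mono2[OF fS HS]) auto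
  moreover have "real (card H)*(M + 1) \<le> 4*(M + 1)" using cardH M by (intro mult_right_mono) auto
  moreover have "real k^2 - real k \<ge> 0" for k :: nat by (cases k) (auto simp: ring_sq)
  then have "(?A bad block) \<le> good_sum l" unfolding good_sum_def by (intro sum_mono2[OF fS HS]) auto
  then have "(?A bad block)/M \<le> good_sum l/M" using M by (simp add: divide_right_mono)
  ultimately show ?thesis by linarith
 qed
 finally show ?thesis unfolding 1 .
qed

text \<open>At level \<open>L\<close> all of \<open>S\<close> is one block. If it is good,
  \<open>(k - 2)^2 \<ge> 0\<close> gives \<open>3*k \<le> k^2 - k + 4\<close>.\<close>

lemma card_le_top:
 assumes "!!x. x \<in> S ==> p x < 2^L" "!!x. x \<in> S ==> q x < 2^L"
 shows "real (card S) \<le> bad_sum L + (good_sum L + 4)/3"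
proof (cases "S = {}")
 case True
 then show ?thesis using bad_sum_nonneg[of L] good_sum_nonneg[of L] by simp
next
 case False
 have "code L x = (0, 0)" if "x \<in> S" for x using assms that by (simp add: code_def)
 then have im: "code L ` S = {(0, 0)}" and bl: "block L (0, 0) = S" using False by (auto simp: block_def)
 show ?thesis
 proof (cases "bad L (0, 0)")
  case True
  then have "bad_sum L = real (card S)" unfolding bad_sum_def im by (simp add: bl)
  then show ?thesis using good_sum_nonneg[of L] by simp
 next
  case False
  then have g: "good_sum L = real (card S)^2 - real (card S)" unfolding good_sum_def im by (simp add: bl)
  have "(real (card S) - 2)\<^sup>2 \<ge> 0" by simp
  then have "3*real (card S) \<le> real (card S)^2 - real (card S) + 4" by (simp add: ring_sq)
  then have "3*real (card S) \<le> good_sum L + 4" unfolding g .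
  then show ?thesis using bad_sum_nonneg[of L] by (simp add: field_simps)
 qed
qed

definition twist_sum :: "nat => real" where
 "twist_sum l = (\<Sum>x\<in>S. \<Sum>y\<in>S. if x ~= y \<and> code l x = code l y then order_sign p x y * order_sign q x y else 0)"

text \<open>With colours coded as signs \<open>e\<close>, a pair contributes
  \<open>- (e x*e y)\<close>, so a block of \<open>k\<close> elements contributes \<open>k\<close>
  minus the square of its sum of signs. This is \<open>k - k^2\<close> for one colour and at most
  \<open>k\<close> otherwise.\<close>

lemma twist_sum_le: "twist_sum l \<le> bad_sum l - good_sum l"
proof -
 define e where "e x = (if \<eta> x then 1 else - 1 :: real)" for x
 have ee: "e x*e x = 1" for x by (simp add: e_def)
 have os: "order_sign p x y * order_sign q x y = - (e x*e y)" if "x \<in> S" "y \<in> S" "x ~= y" for x y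
  using twist[OF that] by (auto simp: order_sign_def e_def split: if_splits)
 let ?A = "\<lambda>x. \<Sum>y\<in>block l (code l x). e x*e y"
 have inner: "(\<Sum>y\<in>S. if x ~= y \<and> code l x = code l y then order_sign p x y * order_sign q x y else 0)
   = 1 - (\<Sum>y\<in>block l (code l x). e x*e y)" if x: "x \<in> S" for x
 proof -
  let ?C = "\<lambda>S. \<Sum>y\<in>S. if code l y = code l x then e x*e y else 0"
  have "(\<Sum>y\<in>S. if x ~= y \<and> code l x = code l y then order_sign p x y * order_sign q x y else 0)
   = (\<Sum>y\<in>S. (if x = y then 1 else 0) - (if code l y = code l x then e x*e y else 0))"
   by (rule sum.cong) (use os[OF x] ee in \<open>auto\<close>)
  also have "... = 1 - (?C S)" using x fin by (simp add: sum_subtractf)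
  also have "(?C S) = (?A x)" unfolding block_def using fin by (simp add: sum.inter_filter)
  finally show ?thesis .
 qed
 let ?B = "\<lambda>c. card (block l c)"
 have "twist_sum l = (\<Sum>x\<in>S. 1 - (?A x))" unfolding twist_sum_def by (rule sum.cong[OF refl inner])
 also have "... = (\<Sum>c\<in>code l ` S. \<Sum>x\<in>{x \<in> S. code l x = c}. 1 - (?A x))"
  by (rule sum.group[OF fin _ order_refl, symmetric]) (use fin in simp)
 also have "... = (\<Sum>c\<in>code l ` S. real (?B c) - (\<Sum>x\<in>block l c. e x)\<^sup>2)"
 proof (rule sum.cong[OF refl])
  fix c
  have "(\<Sum>x\<in>{x \<in> S. code l x = c}. 1 - (?A x)) = (\<Sum>x\<in>block l c. 1 - (\<Sum>y\<in>block l c. e x*e y))"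
   unfolding block_def by (rule sum.cong) auto
  also have "... = real (?B c) - (\<Sum>x\<in>block l c. e x)\<^sup>2" by (simp add: sum_subtractf power2_eq_square sum_product)
  finally show "(\<Sum>x\<in>{x \<in> S. code l x = c}. 1 - (?A x)) = real (?B c) - (\<Sum>x\<in>block l c. e x)\<^sup>2" .
 qed
 also have "... \<le> (\<Sum>c\<in>code l ` S. (if bad l c then real (?B c) else 0) - (if bad l c then 0 else real (?B c)^2 - real (?B c)))"
 proof (rule sum_mono)
  fix c
  show "real (card (block l c)) - (\<Sum>x\<in>block l c. e x)\<^sup>2
   \<le> (if bad l c then real (card (block l c)) else 0) - (if bad l c then 0 else real (card (block l c))^2 - real (card (block l c)))"
   by (simp add: bad_def e_def)
 qed
 also have "... = bad_sum l - good_sum l" unfolding bad_sum_def good_sum_def by (rule sum_subtractf)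
 finally show ?thesis .
qed

end

definition twisted :: "'x set => ('x => nat) => ('x => nat) => bool" where
 "twisted S p q \<longleftrightarrow> (\<exists>\<eta> :: 'x => bool. \<forall>x\<in>S. \<forall>y\<in>S. x ~= y --> ((p x < p y) = (q x < q y)) = (\<eta> x ~= \<eta> y))"

text \<open>The two sequences leave the locale as one pair, so that a choice function can later run
  over all pairs of rows.\<close>

lemma twisted_sums:
 fixes S :: "'x set"
 assumes "finite S" "inj_on p S" "twisted S p q" "!!x. x \<in> S ==> p x < 2^L" "!!x. x \<in> S ==> q x < 2^L"
 shows "\<exists>YG :: (nat => real)\<times>(nat => real). fst YG 0 = 0 \<and> (\<forall>l M. M > 0 --> fst YG (Suc l) \<le> fst YG l + 4*(M + 1) + snd YG l/M)
  \<and> real (card S) \<le> fst YG L + (snd YG L + 4)/3 \<and>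
  (\<forall>l. (\<Sum>x\<in>S. \<Sum>y\<in>S. if x ~= y \<and> p x div 2^l = p y div 2^l \<and> q x div 2^l = q y div 2^l then order_sign p x y * order_sign q x y else 0) \<le> fst YG l - snd YG l)"
proof -
 obtain \<eta> :: "'x => bool" where \<eta>: "\<forall>x\<in>S. \<forall>y\<in>S. x ~= y --> ((p x < p y) = (q x < q y)) = (\<eta> x ~= \<eta> y)"
  using assms(3) unfolding twisted_def ..
 interpret twisted_pair S p q \<eta> using assms(1,2) \<eta> by unfold_locales simp_all
 have t: "(\<Sum>x\<in>S. \<Sum>y\<in>S. if x ~= y \<and> p x div 2^l = p y div 2^l \<and> q x div 2^l = q y div 2^l then order_sign p x y * order_sign q x y else 0) \<le> bad_sum l - good_sum l" for l
  using twist_sum_le[of l] unfolding twist_sum_def code_def prod.inject .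
 show ?thesis using bad_sum_0 bad_sum_Suc card_le_top[OF assms(4,5)] t by (intro exI[of _ "(bad_sum, good_sum)"]) simp
qed

section \<open>Many orders that are pairwise twisted\<close>

lemma card_same_block:
 assumes "finite N" "inj_on (f :: 'x => nat) N"
 shows "card {y\<in>N. f y div 2^l = c} \<le> 2^l"
proof -
 have "card {y\<in>N. f y div 2^l = c} = card (f ` {y\<in>N. f y div 2^l = c})"
  by (rule card_image[symmetric]) (rule inj_on_subset[OF assms(2)], blast)
 also have "... \<le> card {c*2^l..<c*2^l + 2^l}"
 proof (rule card_mono)
  show "f ` {y\<in>N. f y div 2^l = c} \<subseteq> {c*2^l..<c*2^l + 2^l}"
  proof (rule image_subsetI)
   fix y assume "y \<in> {y\<in>N. f y div 2^l = c}"
   then have "f y div 2^l = c" by simp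
   moreover have "f y mod 2^l < 2^l" by simp
   moreover have "f y = f y div 2^l*2^l + f y mod 2^l" by (rule div_mult_mod_eq[symmetric])
   ultimately show "f y \<in> {c*2^l..<c*2^l + 2^l}" by (metis atLeastLessThan_iff le_add1 nat_add_left_cancel_less)
  qed
 qed simp
 finally show ?thesis by simp
qed

text \<open>Over \<open>L\<close> levels the growth factor accumulates to
  \<open>(1 + 1/L)^L\<close>, which is at most \<open>exp 1\<close> and so at most 3.\<close>

lemma geometric_recurrence:
 fixes Y :: "nat => real"
 assumes "Y 0 = 0" "!!l. l < L ==> Y (Suc l) \<le> Y l*(1 + 1/real L) + a" "a \<ge> 0" "L \<ge> 1"
 shows "Y L \<le> 3 * a*real L"
proof -
 have b: "(1::real) + 1/real L \<ge> 1" by simp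
 let ?A = "1 + 1/real L"
 have "l \<le> L ==> Y l \<le> a*real l*?A^l" for l
 proof (induction l)
  case 0 then show ?case using assms(1) by simp
 next
  case (Suc l)
  have "Y (Suc l) \<le> Y l*?A + a" using assms(2) Suc.prems by simp
  also have "... \<le> (a*real l*?A^l)*?A + a*?A^Suc l"
  proof (rule add_mono)
   show "Y l*?A \<le> (a*real l*?A^l)*?A" using Suc b by (intro mult_right_mono) auto
   show "a \<le> a*?A^Suc l" using mult_left_mono[OF one_le_power[OF b, of "Suc l"] assms(3)] by simp
  qed
  also have "... = a*real (Suc l)*?A^Suc l" by (simp add: algebra_simps add_divide_distrib)
  finally show ?case .
 qed
 from this[of L] have "Y L \<le> a*real L*?A^L" by simp
 also have "... \<le> a*real L*3"
 proof (rule mult_left_mono)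
  have "?A^L \<le> exp 1" by (rule exp_ge_one_plus_x_over_n_power_n) (use assms(4) in auto)
  also have "exp 1 \<le> (3::real)" by (rule exp_le)
  finally show "?A^L \<le> 3" .
 qed (use assms(3) in simp)
 finally show ?thesis by (simp add: mult_ac)
qed

text \<open>By Cauchy-Schwarz it is enough to bound the total number of common entries of two rows.
  Summed over pairs of rows, the good pairs \<open>G\<close> of a level are controlled by the bad
  entries \<open>Y\<close> of that level through a positive square, and \<open>Y\<close> by the
  level below; the levels are then unrolled.\<close>

lemma row_bound:
 fixes N :: "'i => 'x set"
 assumes I: "finite I" and X: "finite X" "!!i. i \<in> I ==> N i \<subseteq> X"
  and f: "!!i. i \<in> I ==> inj_on (f i) (N i)" "!!i x. i \<in> I ==> x \<in> N i ==> f i x < 2^L" and L: "L \<ge> 1"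
  and tw: "!!i j. i \<in> I ==> j \<in> I ==> i ~= j ==> twisted (N i\<inter>N j) (f i) (f j)"
  and E: "E = (\<Sum>i\<in>I. real (card (N i)))"
 shows "E\<^sup>2 \<le> real (card X)*(E + 13/3*(E*2^L) + (4/3 + 16*real L*(real L + 1))*(real (card I))\<^sup>2)"
proof -
 define R where "R = real (card I)"
 have finN: "finite (N i)" if "i \<in> I" for i using finite_subset[OF X(2)[OF that] X(1)] .
 define J where "J = {(i, j) \<in> I\<times>I. i ~= j}"
 have finJ: "finite J" and cardJ: "real (card J) \<le> R\<^sup>2"
 proof -
  have s: "J \<subseteq> I\<times>I" by (auto simp: J_def)
  show "finite J" by (rule finite_subset[OF s]) (use I in simp)
  have "card J \<le> card (I\<times>I)" by (rule card_mono[OF _ s]) (use I in simp)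
  then have "card J \<le> card I * card I" by (simp add: card_cartesian_product)
  then have "real (card J) \<le> real (card I * card I)" unfolding of_nat_le_iff .
  then show "real (card J) \<le> R\<^sup>2" by (simp add: R_def power2_eq_square)
 qed
 define T where "T l i j = (\<Sum>x\<in>N i\<inter>N j. \<Sum>y\<in>N i\<inter>N j. if x ~= y \<and> f i x div 2^l = f i y div 2^l \<and> f j x div 2^l = f j y div 2^l then order_sign (f i) x y * order_sign (f j) x y else 0)" for l i j
 have "\<exists>YG. \<forall>e\<in>J. fst (YG e) 0 = 0 \<and> (\<forall>l M. M > 0 --> fst (YG e) (Suc l) \<le> fst (YG e) l + 4*(M + 1) + snd (YG e) l/M)
  \<and> real (card (N (fst e)\<inter>N (snd e))) \<le> fst (YG e) L + (snd (YG e) L + 4)/3 \<and> (\<forall>l. T l (fst e) (snd e) \<le> fst (YG e) l - snd (YG e) l)"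
 proof (rule bchoice, rule ballI)
  fix e assume e: "e \<in> J"
  define i j where "i = fst e" and "j = snd e"
  have ij: "i \<in> I" "j \<in> I" "i ~= j" using e by (auto simp: J_def i_def j_def)
  have 1: "finite (N i\<inter>N j)" using finN[OF ij(1)] by simp
  have 2: "inj_on (f i) (N i\<inter>N j)" using inj_on_subset[OF f(1)[OF ij(1)]] by blast
  have 3: "!!x. x \<in> N i\<inter>N j ==> f i x < 2^L" "!!x. x \<in> N i\<inter>N j ==> f j x < 2^L" using f(2) ij by blast+
  show "\<exists>y. fst y 0 = 0 \<and> (\<forall>l M. M > 0 --> fst y (Suc l) \<le> fst y l + 4*(M + 1) + snd y l/M)
   \<and> real (card (N (fst e)\<inter>N (snd e))) \<le> fst y L + (snd y L + 4)/3 \<and> (\<forall>l. T l (fst e) (snd e) \<le> fst y l - snd y l)"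
   unfolding i_def[symmetric] j_def[symmetric] T_def by (rule twisted_sums[OF 1 2 tw[OF ij] 3])
 qed
 then obtain YG where YG: "\<forall>e\<in>J. fst (YG e) 0 = 0 \<and> (\<forall>l M. M > 0 --> fst (YG e) (Suc l) \<le> fst (YG e) l + 4*(M + 1) + snd (YG e) l/M)
  \<and> real (card (N (fst e)\<inter>N (snd e))) \<le> fst (YG e) L + (snd (YG e) L + 4)/3 \<and> (\<forall>l. T l (fst e) (snd e) \<le> fst (YG e) l - snd (YG e) l)" ..
 define Y where "Y l = (\<Sum>e\<in>J. fst (YG e) l)" for l
 define G where "G l = (\<Sum>e\<in>J. snd (YG e) l)" for l
 have Y0: "Y 0 = 0" unfolding Y_def by (rule sum.neutral) (use YG in blast)
 have YS: "Y (Suc l) \<le> Y l + R\<^sup>2*(4*(M + 1)) + G l/M" if M: "M > 0" for l M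
 proof -
  have "Y (Suc l) \<le> (\<Sum>e\<in>J. fst (YG e) l + 4*(M + 1) + snd (YG e) l/M)" unfolding Y_def by (rule sum_mono) (use YG M in blast)
  also have "... = Y l + real (card J)*(4*(M + 1)) + G l/M" by (simp add: sum.distrib Y_def G_def sum_divide_distrib)
  also have "... \<le> Y l + R\<^sup>2*(4*(M + 1)) + G l/M" using mult_right_mono[OF cardJ, of "4*(M + 1)"] M by simp
  finally show ?thesis .
 qed
 let ?B = "\<lambda>e. card (N (fst e)\<inter>N (snd e))"
 have top: "(\<Sum>e\<in>J. real (?B e)) \<le> Y L + (G L + 4 * R\<^sup>2)/3"
 proof -
  have "(\<Sum>e\<in>J. real (?B e)) \<le> (\<Sum>e\<in>J. fst (YG e) L + (snd (YG e) L + 4)/3)" by (rule sum_mono) (use YG in blast)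
  also have "... = Y L + (G L + 4*real (card J))/3" by (simp add: sum.distrib Y_def G_def add_divide_distrib sum_divide_distrib)
  also have "... \<le> Y L + (G L + 4 * R\<^sup>2)/3" using cardJ by simp
  finally show ?thesis .
 qed
 \<comment> \<open>A square summed over all pairs \<open>x\<close>, \<open>y\<close> is expanded
   over rows. The terms of two different rows are their twist sums, at most \<open>Y l - G l\<close>
   in total; those of equal rows count pairs inside blocks of length \<open>2^l\<close>.\<close>
 have GY: "G l \<le> E*2^l + Y l" for l
 proof -
  define t where "t i x y = (if x \<in> N i \<and> y \<in> N i \<and> x ~= y \<and> f i x div 2^l = f i y div 2^l then order_sign (f i) x y else 0)" for i x y
  have "0 \<le> (\<Sum>x\<in>X. \<Sum>y\<in>X. (\<Sum>i\<in>I. t i x y)\<^sup>2)" by (intro sum_nonneg) simp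
  also have "... = (\<Sum>x\<in>X. \<Sum>y\<in>X. \<Sum>i\<in>I. \<Sum>j\<in>I. t i x y*t j x y)" by (simp add: power2_eq_square sum_product)
  also have "... = (\<Sum>i\<in>I. \<Sum>j\<in>I. \<Sum>x\<in>X. \<Sum>y\<in>X. t i x y*t j x y)"
  proof -
   have "(\<Sum>x\<in>X. \<Sum>y\<in>X. \<Sum>i\<in>I. \<Sum>j\<in>I. t i x y*t j x y) = (\<Sum>x\<in>X. \<Sum>i\<in>I. \<Sum>y\<in>X. \<Sum>j\<in>I. t i x y*t j x y)"
    by (intro sum.cong refl sum.swap)
   also have "... = (\<Sum>i\<in>I. \<Sum>x\<in>X. \<Sum>y\<in>X. \<Sum>j\<in>I. t i x y*t j x y)" by (rule sum.swap)
   also have "... = (\<Sum>i\<in>I. \<Sum>x\<in>X. \<Sum>j\<in>I. \<Sum>y\<in>X. t i x y*t j x y)" by (intro sum.cong refl sum.swap)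
   also have "... = (\<Sum>i\<in>I. \<Sum>j\<in>I. \<Sum>x\<in>X. \<Sum>y\<in>X. t i x y*t j x y)" by (intro sum.cong refl sum.swap)
   finally show ?thesis .
  qed
  also have "... = (\<Sum>(i, j)\<in>I\<times>I. \<Sum>x\<in>X. \<Sum>y\<in>X. t i x y*t j x y)" by (rule sum.cartesian_product)
  also have "... = (\<Sum>(i, j)\<in>J\<union>(\<lambda>i. (i, i)) ` I. \<Sum>x\<in>X. \<Sum>y\<in>X. t i x y*t j x y)"
   by (rule sum.cong) (auto simp: J_def)
  also have "... = (\<Sum>(i, j)\<in>J. \<Sum>x\<in>X. \<Sum>y\<in>X. t i x y*t j x y) + (\<Sum>(i, j)\<in>(\<lambda>i. (i, i)) ` I. \<Sum>x\<in>X. \<Sum>y\<in>X. t i x y*t j x y)"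
   by (rule sum.union_disjoint) (use finJ I in \<open>auto simp: J_def\<close>)
  also have "(\<Sum>(i, j)\<in>(\<lambda>i. (i, i)) ` I. \<Sum>x\<in>X. \<Sum>y\<in>X. t i x y*t j x y) = (\<Sum>i\<in>I. \<Sum>x\<in>X. \<Sum>y\<in>X. t i x y*t i x y)"
   by (subst sum.reindex) (auto simp: inj_on_def)
  also have "(\<Sum>(i, j)\<in>J. \<Sum>x\<in>X. \<Sum>y\<in>X. t i x y*t j x y) = (\<Sum>e\<in>J. T l (fst e) (snd e))"
  proof (rule sum.cong[OF refl])
   fix e assume e: "e \<in> J"
   define i j where "i = fst e" and "j = snd e"
   have ij: "i \<in> I" "j \<in> I" "e = (i, j)" using e by (auto simp: J_def i_def j_def)
   have sub: "N i\<inter>N j \<subseteq> X" using X(2)[OF ij(1)] by blast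
   have z: "t i x y*t j x y = 0" if "x \<notin> N i\<inter>N j \<or> y \<notin> N i\<inter>N j" for x y using that by (auto simp: t_def)
   have "(\<Sum>y\<in>X. t i x y*t j x y) = (\<Sum>y\<in>N i\<inter>N j. t i x y*t j x y)" for x
    by (rule sum.mono_neutral_right[OF X(1) sub]) (use z in blast)
   then have "(\<Sum>x\<in>X. \<Sum>y\<in>X. t i x y*t j x y) = (\<Sum>x\<in>X. \<Sum>y\<in>N i\<inter>N j. t i x y*t j x y)" by (simp only:)
   also have "... = (\<Sum>x\<in>N i\<inter>N j. \<Sum>y\<in>N i\<inter>N j. t i x y*t j x y)"
    by (rule sum.mono_neutral_right[OF X(1) sub]) (use z in \<open>blast intro: sum.neutral\<close>)
   also have "... = T l i j" unfolding T_def t_def by (intro sum.cong refl) auto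
   finally show "(case e of (i, j) => \<Sum>x\<in>X. \<Sum>y\<in>X. t i x y*t j x y) = T l (fst e) (snd e)" by (simp add: ij(3))
  qed
  also have "... \<le> (\<Sum>e\<in>J. fst (YG e) l - snd (YG e) l)" by (rule sum_mono) (use YG in blast)
  also have "... = Y l - G l" by (simp add: Y_def G_def sum_subtractf)
  also have "(\<Sum>i\<in>I. \<Sum>x\<in>X. \<Sum>y\<in>X. t i x y*t i x y) \<le> (\<Sum>i\<in>I. real (card (N i))*2^l)"
  proof (rule sum_mono)
   fix i assume i: "i \<in> I"
   have "(\<Sum>x\<in>X. \<Sum>y\<in>X. t i x y*t i x y) \<le> (\<Sum>x\<in>X. if x \<in> N i then 2^l else 0)"
   proof (rule sum_mono)
    fix x assume "x \<in> X"
    let ?A = "{y \<in> N i. f i y div 2^l = f i x div 2^l}"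
    show "(\<Sum>y\<in>X. t i x y*t i x y) \<le> (if x \<in> N i then 2^l else 0)"
    proof (cases "x \<in> N i")
     case True
     have "(\<Sum>y\<in>X. t i x y*t i x y) \<le> (\<Sum>y\<in>X. if y \<in> ?A then 1 else 0)" by (rule sum_mono) (auto simp: t_def order_sign_def)
     also have "... = real (card (X\<inter>?A))" using X(1) by (simp add: sum.If_cases)
     also have "X\<inter>?A = ?A" using X(2)[OF i] by blast
     also have "real (card ?A) \<le> real (2^l)" unfolding of_nat_le_iff by (rule card_same_block[OF finN[OF i] f(1)[OF i]])
     finally show ?thesis using True by simp
    next
     case False
     then show ?thesis by (simp add: t_def)
    qed
   qed
   also have "... = real (card (X\<inter>N i))*2^l" using X(1) by (simp add: sum.If_cases)
   also have "X\<inter>N i = N i" using X(2)[OF i] by blast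
   finally show "(\<Sum>x\<in>X. \<Sum>y\<in>X. t i x y*t i x y) \<le> real (card (N i))*2^l" .
  qed
  also have "... = E*2^l" by (simp add: E sum_distrib_right)
  finally show ?thesis by simp
 qed
 have E0: "E \<ge> 0" unfolding E by (intro sum_nonneg) simp
 \<comment> \<open>The free parameter \<open>M\<close> of the recurrence is set to \<open>L\<close>,
   which keeps the growth per level at \<open>1 + 1/L\<close>; \<open>a\<close> collects what is
   added at each level.\<close>
 define a where "a = R\<^sup>2*(4*(real L + 1)) + E*2^L/real L"
 have YL: "Y L \<le> 3 * a*real L"
 proof (rule geometric_recurrence[of Y L a, OF Y0 _ _ L])
  fix l assume l: "l < L"
  have "Y (Suc l) \<le> Y l + R\<^sup>2*(4*(real L + 1)) + G l/real L" using YS[of "real L" l] L by simp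
  also have "G l/real L \<le> (E*2^l + Y l)/real L" using GY by (intro divide_right_mono) auto
  also have "E*2^l \<le> E*2^L" using E0 l by (intro mult_left_mono) auto
  finally show "Y (Suc l) \<le> Y l*(1 + 1/real L) + a" using L by (simp add: a_def divide_right_mono add_divide_distrib algebra_simps)
 next
  show "a \<ge> 0" using E0 by (simp add: a_def)
 qed
 have aL: "a*real L = R\<^sup>2*(4*(real L + 1))*real L + E*2^L" using L by (simp add: a_def algebra_simps)
 let ?E = "4/3 + 16*real L*(real L + 1)"
 have "(\<Sum>e\<in>J. real (?B e)) \<le> 4/3*Y L + E*2^L/3 + 4/3 * R\<^sup>2" using top GY[of L] by (simp add: field_simps)
 also have "... \<le> 4*(a*real L) + E*2^L/3 + 4/3 * R\<^sup>2" using YL by simp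
 also have "... = 13/3*(E*2^L) + ?E * R\<^sup>2" unfolding aL by (simp add: algebra_simps)
 finally have off: "(\<Sum>e\<in>J. real (?B e)) \<le> 13/3*(E*2^L) + ?E * R\<^sup>2" .
 define dg where "dg x = (\<Sum>i\<in>I. if x \<in> N i then 1 else 0 :: real)" for x
 have ind: "(\<Sum>x\<in>X. if x \<in> A then 1 else 0) = real (card (X\<inter>A))" for A using X(1) by (simp add: sum.If_cases)
 have dE: "(\<Sum>x\<in>X. dg x) = E"
 proof -
  have "(\<Sum>x\<in>X. dg x) = (\<Sum>i\<in>I. \<Sum>x\<in>X. if x \<in> N i then 1 else 0)" unfolding dg_def by (rule sum.swap)
  also have "... = E" unfolding E
  proof (rule sum.cong[OF refl])
   fix i assume "i \<in> I"
   then have "X\<inter>N i = N i" using X(2) by blast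
   then show "(\<Sum>x\<in>X. if x \<in> N i then 1 else 0) = real (card (N i))" using X(1) by (simp add: sum.If_cases)
  qed
  finally show ?thesis .
 qed
 let ?C = "\<lambda>i j. card (N i\<inter>N j)"
 let ?D = "\<Sum>x\<in>X. (dg x)\<^sup>2"
 have "E\<^sup>2 \<le> real (card X)*?D" using Cauchy_Schwarz_ineq_sum[of "\<lambda>_. 1" dg X] dE by simp
 also have "?D = E + (\<Sum>e\<in>J. real (?B e))"
 proof -
  have "?D = (\<Sum>x\<in>X. \<Sum>i\<in>I. \<Sum>j\<in>I. (if x \<in> N i\<inter>N j then 1 else 0))"
   unfolding dg_def power2_eq_square sum_product by (intro sum.cong refl) auto
  also have "... = (\<Sum>i\<in>I. \<Sum>x\<in>X. \<Sum>j\<in>I. (if x \<in> N i\<inter>N j then 1 else 0))" by (rule sum.swap)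
  also have "... = (\<Sum>i\<in>I. \<Sum>j\<in>I. \<Sum>x\<in>X. (if x \<in> N i\<inter>N j then 1 else 0))" by (intro sum.cong refl sum.swap)
  also have "... = (\<Sum>i\<in>I. \<Sum>j\<in>I. real (?C i j))"
  proof (intro sum.cong refl)
   fix i j assume "i \<in> I" "j \<in> I"
   then have "X\<inter>(N i\<inter>N j) = N i\<inter>N j" using X(2) by blast
   moreover have "(\<Sum>x\<in>X. if x \<in> N i\<inter>N j then 1 else 0) = real (card (X\<inter>(N i\<inter>N j)))" by (rule ind)
   ultimately show "(\<Sum>x\<in>X. if x \<in> N i\<inter>N j then 1 else 0) = real (?C i j)" by simp
  qed
  also have "... = (\<Sum>(i, j)\<in>I\<times>I. real (?C i j))" by (rule sum.cartesian_product)
  also have "... = (\<Sum>(i, j)\<in>(\<lambda>i. (i, i)) ` I\<union>J. real (?C i j))" by (rule sum.cong) (auto simp: J_def)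
  also have "... = (\<Sum>(i, j)\<in>(\<lambda>i. (i, i)) ` I. real (?C i j)) + (\<Sum>(i, j)\<in>J. real (?C i j))"
   by (rule sum.union_disjoint) (use finJ I in \<open>auto simp: J_def\<close>)
  also have "(\<Sum>(i, j)\<in>(\<lambda>i. (i, i)) ` I. real (?C i j)) = E" unfolding E by (subst sum.reindex) (auto simp: inj_on_def)
  finally show ?thesis by (simp add: case_prod_unfold)
 qed
 also have "real (card X)*(E + (\<Sum>e\<in>J. real (card (N (fst e)\<inter>N (snd e)))))
   \<le> real (card X)*(E + (13/3*(E*2^L) + (4/3 + 16*real L*(real L + 1)) * R\<^sup>2))"
  using off by (intro mult_left_mono) auto
 finally show ?thesis by (simp add: R_def add.assoc)
qed

lemma power_two_below:
 assumes "x \<ge> (2::real)"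
 obtains L :: nat where "L \<ge> 1" "2^L \<le> x" "x < 2*2^L"
proof -
 have ex: "\<exists>n. x < 2^n" by (rule real_arch_pow) simp
 define n where "n = (LEAST n. x < 2^n)"
 have n: "x < 2^n" unfolding n_def by (rule LeastI_ex[OF ex])
 have n2: "n \<ge> 2"
 proof (rule ccontr)
  assume "\<not> n \<ge> 2"
  then have "n = 0 \<or> n = 1" by linarith
  then show False using n assms by auto
 qed
 have "\<not> x < 2^(n - 1)" unfolding n_def by (rule not_less_Least) (use n2 in \<open>simp add: n_def[symmetric]\<close>)
 then show ?thesis using n n2 that[of "n - 1"] by (simp add: power_Suc[symmetric])
qed

text \<open>Rows are cut into chunks of \<open>2^L\<close> consecutive ranks, where
  \<open>2^L\<close> is about \<open>E/(10*n)\<close>. Then there are only \<open>21*n\<close>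
  chunks, and the term \<open>E*2^L\<close> of \<open>row_bound\<close> is small against
  \<open>E^2\<close>. Different chunks of one row have no common entry, so they are twisted
  trivially.\<close>

theorem few_edges_of_twisted_orders:
 fixes N :: "'v => 'v set" and key :: "'v => 'v => int"
 assumes V: "finite V" "V ~= {}" and N: "!!v. v \<in> V ==> N v \<subseteq> V" and inj: "!!v. v \<in> V ==> inj_on (key v) (N v)"
  and tw: "!!u v. u \<in> V ==> v \<in> V ==> u ~= v ==> \<exists>\<eta> :: 'v => bool. \<forall>x\<in>N u\<inter>N v. \<forall>y\<in>N u\<inter>N v. x ~= y -->
   ((key u x < key u y) = (key v x < key v y)) = (\<eta> x ~= \<eta> y)"
 shows "(\<Sum>v\<in>V. real (card (N v))) \<le> 400*(real (card V) * sqrt (real (card V)))*(1 + ln (real (card V)))"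
proof -
 define n where "n = real (card V)"
 define E where "E = (\<Sum>v\<in>V. real (card (N v)))"
 have n1: "n \<ge> 1" using V by (simp add: n_def Suc_le_eq card_gt_0_iff)
 have finN: "finite (N v)" if "v \<in> V" for v using finite_subset[OF N[OF that] V(1)] .
 have E0: "E \<ge> 0" unfolding E_def by (intro sum_nonneg) simp
 define l where "l = 1 + ln n"
 have l1: "l \<ge> 1" using n1 by (simp add: l_def)
 have s1: "sqrt n \<ge> 1" using n1 by simp
 let ?F = "n * sqrt n"
 show ?thesis
 proof (cases "E < 20*n")
  case True
  have "20*n \<le> 400*?F*l" using s1 l1 mult_ge1_I by simp
  then show ?thesis using True unfolding E_def n_def l_def by linarith
 next
  case False
  then have x2: "E/(10*n) \<ge> 2" using n1 by (simp add: field_simps)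
  obtain L :: nat where L: "L \<ge> 1" "2^L \<le> E/(10*n)" "E/(10*n) < 2*2^L" using power_two_below[OF x2] .
  define rank where "rank v x = card {y\<in>N v. key v y < key v x}" for v x
  have rank_less: "rank v x < rank v y \<longleftrightarrow> key v x < key v y" if H: "v \<in> V" "x \<in> N v" "y \<in> N v" for v x y
  proof
   assume k: "key v x < key v y"
   let ?C = "{z\<in>N v. key v z < key v x}"
   let ?D = "{z\<in>N v. key v z < key v y}"
   have "?C \<subset> ?D"
   proof
    show "?C \<subseteq> ?D" using k by (simp add: subset_iff)
    show "?C ~= ?D" using k H by auto
   qed
   then show "rank v x < rank v y" unfolding rank_def using finN[OF H(1)] by (intro psubset_card_mono) simp_all
  next
   assume r: "rank v x < rank v y"
   show "key v x < key v y"
   proof (rule ccontr)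
    assume "\<not> key v x < key v y"
    then have "{z\<in>N v. key v z < key v y} \<subseteq> {z\<in>N v. key v z < key v x}" by (simp add: subset_iff)
    then have "rank v y \<le> rank v x" unfolding rank_def using finN[OF H(1)] by (intro card_mono) simp_all
    then show False using r by simp
   qed
  qed
  have rank_inj: "inj_on (rank v) (N v)" if v: "v \<in> V" for v
  proof (rule inj_onI)
   fix x y assume xy: "x \<in> N v" "y \<in> N v" "rank v x = rank v y"
   then have "key v x = key v y" using rank_less[OF v xy(1,2)] rank_less[OF v xy(2,1)] xy(3) by linarith
   then show "x = y" using inj[OF v] xy by (simp add: inj_on_def)
  qed
  have rank_lt: "rank v x < card (N v)" if H: "v \<in> V" "x \<in> N v" for v x
   unfolding rank_def by (rule psubset_card_mono[OF finN[OF H(1)]]) (use H in blast)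
  define B where "B v = (\<lambda>x. rank v x div 2^L) ` N v" for v
  define I where "I = (SIGMA v:V. B v)"
  define N' where "N' i = {x \<in> N (fst i). rank (fst i) x div 2^L = snd i}" for i
  define f :: "'v\<times>nat => 'v => nat" where "f i x = rank (fst i) x mod 2^L" for i x
  have finB: "finite (B v)" if "v \<in> V" for v unfolding B_def using finN[OF that] by simp
  have finI: "finite I" unfolding I_def using V(1) finB by (intro finite_SigmaI) auto
  have fN': "f i x < f i y \<longleftrightarrow> key (fst i) x < key (fst i) y" if H: "i \<in> I" "x \<in> N' i" "y \<in> N' i" for i x y
  proof -
   have v: "fst i \<in> V" "x \<in> N (fst i)" "y \<in> N (fst i)" using H by (auto simp: I_def N'_def)
   have "rank (fst i) x = snd i*2^L + f i x" "rank (fst i) y = snd i*2^L + f i y"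
    using H(2,3) div_mult_mod_eq[of "rank (fst i) x" "2^L"] div_mult_mod_eq[of "rank (fst i) y" "2^L"] by (simp_all add: N'_def f_def)
   then have "f i x < f i y \<longleftrightarrow> rank (fst i) x < rank (fst i) y" by simp
   then show ?thesis using rank_less[OF v] by simp
  qed
  let ?G = "\<lambda>v t. {x \<in> N v. rank v x div 2^L = t}"
  have EI: "E = (\<Sum>i\<in>I. real (card (N' i)))"
  proof -
   have "(\<Sum>i\<in>I. real (card (N' i))) = (\<Sum>v\<in>V. \<Sum>t\<in>B v. real (card (?G v t)))"
    unfolding I_def by (subst sum.Sigma) (use V(1) finB in \<open>auto simp: N'_def case_prod_unfold\<close>)
   also have "... = (\<Sum>v\<in>V. real (card (N v)))"
   proof (rule sum.cong[OF refl])
    fix v assume v: "v \<in> V"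
    have "(\<Sum>t\<in>B v. \<Sum>x\<in>(?G v t). (1::real)) = (\<Sum>x\<in>N v. 1)" unfolding B_def by (rule sum.group) (use finN[OF v] in auto)
    then show "(\<Sum>t\<in>B v. real (card (?G v t))) = real (card (N v))" by simp
   qed
   finally show ?thesis by (simp add: E_def)
  qed
  let ?B = "\<Sum>v\<in>V. real (card (B v))"
  have cI: "real (card I) \<le> 21*n"
  proof -
   have "real (card (B v)) \<le> real (card (N v))/2^L + 1" if v: "v \<in> V" for v
   proof -
    have "B v \<subseteq> {..card (N v) div 2^L}"
     unfolding B_def by (intro image_subsetI) (simp only: atMost_iff div_le_mono less_imp_le rank_lt[OF v])
    then have "card (B v) \<le> card {..card (N v) div 2^L}" by (intro card_mono) simp_all
    then have "real (card (B v)) \<le> real (card (N v) div 2^L + 1)" by simp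
    also have "... = real (card (N v) div 2^L) + 1" by simp
    also have "real (card (N v) div 2^L) \<le> real (card (N v))/real (2^L)" by (rule of_nat_div_le_of_nat)
    finally show ?thesis by simp
   qed
   then have "?B \<le> (\<Sum>v\<in>V. real (card (N v))/2^L + 1)" by (rule sum_mono)
   also have "... = E/2^L + n" by (simp add: sum.distrib E_def n_def sum_divide_distrib)
   also have "E/2^L \<le> 20*n"
   proof -
    show ?thesis using L(3) n1 by (simp add: field_sq)
   qed
   finally have "?B \<le> 21*n" by simp
   moreover have "real (card I) = ?B" unfolding I_def using V(1) finB by (subst card_SigmaI) auto
   ultimately show ?thesis by simp
  qed
  let ?A = "4/3 + 16*real L*(real L + 1)"
  let ?E = "real (card I)"
  have RB: "E\<^sup>2 \<le> real (card V)*(E + 13/3*(E*2^L) + ?A*?E\<^sup>2)"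
  proof (rule row_bound[OF finI V(1) _ _ _ L(1) _ EI, where f = f])
   show "N' i \<subseteq> V" if "i \<in> I" for i
   proof -
    have "fst i \<in> V" using that by (auto simp: I_def)
    from N[OF this] show ?thesis unfolding N'_def by blast
   qed
   show "inj_on (f i) (N' i)" if i: "i \<in> I" for i
   proof (rule inj_onI)
    fix x y assume xy: "x \<in> N' i" "y \<in> N' i" "f i x = f i y"
    have v: "fst i \<in> V" using i by (auto simp: I_def)
    have "key (fst i) x = key (fst i) y" using fN'[OF i xy(1,2)] fN'[OF i xy(2,1)] xy(3) by simp
    then show "x = y" using inj[OF v] xy by (simp add: inj_on_def N'_def)
   qed
   show "f i x < 2^L" for i x by (simp add: f_def)
   show "twisted (N' i\<inter>N' j) (f i) (f j)" if ij: "i \<in> I" "j \<in> I" "i ~= j" for i j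
   proof (cases "fst i = fst j")
    case True
    then have "snd i ~= snd j" using ij(3) by (simp add: prod_eq_iff)
    then have "N' i\<inter>N' j = {}" using True by (auto simp: N'_def)
    then show ?thesis by (simp add: twisted_def)
   next
    case False
    have v: "fst i \<in> V" "fst j \<in> V" using ij by (auto simp: I_def)
    obtain \<eta> :: "'v => bool" where \<eta>: "\<forall>x\<in>N (fst i)\<inter>N (fst j). \<forall>y\<in>N (fst i)\<inter>N (fst j). x ~= y -->
     ((key (fst i) x < key (fst i) y) = (key (fst j) x < key (fst j) y)) = (\<eta> x ~= \<eta> y)" using tw[OF v False] ..
    show ?thesis unfolding twisted_def
    proof (intro exI[of _ \<eta>] ballI impI)
     fix x y assume xy: "x \<in> N' i\<inter>N' j" "y \<in> N' i\<inter>N' j" "x ~= y"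
     have "x \<in> N (fst i)\<inter>N (fst j)" "y \<in> N (fst i)\<inter>N (fst j)" using xy by (auto simp: N'_def)
     then show "((f i x < f i y) = (f j x < f j y)) = (\<eta> x ~= \<eta> y)" using \<eta> xy fN'[OF ij(1)] fN'[OF ij(2)] by simp
    qed
   qed
  qed
  have EV: "E \<le> n*n"
  proof -
   have "E \<le> (\<Sum>v\<in>V. n)" unfolding E_def n_def by (rule sum_mono) (simp add: card_mono[OF V(1) N])
   then show ?thesis by (simp add: n_def)
  qed
  have Ll: "real L \<le> 2*l"
  proof -
   have "2^L \<le> n"
   proof -
    have "E/(10*n) \<le> n*n/(10*n)" using EV n1 by (intro divide_right_mono) auto
    also have "... \<le> n" using n1 by (simp add: field_simps)
    finally show ?thesis using L(2) by simp
   qed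
   then have "ln ((2::real)^L) \<le> ln n" using n1 by (subst ln_le_cancel_iff) auto
   then have "real L*ln 2 \<le> ln n" by (simp add: ln_realpow)
   moreover have "real L*(1/2) \<le> real L*ln 2" using ln2_ge_two_thirds by (intro mult_left_mono) auto
   ultimately show ?thesis by (simp add: l_def)
  qed
  have e0: "E\<^sup>2 \<le> n*E + 13/3*(n*E*2^L) + n*(?A*?E\<^sup>2)" using RB unfolding n_def[symmetric] by (simp add: algebra_simps)
  have e1: "n*E \<le> E\<^sup>2/20" using mult_right_mono[of "20*n" E E] False E0 by (simp add: power2_eq_square)
  have e2: "n*E*2^L \<le> E\<^sup>2/10"
  proof -
   have "n*E*2^L \<le> n*E*(E/(10*n))" using L(2) n1 E0 by (intro mult_left_mono) auto
   also have "... = E\<^sup>2/10" using n1 by (simp add: field_sq)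
   finally show ?thesis .
  qed
  have e3: "n*(?A*?E\<^sup>2) \<le> n*((132*l\<^sup>2)*(441*n\<^sup>2))"
  proof (intro mult_left_mono mult_mono)
   have "?E\<^sup>2 \<le> (21*n)\<^sup>2" using cI by (intro power_mono) auto
   then show "?E\<^sup>2 \<le> 441*n\<^sup>2" by (simp add: power_mult_distrib)
   have LL: "real L*(real L + 1) \<le> 2*(real L)\<^sup>2"
   proof -
    show ?thesis using L(1) by (simp add: ring_sq)
   qed
   have l2: "(real L)\<^sup>2 \<le> 4*l\<^sup>2" using power_mono[OF Ll, of 2] by (simp add: power_mult_distrib)
   have l3: "1 \<le> l\<^sup>2" using l1 by simp
   show "4/3 + 16*real L*(real L + 1) \<le> 132*l\<^sup>2" using LL l2 l3 by (simp add: mult.assoc)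
  qed (use n1 in auto)
  define Z where "Z = n*(n\<^sup>2*l\<^sup>2)"
  have Z0: "Z \<ge> 0" using n1 by (simp add: Z_def)
  have e3': "n*((132*l\<^sup>2)*(441*n\<^sup>2)) = 58212*Z" by (simp add: Z_def)
  \<comment> \<open>The first two terms use up less than half of \<open>E^2\<close>, namely 1/20 +
    13/30, and twice 58212 is below 160000, the square of 400.\<close>
  have "E\<^sup>2 \<le> 160000*Z" using e0 e1 e2 e3 e3' Z0 by simp
  then have "E\<^sup>2 \<le> 160000*(n*(n\<^sup>2*l\<^sup>2))" unfolding Z_def .
  also have "... = (400*?F*l)\<^sup>2" using n1 by (simp add: power_mult_distrib power2_eq_square)
  finally have sq: "E\<^sup>2 \<le> (400*?F*l)\<^sup>2" .
  have "0 \<le> 400*?F*l" using n1 l1 by simp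
  from power2_le_imp_le[OF sq this] have "E \<le> 400*?F*l" .
  then show ?thesis unfolding E_def n_def l_def .
 qed
qed

section \<open>Counting lenses\<close>

text \<open>A pair \<open>(b, c)\<close> stands for the circle \<open>|z|^2 + b.z + c = 0\<close>.\<close>

definition pz :: "complex\<times>real => complex => real" where
 "pz w z = z\<bullet>z + fst w\<bullet>z + snd w"

definition ccw :: "complex => complex => complex => real" where
 "ccw z1 z2 z3 = (Re z2 - Re z1)*(Im z3 - Im z1) - (Re z3 - Re z1)*(Im z2 - Im z1)"

text \<open>Two elements with the same value are removed and matched until \<open>f\<close> is
  injective on the rest; \<open>h\<close> exchanges partners.\<close>

lemma partial_matching:
 assumes "finite A"
 shows "\<exists>M h. M \<subseteq> A \<and> (\<forall>x\<in>M. h x \<in> M \<and> h (h x) = x \<and> h x ~= x \<and> f (h x) = f x) \<and> card A \<le> card (f ` A) + card M"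
 using assms
proof (induction "card A" arbitrary: A rule: less_induct)
 case less
 show ?case
 proof (cases "inj_on f A")
  case True
  then show ?thesis by (intro exI[of _ "{}"]) (simp add: card_image)
 next
  case False
  then obtain x y where xy: "x \<in> A" "y \<in> A" "x ~= y" "f x = f y" unfolding inj_on_def by blast
  define B where "B = A - {x, y}"
  have finB: "finite B" using less.prems by (simp add: B_def)
  have A: "A = insert x (insert y B)" using xy by (auto simp: B_def)
  have xyB: "x \<notin> B" "y \<notin> B" by (simp_all add: B_def)
  have cA: "card A = card B + 2" unfolding A using finB xyB xy(3) by simp
  have lt: "card B < card A" using cA by simp
  from less.hyps[OF lt finB] obtain M h where M: "M \<subseteq> B \<and> (\<forall>x\<in>M. h x \<in> M \<and> h (h x) = x \<and> h x ~= x \<and> f (h x) = f x) \<and> card B \<le> card (f ` B) + card M"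
   by (elim exE) (rule that)
  define M' where "M' = insert x (insert y M)"
  define h' where "h' z = (if z = x then y else if z = y then x else h z)" for z
  have xyM: "x \<notin> M" "y \<notin> M" using M xyB by blast+
  have finM: "finite M" using finite_subset[OF conjunct1[OF M] finB] .
  show ?thesis
  proof (intro exI[of _ M'] exI[of _ h'] conjI ballI)
   show "M' \<subseteq> A" using M by (auto simp: A M'_def)
   have "card (f ` B) \<le> card (f ` A)" by (rule card_mono) (use less.prems in \<open>auto simp: B_def\<close>)
   moreover have "card M' = card M + 2" using xyM xy(3) finM by (simp add: M'_def)
   ultimately show "card A \<le> card (f ` A) + card M'" using M cA by linarith
   fix z assume "z \<in> M'"
   then consider "z = x" | "z = y" | "z \<in> M" by (auto simp: M'_def)
   then have "h' z \<in> M' \<and> h' (h' z) = z \<and> h' z ~= z \<and> f (h' z) = f z"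
   proof cases
    case 3
    then show ?thesis using M xyM by (auto simp: h'_def M'_def)
   qed (use xy in \<open>simp_all add: h'_def M'_def\<close>)
   then show "h' z \<in> M'" "h' (h' z) = z" "h' z ~= z" "f (h' z) = f z" by simp_all
  qed
 qed
qed

text \<open>The colour of \<open>y\<close> records whether the two orders disagree on
  \<open>y\<close> and a fixed \<open>x0\<close>. For a triple containing \<open>x0\<close> the
  product of the three pair signs is negative, so the sign of the third pair follows from the
  colours.\<close>

lemma two_colouring_of_reversed_triples:
 fixes k1 k2 :: "'x => int"
 assumes inj: "inj_on k1 S" "inj_on k2 S"
  and tr: "!!x y z. [|x \<in> S; y \<in> S; z \<in> S; x ~= y; y ~= z; x ~= z|] ==>
   ((k1 y - k1 x)*(k1 z - k1 y)*(k1 z - k1 x))*((k2 y - k2 x)*(k2 z - k2 y)*(k2 z - k2 x)) < 0"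
 shows "\<exists>\<eta> :: 'x => bool. \<forall>x\<in>S. \<forall>y\<in>S. x ~= y --> ((k1 x < k1 y) = (k2 x < k2 y)) = (\<eta> x ~= \<eta> y)"
proof (cases "S = {}")
 case False
 then obtain x0 where x0: "x0 \<in> S" by blast
 define e where "e x y = (k1 y - k1 x)*(k2 y - k2 x)" for x y
 have same: "((k1 x < k1 y) = (k2 x < k2 y)) \<longleftrightarrow> e x y > 0" and nz: "e x y ~= 0" if xy: "x \<in> S" "y \<in> S" "x ~= y" for x y
 proof -
  have "k1 x ~= k1 y" "k2 x ~= k2 y" using inj xy by (auto simp: inj_on_def)
  then show "((k1 x < k1 y) = (k2 x < k2 y)) \<longleftrightarrow> e x y > 0" "e x y ~= 0" by (auto simp: e_def zero_less_mult_iff)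
 qed
 have sym: "e x y = e y x" for x y by (simp add: e_def algebra_simps)
 define \<eta> where "\<eta> y \<longleftrightarrow> y = x0 \<or> e x0 y < 0" for y
 have "((k1 x < k1 y) = (k2 x < k2 y)) = (\<eta> x ~= \<eta> y)" if xy: "x \<in> S" "y \<in> S" "x ~= y" for x y
 proof -
  consider "x = x0" | "y = x0" | "x ~= x0" "y ~= x0" by blast
  then show ?thesis
  proof cases
   case 1
   then show ?thesis using same[OF xy] nz[OF xy] xy(3) by (auto simp: \<eta>_def)
  next
   case 2
   then show ?thesis using same[OF xy] nz[OF xy] xy(3) sym[of x y] by (auto simp: \<eta>_def)
  next
   case 3
   have "e x0 x*e x y*e x0 y < 0" using tr[OF x0 xy(1,2)] 3 xy(3) by (simp add: e_def mult_ac)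
   moreover have "e x0 x ~= 0" "e x0 y ~= 0" "e x y ~= 0" using nz x0 xy 3 by blast+
   ultimately have "e x y > 0 \<longleftrightarrow> (e x0 x < 0) ~= (e x0 y < 0)" by (auto simp: mult_less_0_iff zero_less_mult_iff)
   then show ?thesis using same[OF xy] 3 by (simp add: \<eta>_def)
  qed
 qed
 then show ?thesis by blast
qed simp

text \<open>The quadratic parts cancel; what remains is the equation of the radical axis, the line
  through \<open>p\<close> and \<open>q\<close>.\<close>

lemma pz_diff_eq_ccw:
 assumes "pz w p = pz w' p" "pz w q = pz w' q" "p ~= q"
 shows "\<exists>l. \<forall>z. pz w z - pz w' z = l * ccw p q z"
proof -
 define b c where "b = fst w - fst w'" and "c = snd w - snd w'"
 have d: "pz w z - pz w' z = Re b * Re z + Im b*Im z + c" for z by (simp add: pz_def b_def c_def inner_diff_left inner_complex_def algebra_simps)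
 have p: "Re b * Re p + Im b*Im p + c = 0" and q: "Re b * Re q + Im b*Im q + c = 0" using d[of p] d[of q] assms(1,2) by simp_all
 define x y where "x = Re q - Re p" and "y = Im q - Im p"
 have xy: "x ~= 0 \<or> y ~= 0" using assms(3) by (auto simp: x_def y_def complex_eq_iff)
 have bo: "Re b*x + Im b*y = 0" using p q by (simp add: x_def y_def algebra_simps)
 define N where "N = x\<^sup>2 + y\<^sup>2"
 have N: "N ~= 0" using xy by (simp add: N_def sum_power2_eq_zero_iff)
 let ?A = "Im b*x - Re b*y"
 define l where "l = ?A/N"
 have lb: "Re b = - l*y" "Im b = l*x"
 proof -
  have "N * Re b = x*(Re b*x + Im b*y) - ?A*y" by (simp add: N_def ring_sq)
  then show "Re b = - l*y" using N unfolding bo l_def by (simp add: field_simps)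
  have "N*Im b = y*(Re b*x + Im b*y) + ?A*x" by (simp add: N_def ring_sq)
  then show "Im b = l*x" using N unfolding bo l_def by (simp add: field_simps)
 qed
 have "pz w z - pz w' z = l * ccw p q z" for z
 proof -
  have "pz w z - pz w' z = Re b*(Re z - Re p) + Im b*(Im z - Im p)" using p unfolding d by (simp add: algebra_simps)
  also have "... = l * ccw p q z" unfolding lb ccw_def x_def y_def by (simp add: algebra_simps)
  finally show ?thesis .
 qed
 then show ?thesis by blast
qed

lemma pz_determines:
 assumes "!!z. pz w z = pz w' z"
 shows "w = w'"
proof -
 have "snd w = snd w'" using assms[of 0] by (simp add: pz_def)
 moreover have "fst w = fst w'"
 proof (rule complex_eqI)
  show "Re (fst w) = Re (fst w')" using assms[of 1] \<open>snd w = snd w'\<close> by (simp add: pz_def inner_complex_def)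
  show "Im (fst w) = Im (fst w')" using assms[of \<i>] \<open>snd w = snd w'\<close> by (simp add: pz_def inner_complex_def)
 qed
 ultimately show ?thesis by (simp add: prod_eq_iff)
qed

lemma ccw_cyc: "ccw a b c = ccw b c a" and ccw_swap: "ccw a b c = - ccw b a c"
 by (simp_all add: ccw_def algebra_simps)

lemma ccw_degenerate: "ccw a a b = 0" "ccw a b b = 0" "ccw a b a = 0"
 by (simp_all add: ccw_def)

text \<open>The points \<open>a w 0\<close>, ..., \<open>a w (k w - 1)\<close> run counterclockwise
  around the circle \<open>w\<close>, which \<open>conv\<close> expresses by the orientation of all
  increasing triples. Below, \<open>(w, i)\<close> with \<open>Suc i < k w\<close> stands for the
  arc from the \<open>i\<close>-th point to the next.\<close>

locale circular_lists =
 fixes W :: "(complex\<times>real) set" and k :: "complex\<times>real => nat" and a :: "complex\<times>real => nat => complex"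
 assumes finW: "finite W" and k3: "!!w. w \<in> W ==> k w \<ge> 3"
  and on: "!!w i. [|w \<in> W; i < k w|] ==> pz w (a w i) = 0"
  and conv: "!!w i j l. [|w \<in> W; i < j; j < l; l < k w|] ==> ccw (a w i) (a w j) (a w l) > 0"
begin

text \<open>Unordered, since the two circles of a lens may pass its end points in either
  order.\<close>

definition pair :: "(complex\<times>real)\<times>nat => complex set" where
 "pair x = {a (fst x) (snd x), a (fst x) (Suc (snd x))}"

lemma ccw_nonzero:
 assumes w: "w \<in> W" and i: "i < k w" "j < k w" "l < k w" "i ~= j" "j ~= l" "i ~= l"
 shows "ccw (a w i) (a w j) (a w l) ~= 0"
proof -
 have p: "ccw (a w i) (a w j) (a w l) > 0" if "i < j" "j < l" "l < k w" for i j l using conv[OF w that] .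
 consider "i < j \<and> j < l" | "j < l \<and> l < i" | "l < i \<and> i < j" | "j < i \<and> i < l" | "i < l \<and> l < j" | "l < j \<and> j < i" using i(4-6) by linarith
 then show ?thesis
 proof cases
  case 1 then show ?thesis using p[of i j l] i by simp
 next
  case 2 then show ?thesis using p[of j l i] i ccw_cyc[of "a w i" "a w j" "a w l"] by simp
 next
  case 3 then show ?thesis using p[of l i j] i ccw_cyc[of "a w l" "a w i" "a w j"] by simp
 next
  case 4 then show ?thesis using p[of j i l] i ccw_swap[of "a w i" "a w j" "a w l"] by simp
 next
  case 5 then show ?thesis using p[of i l j] i ccw_cyc[of "a w i" "a w j" "a w l"] ccw_swap[of "a w j" "a w l" "a w i"]
   ccw_cyc[of "a w l" "a w j" "a w i"] ccw_cyc[of "a w i" "a w l" "a w j"] by simp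
 next
  case 6 then show ?thesis using p[of l j i] i ccw_swap[of "a w i" "a w j" "a w l"] ccw_cyc[of "a w l" "a w j" "a w i"] by simp
 qed
qed

lemma a_inj:
 assumes w: "w \<in> W" and i: "i < k w" "j < k w" "i ~= j"
 shows "a w i ~= a w j"
proof
 assume e: "a w i = a w j"
 have "card {i, j} < card {..<k w}" using i k3[OF w] by simp
 then obtain l where l: "l \<in> {..<k w}" "l \<notin> {i, j}" by (metis card_mono finite.emptyI finite.insertI leD subsetI)
 then have "ccw (a w i) (a w j) (a w l) ~= 0" using ccw_nonzero[OF w, of i j l] i by auto
 then show False by (simp add: e ccw_degenerate)
qed

lemma pair_inj:
 assumes "w \<in> W" "Suc i < k w" "Suc j < k w" "pair (w, i) = pair (w, j)"
 shows "i = j"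
proof (rule ccontr)
 assume ne: "i ~= j"
 have i: "i < k w" "j < k w" using assms by auto
 have "a w i \<in> pair (w, j)" "a w (Suc i) \<in> pair (w, j)" using assms(4) by (auto simp: pair_def)
 moreover have "a w i ~= a w j" using a_inj[OF assms(1) i ne] .
 moreover have "a w (Suc i) ~= a w (Suc j)" using a_inj[OF assms(1-3)] ne by simp
 ultimately have "a w i = a w (Suc j)" "a w (Suc i) = a w j" by (simp_all add: pair_def)
 then have "i = Suc j" "Suc i = j" using a_inj[OF assms(1), of i "Suc j"] a_inj[OF assms(1), of "Suc i" j] assms i by blast+
 then show False by simp
qed

lemma chord_ccw:
 assumes w: "w \<in> W" and i: "Suc i < k w" and j: "j < k w"
 shows "ccw (a w i) (a w (Suc i)) (a w j) \<ge> 0" (is ?P) "j ~= i ==> j ~= Suc i ==> ccw (a w i) (a w (Suc i)) (a w j) > 0"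
proof -
 show s: "ccw (a w i) (a w (Suc i)) (a w j) > 0" if "j ~= i" "j ~= Suc i"
 proof (cases "j < i")
  case True
  then show ?thesis using conv[OF w True, of "Suc i"] i ccw_cyc[of "a w j" "a w i" "a w (Suc i)"] by simp
 next
  case False
  then have "Suc i < j" using that by simp
  then show ?thesis using conv[OF w, of i "Suc i" j] j by simp
 qed
 show ?P by (cases "j = i \<or> j = Suc i") (use s in \<open>auto simp: ccw_degenerate\<close>)
qed

text \<open>The equation of \<open>w\<close> restricted to the points of \<open>w'\<close> is a
  multiple of the radical axis, that is, of the common chord. As the list of \<open>w'\<close> lies
  on one side of its own chord, the sign of \<open>l\<close> decides on which side of
  \<open>w\<close> it lies.\<close>

lemma common_chord:
 assumes w: "w \<in> W" "w' \<in> W" "w ~= w'" and i: "Suc i < k w" "Suc j < k w'" and e: "pair (w, i) = pair (w', j)"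
 shows "\<exists>l. l ~= 0 \<and> (\<forall>m<k w'. pz w (a w' m) = l * ccw (a w' j) (a w' (Suc j)) (a w' m))"
proof -
 have j: "j < k w'" using i by simp
 have "a w' j \<in> pair (w, i)" "a w' (Suc j) \<in> pair (w, i)" unfolding e by (simp_all add: pair_def)
 then have z: "pz w (a w' j) = 0" "pz w (a w' (Suc j)) = 0" using on[OF w(1), of i] on[OF w(1), of "Suc i"] i by (auto simp: pair_def)
 have "a w' j ~= a w' (Suc j)" using a_inj[OF w(2) j i(2)] by simp
 then obtain l where l: "\<forall>z. pz w z - pz w' z = l * ccw (a w' j) (a w' (Suc j)) z"
  using pz_diff_eq_ccw[of w "a w' j" w' "a w' (Suc j)"] z on[OF w(2) j] on[OF w(2) i(2)] by auto
 have "l ~= 0"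
 proof
  assume "l = 0"
  then have "pz w z = pz w' z" for z using l by simp
  then show False using pz_determines w(3) by blast
 qed
 moreover have "pz w (a w' m) = l * ccw (a w' j) (a w' (Suc j)) (a w' m)" if "m < k w'" for m
  using l[rule_format, of "a w' m"] on[OF w(2) that] by simp
 ultimately show ?thesis by blast
qed

text \<open>Away from the ends of one common chord no listed point of \<open>w'\<close> lies on
  \<open>w\<close>, so a second common chord has the same ends.\<close>

lemma one_common_chord:
 assumes w: "w \<in> W" "w' \<in> W" "w ~= w'" and i: "Suc i < k w" "Suc i' < k w'" "pair (w, i) = pair (w', i')"
  and j: "Suc j < k w" "Suc j' < k w'" "pair (w, j) = pair (w', j')"
 shows "i = j"
proof -
 obtain l where l: "l ~= 0 \<and> (\<forall>m<k w'. pz w (a w' m) = l * ccw (a w' i') (a w' (Suc i')) (a w' m))"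
  using common_chord[OF w i] ..
 have z: "m = i' \<or> m = Suc i'" if m: "m < k w'" "pz w (a w' m) = 0" for m
 proof (rule ccontr)
  assume "\<not> ?thesis"
  then have "ccw (a w' i') (a w' (Suc i')) (a w' m) > 0" using chord_ccw(2)[OF w(2) i(2) m(1)] by blast
  then show False using l m by auto
 qed
 have "a w' j' \<in> pair (w, j)" "a w' (Suc j') \<in> pair (w, j)" unfolding j(3) by (simp_all add: pair_def)
 then have "pz w (a w' j') = 0" "pz w (a w' (Suc j')) = 0" using on[OF w(1), of j] on[OF w(1), of "Suc j"] j by (auto simp: pair_def)
 then have "j' = i'" using z[of j'] z[of "Suc j'"] j(2) by auto
 then have "pair (w, i) = pair (w, j)" using i(3) j(3) by simp
 then show ?thesis by (rule pair_inj[OF w(1) i(1) j(1)])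
qed

text \<open>Arcs are represented by midpoints of their lifted chords: a circle equation takes there
  the mean of its values at the two ends, and different midpoints on a circle are in convex position
  even if the arcs share an end.\<close>

definition mid :: "(complex\<times>real)\<times>nat => complex" where
 "mid x = (a (fst x) (snd x) + a (fst x) (Suc (snd x))) /\<^sub>R 2"

definition mid_sq :: "(complex\<times>real)\<times>nat => real" where
 "mid_sq x = (a (fst x) (snd x)\<bullet>a (fst x) (snd x) + a (fst x) (Suc (snd x))\<bullet>a (fst x) (Suc (snd x)))/2"

definition mid3 :: "(complex\<times>real)\<times>nat => real\<times>real\<times>real" where
 "mid3 x = (mid_sq x, Re (mid x), Im (mid x))"

text \<open>The integer is 1 or -1 and chooses a side of the circle.\<close>

definition signed :: "(complex\<times>real)\<times>int => real\<times>real\<times>real\<times>real" where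
 "signed v = (real_of_int (snd v), real_of_int (snd v) * Re (fst (fst v)), real_of_int (snd v)*Im (fst (fst v)), real_of_int (snd v) * snd (fst v))"

lemma qev_signed_mid3:
 "qev (signed v) (mid3 x) = real_of_int (snd v)*(pz (fst v) (a (fst x) (snd x)) + pz (fst v) (a (fst x) (Suc (snd x))))/2"
proof -
 have gen: "s*((A + B)/2) + s*r*((x + x')/2) + s*i*((y + y')/2) + s * c = s*((A + (r*x + i*y) + c) + (B + (r*x' + i*y') + c))/2"
  for s A B r x x' i y y' c :: real by (simp add: field_simps)
 show ?thesis using gen by (simp add: mid_def qev_def signed_def mid3_def mid_sq_def pz_def inner_complex_def)
qed

lemma mid3_eq: "pair x = pair y ==> mid3 x = mid3 y"
 by (auto simp: pair_def doubleton_eq_iff mid3_def mid_def mid_sq_def add.commute)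

text \<open>The orientation is affine in each argument, so eight times its value at midpoints is the
  sum over the eight choices of end points; no summand is negative and the first is
  positive.\<close>

lemma ccw_mid_increasing:
 assumes w: "w \<in> W" and i: "i < j" "j < l" "Suc l < k w"
 shows "ccw (mid (w, i)) (mid (w, j)) (mid (w, l)) > 0"
proof -
 have nn: "ccw (a w i) (a w j) (a w l) \<ge> 0" if "i \<le> j" "j \<le> l" "l < k w" for i j l
  using that conv[OF w, of i j l] by (cases "i = j"; cases "j = l") (auto simp: ccw_degenerate)
 have avg: "8 * ccw ((p + p') /\<^sub>R 2) ((q + q') /\<^sub>R 2) ((r + r') /\<^sub>R 2) =
   (ccw p q r + ccw p q r') + (ccw p q' r + ccw p q' r') + ((ccw p' q r + ccw p' q r') + (ccw p' q' r + ccw p' q' r'))" for p q r p' q' r'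
  by (simp add: ccw_def field_simps)
 have "ccw (a w i) (a w j) (a w l) > 0" using conv[OF w i(1,2)] i(3) by simp
 moreover have "ccw (a w i) (a w j) (a w (Suc l)) \<ge> 0" "ccw (a w i) (a w (Suc j)) (a w l) \<ge> 0" "ccw (a w i) (a w (Suc j)) (a w (Suc l)) \<ge> 0"
  "ccw (a w (Suc i)) (a w j) (a w l) \<ge> 0" "ccw (a w (Suc i)) (a w j) (a w (Suc l)) \<ge> 0"
  "ccw (a w (Suc i)) (a w (Suc j)) (a w l) \<ge> 0" "ccw (a w (Suc i)) (a w (Suc j)) (a w (Suc l)) \<ge> 0"
  using i by (auto intro!: nn)
 ultimately have "8 * ccw (mid (w, i)) (mid (w, j)) (mid (w, l)) > 0" unfolding mid_def fst_conv snd_conv avg by linarith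
 then show ?thesis by simp
qed

lemma ccw_mid_sign:
 assumes w: "w \<in> W" and i: "Suc i < k w" "Suc j < k w" "Suc l < k w" "i ~= j" "j ~= l" "i ~= l"
 shows "ccw (mid (w, i)) (mid (w, j)) (mid (w, l))*((real j - real i)*(real l - real j)*(real l - real i)) > 0"
proof -
 define g where "g i j l = ccw (mid (w, i)) (mid (w, j)) (mid (w, l))*((real j - real i)*(real l - real j)*(real l - real i))" for i j l
 have inc: "g i j l > 0" if "i < j" "j < l" "Suc l < k w" for i j l
  unfolding g_def using ccw_mid_increasing[OF w that] that by (intro mult_pos_pos) auto
 have cyc: "g i j l = g j l i" for i j l unfolding g_def ccw_cyc[of "mid (w, i)" "mid (w, j)" "mid (w, l)"] by (simp add: algebra_simps)
 have swap: "g i j l = g j i l" for i j l unfolding g_def ccw_swap[of "mid (w, i)" "mid (w, j)" "mid (w, l)"] by (simp add: algebra_simps)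
 consider "i < j \<and> j < l" | "j < l \<and> l < i" | "l < i \<and> i < j" | "j < i \<and> i < l" | "i < l \<and> l < j" | "l < j \<and> j < i" using i(4-6) by linarith
 then have "g i j l > 0"
 proof cases
  case 1 then show ?thesis using inc[of i j l] i by simp
 next
  case 2 then show ?thesis using inc[of j l i] i cyc[of i j l] by simp
 next
  case 3 then show ?thesis using inc[of l i j] i cyc[of l i j] by simp
 next
  case 4 then show ?thesis using inc[of j i l] i swap[of i j l] by simp
 next
  case 5
  have "g i j l = g i l j" unfolding cyc[of l i j, symmetric] by (rule swap)
  then show ?thesis using 5 inc[of i l j] i by simp
 next
  case 6 then show ?thesis using inc[of l j i] i swap[of i j l] cyc[of l j i] by simp
 qed
 then show ?thesis unfolding g_def .
qed

text \<open>Arcs with the same ends are matched; at most one arc per pair of ends stays alone. The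
  matched arcs are the edges of a graph whose vertices are circles with a sign, and each vertex
  orders its neighbours along its circle. \<open>lens_reversal\<close> makes these orders reverse
  every triple of common neighbours, so they are twisted and the edge bound applies to
  \<open>2 * card W\<close> vertices.\<close>

theorem lens_count:
 assumes A: "A \<subseteq> {x. fst x \<in> W \<and> Suc (snd x) < k (fst x)}"
 shows "real (card A) \<le> real (card (pair ` A)) + 400*(real (2 * card W) * sqrt (real (2 * card W)))*(1 + ln (real (2 * card W)))"
proof (cases "W = {}")
 case True
 then show ?thesis using A by simp
next
 case False
 have finA: "finite A"
 proof (rule finite_subset)
  show "A \<subseteq> (SIGMA w:W. {..<k w})" using A by auto
 qed (use finW in simp)
 from partial_matching[OF finA, of pair] obtain M h where M: "M \<subseteq> A \<and> (\<forall>x\<in>M. h x \<in> M \<and> h (h x) = x \<and> h x ~= x \<and> pair (h x) = pair x) \<and> card A \<le> card (pair ` A) + card M"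
  by (elim exE) (rule that)
 have MA: "fst x \<in> W" "Suc (snd x) < k (fst x)" if "x \<in> M" for x using M A that by blast+
 have h: "h x \<in> M" "h (h x) = x" "h x ~= x" "pair (h x) = pair x" if "x \<in> M" for x using M that by blast+
 have finM: "finite M" using finite_subset[OF conjunct1[OF M] finA] .
 have hne: "fst x ~= fst (h x)" if x: "x \<in> M" for x
 proof
  assume e: "fst x = fst (h x)"
  have "snd x = snd (h x)" by (rule pair_inj[OF MA(1)[OF x] MA(2)[OF x]]) (use MA[OF h(1)[OF x]] h(4)[OF x] e in \<open>simp_all add: pair_def\<close>)
  then show False using e h(3)[OF x] by (simp add: prod_eq_iff)
 qed
 have "\<exists>l. l ~= 0 \<and> (\<forall>m<k (fst (h x)). pz (fst x) (a (fst (h x)) m) = l * ccw (a (fst (h x)) (snd (h x))) (a (fst (h x)) (Suc (snd (h x)))) (a (fst (h x)) m))"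
  if x: "x \<in> M" for x
  by (rule common_chord[OF MA(1)[OF x] MA(1)[OF h(1)[OF x]] hne[OF x] MA(2)[OF x] MA(2)[OF h(1)[OF x]]]) (use h(4)[OF x] in simp)
 then have "\<exists>l. \<forall>x\<in>M. l x ~= 0 \<and> (\<forall>m<k (fst (h x)). pz (fst x) (a (fst (h x)) m) = l x * ccw (a (fst (h x)) (snd (h x))) (a (fst (h x)) (Suc (snd (h x)))) (a (fst (h x)) m))"
  by (intro bchoice ballI)
 then obtain l where l: "\<forall>x\<in>M. l x ~= 0 \<and> (\<forall>m<k (fst (h x)). pz (fst x) (a (fst (h x)) m) = l x * ccw (a (fst (h x)) (snd (h x))) (a (fst (h x)) (Suc (snd (h x)))) (a (fst (h x)) m))" ..
 \<comment> \<open>The sign makes the equation of the circle of \<open>x\<close> negative at all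
   points of the partner's list other than the ends of the common chord.\<close>
 define sg where "sg x = (if l x < 0 then 1 else - 1 :: int)" for x
 have sgl: "real_of_int (sg x)*l x < 0" if "x \<in> M" for x using l that by (auto simp: sg_def)
 have le0: "real_of_int (sg x)*pz (fst x) (a (fst (h x)) m) \<le> 0" if x: "x \<in> M" and m: "m < k (fst (h x))" for x m
 proof -
  have "real_of_int (sg x)*pz (fst x) (a (fst (h x)) m) = (real_of_int (sg x)*l x) * ccw (a (fst (h x)) (snd (h x))) (a (fst (h x)) (Suc (snd (h x)))) (a (fst (h x)) m)"
   using l x m by (simp only: mult.assoc)
  then show ?thesis using chord_ccw(1)[OF MA(1)[OF h(1)[OF x]] MA(2)[OF h(1)[OF x]] m] less_imp_le[OF sgl[OF x]] by (simp only: mult_nonpos_nonneg)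
 qed
 have lt0: "real_of_int (sg x)*pz (fst x) (a (fst (h x)) m) < 0" if x: "x \<in> M" and m: "m < k (fst (h x))" "m ~= snd (h x)" "m ~= Suc (snd (h x))" for x m
 proof -
  have "real_of_int (sg x)*pz (fst x) (a (fst (h x)) m) = (real_of_int (sg x)*l x) * ccw (a (fst (h x)) (snd (h x))) (a (fst (h x)) (Suc (snd (h x)))) (a (fst (h x)) m)"
   using l x m(1) by (simp only: mult.assoc)
  then show ?thesis using chord_ccw(2)[OF MA(1)[OF h(1)[OF x]] MA(2)[OF h(1)[OF x]] m] sgl[OF x] by (simp only: mult_neg_pos)
 qed
 define cap where "cap x = (fst x, sg x)" for x
 have E0: "qev (signed (cap x)) (mid3 x) = 0" if x: "x \<in> M" for x
  unfolding qev_signed_mid3 using on[OF MA(1)[OF x]] MA(2)[OF x] by (simp add: cap_def)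
 have mh: "mid3 (h x) = mid3 x" if "x \<in> M" for x by (rule mid3_eq[OF h(4)[OF that]])
 have E0': "qev (signed (cap (h x))) (mid3 x) = 0" if x: "x \<in> M" for x using E0[OF h(1)[OF x]] unfolding mh[OF x] .
 have E1: "qev (signed (cap x)) (mid3 y) < 0" if x: "x \<in> M" and y: "y \<in> M" "fst y = fst (h x)" "snd y ~= snd (h x)" for x y
 proof -
  define F where "F m = real_of_int (sg x)*pz (fst x) (a (fst (h x)) m)" for m
  have m: "snd y < k (fst (h x))" "Suc (snd y) < k (fst (h x))" using MA(2)[OF y(1)] y(2) by simp_all
  have "F (snd y) \<le> 0" "F (Suc (snd y)) \<le> 0" unfolding F_def by (intro le0 x m)+
  moreover have "F (snd y) < 0 \<or> F (Suc (snd y)) < 0"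
  proof (cases "snd y = Suc (snd (h x))")
   case True
   then show ?thesis unfolding F_def using lt0[OF x m(2)] by simp
  next
   case False
   then show ?thesis unfolding F_def using lt0[OF x m(1) y(3)] by simp
  qed
  ultimately have "F (snd y) + F (Suc (snd y)) < 0" by linarith
  moreover have "qev (signed (cap x)) (mid3 y) = (F (snd y) + F (Suc (snd y)))/2"
   unfolding qev_signed_mid3 F_def by (simp add: cap_def y(2) algebra_simps)
  ultimately show ?thesis by simp
 qed
 have arc_eq: "x = y" if x: "x \<in> M" and y: "y \<in> M" and e: "fst x = fst y" "fst (h x) = fst (h y)" for x y
 proof -
  have "snd x = snd y" by (rule one_common_chord[OF MA(1)[OF x] MA(1)[OF h(1)[OF x]] hne[OF x], of "snd x" "snd (h x)" "snd y" "snd (h y)"])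
    (use MA(2)[OF x] MA(2)[OF h(1)[OF x]] h(4)[OF x] MA(2)[OF y] MA(2)[OF h(1)[OF y]] h(4)[OF y] e in \<open>simp_all add: pair_def\<close>)
  then show ?thesis using e(1) by (simp add: prod_eq_iff)
 qed
 define V where "V = W\<times>{1, - 1 :: int}"
 define Nb where "Nb v = (\<lambda>x. cap (h x)) ` {x\<in>M. cap x = v}" for v
 have finV: "finite V" "V ~= {}" and cV: "card V = 2 * card W" using finW False by (auto simp: V_def card_cartesian_product)
 have capV: "cap x \<in> V" if "x \<in> M" for x using MA(1)[OF that] by (simp add: cap_def V_def sg_def)
 define pick where "pick v u = (SOME x. x \<in> M \<and> cap x = v \<and> cap (h x) = u)" for v u
 have pick: "pick v u \<in> M \<and> cap (pick v u) = v \<and> cap (h (pick v u)) = u" if "u \<in> Nb v" for u v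
 proof -
  from that obtain x where "x \<in> M \<and> cap x = v \<and> cap (h x) = u" unfolding Nb_def by blast
  then show ?thesis unfolding pick_def by (rule someI)
 qed
 \<comment> \<open>The position along the circle, read backwards for the sign -1. With the sign
   built in, the conclusion of \<open>lens_reversal\<close> becomes a statement about orders
   alone.\<close>
 define key where "key v u = snd v * int (snd (pick v u))" for v u
 have sv: "snd v * snd v = 1" "snd v ~= 0" "real_of_int (snd v)*real_of_int (snd v) = 1" "\<bar>real_of_int (snd v)\<bar> = 1" if "v \<in> V" for v
  using that by (auto simp: V_def)
 have key_inj: "inj_on (key v) (Nb v)" if v: "v \<in> V" for v
 proof (rule inj_onI)
  fix u u' assume u: "u \<in> Nb v" "u' \<in> Nb v" "key v u = key v u'"
  have "snd (pick v u) = snd (pick v u')" using u(3) sv(2)[OF v] by (simp add: key_def)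
  moreover have "fst (pick v u) = fst (pick v u')" using pick[OF u(1)] pick[OF u(2)] unfolding cap_def by (metis fst_conv)
  ultimately have "pick v u = pick v u'" by (simp add: prod_eq_iff)
  then show "u = u'" using pick[OF u(1)] pick[OF u(2)] by metis
 qed
 have triple: "((key u t2 - key u t1)*(key u t3 - key u t2)*(key u t3 - key u t1))*((key v t2 - key v t1)*(key v t3 - key v t2)*(key v t3 - key v t1)) < 0"
  if uv: "u \<in> V" "v \<in> V" "u ~= v" and t: "t1 \<in> Nb u\<inter>Nb v" "t2 \<in> Nb u\<inter>Nb v" "t3 \<in> Nb u\<inter>Nb v" "t1 ~= t2" "t2 ~= t3" "t1 ~= t3" for u v t1 t2 t3
 proof -
  \<comment> \<open>The matched arcs on \<open>u\<close> and on \<open>v\<close> whose partners lie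
    on the common neighbour \<open>s\<close>. The vertices \<open>t1\<close>, \<open>t2\<close>,
    \<open>t3\<close> take the places of \<open>G1\<close>, \<open>G2\<close>,
    \<open>G3\<close>.\<close>
  define x where "x s = pick u s" for s
  define y where "y s = pick v s" for s
  define T where "T = {t1, t2, t3}"
  have x: "x s \<in> M" "cap (x s) = u" "cap (h (x s)) = s" and y: "y s \<in> M" "cap (y s) = v" "cap (h (y s)) = s" if "s \<in> T" for s
   using pick[of s u] pick[of s v] t that by (auto simp: x_def y_def T_def)
  have fx: "fst (x s) = fst u" "fst (h (x s)) = fst s" and fy: "fst (y s) = fst v" "fst (h (y s)) = fst s" if "s \<in> T" for s
   using arg_cong[OF x(2)[OF that], of fst] arg_cong[OF x(3)[OF that], of fst] arg_cong[OF y(2)[OF that], of fst] arg_cong[OF y(3)[OF that], of fst]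
   by (simp_all add: cap_def)
  have dx: "snd (x s) ~= snd (x s')" and dy: "snd (y s) ~= snd (y s')" if s: "s \<in> T" "s' \<in> T" "s ~= s'" for s s'
  proof -
   have "x s ~= x s'" using x(3)[OF s(1)] x(3)[OF s(2)] s(3) by metis
   then show "snd (x s) ~= snd (x s')" using fx(1)[OF s(1)] fx(1)[OF s(2)] by (simp add: prod_eq_iff)
   have "y s ~= y s'" using y(3)[OF s(1)] y(3)[OF s(2)] s(3) by metis
   then show "snd (y s) ~= snd (y s')" using fy(1)[OF s(1)] fy(1)[OF s(2)] by (simp add: prod_eq_iff)
  qed
  have ox: "qev (signed s) (mid3 (x s')) < 0" if s: "s \<in> T" "s' \<in> T" "s ~= s'" for s s'
  proof -
   have "qev (signed (cap (h (x s)))) (mid3 (x s')) < 0"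
    by (rule E1[OF h(1)[OF x(1)[OF s(1)]] x(1)[OF s(2)]]) (use h(2)[OF x(1)[OF s(1)]] fx(1)[OF s(1)] fx(1)[OF s(2)] dx[OF s] in simp_all)
   then show ?thesis unfolding x(3)[OF s(1)] .
  qed
  have oy: "qev (signed s) (mid3 (y s')) < 0" if s: "s \<in> T" "s' \<in> T" "s ~= s'" for s s'
  proof -
   have "qev (signed (cap (h (y s)))) (mid3 (y s')) < 0"
    by (rule E1[OF h(1)[OF y(1)[OF s(1)]] y(1)[OF s(2)]]) (use h(2)[OF y(1)[OF s(1)]] fy(1)[OF s(1)] fy(1)[OF s(2)] dy[OF s] in simp_all)
   then show ?thesis unfolding y(3)[OF s(1)] .
  qed
  have hxy: "snd (h (y s)) ~= snd (h (x s))" if s: "s \<in> T" for s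
  proof
   assume "snd (h (y s)) = snd (h (x s))"
   then have "h (y s) = h (x s)" using fx(2)[OF s] fy(2)[OF s] by (simp add: prod_eq_iff)
   then have "y s = x s" using h(2)[OF x(1)[OF s]] h(2)[OF y(1)[OF s]] by metis
   then show False using x(2)[OF s] y(2)[OF s] uv(3) by metis
  qed
  have uy: "qev (signed u) (mid3 (y s)) < 0" and vx: "qev (signed v) (mid3 (x s)) < 0" if s: "s \<in> T" for s
  proof -
   have "qev (signed (cap (x s))) (mid3 (h (y s))) < 0"
    by (rule E1[OF x(1)[OF s] h(1)[OF y(1)[OF s]]]) (use fx(2)[OF s] fy(2)[OF s] hxy[OF s] in simp_all)
   then show "qev (signed u) (mid3 (y s)) < 0" unfolding x(2)[OF s] mh[OF y(1)[OF s]] .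
   have "qev (signed (cap (y s))) (mid3 (h (x s))) < 0"
    by (rule E1[OF y(1)[OF s] h(1)[OF x(1)[OF s]]]) (use fx(2)[OF s] fy(2)[OF s] hxy[OF s] in simp_all)
   then show "qev (signed v) (mid3 (x s)) < 0" unfolding y(2)[OF s] mh[OF x(1)[OF s]] .
  qed
  have ux: "qev (signed u) (mid3 (x s)) = 0" and vy: "qev (signed v) (mid3 (y s)) = 0"
   and sx: "qev (signed s) (mid3 (x s)) = 0" and sy: "qev (signed s) (mid3 (y s)) = 0" if s: "s \<in> T" for s
   using E0[OF x(1)[OF s]] E0[OF y(1)[OF s]] E0'[OF x(1)[OF s]] E0'[OF y(1)[OF s]] x(2,3)[OF s] y(2,3)[OF s] by simp_all
  have tT: "t1 \<in> T" "t2 \<in> T" "t3 \<in> T" by (simp_all add: T_def)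
  note t' = t(4-6) t(4-6)[symmetric]
  have R: "(real_of_int (snd u) * orient (Re (mid (x t1)), Im (mid (x t1))) (Re (mid (x t2)), Im (mid (x t2))) (Re (mid (x t3)), Im (mid (x t3))))
    * (real_of_int (snd v) * orient (Re (mid (y t1)), Im (mid (y t1))) (Re (mid (y t2)), Im (mid (y t2))) (Re (mid (y t3)), Im (mid (y t3)))) < 0"
   by (rule lens_reversal[OF sv(4)[OF uv(1)] sv(4)[OF uv(2)] signed_def signed_def signed_def[of t1] signed_def[of t2] signed_def[of t3]
      mid3_def mid3_def mid3_def mid3_def mid3_def mid3_def
      ux[OF tT(1)] ux[OF tT(2)] ux[OF tT(3)] vy[OF tT(1)] vy[OF tT(2)] vy[OF tT(3)]
      sx[OF tT(1)] sx[OF tT(2)] sx[OF tT(3)] sy[OF tT(1)] sy[OF tT(2)] sy[OF tT(3)]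
      ox[OF tT(2,1) t'(4)] ox[OF tT(3,1) t'(6)] ox[OF tT(1,2) t'(1)] ox[OF tT(3,2) t'(5)] ox[OF tT(1,3) t'(3)] ox[OF tT(2,3) t'(2)]
      oy[OF tT(2,1) t'(4)] oy[OF tT(3,1) t'(6)] oy[OF tT(1,2) t'(1)] oy[OF tT(3,2) t'(5)] oy[OF tT(1,3) t'(3)] oy[OF tT(2,3) t'(2)]
      uy[OF tT(1)] uy[OF tT(2)] uy[OF tT(3)] vx[OF tT(1)] vx[OF tT(2)] vx[OF tT(3)]])
  have oc: "orient (Re z1, Im z1) (Re z2, Im z2) (Re z3, Im z3) = ccw z1 z2 z3" for z1 z2 z3 by (simp add: orient_def ccw_def)
  define Ox where "Ox = ccw (mid (x t1)) (mid (x t2)) (mid (x t3))"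
  define Oy where "Oy = ccw (mid (y t1)) (mid (y t2)) (mid (y t3))"
  define kx where "kx s = real (snd (x s))" for s
  define ky where "ky s = real (snd (y s))" for s
  define Dx where "Dx = (kx t2 - kx t1)*(kx t3 - kx t2)*(kx t3 - kx t1)"
  define Dy where "Dy = (ky t2 - ky t1)*(ky t3 - ky t2)*(ky t3 - ky t1)"
  have xs: "x s = (fst u, snd (x s))" "y s = (fst v, snd (y s))" "Suc (snd (x s)) < k (fst u)" "Suc (snd (y s)) < k (fst v)" if s: "s \<in> T" for s
  proof -
   show "x s = (fst u, snd (x s))" unfolding fx(1)[OF s, symmetric] by simp
   show "y s = (fst v, snd (y s))" unfolding fy(1)[OF s, symmetric] by simp
   show "Suc (snd (x s)) < k (fst u)" using MA(2)[OF x(1)[OF s]] unfolding fx(1)[OF s] .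
   show "Suc (snd (y s)) < k (fst v)" using MA(2)[OF y(1)[OF s]] unfolding fy(1)[OF s] .
  qed
  have uW: "fst u \<in> W" "fst v \<in> W" using uv by (auto simp: V_def)
  have Px: "Ox*Dx > 0" unfolding Ox_def Dx_def kx_def by (subst xs(1)[OF tT(1)], subst xs(1)[OF tT(2)], subst xs(1)[OF tT(3)])
    (rule ccw_mid_sign[OF uW(1) xs(3)[OF tT(1)] xs(3)[OF tT(2)] xs(3)[OF tT(3)] dx[OF tT(1,2) t(4)] dx[OF tT(2,3) t(5)] dx[OF tT(1,3) t(6)]])
  have Py: "Oy*Dy > 0" unfolding Oy_def Dy_def ky_def by (subst xs(2)[OF tT(1)], subst xs(2)[OF tT(2)], subst xs(2)[OF tT(3)])
    (rule ccw_mid_sign[OF uW(2) xs(4)[OF tT(1)] xs(4)[OF tT(2)] xs(4)[OF tT(3)] dy[OF tT(1,2) t(4)] dy[OF tT(2,3) t(5)] dy[OF tT(1,3) t(6)]])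
  define su sw where "su = real_of_int (snd u)" and "sw = real_of_int (snd v)"
  have R': "(su*Ox)*(sw*Oy) < 0" using R unfolding oc Ox_def[symmetric] Oy_def[symmetric] su_def[symmetric] sw_def[symmetric] .
  have neg: "(su*Dx)*(sw*Dy) < 0"
  proof -
   have "((su*Ox)*(sw*Oy))*((Ox*Dx)*(Oy*Dy)) < 0" by (rule mult_neg_pos[OF R' mult_pos_pos[OF Px Py]])
   also have "((su*Ox)*(sw*Oy))*((Ox*Dx)*(Oy*Dy)) = (Ox*Oy)\<^sup>2*((su*Dx)*(sw*Dy))" by (simp add: power2_eq_square)
   finally show ?thesis by (simp add: mult_less_0_iff)
  qed
  have cube: "(s*p2 - s*p1)*(s*p3 - s*p2)*(s*p3 - s*p1) = s*((p2 - p1)*(p3 - p2)*(p3 - p1))" if "s * s = 1" for s p1 p2 p3 :: real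
  proof -
   have "(s*p2 - s*p1)*(s*p3 - s*p2)*(s*p3 - s*p1) = (s * s) * s*((p2 - p1)*(p3 - p2)*(p3 - p1))" by (simp add: algebra_simps)
   then show ?thesis unfolding that by simp
  qed
  have ku: "real_of_int (key u s) = su*kx s" and kv: "real_of_int (key v s) = sw*ky s" for s
   by (simp_all add: key_def su_def sw_def kx_def ky_def x_def y_def)
  have "real_of_int (((key u t2 - key u t1)*(key u t3 - key u t2)*(key u t3 - key u t1))*((key v t2 - key v t1)*(key v t3 - key v t2)*(key v t3 - key v t1)))
   = (su*Dx)*(sw*Dy)"
   unfolding of_int_mult of_int_diff ku kv Dx_def Dy_def
   by (subst cube, simp add: su_def sv(3)[OF uv(1)], subst cube, simp add: sw_def sv(3)[OF uv(2)], rule refl)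
  then show ?thesis using neg by (metis of_int_less_0_iff)
 qed
 have tw: "\<exists>\<eta> :: (complex\<times>real)\<times>int => bool. \<forall>x\<in>Nb u\<inter>Nb v. \<forall>y\<in>Nb u\<inter>Nb v. x ~= y -->
   ((key u x < key u y) = (key v x < key v y)) = (\<eta> x ~= \<eta> y)" if uv: "u \<in> V" "v \<in> V" "u ~= v" for u v
 proof (rule two_colouring_of_reversed_triples)
  show "inj_on (key u) (Nb u\<inter>Nb v)" by (rule inj_on_subset[OF key_inj[OF uv(1)]]) blast
  show "inj_on (key v) (Nb u\<inter>Nb v)" by (rule inj_on_subset[OF key_inj[OF uv(2)]]) blast
 qed (rule triple[OF uv])
 have NV: "Nb v \<subseteq> V" if "v \<in> V" for v unfolding Nb_def using capV h(1) by blast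
 let ?A = "\<Sum>v\<in>V. real (card (Nb v))"
 have cM: "real (card M) = ?A"
 proof -
  have "(\<Sum>v\<in>V. \<Sum>x\<in>{x\<in>M. cap x = v}. (1::real)) = (\<Sum>x\<in>M. 1)" by (rule sum.group[OF finM finV(1)]) (use capV in blast)
  moreover have "card (Nb v) = card {x\<in>M. cap x = v}" for v unfolding Nb_def
  proof (rule card_image, rule inj_onI)
   fix x y assume "x \<in> {x\<in>M. cap x = v}" "y \<in> {x\<in>M. cap x = v}" "cap (h x) = cap (h y)"
   then show "x = y" using arc_eq by (fastforce simp: cap_def)
  qed
  ultimately show ?thesis by simp
 qed
 have "?A \<le> 400*(real (card V) * sqrt (real (card V)))*(1 + ln (real (card V)))" by (rule few_edges_of_twisted_orders[OF finV NV key_inj tw])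
 moreover have "real (card A) \<le> real (card (pair ` A) + card M)" unfolding of_nat_le_iff by (rule conjunct2[OF conjunct2[OF M]])
 ultimately show ?thesis unfolding cV of_nat_add cM by linarith
qed

end

section \<open>Circles in the plane\<close>

definition zc :: "complex\<times>real => complex set" where
 "zc w = {z. pz w z = 0}"

text \<open>In the frame \<open>v\<close>, \<open>w\<close> the orientation equals the product
  \<open>(t - s)*(u - s)*(u - t)\<close> divided by the three denominators, so increasing parameters
  run counterclockwise.\<close>

lemma ccw_cpar:
 fixes p v w :: complex
 assumes "s < t" "t < u" and vw: "Re v * Im w - Im v * Re w > 0"
 shows "ccw (cpar p v w s) (cpar p v w t) (cpar p v w u) > 0"
proof -
 define W where "W = w\<bullet>w"
 define q where "q s = 1 + W * s\<^sup>2" for s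
 have q: "q s > 0" for s using cpar_denom_pos[of w s] by (simp add: q_def W_def)
 have R: "Re (cpar p v w s) = Re p + (s/q s) * Re v + (s\<^sup>2/q s) * Re w" "Im (cpar p v w s) = Im p + (s/q s)*Im v + (s\<^sup>2/q s)*Im w" for s
  by (simp_all add: cpar_def q_def W_def)
 have aff: "ccw (cpar p v w s) (cpar p v w t) (cpar p v w u) = (Re v * Im w - Im v * Re w) *
   ((t/q t - s/q s)*(u\<^sup>2/q u - s\<^sup>2/q s) - (u/q u - s/q s)*(t\<^sup>2/q t - s\<^sup>2/q s))"
 proof -
  have g: "(P + A2 * a + B2 * b - (P + A1 * a + B1 * b))*(P' + A3 * c + B3*e - (P' + A1 * c + B1*e))
    - (P + A3 * a + B3 * b - (P + A1 * a + B1 * b))*(P' + A2 * c + B2*e - (P' + A1 * c + B1*e))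
    = (a*e - c * b)*((A2 - A1)*(B3 - B1) - (A3 - A1)*(B2 - B1))" for P P' A1 A2 A3 B1 B2 B3 a b c e :: real
   by (simp add: algebra_simps)
  show ?thesis unfolding ccw_def R by (rule g)
 qed
 have sub: "a/q t - b/q s = (a*q s - b*q t)/(q s*q t)" for a b s t using q[of s] q[of t] by (simp add: field_simps)
 have n1: "t*q s - s*q t = (t - s)*(1 - W * s*t)" for s t by (simp add: q_def ring_sq)
 have n2: "t\<^sup>2*q s - s\<^sup>2*q t = (t - s)*(t + s)" for s t by (simp add: q_def ring_sq)
 have core: "(1 - W * s*t)*(u + s) - (1 - W * s*u)*(t + s) = (u - t)*q s" by (simp add: q_def ring_sq)
 have "(t/q t - s/q s)*(u\<^sup>2/q u - s\<^sup>2/q s) - (u/q u - s/q s)*(t\<^sup>2/q t - s\<^sup>2/q s)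
  = ((t - s)*(1 - W * s*t))/(q s*q t)*(((u - s)*(u + s))/(q s*q u)) - ((u - s)*(1 - W * s*u))/(q s*q u)*(((t - s)*(t + s))/(q s*q t))"
  unfolding sub n1 n2 ..
 also have "... = (t - s)*(u - s)*((1 - W * s*t)*(u + s) - (1 - W * s*u)*(t + s))/((q s*q t)*(q s*q u))"
 proof -
  have g: "(a * b)/d*((c*e)/f) - (c * b')/f*((a*e')/d) = a * c*(b*e - b'*e')/(d*f)" for a b c d e f b' e' :: real
   by (simp add: diff_divide_distrib right_diff_distrib mult_ac)
  show ?thesis by (rule g)
 qed
 also have "... = (t - s)*(u - s)*((u - t)*q s)/((q s*q t)*(q s*q u))" unfolding core ..
 also have "... > 0" using assms(1,2) q[of s] q[of t] q[of u] by (intro divide_pos_pos mult_pos_pos) auto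
 finally show ?thesis unfolding aff using vw by (intro mult_pos_pos)
qed

lemma zc_base:
 assumes p: "pz w p = 0" "pz w q = 0" "p ~= q"
 obtains v W where "norm v = 1" "v\<bullet>W = 0" "W ~= 0" "zc w = circ p v W" "Re v * Im W - Im v * Re W > 0"
proof -
 \<comment> \<open>\<open>n\<close> leads from \<open>p\<close> to the centre and is non-zero
   because of the second point \<open>q\<close>. Then \<open>v\<close> is \<open>n\<close> turned
   clockwise and normalised, and \<open>W\<close> is \<open>n\<close> divided by twice its squared
   length, which makes the frame positively oriented.\<close>
 define n where "n = - (fst w /\<^sub>R 2) - p"
 have id: "pz w z = (z - p)\<bullet>(z - p) - 2*(n\<bullet>(z - p))" for z
 proof -
  have f: "fst w = - (2 *R (n + p))" by (simp add: n_def algebra_simps)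
  have "pz w z - pz w p = z\<bullet>z + fst w\<bullet>z - (p\<bullet>p + fst w\<bullet>p)" by (simp add: pz_def)
  also have "... = (z - p)\<bullet>(z - p) - 2*(n\<bullet>(z - p))" unfolding f by (simp add: inner_complex_def algebra_simps)
  finally have "pz w z - pz w p = (z - p)\<bullet>(z - p) - 2*(n\<bullet>(z - p))" .
  then show ?thesis using p(1) by simp
 qed
 have n0: "n ~= 0"
 proof
  assume "n = 0"
  then have "(q - p)\<bullet>(q - p) = 0" using id[of q] p(2) by simp
  then show False using p(3) by simp
 qed
 define N where "N = n\<bullet>n"
 have N: "N > 0" using n0 by (simp add: N_def)
 define r where "r = norm n"
 have r: "r > 0" "r*r = N" using n0 by (simp_all add: r_def N_def dot_square_norm power2_eq_square)
 let ?A = "- \<i>*n"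
 define v where "v = (1/r) *R ?A"
 define W where "W = (1/(2*N)) *R n"
 have Nn: "N = Re n * Re n + Im n*Im n" by (simp add: N_def inner_complex_def)
 have v1: "norm v = 1" using r(1) by (simp add: v_def r_def norm_mult)
 have vw: "v\<bullet>W = 0" by (simp add: v_def W_def inner_complex_def)
 have w0: "W ~= 0" using n0 N by (simp add: W_def)
 have ww: "W\<bullet>W = 1/(4*N)" using N by (simp add: W_def N_def[symmetric])
 have cr: "Re v * Im W - Im v * Re W > 0"
 proof -
  have "Re v * Im W - Im v * Re W = (1/r)*(1/(2*N))*N" by (simp add: v_def W_def Nn add_divide_distrib algebra_simps)
  then show ?thesis using N r by simp
 qed
 have nv: "n\<bullet>v = 0" by (simp add: v_def inner_complex_def)
 have vv: "v\<bullet>v = 1" using v1 by (simp add: dot_square_norm)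
 have nw: "n\<bullet>W = 1/2" using N by (simp add: W_def N_def[symmetric])
 have "zc w = circ p v W"
 proof (rule equalityI; rule subsetI)
  fix z assume "z \<in> circ p v W"
  then obtain a b where z: "z = p + a *R v + b *R W" and ab: "a\<^sup>2 + (W\<bullet>W) * b\<^sup>2 = b" unfolding circ_def by auto
  have zp: "z - p = a *R v + b *R W" by (simp add: z)
  have "(z - p)\<bullet>(z - p) = a\<^sup>2 + (W\<bullet>W) * b\<^sup>2"
   unfolding zp inner_add by (simp add: vv vw inner_commute[of W v] power2_eq_square)
  moreover have "2*(n\<bullet>(z - p)) = b" unfolding zp inner_add_right by (simp add: nv nw)
  ultimately show "z \<in> zc w" unfolding zc_def mem_Collect_eq using id[of z] ab by linarith
 next
  fix z assume "z \<in> zc w"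
  then have eq: "(z - p)\<bullet>(z - p) = 2*(n\<bullet>(z - p))" using id[of z] by (simp add: zc_def)
  define a b where "a = v\<bullet>(z - p)" and "b = 2*(n\<bullet>(z - p))"
  have dec: "z - p = a *R v + b *R W"
  proof -
   define x where "x = z - p"
   have "N *R x = (?A\<bullet>x) *R ?A + (n\<bullet>x) *R n" by (simp add: complex_eq_iff Nn inner_complex_def algebra_simps)
   then have "x = (1/N) *R ((?A\<bullet>x) *R ?A + (n\<bullet>x) *R n)" using N by (metis (no_types) divide_self_if less_irrefl scaleR_one scaleR_scaleR times_divide_eq_left mult_1)
   also have "... = (v\<bullet>x) *R v + (2*(n\<bullet>x)) *R W" unfolding v_def W_def using N by (simp add: scaleR_add_right r(2)[symmetric])
   finally show ?thesis unfolding a_def b_def x_def .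
  qed
  have "(z - p)\<bullet>(z - p) = a\<^sup>2 + (W\<bullet>W) * b\<^sup>2"
   unfolding dec inner_add by (simp add: vv vw inner_commute[of W v] power2_eq_square)
  then have "a\<^sup>2 + (W\<bullet>W) * b\<^sup>2 = b" using eq unfolding b_def by linarith
  moreover have "z = p + a *R v + b *R W" using dec by (simp add: algebra_simps)
  ultimately show "z \<in> circ p v W" unfolding circ_def by blast
 qed
 then show ?thesis using that v1 vw w0 cr by blast
qed

lemma zc_inj:
 assumes "pz w p = 0" "pz w q = 0" "p ~= q" "zc w = zc w'"
 shows "w = w'"
proof -
 obtain v W where c: "norm v = 1" "v\<bullet>W = 0" "W ~= 0" "zc w = circ p v W" "Re v * Im W - Im v * Re W > 0"
  using zc_base[OF assms(1-3)] .
 have z: "pz w (cpar p v W s) = 0" "pz w' (cpar p v W s) = 0" for s using cpar_in_circ[of p v W s] c(4) assms(4) unfolding zc_def by auto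
 have cc: "ccw (cpar p v W 0) (cpar p v W 1) (cpar p v W 2) > 0" by (rule ccw_cpar[OF _ _ c(5)]) simp_all
 then have ne: "cpar p v W 0 ~= cpar p v W 1" by (metis ccw_degenerate(1) less_irrefl)
 obtain l where l: "\<forall>y. pz w y - pz w' y = l * ccw (cpar p v W 0) (cpar p v W 1) y"
 proof -
  have e: "pz w (cpar p v W s) = pz w' (cpar p v W s)" for s unfolding z ..
  from pz_diff_eq_ccw[OF e e ne] that show ?thesis by (elim exE)
 qed
 have "l = 0" using l[rule_format, of "cpar p v W 2"] z cc by simp
 then show ?thesis using l by (intro pz_determines) simp
qed

text \<open>Sorting the parameters lists the points counterclockwise; only the antipode of
  \<open>p\<close> can be missing, hence \<open>k + 1\<close>.\<close>

lemma circle_enumeration: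
 assumes P: "finite P" and p: "pz w p = 0" "pz w q = 0" "p ~= q"
 obtains v W s k where "norm v = 1" "v\<bullet>W = 0" "W ~= 0" "zc w = circ p v W" "Re v * Im W - Im v * Re W > 0"
  "!!i j. i < j ==> j < (k::nat) ==> s i < s j" "!!i. i < k ==> cpar p v W (s i) \<in> P\<inter>zc w" "card (P\<inter>zc w) \<le> k + 1"
proof -
 obtain v W where c: "norm v = 1" "v\<bullet>W = 0" "W ~= 0" "zc w = circ p v W" "Re v * Im W - Im v * Re W > 0"
  using zc_base[OF p] .
 have inj: "inj (cpar p v W)" using cpar_inj[OF c(1-3)] by (auto intro: injI)
 define S where "S = cpar p v W -` P"
 have finS: "finite S" unfolding S_def by (rule finite_vimageI[OF P inj])
 define xs where "xs = sorted_list_of_set S"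
 have xs: "set xs = S" "sorted_wrt (<) xs" "length xs = card S"
  unfolding xs_def using finS by (simp_all add: sorted_list_of_set.strict_sorted_key_list_of_set[of S])
 let ?e = "p + (1/(W\<bullet>W)) *R W"
 let ?A = "cpar p v W ` S"
 have sub: "P\<inter>zc w \<subseteq> insert ?e ?A"
 proof
  fix z assume z: "z \<in> P\<inter>zc w"
  then have "z \<in> circ p v W" using c(4) by simp
  from circ_param[OF this c(3)] consider "z = ?e" | s where "z = cpar p v W s" by blast
  then show "z \<in> insert ?e ?A"
  proof cases
   case (2 s)
   then show ?thesis using z by (simp add: S_def)
  qed blast
 qed
 have "card (P\<inter>zc w) \<le> card (insert ?e ?A)" by (rule card_mono[OF _ sub]) (use finS in simp)
 also have "... \<le> Suc (card ?A)" using finS by (simp add: card_insert_if)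
 also have "card ?A \<le> card S" by (rule card_image_le[OF finS])
 finally have cd: "card (P\<inter>zc w) \<le> length xs + 1" using xs(3) by simp
 show ?thesis
 proof (rule that[OF c, of "length xs" "\<lambda>i. xs ! i"])
  show "xs ! i < xs ! j" if "i < j" "j < length xs" for i j using sorted_wrt_nth_less[OF xs(2) that] .
  show "cpar p v W (xs ! i) \<in> P\<inter>zc w" if "i < length xs" for i
  proof -
   have "xs ! i \<in> S" using nth_mem[OF that] xs(1) by simp
   then show ?thesis using cpar_in_circ[of p v W "xs ! i"] c(4) by (simp add: S_def)
  qed
  show "card (P\<inter>zc w) \<le> length xs + 1" by (rule cd)
 qed
qed

text \<open>A zero lies in at most one half-open arc and is the right end of at most one
  arc.\<close>

lemma card_arcs_meeting_zeros:
 fixes s :: "nat => real"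
 assumes Z: "finite Z" and s: "!!i j. i < j ==> j < k ==> s i < s j"
 shows "card {i. Suc i < k \<and> (\<exists>z\<in>Z. s i \<le> z \<and> z \<le> s (Suc i))} \<le> 2 * card Z"
proof -
 define A where "A = {i. Suc i < k \<and> (\<exists>z\<in>Z. s i \<le> z \<and> z < s (Suc i))}"
 define B where "B = {i. Suc i < k \<and> s (Suc i) \<in> Z}"
 have fin: "finite A" "finite B" by (rule finite_subset[of _ "{..<k}"]; auto simp: A_def B_def)+
 have mono: "s i \<le> s j" if "i \<le> j" "j < k" for i j using s[of i j] that by (cases "i = j") auto
 define f where "f i = (SOME z. z \<in> Z \<and> s i \<le> z \<and> z < s (Suc i))" for i
 have f: "f i \<in> Z \<and> s i \<le> f i \<and> f i < s (Suc i)" if "i \<in> A" for i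
  unfolding f_def by (rule someI_ex) (use that in \<open>auto simp: A_def\<close>)
 have less: "f i < f j" if "i \<in> A" "j \<in> A" "i < j" for i j
 proof -
  have "s (Suc i) \<le> s j" by (rule mono) (use that in \<open>auto simp: A_def\<close>)
  then show ?thesis using f[OF that(1)] f[OF that(2)] by linarith
 qed
 have "inj_on f A"
 proof (rule inj_onI)
  fix i j assume ij: "i \<in> A" "j \<in> A" "f i = f j"
  show "i = j" using less[OF ij(1,2)] less[OF ij(2,1)] ij(3) by (metis less_irrefl nat_neq_iff)
 qed
 moreover have "f ` A \<subseteq> Z" using f by blast
 ultimately have A: "card A \<le> card Z" using Z by (metis card_inj_on_le)
 have "inj_on (\<lambda>i. s (Suc i)) B"
 proof (rule inj_onI)
  fix i j assume ij: "i \<in> B" "j \<in> B" "s (Suc i) = s (Suc j)"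
  then have "Suc i < k" "Suc j < k" by (simp_all add: B_def)
  then show "i = j" using s[of "Suc i" "Suc j"] s[of "Suc j" "Suc i"] ij(3) by (metis Suc_less_eq less_irrefl nat_neq_iff)
 qed
 moreover have "(\<lambda>i. s (Suc i)) ` B \<subseteq> Z" by (auto simp: B_def)
 ultimately have B: "card B \<le> card Z" using Z by (metis card_inj_on_le)
 let ?A = "{i. Suc i < k \<and> (\<exists>z\<in>Z. s i \<le> z \<and> z \<le> s (Suc i))}"
 have "?A \<subseteq> A\<union>B" unfolding A_def B_def using order_le_less by blast
 then have "card ?A \<le> card (A\<union>B)" using fin by (intro card_mono) auto
 also have "... \<le> card A + card B" by (rule card_Un_le)
 finally show ?thesis using A B by simp
qed

text \<open>With at most one exception, an element of \<open>B\<close> is followed by an index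
  outside \<open>B\<close>; the index \<open>n\<close> accounts for one more unit.\<close>

lemma card_with_few_adjacent:
 assumes "card {i. i \<in> B \<and> Suc i \<in> B} \<le> 1" "B \<subseteq> {..<n::nat}"
 shows "n \<le> 2 * card ({..<n} - B) + 2"
proof -
 define A where "A = {i. i \<in> B \<and> Suc i \<in> B}"
 have finB: "finite B" using finite_subset[OF assms(2)] by simp
 have AB: "A \<subseteq> B" by (auto simp: A_def)
 have "Suc ` (B - A) \<subseteq> {..n} - B" using assms(2) by (auto simp: A_def)
 then have "card (Suc ` (B - A)) \<le> card ({..n} - B)" by (intro card_mono) auto
 then have 1: "card (B - A) \<le> card ({..n} - B)" by (simp add: card_image)
 let ?A = "{..<n} - B"
 have "{..n} - B \<subseteq> insert n ?A" by auto
 then have "card ({..n} - B) \<le> card (insert n ?A)" by (intro card_mono) auto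
 also have "... \<le> card ?A + 1" by (simp add: card_insert_if)
 finally have 2: "card ({..n} - B) \<le> card ?A + 1" .
 have "card B = card (B - A) + card A" using card_Diff_subset[OF finite_subset[OF AB finB] AB] card_mono[OF finB AB] by simp
 moreover have "n = card B + card ?A" using card_Diff_subset[OF finB assms(2)] card_mono[OF _ assms(2)] by simp
 ultimately show ?thesis using 1 2 assms(1) unfolding A_def[symmetric] by linarith
qed

text \<open>In the space of pairs \<open>(b, c)\<close> the circles through \<open>p\<close> and
  \<open>q\<close> form a line, and this is its direction.\<close>

definition dual_dir :: "complex => complex => complex\<times>real" where
 "dual_dir p q = (\<i>*(p - q), - ((\<i>*(p - q))\<bullet>p))"

lemma dual_line:
 assumes "p ~= q" "pz w0 p = 0" "pz w0 q = 0"
 shows "pz w p = 0 \<and> pz w q = 0 \<longleftrightarrow> (\<exists>t. w = w0 + t *R dual_dir p q)"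
proof
 assume w: "pz w p = 0 \<and> pz w q = 0"
 define b c where "b = fst w - fst w0" and "c = snd w - snd w0"
 have p: "b\<bullet>p + c = 0" using w assms(2) by (simp add: pz_def b_def c_def inner_diff_left)
 have q: "b\<bullet>q + c = 0" using w assms(3) by (simp add: pz_def b_def c_def inner_diff_left)
 define d where "d = p - q"
 have d0: "d\<bullet>d ~= 0" using assms(1) by (simp add: d_def)
 have bd: "b\<bullet>d = 0" using p q by (simp add: d_def inner_diff_right)
 let ?A = "d\<bullet>d"
 define t where "t = (b\<bullet>(\<i>*d))/?A"
 have "?A *R b = (b\<bullet>d) *R d + (b\<bullet>(\<i>*d)) *R (\<i>*d)" by (simp add: complex_eq_iff inner_complex_def algebra_simps)
 then have "?A *R b = ?A *R (t *R (\<i>*d))" using bd d0 by (simp add: t_def)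
 then have b: "b = t *R (\<i>*d)" using d0 by (metis scaleR_cancel_left)
 have "c = - (t*((\<i>*d)\<bullet>p))" using p unfolding b inner_scaleR_left by linarith
 then have "w = w0 + t *R dual_dir p q" using b unfolding dual_dir_def d_def[symmetric] by (simp add: prod_eq_iff b_def c_def algebra_simps)
 then show "\<exists>t. w = w0 + t *R dual_dir p q" ..
next
 assume "\<exists>t. w = w0 + t *R dual_dir p q"
 then obtain t where w: "w = w0 + t *R dual_dir p q" ..
 have e: "pz w z = pz w0 z + t*((\<i>*(p - q))\<bullet>(z - p))" for z
  unfolding w pz_def dual_dir_def by (simp add: inner_add_left inner_diff_right algebra_simps)
 have "(\<i>*(p - q))\<bullet>(q - p) = 0" by (simp add: inner_complex_def algebra_simps)
 then show "pz w p = 0 \<and> pz w q = 0" using e assms(2,3) by simp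
qed

lemma zc_circ:
 assumes "pz w p = 0" "pz w q = 0" "p ~= q" "pz w x = 0"
 obtains v W where "norm v = 1" "v\<bullet>W = 0" "W ~= 0" "zc w = circ x v W"
proof (cases "x = p")
 case True
 then show ?thesis using zc_base[OF assms(1-3)] that by metis
next
 case False
 then show ?thesis using zc_base[OF assms(4,1)] that by metis
qed

lemma card_zeros_on_zc:
 assumes F: "rpd d F" and w: "pz w p = 0" "pz w q = 0" "p ~= q" and x: "x \<in> zc w" "F x ~= 0"
 shows "finite {y \<in> zc w. F y = 0}" "card {y \<in> zc w. F y = 0} \<le> 2*d + 1" (is ?P)
proof -
 have "pz w x = 0" using x(1) by (simp add: zc_def)
 obtain v W where c: "norm v = 1" "v\<bullet>W = 0" "W ~= 0" "zc w = circ x v W" using zc_circ[OF w \<open>pz w x = 0\<close>] .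
 from card_zeros_on_circ[OF F c(3) x(1)[unfolded c(4)] x(2)]
 show "finite {y \<in> zc w. F y = 0}" ?P unfolding c(4) by auto
qed

text \<open>In the plane a non-zero gradient fixes the tangent up to sign by the first contact
  equation and the curvature by the second. So a point where the gradient is non-zero carries at
  most one circle of the zero set.\<close>

lemma flat_circle_unique:
 fixes G :: "complex => real"
 assumes G: "rpd d G" and nz: "dd u G p ~= 0"
  and 1: "norm v = 1" "v\<bullet>w = 0" "!!s. G (cpar p v w s) = 0"
  and 2: "norm v' = 1" "v'\<bullet>w' = 0" "!!s. G (cpar p v' w' s) = 0"
 shows "circ p v w = circ p v' w'"
proof -
 obtain N where N: "\<forall>h. dd h G p = h\<bullet>N" using gradient_exists[OF G] ..
 have N0: "N ~= 0" using nz N by auto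
 have v: "v\<bullet>N = 0" "v'\<bullet>N = 0" using circle_contact_equations(1)[OF G 1(3)] circle_contact_equations(1)[OF G 2(3)] N by simp_all
 have e: "2*(w\<bullet>N) + dd v (dd v G) p = 0" "2*(w'\<bullet>N) + dd v' (dd v' G) p = 0"
  using circle_contact_equations(2)[OF G 1(3)] circle_contact_equations(2)[OF G 2(3)] N by simp_all
 define r where "r = Re v * Re v' + Im v * Im v'"
 have nn: "Re v * Re v + Im v * Im v = 1" "Re v' * Re v' + Im v'*Im v' = 1" using 1(1) 2(1) by (simp_all add: cmod_def power2_eq_square)
 let ?A = "Re v * Im v' - Im v * Re v'"
 let ?C = "Re v * Re N + Im v * Im N"
 have par: "Re v * Im v' - Im v * Re v' = 0"
 proof -
  have a: "Re v * Re N + Im v * Im N = 0" "Re v' * Re N + Im v'*Im N = 0" using v by (simp_all add: inner_complex_def)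
  have "?A * Re N = Im v'*?C - Im v * (Re v' * Re N + Im v'*Im N)" by (simp add: algebra_simps)
  moreover have "?A*Im N = Re v * (Re v' * Re N + Im v'*Im N) - Re v'*?C" by (simp add: algebra_simps)
  ultimately have "?A * Re N = 0" "?A*Im N = 0" unfolding a by simp_all
  then show ?thesis using N0 by (auto simp: complex_eq_iff)
 qed
 let ?B = "1 - (Re v * Re v + Im v * Im v)"
 have v': "v' = r *R v"
 proof (rule complex_eqI)
  have "Re v' - r * Re v = Re v'*?B - Im v * ?A" by (simp add: r_def algebra_simps)
  then show "Re v' = Re (r *R v)" unfolding nn par by simp
  have "Im v' - r*Im v = Im v'*?B + Re v * ?A" by (simp add: r_def algebra_simps)
  then show "Im v' = Im (r *R v)" unfolding nn par by simp
 qed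
 have r1: "\<bar>r\<bar> = 1" using arg_cong[OF v', of norm] 1(1) 2(1) by simp
 then have rr: "v' = v \<or> v' = - v" using v' by (auto simp: abs_if split: if_splits)
 have vr: "v'\<bullet>w' = r*(v\<bullet>w')" unfolding v' by simp
 have "v\<bullet>w' = 0" using 2(2) r1 unfolding vr by auto
 have ddm: "dd (- v) (dd (- v) G) p = dd v (dd v G) p"
 proof -
  have m: "dd (- v) F = (\<lambda>x. - dd v F x)" if "rpd d F" for F using dd_lincomb_fun[OF that, of "- 1" v 0 v] by simp
  have r: "rpd d (\<lambda>x. - dd v G x)" using rpd_cmult[OF rpd_dd[OF G], of "- 1" v] by simp
  show ?thesis unfolding m[OF G] m[OF r] using dd_cmult[OF rpd_dd[OF G], of v "- 1" v] by simp
 qed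
 have "dd v' (dd v' G) p = dd v (dd v G) p" using rr ddm by auto
 then have "(w - w')\<bullet>N = 0" using e by (simp add: inner_diff_left)
 moreover have "(w - w')\<bullet>v = 0" using 1(2) \<open>v \<bullet> w' = 0\<close> by (simp add: inner_commute[of _ v] inner_diff_right)
 ultimately have "w - w' = 0"
 proof -
  define x where "x = w - w'"
  have x: "Re x * Re N + Im x*Im N = 0" "Re x * Re v + Im x*Im v = 0" and vN: "Re v * Re N + Im v * Im N = 0"
   using \<open>(w - w') \<bullet> N = 0\<close> \<open>(w - w') \<bullet> v = 0\<close> v(1) by (simp_all add: x_def inner_complex_def)
  define t where "t = Re v * Im N - Im v * Re N"
  have t0: "t ~= 0"
  proof
   assume "t = 0"
   have "Re N = Re v * ?C - Im v * t + Re N*?B" by (simp add: t_def algebra_simps)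
   moreover have "Im N = Im v * ?C + Re v * t + Im N*?B" by (simp add: t_def algebra_simps)
   ultimately have "Re N = 0" "Im N = 0" unfolding vN nn \<open>t = 0\<close> by simp_all
   then show False using N0 by (simp add: complex_eq_iff)
  qed
  have "t * Re x = Im N*(Re x * Re v + Im x*Im v) - Im v * (Re x * Re N + Im x*Im N)" by (simp add: t_def algebra_simps)
  moreover have "t*Im x = Re v * (Re x * Re N + Im x*Im N) - Re N*(Re x * Re v + Im x*Im v)" by (simp add: t_def algebra_simps)
  ultimately have "Re x = 0" "Im x = 0" unfolding x using t0 by simp_all
  then show ?thesis unfolding x_def[symmetric] by (simp add: complex_eq_iff)
 qed
 then have "w' = w" by simp
 then show ?thesis using rr circ_minus[of p v w] by auto
qed

text \<open>The argument with orders of vanishing in dimension two: on each circle at most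
  \<open>2*d + 1\<close> points have a larger order than the circle, and any other incidence is the
  only one of its kind at its point by \<open>flat_circle_unique\<close>.\<close>

theorem incidences_in_zero_set:
 fixes g :: "complex => real"
 assumes g: "rpd d g" "g x0 ~= 0" and P: "finite P" and W: "finite W"
  and two: "!!w. w \<in> W ==> \<exists>p q. pz w p = 0 \<and> pz w q = 0 \<and> p ~= q"
  and z: "!!w x. w \<in> W ==> x \<in> zc w ==> g x = 0"
 shows "(\<Sum>w\<in>W. card (P\<inter>zc w)) \<le> (2*d + 1) * card W + card P"
proof -
 obtain u where u: "!!p. p \<in> P ==> g (p + u) ~= 0" using avoiding_direction[OF g P] by blast
 have ex: "\<exists>n. (dd u ^^ n) g p ~= 0" if "p \<in> P" for p using some_ddn_nonzero[OF g(1) u[OF that]] .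
 define jp where "jp p = (LEAST n. (dd u ^^ n) g p ~= 0)" for p
 define jc where "jc w = (LEAST n. \<exists>x\<in>zc w. (dd u ^^ n) g x ~= 0)" for w
 have jp: "(dd u ^^ jp p) g p ~= 0" if "p \<in> P" for p unfolding jp_def by (rule LeastI_ex[OF ex[OF that]])
 have jc: "\<exists>x\<in>zc w. (dd u ^^ jc w) g x ~= 0" if "p \<in> P" "p \<in> zc w" for p w
  unfolding jc_def by (rule LeastI_ex) (use ex[OF that(1)] that(2) in blast)
 have jc_less: "(dd u ^^ n) g x = 0" if "n < jc w" "x \<in> zc w" for n x w using not_less_Least[OF that(1)[unfolded jc_def]] that(2) by blast
 define X where "X w = {p \<in> P\<inter>zc w. (dd u ^^ jc w) g p ~= 0}" for w
 have finX: "finite (X w)" for w using P by (simp add: X_def)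
 have one: "card (P\<inter>zc w) \<le> (2*d + 1) + card (X w)" if w: "w \<in> W" for w
 proof (cases "P\<inter>zc w = {}")
  case False
  then obtain p where p: "p \<in> P" "p \<in> zc w" by blast
  obtain x where x: "x \<in> zc w" "(dd u ^^ jc w) g x ~= 0" using jc[OF p] by blast
  obtain p1 q1 where pq: "pz w p1 = 0" "pz w q1 = 0" "p1 ~= q1" using two[OF w] by blast
  note k = card_zeros_on_zc[OF rpd_ddn[OF g(1)] pq x]
  let ?A = "{y \<in> zc w. (dd u ^^ jc w) g y = 0}"
  have "P\<inter>zc w \<subseteq> ?A\<union>X w" by (auto simp: X_def)
  then have "card (P\<inter>zc w) \<le> card (?A\<union>X w)" using k(1) finX by (intro card_mono) auto
  also have "... \<le> card ?A + card (X w)" by (rule card_Un_le)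
  finally show ?thesis using k(2) by linarith
 qed simp
 let ?B = "\<Sum>w\<in>W. card (X w)"
 have "X w\<inter>X w' = {}" if w: "w \<in> W" "w' \<in> W" "w ~= w'" for w w'
 proof (rule ccontr)
  assume "X w\<inter>X w' ~= {}"
  then obtain p where p: "p \<in> X w" "p \<in> X w'" by blast
  have eqj: "jc y = jp p \<and> jp p \<ge> 1" if y: "y \<in> W" "p \<in> X y" for y
  proof -
   have pP: "p \<in> P" "p \<in> zc y" and nz: "(dd u ^^ jc y) g p ~= 0" using y(2) by (auto simp: X_def)
   have "jp p \<le> jc y" unfolding jp_def by (rule Least_le[of "\<lambda>n. (dd u ^^ n) g p ~= 0", OF nz])
   moreover have "\<not> jp p < jc y" using jc_less[of "jp p" y p] jp[OF pP(1)] pP(2) by blast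
   ultimately have e: "jc y = jp p" by simp
   have "jp p ~= 0"
   proof
    assume "jp p = 0"
    then show False using nz z[OF y(1) pP(2)] e by simp
   qed
   then show ?thesis using e by simp
  qed
  define G where "G = (dd u ^^ (jp p - 1)) g"
  have rG: "rpd d G" unfolding G_def by (rule rpd_ddn[OF g(1)])
  have j1: "jp p \<ge> 1" using eqj[OF w(1) p(1)] by simp
  have "dd u G = (dd u ^^ Suc (jp p - 1)) g" by (simp add: G_def)
  also have "Suc (jp p - 1) = jp p" using j1 by simp
  finally have Gnz: "dd u G p ~= 0" using jp[of p] p by (simp add: X_def)
  have rep: "\<exists>v a. norm v = 1 \<and> v\<bullet>a = 0 \<and> zc y = circ p v a \<and> (\<forall>s. G (cpar p v a s) = 0)" if y: "y \<in> W" "p \<in> X y" for y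
  proof -
   obtain p1 q1 where pq: "pz y p1 = 0" "pz y q1 = 0" "p1 ~= q1" using two[OF y(1)] by blast
   have "pz y p = 0" using y(2) by (simp add: X_def zc_def)
   obtain v a where c: "norm v = 1" "v\<bullet>a = 0" "a ~= 0" "zc y = circ p v a" using zc_circ[OF pq \<open>pz y p = 0\<close>] .
   have "G (cpar p v a s) = 0" for s unfolding G_def by (rule jc_less[of _ y]) (use eqj[OF y] j1 cpar_in_circ[of p v a s] c(4) in simp_all)
   then show ?thesis using c by blast
  qed
  obtain v a where 1: "norm v = 1 \<and> v\<bullet>a = 0 \<and> zc w = circ p v a \<and> (\<forall>s. G (cpar p v a s) = 0)" using rep[OF w(1) p(1)] by blast
  obtain v' a' where 2: "norm v' = 1 \<and> v'\<bullet>a' = 0 \<and> zc w' = circ p v' a' \<and> (\<forall>s. G (cpar p v' a' s) = 0)" using rep[OF w(2) p(2)] by blast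
  have "circ p v a = circ p v' a'" using flat_circle_unique[OF rG Gnz, of v a v' a'] 1 2 by simp
  then have "zc w = zc w'" using 1 2 by simp
  moreover obtain p1 q1 where pq: "pz w p1 = 0" "pz w q1 = 0" "p1 ~= q1" using two[OF w(1)] by blast
  ultimately show False using zc_inj[OF pq] w(3) by blast
 qed
 then have "?B = card (\<Union>w\<in>W. X w)" using W finX by (subst card_UN_disjoint) auto
 also have "... \<le> card P" by (rule card_mono[OF P]) (auto simp: X_def)
 finally have XP: "?B \<le> card P" .
 have "(\<Sum>w\<in>W. card (P\<inter>zc w)) \<le> (\<Sum>w\<in>W. (2*d + 1) + card (X w))" by (rule sum_mono[OF one])
 also have "... = (2*d + 1) * card W + ?B" unfolding sum.distrib by simp
 finally show ?thesis using XP by linarith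
qed

text \<open>The circles through \<open>q\<close> form a plane with normal vector
  \<open>(q, 1)\<close> in the space of circles. It contains the lines belonging to the chords
  \<open>p\<close>, \<open>q\<close> and \<open>q\<close>, \<open>r\<close>, which are not parallel
  when the three points are not collinear, so \<open>N\<close> is a multiple of this normal.\<close>

lemma dual_gradient_at_vertex:
 assumes "dual_dir p q\<bullet>N = 0" "dual_dir q r\<bullet>N = 0" "ccw p q r ~= 0"
 shows "fst N = snd N *R q"
proof -
 define Q where "Q = fst N - snd N *R q"
 have 1: "(\<i>*(p - q))\<bullet>Q = 0" using assms(1) by (simp add: dual_dir_def Q_def inner_prod_def inner_complex_def algebra_simps)
 have 2: "(\<i>*(q - r))\<bullet>Q = 0" using assms(2) by (simp add: dual_dir_def Q_def inner_prod_def inner_complex_def algebra_simps)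
 define a b c d where "a = Re p - Re q" and "b = Im p - Im q" and "c = Re q - Re r" and "d = Im q - Im r"
 have e1: "a*Im Q - b * Re Q = 0" and e2: "c*Im Q - d * Re Q = 0" using 1 2 by (simp_all add: inner_complex_def a_def b_def c_def d_def algebra_simps)
 have cc: "ccw p q r = a*d - b * c" by (simp add: ccw_def a_def b_def c_def d_def algebra_simps)
 have "(a*d - b * c) * Re Q = c*(a*Im Q - b * Re Q) - a*(c*Im Q - d * Re Q)" by (simp add: algebra_simps)
 moreover have "(a*d - b * c)*Im Q = d*(a*Im Q - b * Re Q) - b*(c*Im Q - d * Re Q)" by (simp add: algebra_simps)
 ultimately have "Re Q = 0" "Im Q = 0" using assms(3) unfolding e1 e2 cc by simp_all
 then show ?thesis unfolding Q_def by (simp add: complex_eq_iff)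
qed

lemma card_fibres_le:
 assumes "finite A" "!!y. y \<in> f ` A ==> card {x\<in>A. f x = y} \<le> c"
 shows "card A \<le> c * card (f ` A)"
proof -
 have "card A = (\<Sum>y\<in>f ` A. card {x\<in>A. f x = y})"
  using sum.group[OF assms(1) finite_imageI[OF assms(1)], of f f "\<lambda>_. 1::nat"] by simp
 also have "... \<le> (\<Sum>y\<in>f ` A. c)" by (rule sum_mono[OF assms(2)])
 finally show ?thesis by (simp add: mult.commute)
qed

lemma zeros_on_line:
 assumes F: "rpd e F" and nz: "F (w + t0 *R d) ~= 0"
 shows "finite {t. F (w + t *R d) = 0}" (is ?Q) "card {t. F (w + t *R d) = 0} \<le> e" (is ?P)
proof -
 obtain q where q: "degree q \<le> e \<and> (\<forall>t. F (w + t *R d) = poly q t)" using rpd_line[OF F] ..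
 have "q ~= 0" using nz q by auto
 then show ?Q ?P using poly_roots_finite[of q] card_poly_roots_bound[of q] q by simp_all
qed

context circular_lists
begin

lemma arc_line:
 assumes x: "fst x \<in> W" "Suc (snd x) < k (fst x)" and y: "fst y \<in> W" "Suc (snd y) < k (fst y)" and e: "pair y = pair x"
 shows "\<exists>t. fst y = fst x + t *R dual_dir (a (fst x) (snd x)) (a (fst x) (Suc (snd x)))"
proof -
 have "pz (fst x) (a (fst x) (snd x)) = 0 \<and> pz (fst x) (a (fst x) (Suc (snd x))) = 0" using on[OF x(1)] x(2) by simp
 moreover have "a (fst x) (snd x) ~= a (fst x) (Suc (snd x))" using a_inj[OF x(1)] x(2) by simp
 moreover have "pz (fst y) z = 0" if "z \<in> pair y" for z using that on[OF y(1)] y(2) by (auto simp: pair_def)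
 then have "pz (fst y) (a (fst x) (snd x)) = 0 \<and> pz (fst y) (a (fst x) (Suc (snd x))) = 0" unfolding e by (simp add: pair_def)
 ultimately show ?thesis using dual_line by blast
qed

lemma finite_arcs: "A \<subseteq> {x. fst x \<in> W \<and> Suc (snd x) < k (fst x)} ==> finite A"
proof (rule finite_subset)
 assume A: "A \<subseteq> {x. fst x \<in> W \<and> Suc (snd x) < k (fst x)}"
 show "A \<subseteq> (SIGMA w:W. {..<k w})"
 proof
  fix x assume "x \<in> A"
  then have "fst x \<in> W" "Suc (snd x) < k (fst x)" using A by blast+
  then show "x \<in> (SIGMA w:W. {..<k w})" by (cases x) simp
 qed
qed (use finW in simp)

lemma dual_dir_nonzero:
 assumes "fst x \<in> W" "Suc (snd x) < k (fst x)"
 shows "dual_dir (a (fst x) (snd x)) (a (fst x) (Suc (snd x))) ~= 0"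
 using a_inj[OF assms(1), of "snd x" "Suc (snd x)"] assms(2) by (simp add: dual_dir_def zero_prod_def)

text \<open>\<open>lens_count\<close> is applied inside each cell of the space of circles, where at
  most \<open>n\<close> circles live. A pair of ends is a line in that space, enters at most
  \<open>e + 1\<close> cells, and is counted once in each. The factor 800 is 400 for the two signs
  of every circle.\<close>

theorem arcs_off_zero_set:
 fixes Z :: "complex\<times>real => 'b"
 assumes A: "A \<subseteq> {x. fst x \<in> W \<and> Suc (snd x) < k (fst x)}" and F: "rpd e F" and nz: "!!x. x \<in> A ==> F (fst x) ~= 0"
  and Z: "path_invariant F Z"
  and n: "n \<ge> 0" "!!w. F w ~= 0 ==> real (card {w'\<in>W. Z w' = Z w}) \<le> n"
 shows "real (card A) \<le> (real e + 1)*real (card (pair ` A)) + 800*real (card W) * sqrt (2*n)*(1 + ln (1 + 2*n))"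
proof -
 define c where "c x = Z (fst x)" for x :: "(complex\<times>real)\<times>nat"
 have finA: "finite A" by (rule finite_arcs[OF A])
 define Ak where "Ak y = {x\<in>A. c x = y}" for y
 define Wk where "Wk y = {w\<in>W. Z w = y}" for y
 let ?D = "1 + ln (1 + 2*n)"
 define S where "S = 800 * sqrt (2*n)*?D"
 have cls: "real (card (Ak y)) \<le> real (card (pair ` Ak y)) + real (card (Wk y))*S" if y: "y \<in> c ` A" for y
 proof -
  obtain x0 where x0: "x0 \<in> A" "y = Z (fst x0)" using y by (auto simp: c_def)
  have sub: "Wk y \<subseteq> W" by (auto simp: Wk_def)
  have finWk: "finite (Wk y)" by (rule finite_subset[OF sub finW])
  interpret K: circular_lists "Wk y" k a
  proof (unfold_locales)
   show "finite (Wk y)" by (rule finWk)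
   show "3 \<le> k w" if "w \<in> Wk y" for w using k3 that sub by blast
   show "pz w (a w i) = 0" if "w \<in> Wk y" "i < k w" for w i using on that sub by blast
   show "0 < ccw (a w i) (a w j) (a w l)" if "w \<in> Wk y" "i < j" "j < l" "l < k w" for w i j l using conv that sub by blast
  qed
  let ?A = "real (2 * card (Wk y))"
  have "Ak y \<subseteq> {x. fst x \<in> Wk y \<and> Suc (snd x) < k (fst x)}" using A by (auto simp: Ak_def Wk_def c_def)
  from K.lens_count[OF this]
  have 1: "real (card (Ak y)) \<le> real (card (pair ` Ak y)) + 400*(real (2 * card (Wk y)) * sqrt ?A)*(1 + ln ?A)" .
  have n1: "real (card (Wk y)) \<ge> 1"
  proof -
   have "fst x0 \<in> Wk y" using x0 A by (auto simp: Wk_def)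
   then have "card (Wk y) ~= 0" using finWk by auto
   then show ?thesis by simp
  qed
  have n2: "real (card (Wk y)) \<le> n" using n(2)[OF nz[OF x0(1)]] unfolding Wk_def x0(2) .
  have "sqrt ?A \<le> sqrt (2*n)" using n2 by simp
  moreover have "1 + ln ?A \<le> 1 + ln (1 + 2*n)" using n1 n2 by simp
  moreover have "0 \<le> ln ?A" using n1 by simp
  ultimately have "sqrt ?A*(1 + ln ?A) \<le> sqrt (2*n)*?D" using n2 n1 by (intro mult_mono) auto
  then have "800*real (card (Wk y))*(sqrt ?A*(1 + ln ?A)) \<le> 800*real (card (Wk y))*(sqrt (2*n)*?D)" by (intro mult_left_mono) auto
  then show ?thesis using 1 by (simp add: S_def mult_ac)
 qed
 have S0: "S \<ge> 0" unfolding S_def using n(1) by simp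
 have "real (card A) = (\<Sum>y\<in>c ` A. real (card (Ak y)))"
  using sum.group[OF finA finite_imageI[OF finA], of c c "\<lambda>_. 1::real"] by (simp add: Ak_def)
 also have "... \<le> (\<Sum>y\<in>c ` A. real (card (pair ` Ak y)) + real (card (Wk y))*S)" by (rule sum_mono[OF cls])
 also have "... = real (\<Sum>y\<in>c ` A. card (pair ` Ak y)) + real (\<Sum>y\<in>c ` A. card (Wk y))*S" by (simp add: sum.distrib sum_distrib_right)
 also have "(\<Sum>y\<in>c ` A. card (Wk y)) \<le> card W"
 proof -
  have "(\<Sum>y\<in>c ` A. card (Wk y)) = card (\<Union>y\<in>c ` A. Wk y)" using finA finW by (subst card_UN_disjoint) (auto simp: Wk_def)
  also have "... \<le> card W" by (rule card_mono[OF finW]) (auto simp: Wk_def)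
  finally show ?thesis .
 qed
 also have "(\<Sum>y\<in>c ` A. card (pair ` Ak y)) \<le> (e + 1) * card (pair ` A)"
 proof -
  \<comment> \<open>Pairs of ends together with a cell in which they occur. The fibre over one pair
    consists of labels met by its dual line.\<close>
  define Q where "Q = (\<lambda>x. (c x, pair x)) ` A"
  have finQ: "finite Q" using finA by (simp add: Q_def)
  have "(\<Sum>y\<in>c ` A. card (pair ` Ak y)) = card (SIGMA y:c ` A. pair ` Ak y)" using finA by (simp add: Ak_def)
  also have "(SIGMA y:c ` A. pair ` Ak y) = Q"
  proof (rule equalityI; rule subsetI)
   fix z assume "z \<in> (SIGMA y:c ` A. pair ` Ak y)"
   then obtain x where "x \<in> A" "fst z = c x" "snd z = pair x" by (auto simp: Ak_def)
   then have "x \<in> A \<and> z = (c x, pair x)" by (simp add: prod_eq_iff)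
   then show "z \<in> Q" unfolding Q_def by blast
  next
   fix z assume "z \<in> Q"
   then show "z \<in> (SIGMA y:c ` A. pair ` Ak y)" unfolding Q_def Ak_def by blast
  qed
  also have "card Q \<le> (e + 1) * card (snd ` Q)"
  proof (rule card_fibres_le[OF finQ])
   fix y assume "y \<in> snd ` Q"
   then obtain x where x: "x \<in> A" "y = pair x" by (auto simp: Q_def)
   have xW: "fst x \<in> W" "Suc (snd x) < k (fst x)" using x(1) A by auto
   define d where "d = dual_dir (a (fst x) (snd x)) (a (fst x) (Suc (snd x)))"
   define f where "f t = fst x + t *R d" for t
   have "F (fst x + 0 *R d) ~= 0" using nz[OF x(1)] by simp
   note zl = zeros_on_line[OF F this]
   have finz: "finite {s. F (f s) = 0}" unfolding f_def by (rule zl(1))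
   have cont: "continuous_on T f" for T unfolding f_def by (intro continuous_intros)
   note cp = cells_on_path[OF finz cont Z]
   let ?B = "\<lambda>s. Z (f s)"
   let ?C = "{s. F (f s) ~= 0}"
   have "fst ` {z \<in> Q. snd z = y} \<subseteq> ?B ` ?C"
   proof (rule image_subsetI)
    fix z assume "z \<in> {z \<in> Q. snd z = y}"
    then obtain x' where x': "x' \<in> A" "z = (c x', pair x')" "pair x' = pair x" using x(2) by (auto simp: Q_def)
    have x'W: "fst x' \<in> W" "Suc (snd x') < k (fst x')" using x'(1) A by auto
    obtain t where t: "fst x' = f t" using arc_line[OF xW x'W x'(3)] unfolding f_def d_def by blast
    have "F (f t) ~= 0" using nz[OF x'(1)] t by simp
    moreover have "fst z = Z (f t)" using x'(2) t by (simp add: c_def)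
    ultimately show "fst z \<in> ?B ` ?C" by blast
   qed
   then have "card (fst ` {z \<in> Q. snd z = y}) \<le> card (?B ` ?C)" by (rule card_mono[OF cp(1)])
   also have "... \<le> e + 1" using cp(2) zl(2) unfolding f_def by linarith
   also have "card (fst ` {z \<in> Q. snd z = y}) = card {z \<in> Q. snd z = y}" by (rule card_image) (auto simp: inj_on_def prod_eq_iff)
   finally show "card {z \<in> Q. snd z = y} \<le> e + 1" .
  qed
  also have "snd ` Q = pair ` A" by (auto simp: Q_def image_image)
  finally show ?thesis .
 qed
 finally have "real (card A) \<le> real ((e + 1) * card (pair ` A)) + real (card W)*S" using S0 by (simp add: mult_right_mono)
 then show ?thesis by (simp add: S_def algebra_simps)
qed

text \<open>Orders of vanishing once more, at a circle \<open>w\<close> and along the dual lines of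
  its arcs. If the order of the line is smaller, \<open>w\<close> is one of at most \<open>e\<close>
  zeros of a derivative on that line. Otherwise the arc is in \<open>Bd\<close>, and its line lies
  in the zero set of a derivative whose gradient at \<open>w\<close> is not zero. Two consecutive
  such arcs determine the direction of that gradient, so they occur at most once on
  \<open>w\<close>, and roughly half of the arcs of \<open>w\<close> are outside
  \<open>Bd\<close>.\<close>

theorem arcs_on_zero_set:
 assumes F: "rpd e F" "F w0 ~= 0" and z: "!!w. w \<in> W ==> F w = 0"
 obtains Bd where "!!w. w \<in> W ==> k w - 1 \<le> 2 * card {i. Suc i < k w \<and> (w, i) \<notin> Bd} + 2"
  "!!A. A \<subseteq> {x. fst x \<in> W \<and> Suc (snd x) < k (fst x)} ==> card (A - Bd) \<le> e * card (pair ` A)"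
proof -
 obtain u where u: "!!w. w \<in> W ==> F (w + u) ~= 0" using avoiding_direction[OF F finW] by blast
 have ex: "\<exists>n. (dd u ^^ n) F w ~= 0" if "w \<in> W" for w using some_ddn_nonzero[OF F(1) u[OF that]] .
 define j where "j w = (LEAST n. (dd u ^^ n) F w ~= 0)" for w
 define Ln where "Ln P = {w. \<forall>p\<in>P. pz w p = 0}" for P :: "complex set"
 define jl where "jl P = (LEAST n. \<exists>y\<in>Ln P. (dd u ^^ n) F y ~= 0)" for P
 have j: "(dd u ^^ j w) F w ~= 0" if "w \<in> W" for w unfolding j_def by (rule LeastI_ex[OF ex[OF that]])
 have j1: "j w \<ge> 1" if w: "w \<in> W" for w
 proof -
  have "j w ~= 0"
  proof
   assume "j w = 0"
   then show False using j[OF w] z[OF w] by simp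
  qed
  then show ?thesis by simp
 qed
 have inLn: "fst x \<in> Ln (pair x)" if "fst x \<in> W" "Suc (snd x) < k (fst x)" for x using on[OF that(1)] that(2) by (simp add: Ln_def pair_def)
 have jl: "\<exists>y\<in>Ln P. (dd u ^^ jl P) F y ~= 0" if "w \<in> W" "w \<in> Ln P" for w P
  unfolding jl_def by (rule LeastI_ex) (use ex[OF that(1)] that(2) in blast)
 have jl_less: "(dd u ^^ n) F y = 0" if "n < jl P" "y \<in> Ln P" for n y P using not_less_Least[OF that(1)[unfolded jl_def]] that(2) by blast
 have jl_le: "jl P \<le> j w" if "w \<in> W" "w \<in> Ln P" for w P
  unfolding jl_def by (rule Least_le[of "\<lambda>n. \<exists>y\<in>Ln P. (dd u ^^ n) F y ~= 0"]) (use j[OF that(1)] that(2) in blast)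
 define Bd where "Bd = {x. jl (pair x) = j (fst x)}"
 have LnW: "Ln (pair x) = {w. pz w (a (fst x) (snd x)) = 0 \<and> pz w (a (fst x) (Suc (snd x))) = 0}" for x by (auto simp: Ln_def pair_def)
 have line: "y \<in> Ln (pair x) \<longleftrightarrow> (\<exists>t. y = fst x + t *R dual_dir (a (fst x) (snd x)) (a (fst x) (Suc (snd x))))"
  if x: "fst x \<in> W" "Suc (snd x) < k (fst x)" for x y
  unfolding LnW mem_Collect_eq
  by (rule dual_line) (use a_inj[OF x(1), of "snd x" "Suc (snd x)"] x(2) on[OF x(1)] in simp_all)
 show ?thesis
 proof (rule that[of Bd])
  fix w assume w: "w \<in> W"
  define B where "B = {i. Suc i < k w \<and> (w, i) \<in> Bd}"
  define h where "h = (dd u ^^ (j w - 1)) F"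
  have rh: "rpd e h" unfolding h_def by (rule rpd_ddn[OF F(1)])
  have "dd u h = (dd u ^^ Suc (j w - 1)) F" by (simp add: h_def)
  also have "Suc (j w - 1) = j w" using j1[OF w] by simp
  finally have hnz: "dd u h w ~= 0" using j[OF w] by simp
  obtain N where N: "\<forall>y. dd y h w = y\<bullet>N" using gradient_exists[OF rh] ..
  have N0: "N ~= 0" using hnz N by auto
  have perp: "dual_dir (a w i) (a w (Suc i))\<bullet>N = 0" if i: "i \<in> B" for i
  proof -
   define x where "x = (w, i)"
   have x: "fst x \<in> W" "Suc (snd x) < k (fst x)" "jl (pair x) = j w" using i w by (simp_all add: x_def B_def Bd_def)
   define d where "d = dual_dir (a w i) (a w (Suc i))"
   have zero: "h (w + t *R d) = 0" for t
   proof -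
    have "w + t *R d \<in> Ln (pair x)" unfolding line[OF x(1,2)] by (intro exI[of _ t]) (simp add: x_def d_def)
    then show ?thesis unfolding h_def using jl_less[of "j w - 1" "pair x"] x(3) j1[OF w] by simp
   qed
   have "((\<lambda>t. h (w + t *R d)) has_real_derivative dd d h (w + 0 *R d)) (at 0)" by (rule dd_line[OF rh])
   then have "((\<lambda>t. 0) has_real_derivative dd d h w) (at 0)" unfolding zero by simp
   from DERIV_unique[OF this DERIV_const] have "dd d h w = 0" .
   then show ?thesis using N unfolding d_def by simp
  qed
  \<comment> \<open>Two neighbouring arcs in \<open>Bd\<close> at the vertex
    \<open>a w (Suc i)\<close> make the gradient a multiple of \<open>(a w (Suc i), 1)\<close>;
    different vertices would make it zero.\<close>
  have adj: "fst N = snd N *R a w (Suc i)" if "i \<in> B" "Suc i \<in> B" for i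
  proof (rule dual_gradient_at_vertex[OF perp[OF that(1)] perp[OF that(2)]])
   show "ccw (a w i) (a w (Suc i)) (a w (Suc (Suc i))) ~= 0" using conv[OF w, of i "Suc i" "Suc (Suc i)"] that(2) by (simp add: B_def)
  qed
  have eqadj: "i = i'" if i: "i \<in> B" "Suc i \<in> B" and i': "i' \<in> B" "Suc i' \<in> B" for i i'
  proof (rule ccontr)
   assume "i ~= i'"
   then have "a w (Suc i) ~= a w (Suc i')" using a_inj[OF w, of "Suc i" "Suc i'"] i i' by (simp add: B_def)
   moreover have "snd N *R a w (Suc i) = snd N *R a w (Suc i')" by (simp only: adj[OF i, symmetric] adj[OF i', symmetric])
   ultimately have "snd N = 0" by (metis scaleR_cancel_left)
   then have "N = 0" using adj[OF i] by (simp add: prod_eq_iff)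
   then show False using N0 by simp
  qed
  let ?A = "{i. i \<in> B \<and> Suc i \<in> B}"
  let ?C = "{i. Suc i < k w \<and> (w, i) \<notin> Bd}"
  have "card ?A \<le> 1"
  proof (cases "?A = {}")
   case False
   then obtain i where "i \<in> B" "Suc i \<in> B" by blast
   then have "?A \<subseteq> {i}" using eqadj by blast
   from card_mono[OF _ this] show ?thesis by simp
  next
   case True
   show ?thesis unfolding True by simp
  qed
  moreover have "B \<subseteq> {..<k w - 1}" by (auto simp: B_def)
  ultimately have "k w - 1 \<le> 2 * card ({..<k w - 1} - B) + 2" by (rule card_with_few_adjacent)
  moreover have "{..<k w - 1} - B = ?C" by (auto simp: B_def)
  ultimately show "k w - 1 \<le> 2 * card ?C + 2" by simp
 next
  fix A assume A: "A \<subseteq> {x. fst x \<in> W \<and> Suc (snd x) < k (fst x)}"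
  have finA: "finite A" by (rule finite_arcs[OF A])
  have "card (A - Bd) \<le> e * card (pair ` (A - Bd))"
  proof (rule card_fibres_le)
   show "finite (A - Bd)" using finA by simp
   fix P assume "P \<in> pair ` (A - Bd)"
   then obtain x where x: "x \<in> A" "x \<notin> Bd" "P = pair x" by blast
   have xW: "fst x \<in> W" "Suc (snd x) < k (fst x)" using x(1) A by auto
   define d where "d = dual_dir (a (fst x) (snd x)) (a (fst x) (Suc (snd x)))"
   have d0: "d ~= 0" unfolding d_def by (rule dual_dir_nonzero[OF xW])
   obtain y where y: "y \<in> Ln (pair x)" "(dd u ^^ jl (pair x)) F y ~= 0" using jl[OF xW(1) inLn[OF xW]] by blast
   obtain t0 where t0: "y = fst x + t0 *R d" using y(1) unfolding line[OF xW] d_def by blast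
   have nzl: "(dd u ^^ jl (pair x)) F (fst x + t0 *R d) ~= 0" using y(2) t0 by simp
   note zl = zeros_on_line[OF rpd_ddn[OF F(1)] nzl]
   define Z where "Z = {t. (dd u ^^ jl (pair x)) F (fst x + t *R d) = 0}"
   let ?B = "\<lambda>t. fst x + t *R d"
   have "fst ` {x' \<in> A - Bd. pair x' = P} \<subseteq> ?B ` Z"
   proof (rule image_subsetI)
    fix x' assume "x' \<in> {x' \<in> A - Bd. pair x' = P}"
    then have x': "x' \<in> A" "x' \<notin> Bd" "pair x' = pair x" using x(3) by auto
    have x'W: "fst x' \<in> W" "Suc (snd x') < k (fst x')" using x'(1) A by auto
    obtain t where t: "fst x' = fst x + t *R d" using arc_line[OF xW x'W x'(3)] unfolding d_def by blast
    have "jl (pair x') \<le> j (fst x')" by (rule jl_le[OF x'W(1) inLn[OF x'W]])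
    moreover have "jl (pair x') ~= j (fst x')" using x'(2) by (simp add: Bd_def)
    ultimately have "jl (pair x) < j (fst x')" using x'(3) by simp
    then have "(dd u ^^ jl (pair x)) F (fst x') = 0"
     using not_less_Least[of "jl (pair x)" "\<lambda>n. (dd u ^^ n) F (fst x') ~= 0"] unfolding j_def by blast
    then have "t \<in> Z" using t by (simp add: Z_def)
    then show "fst x' \<in> ?B ` Z" using t by blast
   qed
   then have "card (fst ` {x' \<in> A - Bd. pair x' = P}) \<le> card (?B ` Z)" using zl(1) by (intro card_mono) (simp_all add: Z_def)
   also have "... \<le> card Z" by (rule card_image_le) (use zl(1) in \<open>simp add: Z_def\<close>)
   also have "... \<le> e" using zl(2) by (simp add: Z_def)
   also have "card (fst ` {x' \<in> A - Bd. pair x' = P}) = card {x' \<in> A - Bd. pair x' = P}"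
   proof (rule card_image, rule inj_onI)
    fix y y' assume y: "y \<in> {x' \<in> A - Bd. pair x' = P}" "y' \<in> {x' \<in> A - Bd. pair x' = P}" "fst y = fst y'"
    have yW: "fst y \<in> W" "Suc (snd y) < k (fst y)" "Suc (snd y') < k (fst y)" using y A by auto
    have "pair (fst y, snd y) = pair (fst y, snd y')" using y by (simp add: pair_def)
    from pair_inj[OF yW(1-3) this] show "y = y'" using y(3) by (simp add: prod_eq_iff)
   qed
   finally show "card {x' \<in> A - Bd. pair x' = P} \<le> e" .
  qed
  also have "... \<le> e * card (pair ` A)" using finA by (intro mult_left_mono card_mono) auto
  finally show "card (A - Bd) \<le> e * card (pair ` A)" .
 qed
qed

end

section \<open>Incidences in the plane by a double partition\<close>

lemma card_eq_sum_rows: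
 assumes "finite X" "finite W" "!!x. x \<in> X ==> fst x \<in> W"
 shows "card X = (\<Sum>w\<in>W. card {i. (w, i) \<in> X})"
proof -
 have fin: "finite {i. (w, i) \<in> X}" for w
 proof (rule finite_subset)
  show "{i. (w, i) \<in> X} \<subseteq> snd ` X" by force
 qed (use assms(1) in simp)
 have "X = (SIGMA w:W. {i. (w, i) \<in> X})" using assms(3) by force
 then have "card X = card (SIGMA w:W. {i. (w, i) \<in> X})" by simp
 then show ?thesis using assms(2) fin by simp
qed

lemma plane_partition:
 obtains A where "A > 0 \<and> (\<forall>S D. finite S \<and> D \<ge> (1::real) --> (\<exists>F (z :: complex => nat => real) d. rpd d F \<and> real d \<le> A*D \<and> (\<exists>x. F x ~= 0) \<and>
   (small_cells D 2 S F z) \<and>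
   (path_invariant F z)))"
proof -
 have surj: "\<exists>x::complex. \<forall>t<2. x\<bullet>(if t = 0 then 1 else \<i>) = y t" for y :: "nat => real"
  by (intro exI[of _ "Complex (y 0) (y 1)"]) (auto simp: inner_complex_def less_Suc_eq numeral_2_eq_2)
 from polynomial_partition[OF surj] that show ?thesis by (elim meta_mp[elim_format] exE) auto
qed

lemma dual_partition:
 obtains A where "A > 0 \<and> (\<forall>S D. finite S \<and> D \<ge> (1::real) --> (\<exists>F (z :: complex\<times>real => nat => real) d. rpd d F \<and> real d \<le> A*D \<and> (\<exists>x. F x ~= 0) \<and>
   (small_cells D 3 S F z) \<and>
   (path_invariant F z)))"
proof -
 have surj: "\<exists>x::complex\<times>real. \<forall>t<3. x\<bullet>(if t = 0 then (1, 0) else if t = 1 then (\<i>, 0) else (0, 1)) = y t" for y :: "nat => real"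
  by (intro exI[of _ "(Complex (y 0) (y 1), y 2)"]) (auto simp: inner_complex_def inner_prod_def less_Suc_eq numeral_2_eq_2 numeral_3_eq_3)
 from polynomial_partition[OF surj] that show ?thesis by (elim meta_mp[elim_format] exE) auto
qed

lemma card_same_class_pairs:
 assumes P: "finite P" and c: "!!p. g p ~= (0::real) ==> real (card {q\<in>P. z q = z p}) \<le> c" and c0: "c \<ge> 0"
 shows "finite {(p, q). p \<in> P \<and> q \<in> P \<and> g p ~= 0 \<and> z q = z p}" (is ?Q)
  "real (card {(p, q). p \<in> P \<and> q \<in> P \<and> g p ~= 0 \<and> z q = z p}) \<le> real (card P) * c" (is ?P)
proof -
 define P' where "P' = {p\<in>P. g p ~= 0}"
 let ?A = "\<lambda>p. {q\<in>P. z q = z p}"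
 have e: "{(p, q). p \<in> P \<and> q \<in> P \<and> g p ~= 0 \<and> z q = z p} = (SIGMA p:P'. (?A p))" by (auto simp: P'_def)
 show ?Q unfolding e using P by (simp add: P'_def)
 have "real (card (SIGMA p:P'. (?A p))) = (\<Sum>p\<in>P'. real (card (?A p)))" using P by (simp add: P'_def)
 also have "... \<le> (\<Sum>p\<in>P'. c)" by (rule sum_mono) (use c in \<open>simp add: P'_def\<close>)
 also have "... \<le> real (card P) * c" using P c0 by (simp add: P'_def mult_right_mono card_mono)
 finally show ?P unfolding e .
qed

text \<open>Both partitions act together. The cells of \<open>g\<close> in the plane limit the pairs
  of ends of clean arcs to \<open>card P * c\<close>; the cells of \<open>f\<close> in the space of
  circles limit how many clean arcs share a pair. Circles are sorted into those with few points
  (\<open>W - W3\<close>), those inside the zero set of \<open>g\<close> (\<open>WZ\<close>), and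
  those off (\<open>W1\<close>) or on (\<open>W2\<close>) the zero set of \<open>f\<close>.\<close>

lemma planar_count:
 fixes g :: "complex => real" and f :: "complex\<times>real => real"
 assumes P: "finite P" and W: "finite W"
  and g: "rpd d g" "g x0 ~= 0" and m: "path_invariant g m"
  and c: "c \<ge> 0" "!!p. g p ~= 0 ==> real (card {q\<in>P. m q = m p}) \<le> c"
  and f: "rpd e f" "f w0 ~= 0" and b: "path_invariant f b"
  and n: "n \<ge> 0" "!!w. f w ~= 0 ==> real (card {w'\<in>W. b w' = b w}) \<le> n"
 shows "real (\<Sum>w\<in>W. card (P\<inter>zc w)) \<le> (14*real d + 16)*real (card W) + real (card P) + (3*real e + 1)*(real (card P) * c)
   + 800*real (card W) * sqrt (2*n)*(1 + ln (1 + 2*n))"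
proof -
 let ?C = "\<lambda>w. P\<inter>zc w"
 \<comment> \<open>Four incidences guarantee three listed points although the list may omit one;
   \<open>circular_lists\<close> requires three.\<close>
 define W3 where "W3 = {w\<in>W. card (?C w) \<ge> 4}"
 have finW3: "finite W3" using W by (simp add: W3_def)
 have two: "\<exists>p q. p \<in> P \<and> pz w p = 0 \<and> pz w q = 0 \<and> p ~= q" if w: "w \<in> W3" for w
 proof -
  have "4 \<le> card (?C w)" using w by (simp add: W3_def)
  then obtain T where "T \<subseteq> P\<inter>zc w" "card T = 2" by (metis le_trans numeral_le_iff obtain_subset_with_card_n semiring_norm(68,71) one_le_numeral nat_le_linear)
  then show ?thesis unfolding card_2_iff zc_def by blast
 qed
 let ?E = "\<lambda>w p v u s (k::nat). norm v = 1 \<and> v\<bullet>u = 0 \<and> u ~= 0 \<and> zc w = circ p v u \<and> Re v * Im u - Im v * Re u > 0 \<and>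
   (\<forall>i j. i < j --> j < k --> s i < s j) \<and> (\<forall>i<k. cpar p v u (s i) \<in> P\<inter>zc w) \<and> card (P\<inter>zc w) \<le> k + 1"
 have "\<exists>T :: complex \<times> complex \<times> complex\<times>(nat => real)\<times>nat. (case T of (p, v, u, s, k) =>
   ?E w p v u s k)" if w: "w \<in> W3" for w
 proof -
  obtain p q where pq: "pz w p = 0" "pz w q = 0" "p ~= q" using two[OF w] by blast
  obtain v u s k where "norm v = 1" "v\<bullet>u = 0" "u ~= 0" "zc w = circ p v u" "Re v * Im u - Im v * Re u > 0"
   "!!i j. i < j ==> j < (k::nat) ==> s i < s j" "!!i. i < k ==> cpar p v u (s i) \<in> P\<inter>zc w" "card (?C w) \<le> k + 1"
   by (rule circle_enumeration[OF P pq]) (rule that)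
  then show ?thesis by (intro exI[of _ "(p, v, u, s, k)"]) simp
 qed
 then have "\<exists>T. \<forall>w\<in>W3. (case T w of (p, v, u, s, k) =>
   ?E w p v u s k)"
  by (intro bchoice ballI)
 then obtain T where T: "\<forall>w\<in>W3. (case T w of (p, v, u, s, k) =>
   ?E w p v u s k)" ..
 define p where "p w = fst (T w)" for w
 define v where "v w = fst (snd (T w))" for w
 define u where "u w = fst (snd (snd (T w)))" for w
 define s where "s w = fst (snd (snd (snd (T w))))" for w
 define k where "k w = snd (snd (snd (snd (T w))))" for w
 have C: "?E w (p w) (v w) (u w) (s w) (k w)" if "w \<in> W3" for w using bspec[OF T that] unfolding p_def v_def u_def s_def k_def case_prod_unfold .
 define a where "a w i = cpar (p w) (v w) (u w) (s w i)" for w i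
 have ck: "card (?C w) \<le> k w + 1" if "w \<in> W3" for w using C[OF that] by blast
 have k3: "k w \<ge> 3" if "w \<in> W3" for w
 proof -
  have "4 \<le> card (?C w)" using that by (simp add: W3_def)
  then show ?thesis using ck[OF that] by linarith
 qed
 have mono: "s w i < s w j" if "w \<in> W3" "i < j" "j < k w" for w i j using C[OF that(1)] that(2,3) by blast
 have aP: "a w i \<in> P" "a w i \<in> zc w" if "w \<in> W3" "i < k w" for w i using C[OF that(1)] that(2) unfolding a_def by blast+
 have cl: "circular_lists W' k a" if "W' \<subseteq> W3" for W'
 proof (unfold_locales)
  show "finite W'" by (rule finite_subset[OF that finW3])
  show "3 \<le> k w" if "w \<in> W'" for w using k3 that \<open>W' \<subseteq> W3\<close> by blast
  show "pz w (a w i) = 0" if "w \<in> W'" "i < k w" for w i using aP(2)[of w i] that \<open>W' \<subseteq> W3\<close> by (auto simp: zc_def)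
  show "0 < ccw (a w i) (a w j) (a w l)" if h: "w \<in> W'" "i < j" "j < l" "l < k w" for w i j l
  proof -
   have w: "w \<in> W3" using h(1) \<open>W' \<subseteq> W3\<close> by blast
   show ?thesis unfolding a_def by (rule ccw_cpar) (use mono[OF w] h C[OF w] in auto)
  qed
 qed
 define WZ where "WZ = {w\<in>W3. \<forall>x\<in>zc w. g x = 0}"
 define W1 where "W1 = {w\<in>W3. \<not> (\<forall>x\<in>zc w. g x = 0) \<and> f w ~= 0}"
 define W2 where "W2 = {w\<in>W3. \<not> (\<forall>x\<in>zc w. g x = 0) \<and> f w = 0}"
 have W12: "W1 \<subseteq> W3" "W2 \<subseteq> W3" "WZ \<subseteq> W3" "finite W1" "finite W2" "finite WZ" using finW3 by (auto simp: W1_def W2_def WZ_def)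
 interpret C1: circular_lists W1 k a by (rule cl[OF W12(1)])
 interpret C2: circular_lists W2 k a by (rule cl[OF W12(2)])
 define pr' where "pr' x = {a (fst x) (snd x), a (fst x) (Suc (snd x))}" for x
 have pe: "C1.pair = pr'" "C2.pair = pr'" by (simp_all add: fun_eq_iff C1.pair_def C2.pair_def pr'_def)
 \<comment> \<open>The clean arcs: both end points carry the same cell label and \<open>g\<close> is
   non-zero at the first.\<close>
 define A where "A = {x. fst x \<in> W1\<union>W2 \<and> Suc (snd x) < k (fst x) \<and> g (a (fst x) (snd x)) ~= 0 \<and> m (a (fst x) (Suc (snd x))) = m (a (fst x) (snd x))}"
 define Pi where "Pi = pr' ` A"
 let ?A = "{(p, q). p \<in> P \<and> q \<in> P \<and> g p ~= 0 \<and> m q = m p}"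
 have prs: "finite ?A"
  "real (card ?A) \<le> real (card P) * c"
  by (rule card_same_class_pairs[OF P _ c(1)], erule c(2))+
 have PiS: "Pi \<subseteq> (\<lambda>(p, q). {p, q}) ` ?A" unfolding Pi_def
 proof (rule image_subsetI)
  fix x assume x: "x \<in> A"
  then have w: "fst x \<in> W3" "snd x < k (fst x)" "Suc (snd x) < k (fst x)" using W12 by (auto simp: A_def)
  have "(a (fst x) (snd x), a (fst x) (Suc (snd x))) \<in> ?A" using aP(1)[OF w(1,2)] aP(1)[OF w(1,3)] x by (simp add: A_def)
  from imageI[OF this, of "\<lambda>(p, q). {p, q}"]
  show "pr' x \<in> (\<lambda>(p, q). {p, q}) ` ?A" by (simp add: pr'_def)
 qed
 have finPi: "finite Pi" by (rule finite_subset[OF PiS]) (use prs(1) in simp)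
 have cPi: "real (card Pi) \<le> real (card P) * c"
 proof -
  have "card Pi \<le> card ((\<lambda>(p, q). {p, q}) ` ?A)" by (rule card_mono[OF _ PiS]) (use prs(1) in simp)
  also have "... \<le> card ?A" by (rule card_image_le[OF prs(1)])
  finally show ?thesis using prs(2) by simp
 qed
 \<comment> \<open>An arc that is not clean contains a zero of \<open>g\<close>. There are at most
   \<open>2*d + 1\<close> zeros on the parametrised circle, each in at most two closed arcs.\<close>
 have nonclean: "card {i. Suc i < k w \<and> (w, i) \<notin> A} \<le> 4*d + 2" if w: "w \<in> W1\<union>W2" for w
 proof -
  have w3: "w \<in> W3" using w W12 by blast
  obtain x where x: "x \<in> zc w" "g x ~= 0" using w by (auto simp: W1_def W2_def)
  note Cw = C[OF w3]
  define Z where "Z = {t. g (cpar (p w) (v w) (u w) t) = 0}"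
  have "x \<in> circ (p w) (v w) (u w)" using x(1) Cw by simp
  note zz = zeros_along_cpar[OF g(1) _ _ _ this x(2), folded Z_def]
  have Z: "finite Z" "card Z \<le> 2*d + 1" using zz Cw by simp_all
  have "{i. Suc i < k w \<and> (w, i) \<notin> A} \<subseteq> {i. Suc i < k w \<and> (\<exists>z\<in>Z. s w i \<le> z \<and> z \<le> s w (Suc i))}"
  proof
   fix i assume "i \<in> {i. Suc i < k w \<and> (w, i) \<notin> A}"
   then have i: "Suc i < k w" "(w, i) \<notin> A" by auto
   have le: "s w i \<le> s w (Suc i)" using mono[OF w3, of i "Suc i"] i by simp
   have "\<exists>z\<in>Z. s w i \<le> z \<and> z \<le> s w (Suc i)"
   proof (rule ccontr)
    assume "\<not> ?thesis"
    then have nz: "\<forall>t\<in>{s w i..s w (Suc i)}. g (cpar (p w) (v w) (u w) t) ~= 0" by (auto simp: Z_def)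
    then have "m (a w i) = m (a w (Suc i))" unfolding a_def
     using m[rule_format, of "s w i" "s w (Suc i)" "cpar (p w) (v w) (u w)"] le continuous_on_cpar by blast
    moreover have "g (a w i) ~= 0" unfolding a_def using nz le by simp
    ultimately have "(w, i) \<in> A" using w i(1) by (simp add: A_def)
    then show False using i(2) by simp
   qed
   then show "i \<in> {i. Suc i < k w \<and> (\<exists>z\<in>Z. s w i \<le> z \<and> z \<le> s w (Suc i))}" using i(1) by simp
  qed
  moreover have "finite {i. Suc i < k w \<and> (\<exists>z\<in>Z. s w i \<le> z \<and> z \<le> s w (Suc i))}"
   by (rule finite_subset[of _ "{..<k w}"]) auto
  ultimately have "card {i. Suc i < k w \<and> (w, i) \<notin> A} \<le> card {i. Suc i < k w \<and> (\<exists>z\<in>Z. s w i \<le> z \<and> z \<le> s w (Suc i))}"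
   by (rule card_mono[rotated])
  also have "... \<le> 2 * card Z" by (rule card_arcs_meeting_zeros[OF Z(1)]) (use mono[OF w3] in blast)
  finally show ?thesis using Z(2) by simp
 qed
 define A1 where "A1 = {x\<in>A. fst x \<in> W1}"
 define A2 where "A2 = {x\<in>A. fst x \<in> W2}"
 let ?K = "{x. fst x \<in> W2 \<and> Suc (snd x) < k (fst x)}"
 have A1s: "A1 \<subseteq> {x. fst x \<in> W1 \<and> Suc (snd x) < k (fst x)}" and A2s: "A2 \<subseteq> ?K" by (auto simp: A1_def A2_def A_def)
 have finA1: "finite A1" by (rule C1.finite_arcs[OF A1s])
 have finA2: "finite A2" by (rule C2.finite_arcs[OF A2s])
 have pA: "card (pr' ` A1) \<le> card Pi" "card (pr' ` A2) \<le> card Pi" by (rule card_mono[OF finPi]; auto simp: Pi_def A1_def A2_def)+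
 obtain Bd where Bd: "!!w. w \<in> W2 ==> k w - 1 \<le> 2 * card {i. Suc i < k w \<and> (w, i) \<notin> Bd} + 2"
  "!!A. A \<subseteq> ?K ==> card (A - Bd) \<le> e * card (pr' ` A)"
  unfolding pe(2)[symmetric] by (rule C2.arcs_on_zero_set[OF f, of ]) (auto simp: W2_def intro: that)
 let ?L = "real e + 1"
 have L1: "real (card A1) \<le> ?L*real (card (pr' ` A1)) + 800*real (card W1) * sqrt (2*n)*(1 + ln (1 + 2*n))" unfolding pe(1)[symmetric]
 proof (rule C1.arcs_off_zero_set[OF A1s f(1) _ b n(1)])
  show "f (fst x) ~= 0" if "x \<in> A1" for x using that by (simp add: A1_def W1_def)
  show "real (card {w' \<in> W1. b w' = b w}) \<le> n" if "f w ~= 0" for w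
  proof -
   have "card {w' \<in> W1. b w' = b w} \<le> card {w' \<in> W. b w' = b w}" using W by (intro card_mono) (auto simp: W1_def W3_def)
   then show ?thesis using n(2)[OF that] by simp
  qed
 qed
 let ?G = "\<lambda>w. {i. (w, i) \<in> A1}"
 have S1: "(\<Sum>w\<in>W1. card (?C w)) \<le> card A1 + (4*d + 4) * card W1"
 proof -
  have "card (?C w) \<le> card (?G w) + (4*d + 4)" if w: "w \<in> W1" for w
  proof -
   have "w \<in> W3" using w W12 by blast
   have fin: "finite (?G w)" by (rule finite_subset[of _ "snd ` A1"]) (use finA1 in force)+
   let ?B = "{i. Suc i < k w \<and> (w, i) \<notin> A}"
   have "{..<k w - 1} \<subseteq> (?G w)\<union>?B" using w by (auto simp: A1_def)
   moreover have fin2: "finite ?B" by (rule finite_subset[of _ "{..<k w}"]) auto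
   ultimately have "card {..<k w - 1} \<le> card ((?G w)\<union>?B)" using fin by (intro card_mono) auto
   also have "... \<le> card (?G w) + card ?B" by (rule card_Un_le)
   finally have "k w - 1 \<le> card (?G w) + card ?B" by simp
   moreover have "card ?B \<le> 4*d + 2" using w by (intro nonclean) simp
   ultimately show ?thesis using ck[OF \<open>w \<in> W3\<close>] by linarith
  qed
  then have "(\<Sum>w\<in>W1. card (?C w)) \<le> (\<Sum>w\<in>W1. card (?G w) + (4*d + 4))" by (rule sum_mono)
  also have "... = card A1 + (4*d + 4) * card W1"
  proof -
   have "card A1 = (\<Sum>w\<in>W1. card (?G w))" by (rule card_eq_sum_rows[OF finA1 W12(4)]) (simp add: A1_def)
   then show ?thesis unfolding sum.distrib by (simp add: algebra_simps)
  qed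
  finally show ?thesis .
 qed
 let ?D = "\<lambda>w. {i. (w, i) \<in> A2 - Bd}"
 have S2: "(\<Sum>w\<in>W2. card (?C w)) \<le> 2 * card (A2 - Bd) + (8*d + 8) * card W2"
 proof -
  have fin3: "finite (A2 - Bd)" using finA2 by simp
  have "card (?C w) \<le> 2 * card (?D w) + (8*d + 8)" if w: "w \<in> W2" for w
  proof -
   have "w \<in> W3" using w W12 by blast
   have fin: "finite (?D w)" by (rule finite_subset[of _ "snd ` A2"]) (use finA2 in force)+
   let ?F = "{i. Suc i < k w \<and> (w, i) \<notin> A}"
   let ?H = "{i. Suc i < k w \<and> (w, i) \<notin> Bd}"
   have "?H \<subseteq> (?D w)\<union>?F" using w by (auto simp: A2_def)
   moreover have fin2: "finite ?F" by (rule finite_subset[of _ "{..<k w}"]) auto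
   ultimately have "card ?H \<le> card ((?D w)\<union>?F)" using fin by (intro card_mono) auto
   also have "... \<le> card (?D w) + card ?F" by (rule card_Un_le)
   finally have "card ?H \<le> card (?D w) + (4*d + 2)" using nonclean[of w] w by simp
   moreover have "card (?C w) \<le> k w + 1" using C[OF \<open>w \<in> W3\<close>] by blast
   ultimately show ?thesis using Bd(1)[OF w] by linarith
  qed
  then have "(\<Sum>w\<in>W2. card (?C w)) \<le> (\<Sum>w\<in>W2. 2 * card (?D w) + (8*d + 8))" by (rule sum_mono)
  also have "... = 2*(\<Sum>w\<in>W2. card (?D w)) + (8*d + 8) * card W2" unfolding sum.distrib sum_distrib_left by (simp add: algebra_simps)
  also have "(\<Sum>w\<in>W2. card (?D w)) = card (A2 - Bd)" by (rule card_eq_sum_rows[OF fin3 W12(5), symmetric]) (auto simp: A2_def)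
  finally show ?thesis .
 qed
 have SZ: "(\<Sum>w\<in>WZ. card (?C w)) \<le> (2*d + 1) * card WZ + card P"
 proof (rule incidences_in_zero_set[OF g P W12(6)])
  show "\<exists>p q. pz w p = 0 \<and> pz w q = 0 \<and> p ~= q" if "w \<in> WZ" for w using two[of w] that W12(3) by blast
  show "g x = 0" if "w \<in> WZ" "x \<in> zc w" for w x using that by (simp add: WZ_def)
 qed
 have S0: "(\<Sum>w\<in>W - W3. card (?C w)) \<le> 3 * card (W - W3)"
 proof -
  have "(\<Sum>w\<in>W - W3. card (?C w)) \<le> (\<Sum>w\<in>W - W3. 3)" by (rule sum_mono) (auto simp: W3_def)
  then show ?thesis by simp
 qed
 have parts: "W = (W - W3)\<union>(WZ\<union>(W1\<union>W2))" by (auto simp: W3_def WZ_def W1_def W2_def)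
 have dj: "(W - W3)\<inter>(WZ\<union>(W1\<union>W2)) = {}" "WZ\<inter>(W1\<union>W2) = {}" "W1\<inter>W2 = {}" by (auto simp: WZ_def W1_def W2_def)
 have sumW: "(\<Sum>w\<in>W. h w) = (\<Sum>w\<in>W - W3. h w) + ((\<Sum>w\<in>WZ. h w) + ((\<Sum>w\<in>W1. h w) + (\<Sum>w\<in>W2. h w)))" for h :: "_ => nat"
  by (subst parts) (use W W12 dj in \<open>simp add: sum.union_disjoint\<close>)
 define n0 nz n1 n2 where "n0 = card (W - W3)" and "nz = card WZ" and "n1 = card W1" and "n2 = card W2"
 have cW: "card W = n0 + (nz + (n1 + n2))" using sumW[of "\<lambda>_. 1"] by (simp add: n0_def nz_def n1_def n2_def)
 define t where "t = sqrt (2*n)*(1 + ln (1 + 2*n))"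
 have t0: "t \<ge> 0" using n(1) by (simp add: t_def)
 let ?J = "real (card P) * c"
 have "(\<Sum>w\<in>W. card (?C w)) \<le> 3*n0 + ((2*d + 1)*nz + card P) + (card A1 + (4*d + 4)*n1) + (2 * card (A2 - Bd) + (8*d + 8)*n2)"
  unfolding sumW n0_def nz_def n1_def n2_def using S0 SZ S1 S2 by linarith
 also have "... \<le> (14*d + 16) * card W + card P + card A1 + 2 * card (A2 - Bd)"
 proof -
  show ?thesis using cW by (simp add: ring_sq)
 qed
 finally have "real (\<Sum>w\<in>W. card (?C w)) \<le> real ((14*d + 16) * card W + card P + card A1 + 2 * card (A2 - Bd))" unfolding of_nat_le_iff .
 also have "... = (14*real d + 16)*real (card W) + real (card P) + real (card A1) + 2*real (card (A2 - Bd))" by simp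
 also have "real (card A1) \<le> ?L*?J + 800*real (card W)*t"
 proof -
  have "?L*real (card (pr' ` A1)) \<le> ?L*?J" using pA(1) cPi by (intro mult_left_mono) auto
  moreover have "800*real (card W1)*t \<le> 800*real (card W)*t" using t0 cW by (intro mult_right_mono) (auto simp: n1_def)
  moreover have "real (card A1) \<le> ?L*real (card (pr' ` A1)) + 800*real (card W1)*t" using L1 unfolding t_def by (simp only: mult.assoc)
  ultimately show ?thesis by linarith
 qed
 also have "real (card (A2 - Bd)) \<le> real e*?J"
 proof -
  have "real (card (A2 - Bd)) \<le> real (e * card (pr' ` A2))" unfolding of_nat_le_iff by (rule Bd(2)[OF A2s])
  also have "... = real e*real (card (pr' ` A2))" by simp
  also have "... \<le> real e*?J" using pA(2) cPi by (intro mult_left_mono) auto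
  finally show ?thesis .
 qed
 finally show ?thesis by (simp add: t_def algebra_simps)
qed

theorem planar_parametric:
 obtains K :: real where "K > 0" "!!P W D r. [|finite P; finite W; D \<ge> 1; r \<ge> 1|] ==>
  real (\<Sum>w\<in>W. card (P\<inter>zc w)) \<le> K*(real (card W)*D + r*((real (card P))\<^sup>2/D\<^sup>2)
   + real (card W) * sqrt (real (card W)/r^3)*(1 + ln (1 + 4*(real (card W)/r^3))) + real (card P))"
proof -
 obtain A1 where A1: "A1 > 0 \<and> (\<forall>S D. finite S \<and> D \<ge> (1::real) --> (\<exists>F (z :: complex => nat => real) d. rpd d F \<and> real d \<le> A1*D \<and> (\<exists>x. F x ~= 0) \<and>
   (small_cells D 2 S F z) \<and>
   (path_invariant F z)))"
  by (rule plane_partition)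
 obtain A2 where A2: "A2 > 0 \<and> (\<forall>S D. finite S \<and> D \<ge> (1::real) --> (\<exists>F (z :: complex\<times>real => nat => real) d. rpd d F \<and> real d \<le> A2*D \<and> (\<exists>x. F x ~= 0) \<and>
   (small_cells D 3 S F z) \<and>
   (path_invariant F z)))"
  by (rule dual_partition)
 define K where "K = 14*A1 + 6*A2 + 2000"
 show ?thesis
 proof (rule that[of K])
  show "K > 0" using A1 A2 by (simp add: K_def)
  fix P :: "complex set" and W :: "(complex\<times>real) set" and D r :: real
  assume P: "finite P" and W: "finite W" and D: "D \<ge> 1" and r: "r \<ge> 1"
  define n m where "n = real (card W)" and "m = real (card P)"
  from conjunct2[OF A1, rule_format, OF conjI[OF P D]]
  obtain g and z :: "complex => nat => real" and d where g: "rpd d g \<and> real d \<le> A1*D \<and> (\<exists>x. g x ~= 0) \<and>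
   (small_cells D 2 P g z) \<and>
   (path_invariant g z)" by (elim exE) (rule that)
  from conjunct2[OF A2, rule_format, OF conjI[OF W r]]
  obtain f and a :: "complex\<times>real => nat => real" and e where f: "rpd e f \<and> real e \<le> A2*r \<and> (\<exists>x. f x ~= 0) \<and>
   (\<forall>p. f p ~= 0 --> r^3 * card {q\<in>W. a q = a p} \<le> 2 * card W) \<and>
   (path_invariant f a)" by (elim exE) (rule that)
  note g1 = conjunct1[OF g] and g2 = conjunct1[OF conjunct2[OF g]] and g3 = conjunct1[OF conjunct2[OF conjunct2[OF g]]]
   and g4 = conjunct1[OF conjunct2[OF conjunct2[OF conjunct2[OF g]]]] and g5 = conjunct2[OF conjunct2[OF conjunct2[OF conjunct2[OF g]]]]
  note f1 = conjunct1[OF f] and f2 = conjunct1[OF conjunct2[OF f]] and f3 = conjunct1[OF conjunct2[OF conjunct2[OF f]]]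
   and f4 = conjunct1[OF conjunct2[OF conjunct2[OF conjunct2[OF f]]]] and f5 = conjunct2[OF conjunct2[OF conjunct2[OF conjunct2[OF f]]]]
  obtain x0 where x0: "g x0 ~= 0" using g3 ..
  obtain w0 where w0: "f w0 ~= 0" using f3 ..
  define c where "c = 2*m/D\<^sup>2"
  define \<nu> where "\<nu> = 2*(n/r^3)"
  have D2: "D\<^sup>2 > 0" and r3: "r^3 > 0" using D r by simp_all
  have c0: "c \<ge> 0" and \<nu>0: "\<nu> \<ge> 0" using D2 r3 by (simp_all add: c_def \<nu>_def m_def n_def)
  have cc: "real (card {q \<in> P. z q = z p}) \<le> c" if "g p ~= 0" for p using g4[rule_format, OF that] D2 by (simp add: c_def m_def field_simps)
  have \<nu>\<nu>: "real (card {q \<in> W. a q = a p}) \<le> \<nu>" if "f p ~= 0" for p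
   using f4[rule_format, OF that] r3 by (simp add: \<nu>_def n_def field_simps)
  let ?B = "\<Sum>w\<in>W. card (P\<inter>zc w)"
  have main: "real ?B \<le> (14*real d + 16)*n + m + (3*real e + 1)*(m * c) + 800*n * sqrt (2*\<nu>)*(1 + ln (1 + 2*\<nu>))"
   unfolding n_def m_def by (rule planar_count[OF P W g1 x0 g5 c0 cc f1 w0 f5 \<nu>0 \<nu>\<nu>])
  have n0: "n \<ge> 0" and m0: "m \<ge> 0" by (simp_all add: n_def m_def)
  define x where "x = n/r^3"
  have x0': "x \<ge> 0" using n0 r3 by (simp add: x_def)
  define l where "l = n * sqrt x*(1 + ln (1 + 4*x))"
  have l0: "l \<ge> 0" using n0 x0' by (simp add: l_def)
  let ?A = "r*(m\<^sup>2/D\<^sup>2)"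
  have "800*n * sqrt (2*\<nu>)*(1 + ln (1 + 2*\<nu>)) = 1600*l"
  proof -
   have "sqrt (2*\<nu>) = 2 * sqrt x" using real_sqrt_mult[of 4 x] by (simp add: \<nu>_def x_def)
   then show ?thesis by (simp add: l_def \<nu>_def x_def)
  qed
  moreover have "(14*real d + 16)*n \<le> K*(n*D)"
  proof -
   have "14*real d + 16 \<le> 14*(A1*D) + 16*D" using g2 D by linarith
   also have "... \<le> K*D"
   proof -
    show ?thesis using A2 D by (simp add: ring_sq K_def)
   qed
   finally have "(14*real d + 16)*n \<le> (K*D)*n" using n0 by (rule mult_right_mono)
   then show ?thesis by (simp add: mult_ac)
  qed
  moreover have "(3*real e + 1)*(m * c) \<le> K*?A"
  proof -
   have "3*real e + 1 \<le> 3*(A2*r) + 1*r" using f2 r by linarith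
   also have "... \<le> (K/2)*r"
   proof -
    show ?thesis using A1 r by (simp add: ring_sq K_def)
   qed
   finally have "(3*real e + 1)*(m * c) \<le> ((K/2)*r)*(m * c)" using m0 c0 by (intro mult_right_mono) auto
   also have "... = K*?A" by (simp add: c_def power2_eq_square)
   finally show ?thesis .
  qed
  moreover have "1600*l \<le> K*l" using l0 A1 A2 by (intro mult_right_mono) (auto simp: K_def)
  moreover have "m \<le> K*m" using m0 A1 A2 mult_right_mono[of 1 K m] by (simp add: K_def)
  ultimately have "real ?B \<le> K*(n*D) + K*?A + K*l + K*m" using main by linarith
  then show "real (\<Sum>w\<in>W. card (P\<inter>zc w)) \<le> K*(real (card W)*D + r*((real (card P))\<^sup>2/D\<^sup>2)
   + real (card W) * sqrt (real (card W)/r^3)*(1 + ln (1 + 4*(real (card W)/r^3))) + real (card P))"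
   unfolding n_def[symmetric] m_def[symmetric] x_def[symmetric] l_def[symmetric] by (simp add: distrib_left)
 qed
qed

section \<open>Inversion\<close>

lemma circ_equations:
 fixes v w n :: "real^3"
 assumes vw: "norm v = 1" "v\<bullet>w = 0" "w ~= 0" and n: "n\<bullet>v = 0" "n\<bullet>w = 0"
  "!!x. x = (x\<bullet>v) *R v + ((x\<bullet>w)/(w\<bullet>w)) *R w + (x\<bullet>n) *R n"
 shows "x \<in> circ p v w \<longleftrightarrow> (x - p)\<bullet>(x - p) - (x - p)\<bullet>w/(w\<bullet>w) = 0 \<and> (x - p)\<bullet>n = 0"
proof -
 define W where "W = w\<bullet>w"
 have W: "W > 0" using vw(3) by (simp add: W_def)
 have vv: "v\<bullet>v = 1" "w\<bullet>v = 0" "w\<bullet>w = W" "v\<bullet>n = 0" "w\<bullet>n = 0" using vw(1,2) n(1,2) by (simp_all add: dot_square_norm inner_commute W_def)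
 have sq: "(a *R v + b *R w)\<bullet>(a *R v + b *R w) = a\<^sup>2 + W * b\<^sup>2" for a b
  unfolding inner_add by (simp add: vv vw(2) power2_eq_square)
 have iw: "(a *R v + b *R w)\<bullet>w = b*W" for a b unfolding inner_add_left by (simp add: vv vw(2))
 have inn: "(a *R v + b *R w)\<bullet>n = 0" for a b unfolding inner_add_left by (simp add: vv)
 show ?thesis
 proof
  assume "x \<in> circ p v w"
  then obtain a b where x: "x = p + a *R v + b *R w" and ab: "a\<^sup>2 + W * b\<^sup>2 = b" unfolding circ_def W_def by blast
  have xp: "x - p = a *R v + b *R w" by (simp add: x)
  show "(x - p)\<bullet>(x - p) - (x - p)\<bullet>w/(w\<bullet>w) = 0 \<and> (x - p)\<bullet>n = 0"
   unfolding xp sq iw inn W_def[symmetric] ab using W by simp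
 next
  assume h: "(x - p)\<bullet>(x - p) - (x - p)\<bullet>w/(w\<bullet>w) = 0 \<and> (x - p)\<bullet>n = 0"
  define a b where "a = (x - p)\<bullet>v" and "b = ((x - p)\<bullet>w)/W"
  have "(x - p) = a *R v + b *R w + ((x - p)\<bullet>n) *R n" unfolding a_def b_def W_def by (rule n(3))
  then have xp: "x - p = a *R v + b *R w" using conjunct2[OF h] by (simp only: scaleR_zero_left add_0_right)
  have "a\<^sup>2 + W * b\<^sup>2 = b" using conjunct1[OF h] unfolding xp sq iw W_def[symmetric] using W by simp
  moreover have "x = p + a *R v + b *R w" using xp by (simp add: algebra_simps)
  ultimately show "x \<in> circ p v w" unfolding circ_def W_def by blast
 qed
qed

lemma is_plane_normal: "n ~= 0 ==> is_plane {x :: real^3. n\<bullet>x = b}"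
 unfolding is_plane_def by (simp add: affine_hyperplane aff_dim_hyperplane)

lemma is_circle_circ:
 fixes v w :: "real^3"
 assumes vw: "norm v = 1" "v\<bullet>w = 0" "w ~= 0"
 shows "is_circle (circ p v w)"
proof -
 obtain n where n: "norm n = 1" "n\<bullet>v = 0" "n\<bullet>w = 0"
  "!!x. x = (x\<bullet>v) *R v + ((x\<bullet>w)/(w\<bullet>w)) *R w + (x\<bullet>n) *R n"
  using circle_normal_frame[OF vw] by (elim exE conjE) (rule that, assumption+, simp only:)
 define W where "W = w\<bullet>w"
 have W: "W > 0" using vw(3) by (simp add: W_def)
 let ?A = "1/(2*W)"
 define c where "c = p + ?A *R w"
 have n0: "n ~= 0" using n(1) by auto
 let ?B = "sqrt (1/(4*W))"
 have sph: "x \<in> sphere c ?B \<longleftrightarrow> (x - p)\<bullet>(x - p) - (x - p)\<bullet>w/W = 0" for x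
 proof -
  have "(x - c)\<bullet>(x - c) = ((x - p) - ?A *R w)\<bullet>((x - p) - ?A *R w)" by (simp add: c_def diff_diff_eq)
  also have "... = (x - p)\<bullet>(x - p) - (x - p)\<bullet>w/W + 1/(4*W)"
   unfolding inner_diff_left[of "x - p" "?A *R w"] inner_diff_right[of _ "x - p" "?A *R w"]
   using W by (simp add: inner_commute[of w "x - p"] W_def[symmetric])
  finally have e: "(x - c)\<bullet>(x - c) = (x - p)\<bullet>(x - p) - (x - p)\<bullet>w/W + 1/(4*W)" .
  have "dist c x = sqrt ((x - c)\<bullet>(x - c))" unfolding dist_norm norm_minus_commute[of c x] by (rule norm_eq_sqrt_inner)
  then have "x \<in> sphere c ?B \<longleftrightarrow> (x - c)\<bullet>(x - c) = 1/(4*W)" unfolding mem_sphere by (simp only: real_sqrt_eq_iff)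
  then show ?thesis unfolding e by simp
 qed
 have pl: "n\<bullet>x = n\<bullet>p \<longleftrightarrow> (x - p)\<bullet>n = 0" for x by (simp add: inner_diff_left inner_commute[of n])
 have "circ p v w = {x. n\<bullet>x = n\<bullet>p}\<inter>sphere c ?B"
  by (rule equalityI; rule subsetI) (simp_all only: Int_iff mem_Collect_eq sph pl circ_equations[OF vw n(2-4)] W_def[symmetric] simp_thms)
 moreover have "c \<in> {x. n\<bullet>x = n\<bullet>p}" by (simp add: c_def inner_add_right n(3))
 moreover have "sqrt (1/(4*W)) > 0" using W by simp
 ultimately show ?thesis unfolding is_circle_def using is_plane_normal[OF n0] by blast
qed

lemma plane_equation:
 assumes "is_plane S" "p \<in> S"
 obtains n where "n ~= 0" "!!x. x \<in> S \<longleftrightarrow> n\<bullet>(x - p) = 0"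
proof -
 obtain b1 b2 where b: "norm b1 = 1" "norm b2 = 1" "b1\<bullet>b2 = 0" "S = {p + s *R b1 + t *R b2 |s t. True}"
  by (rule plane_frame[OF assms])
 have b2: "b2 ~= 0" "b2\<bullet>b2 = 1" using b(2) by (auto simp: dot_square_norm)
 obtain n where n: "norm n = 1" "n\<bullet>b1 = 0" "n\<bullet>b2 = 0"
  "!!x. x = (x\<bullet>b1) *R b1 + ((x\<bullet>b2)/(b2\<bullet>b2)) *R b2 + (x\<bullet>n) *R n"
  using circle_normal_frame[OF b(1,3) b2(1)] by (elim exE conjE) (rule that, assumption+, simp only:)
 let ?A = "\<lambda>x. ((x - p)\<bullet>b2)/(b2\<bullet>b2)"
 have "x \<in> S \<longleftrightarrow> n\<bullet>(x - p) = 0" for x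
 proof
  assume "x \<in> S"
  then obtain s t where "x = p + s *R b1 + t *R b2" unfolding b(4) by blast
  then show "n\<bullet>(x - p) = 0" using n(2,3) by (simp add: ring_sq)
 next
  assume h: "n\<bullet>(x - p) = 0"
  have "x - p = ((x - p)\<bullet>b1) *R b1 + (?A x) *R b2 + ((x - p)\<bullet>n) *R n" by (rule n(4))
  then have "x - p = ((x - p)\<bullet>b1) *R b1 + (?A x) *R b2" using h by (simp only: inner_commute[of _ n] scaleR_zero_left add_0_right)
  then have "x = p + ((x - p)\<bullet>b1) *R b1 + (?A x) *R b2" by (metis add.assoc add.commute diff_add_cancel)
  then show "x \<in> S" unfolding b(4) by blast
 qed
 moreover have "n ~= 0" using n(1) by auto
 ultimately show thesis using that[of n] by simp
qed

text \<open>One shape of equation for both surfaces, with \<open>A = 0\<close> for planes.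
  \<open>B\<close> is a normal vector at \<open>p\<close>, which is why it is non-zero.\<close>

lemma plane_or_sphere_equation:
 fixes S :: "(real^3) set"
 assumes S: "is_plane S \<or> is_sphere S" and p: "p \<in> S"
 obtains A B where "B ~= 0" "!!x. x \<in> S \<longleftrightarrow> A*((x - p)\<bullet>(x - p)) + B\<bullet>(x - p) = 0"
 using S
proof
 assume pl: "is_plane S"
 show thesis by (rule plane_equation[OF pl p]) (rule that[of _ 0], simp_all)
next
 assume "is_sphere S"
 then obtain c r where c: "r > 0" "S = sphere c r" unfolding is_sphere_def by blast
 have dp: "dist c p = r" using p c by simp
 have "x \<in> S \<longleftrightarrow> 1*((x - p)\<bullet>(x - p)) + (2 *R (p - c))\<bullet>(x - p) = 0" for x
 proof -
  have "x \<in> S \<longleftrightarrow> dist c x = dist c p" using c dp by simp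
  also have "... \<longleftrightarrow> (dist c x)\<^sup>2 = (dist c p)\<^sup>2" by (simp add: power2_eq_iff_nonneg)
  also have "(dist c x)\<^sup>2 = ((x - p) + (p - c))\<bullet>((x - p) + (p - c))" unfolding dist_norm norm_minus_commute[of c x] by (simp add: power2_norm_eq_inner)
  also have "... = (x - p)\<bullet>(x - p) + (2 *R (p - c))\<bullet>(x - p) + (p - c)\<bullet>(p - c)"
   unfolding inner_add_left[of "x - p" "p - c"] inner_add_right[of _ "x - p" "p - c"] by (simp add: inner_commute[of "x - p" "p - c"])
  also have "(dist c p)\<^sup>2 = (p - c)\<bullet>(p - c)" unfolding dist_norm norm_minus_commute[of c p] by (simp add: power2_norm_eq_inner)
  finally show ?thesis by simp
 qed
 moreover have "2 *R (p - c) ~= 0" using dp c(1) by auto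
 ultimately show thesis using that[of "2 *R (p - c)" 1] by blast
qed

lemma circ_distinct_curvature:
 fixes w w' :: "real^3"
 assumes v: "norm v = 1" "v\<bullet>w = 0" "w ~= 0" "v\<bullet>w' = 0" and e: "circ p v w = circ p v w'"
 shows "w = w'"
proof -
 define W where "W = w\<bullet>w"
 have W: "W ~= 0" using v(3) by (simp add: W_def)
 define x where "x = p + (1/W) *R w"
 have "x = p + 0 *R v + (1/W) *R w" by (simp add: x_def)
 moreover have "0\<^sup>2 + (w\<bullet>w)*(1/W)\<^sup>2 = 1/W" using W by (simp add: W_def[symmetric] power2_eq_square)
 ultimately have "x \<in> circ p v w" unfolding circ_def by blast
 moreover have "x ~= p" using W v(3) by (simp add: x_def)
 ultimately obtain t where t: "x - p = ((x - p)\<bullet>(x - p)) *R (w' + t *R v)" using circ_inversion[OF v(1,4), of x p] e by blast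
 have xp: "x - p = (1/W) *R w" by (simp add: x_def)
 have "(1/W) *R w = (1/W) *R (w' + t *R v)" using xp t by (simp add: W_def)
 then have ww: "w = w' + t *R v" using W by simp
 have "v\<bullet>w = v\<bullet>w' + t*(v\<bullet>v)" unfolding ww by (simp add: inner_add_right)
 then have "t = 0" using v by (simp add: dot_square_norm)
 then show ?thesis using ww by simp
qed

text \<open>A centre of inversion off all points and circles is wanted. Infinitely many circles on
  \<open>S\<close> have tangent \<open>e1\<close> at \<open>p\<close>, so one of them is not in
  \<open>C\<close>; it meets each circle of \<open>C\<close> and the set \<open>P\<close> in
  finitely many points only.\<close>

lemma point_off_circles:
 fixes S :: "(real^3) set"
 assumes S: "is_plane S \<or> is_sphere S" "p \<in> S" and P: "finite P" and C: "finite C" "!!c. c \<in> C ==> is_circle c"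
 shows "\<exists>p0\<in>S. p0 \<notin> P \<and> (\<forall>c\<in>C. p0 \<notin> c)"
proof -
 obtain A B where AB: "B ~= 0" "!!x. x \<in> S \<longleftrightarrow> A*((x - p)\<bullet>(x - p)) + B\<bullet>(x - p) = 0"
  by (rule plane_or_sphere_equation[OF S]) (rule that)
 define e3 where "e3 = (1/norm B) *R B"
 have "norm e3 = 1" using AB(1) by (simp add: e3_def)
 from orthonormal_frame[OF this] obtain e1 e2 where fr: "norm e1 = 1 \<and> norm e2 = 1 \<and> e1\<bullet>e2 = 0 \<and> e1\<bullet>e3 = 0 \<and> e2\<bullet>e3 = 0 \<and>
  (\<forall>x. x = (x\<bullet>e1) *R e1 + (x\<bullet>e2) *R e2 + (x\<bullet>e3) *R e3)"
  by (elim exE) (rule that)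
 note e = conjunct1[OF fr] conjunct1[OF conjunct2[OF fr]] conjunct1[OF conjunct2[OF conjunct2[OF fr]]]
  conjunct1[OF conjunct2[OF conjunct2[OF conjunct2[OF fr]]]] conjunct1[OF conjunct2[OF conjunct2[OF conjunct2[OF conjunct2[OF fr]]]]]
 have B: "e1\<bullet>B = 0" "e2\<bullet>B = 0" using e(4,5) AB(1) by (simp_all add: e3_def)
 have ee: "e2\<bullet>e2 = 1" "e1\<bullet>e1 = 1" using e by (simp_all add: dot_square_norm)
 \<comment> \<open>The component along \<open>B\<close> is dictated by
   \<open>circ p e1 (w t) \<subseteq> S\<close>, while \<open>t\<close> is free and changes the
   curvature.\<close>
 define w where "w t = t *R e2 - (A/(B\<bullet>B)) *R B" for t :: real
 have w: "e1\<bullet>w t = 0" "e2\<bullet>w t = t" "B\<bullet>w t = - A" for t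
  using e B AB(1) ee by (simp_all add: w_def inner_diff_right inner_commute[of B e2])
 have w0: "w t ~= 0" if "t > 0" for t using w(2)[of t] that by auto
 have sub: "circ p e1 (w t) \<subseteq> S" for t
 proof
  fix x assume "x \<in> circ p e1 (w t)"
  then obtain a b where x: "x = p + a *R e1 + b *R w t" and ab: "a\<^sup>2 + (w t\<bullet>w t) * b\<^sup>2 = b" unfolding circ_def by blast
  have xp: "x - p = a *R e1 + b *R w t" by (simp add: x)
  have "(x - p)\<bullet>(x - p) = a\<^sup>2 + (w t\<bullet>w t) * b\<^sup>2"
   unfolding xp inner_add by (simp add: ee w inner_commute[of "w t" e1] power2_eq_square)
  moreover have "B\<bullet>(x - p) = - A * b" unfolding xp inner_add_right by (simp add: w B inner_commute[of B e1])
  ultimately show "x \<in> S" unfolding AB(2) using ab by simp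
 qed
 have inj: "inj_on (\<lambda>t. circ p e1 (w t)) {0<..}"
 proof (rule inj_onI)
  fix t s :: real assume "t \<in> {0<..}" "s \<in> {0<..}" "circ p e1 (w t) = circ p e1 (w s)"
  then have ts: "t > 0" "circ p e1 (w t) = circ p e1 (w s)" by simp_all
  have "w t = w s" by (rule circ_distinct_curvature[OF e(1) w(1) w0[OF ts(1)] w(1) ts(2)])
  then show "t = s" using w(2) by metis
 qed
 have "infinite ((\<lambda>t. circ p e1 (w t)) ` {0<..})" using finite_imageD[OF _ inj] infinite_Ioi by blast
 then have "\<not> (\<lambda>t. circ p e1 (w t)) ` {0<..} \<subseteq> C" using C(1) finite_subset by blast
 then obtain t where t: "t > 0" "circ p e1 (w t) \<notin> C" by blast
 define D where "D = circ p e1 (w t)"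
 have d: "is_circle D" unfolding D_def by (rule is_circle_circ[OF e(1) w(1) w0[OF t(1)]])
 have "inj (cpar p e1 (w t))" using cpar_inj[OF e(1) w(1) w0[OF t(1)]] by (auto intro: injI)
 then have "infinite (range (cpar p e1 (w t)))" using finite_imageD infinite_UNIV_char_0 by blast
 moreover have "range (cpar p e1 (w t)) \<subseteq> D" unfolding D_def using cpar_in_circ by blast
 ultimately have infd: "infinite D" by (rule infinite_super[rotated])
 have fin: "finite (D \<inter> c)" if g: "c \<in> C" for c
 proof (rule ccontr)
  assume inf: "infinite (D \<inter> c)"
  obtain T where T: "finite T" "card T = 3" "T \<subseteq> D \<inter> c" using infinite_arbitrarily_large[OF inf] by blast
  then obtain x y z where xyz: "T = {x, y, z}" "x ~= y" "y ~= z" "x ~= z" using card_3_iff[of T] by blast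
  have "D = c" using circles_share_two_points[OF d C(2)[OF g], of x y z] T(3) xyz by blast
  then show False using g t(2) unfolding D_def by simp
 qed
 let ?A = "\<Union>c\<in>C. D \<inter> c"
 have "finite (P\<union>?A)" using P C(1) fin by blast
 then have "\<not> D \<subseteq> P\<union>?A" using infd by (blast dest: infinite_super)
 then obtain p0 where "p0 \<in> D" "p0 \<notin> P" "\<forall>c\<in>C. p0 \<notin> c" by blast
 then show ?thesis using sub[of t] unfolding D_def by blast
qed

text \<open>On a sphere the circle is cut out by its own plane, on a plane by its own sphere. Both
  are polynomials of the stated shape around \<open>p0\<close>, and \<open>E\<close> is their value
  at \<open>p0\<close>, which is not on the circle.\<close>

lemma circle_as_section:
 fixes S :: "(real^3) set"
 assumes S: "is_plane S \<or> is_sphere S" and g: "is_circle G" "G \<subseteq> S" and p0: "p0 \<in> S" "p0 \<notin> G"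
 obtains X H E where "E ~= 0" "!!x. x \<in> S ==> x \<in> G \<longleftrightarrow> X*((x - p0)\<bullet>(x - p0)) + H\<bullet>(x - p0) + E = 0"
proof -
 obtain T c r where T: "is_plane T" "c \<in> T" "r > 0" "G = T\<inter>sphere c r" using g(1) unfolding is_circle_def by blast
 obtain b1 b2 where b: "norm b1 = 1" "norm b2 = 1" "b1\<bullet>b2 = 0" "T = {c + s *R b1 + t *R b2 |s t. True}"
  by (rule plane_frame[OF T(1,2)])
 obtain n where n: "n ~= 0" "!!x. x \<in> T \<longleftrightarrow> n\<bullet>(x - c) = 0" by (rule plane_equation[OF T(1,2)]) (rule that)
 let ?A = "\<lambda>x. (x - p0)\<bullet>(x - p0)"
 obtain A B where AB: "B ~= 0" "!!x. x \<in> S \<longleftrightarrow> A*(?A x) + B\<bullet>(x - p0) = 0"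
  by (rule plane_or_sphere_equation[OF S p0(1)]) (rule that)
 define f where "f x = (x - c)\<bullet>(x - c) - r\<^sup>2" for x
 define k where "k x = A*(?A x) + B\<bullet>(x - p0)" for x
 have f: "x \<in> sphere c r \<longleftrightarrow> f x = 0" for x
 proof -
  have "x \<in> sphere c r \<longleftrightarrow> (norm (x - c))\<^sup>2 = r\<^sup>2" using T(3) by (simp add: dist_norm norm_minus_commute power2_eq_iff_nonneg)
  then show ?thesis by (simp add: f_def power2_norm_eq_inner)
 qed
 have sq: "(y + z)\<bullet>(y + z) = y\<bullet>y + 2*(z\<bullet>y) + z\<bullet>z" for y z :: "real^3" by (simp add: inner_add inner_commute)
 define q where "q = (2*A) *R (c - p0) + B"
 define L where "L = k c + A*r\<^sup>2"
 have aff: "k (c + y) - A*f (c + y) = L + q\<bullet>y" for y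
 proof -
  have "k (c + y) = A*(y\<bullet>y + 2*((c - p0)\<bullet>y) + (c - p0)\<bullet>(c - p0)) + (B\<bullet>y + B\<bullet>(c - p0))" using sq by (simp add: ring_sq k_def)
  then show ?thesis by (simp add: k_def f_def q_def L_def inner_add_left algebra_simps)
 qed
 have zero: "L + q\<bullet>(t *R u) = 0" if u: "norm u = 1" "!!t. c + t *R u \<in> T" and t: "\<bar>t\<bar> = r" for u t
 proof -
  have "c + t *R u \<in> G" using u t unfolding T(4) by (simp add: dist_norm)
  then have "k (c + t *R u) = 0" "f (c + t *R u) = 0" using g(2) AB(2) T(4) f unfolding k_def by blast+
  then show ?thesis using aff[of "t *R u"] by simp
 qed
 have T12: "c + t *R b1 \<in> T" "c + t *R b2 \<in> T" for t using b(4) by (auto intro: exI[of _ t] exI[of _ 0])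
 have q: "q\<bullet>b1 = 0" "q\<bullet>b2 = 0" "L = 0"
  using zero[OF b(1) T12(1), of r] zero[OF b(1) T12(1), of "- r"] zero[OF b(2) T12(2), of r] zero[OF b(2) T12(2), of "- r"] T(3) by auto
 have kf: "k x = A*f x" if x: "x \<in> T" for x
 proof -
  obtain s t where "x = c + s *R b1 + t *R b2" using x unfolding b(4) by blast
  then have "x = c + (s *R b1 + t *R b2)" by (simp add: add.assoc)
  then show ?thesis using aff[of "s *R b1 + t *R b2"] q by (simp add: inner_add_right)
 qed
 have S0: "x \<in> S \<longleftrightarrow> k x = 0" for x unfolding k_def by (rule AB(2))
 show ?thesis
 proof (cases "A = 0")
  case False
  have sec: "x \<in> G \<longleftrightarrow> 0*(?A x) + n\<bullet>(x - p0) + n\<bullet>(p0 - c) = 0" if "x \<in> S" for x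
  proof -
   have "x \<in> G \<longleftrightarrow> x \<in> T" using kf[of x] that S0[of x] f[of x] T(4) False by auto
   moreover have "n\<bullet>(x - c) = n\<bullet>(x - p0) + n\<bullet>(p0 - c)" by (simp add: inner_diff_right)
   ultimately show ?thesis using n(2)[of x] by simp
  qed
  show ?thesis by (rule that[OF _ sec]) (use sec[OF p0(1)] p0(2) in simp_all)
 next
  case True
  have TS: "B\<bullet>z = 0" if "n\<bullet>z = 0" for z
  proof -
   have "c + z \<in> T" "c \<in> T" using n(2)[of "c + z"] that T(2) by simp_all
   then have "k (c + z) = 0" "k c = 0" using kf True by simp_all
   then show ?thesis using True by (simp add: k_def inner_add_right inner_diff_right)
  qed
  have nn: "n\<bullet>n ~= 0" "B\<bullet>B ~= 0" using n(1) AB(1) by simp_all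
  have nB: "n\<bullet>B ~= 0" using TS[of "B - ((n\<bullet>B)/(n\<bullet>n)) *R n"] nn by (auto simp: inner_diff_right)
  have ST: "x \<in> T" if "x \<in> S" for x
  proof -
   have "B\<bullet>(c - p0) = 0" "B\<bullet>(x - p0) = 0" using that kf[OF T(2)] S0[of x] True by (simp_all add: k_def)
   then have "B\<bullet>(x - c) = 0" by (simp add: inner_diff_right)
   then show ?thesis using TS[of "(x - c) - ((n\<bullet>(x - c))/(n\<bullet>B)) *R B"] nB nn n(2) by (simp add: inner_diff_right[of _ "x - c"])
  qed
  then have sec: "x \<in> G \<longleftrightarrow> 1*(?A x) + (2 *R (p0 - c))\<bullet>(x - p0) + f p0 = 0" if "x \<in> S" for x
  proof -
   have "f x = (x - p0)\<bullet>(x - p0) + 2*((p0 - c)\<bullet>(x - p0)) + f p0" using sq by (simp add: ring_sq f_def)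
   then show ?thesis using that f[of x] ST[OF that] unfolding T(4) by simp
  qed
  show ?thesis by (rule that[OF _ sec]) (use sec[OF p0(1)] p0(2) in simp_all)
 qed
qed

text \<open>Inversion at \<open>p0\<close> maps \<open>S\<close> into a plane at height
  \<open>K\<close> above the span of \<open>e1\<close> and \<open>e2\<close>. Dividing the equation
  of a section by the squared distance \<open>M\<close> from \<open>p0\<close>, where
  \<open>inverse M\<close> is the squared norm of the image, leaves a circle equation with leading
  coefficient \<open>E\<close>; the condition \<open>E ~= 0\<close> says that no circle becomes a
  line.\<close>

theorem sphere_coordinates:
 fixes S :: "(real^3) set"
 assumes S: "is_plane S \<or> is_sphere S" and p0: "p0 \<in> S"
 obtains f :: "real^3 => complex" where "inj_on f (S - {p0})"
  "!!G. [|is_circle G; G \<subseteq> S; p0 \<notin> G|] ==> \<exists>w. \<forall>x\<in>S - {p0}. x \<in> G \<longleftrightarrow> f x \<in> zc w"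
proof -
 obtain A B where AB: "B ~= 0" "!!x. x \<in> S \<longleftrightarrow> A*((x - p0)\<bullet>(x - p0)) + B\<bullet>(x - p0) = 0"
  by (rule plane_or_sphere_equation[OF S p0]) (rule that)
 define e3 where "e3 = (1/norm B) *R B"
 have "norm e3 = 1" using AB(1) by (simp add: e3_def)
 from orthonormal_frame[OF this] obtain e1 e2 where fr: "norm e1 = 1 \<and> norm e2 = 1 \<and> e1\<bullet>e2 = 0 \<and> e1\<bullet>e3 = 0 \<and> e2\<bullet>e3 = 0 \<and>
  (\<forall>x. x = (x\<bullet>e1) *R e1 + (x\<bullet>e2) *R e2 + (x\<bullet>e3) *R e3)"
  by (elim exE) (rule that)
 note e = conjunct1[OF fr] conjunct1[OF conjunct2[OF fr]] conjunct1[OF conjunct2[OF conjunct2[OF fr]]]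
  conjunct1[OF conjunct2[OF conjunct2[OF conjunct2[OF fr]]]] conjunct1[OF conjunct2[OF conjunct2[OF conjunct2[OF conjunct2[OF fr]]]]]
  conjunct2[OF conjunct2[OF conjunct2[OF conjunct2[OF conjunct2[OF fr]]]], rule_format]
 define y where "y x = inverse ((x - p0)\<bullet>(x - p0)) *R (x - p0)" for x
 define K where "K = - A/norm B"
 have N: "(x - p0)\<bullet>(x - p0) > 0" if "x ~= p0" for x using that by simp
 have y3: "y x\<bullet>e3 = K" if x: "x \<in> S - {p0}" for x
 proof -
  define M where "M = (x - p0)\<bullet>(x - p0)"
  have M: "M > 0" using N[of x] x by (simp add: M_def)
  have "A*M + B\<bullet>(x - p0) = 0" using x AB(2)[of x] by (simp add: M_def)
  then have b: "B\<bullet>(x - p0) = - A*M" by simp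
  have "y x\<bullet>e3 = inverse M*(1/norm B)*(B\<bullet>(x - p0))" by (simp add: y_def e3_def M_def[symmetric] inner_commute[of B])
  then show ?thesis unfolding b K_def using M by simp
 qed
 define f where "f x = Complex (y x\<bullet>e1) (y x\<bullet>e2)" for x
 show ?thesis
 proof (rule that[of f])
  show "inj_on f (S - {p0})"
  proof (rule inj_onI)
   fix x x' assume x: "x \<in> S - {p0}" "x' \<in> S - {p0}" "f x = f x'"
   have "y x\<bullet>e1 = y x'\<bullet>e1" "y x\<bullet>e2 = y x'\<bullet>e2" using x(3) by (simp_all add: f_def)
   note y12 = this
   have yf: "y z = (y z\<bullet>e1) *R e1 + (y z\<bullet>e2) *R e2 + K *R e3" if "z \<in> S - {p0}" for z
    unfolding y3[OF that, symmetric] by (rule e(6))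
   have "y x = (y x\<bullet>e1) *R e1 + (y x\<bullet>e2) *R e2 + K *R e3" by (rule yf[OF x(1)])
   also have "... = (y x'\<bullet>e1) *R e1 + (y x'\<bullet>e2) *R e2 + K *R e3" by (simp only: y12)
   also have "... = y x'" by (rule yf[OF x(2), symmetric])
   finally have yy: "y x = y x'" .
   have inv_inv: "z - p0 = inverse (y z\<bullet>y z) *R y z" if "z ~= p0" for z
   proof -
    define M where "M = (z - p0)\<bullet>(z - p0)"
    have M: "M ~= 0" using that by (simp add: M_def)
    have Y: "y z = inverse M *R (z - p0)" by (simp add: y_def M_def)
    show ?thesis using Y M by (simp add: M_def)
   qed
   have "x - p0 = x' - p0" using inv_inv[of x] inv_inv[of x'] x yy by simp
   then show "x = x'" by simp
  qed
  fix G assume g: "is_circle G" "G \<subseteq> S" "p0 \<notin> G"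
  obtain X H E where E: "E ~= 0" and XH: "!!x. x \<in> S ==> x \<in> G \<longleftrightarrow> X*((x - p0)\<bullet>(x - p0)) + H\<bullet>(x - p0) + E = 0"
   by (rule circle_as_section[OF S g(1,2) p0 g(3)]) (rule that)
  define b where "b = Complex (H\<bullet>e1/E) (H\<bullet>e2/E)"
  define c where "c = K\<^sup>2 + (X + K*(H\<bullet>e3))/E"
  have "x \<in> G \<longleftrightarrow> f x \<in> zc (b, c)" if x: "x \<in> S - {p0}" for x
  proof -
   define M where "M = (x - p0)\<bullet>(x - p0)"
   have M: "M > 0" using N[of x] x by (simp add: M_def)
   have Y: "y x = inverse M *R (x - p0)" by (simp add: y_def M_def)
   have xp: "x - p0 = M *R y x" unfolding Y using M by simp
   have yyM: "y x\<bullet>y x = inverse M" unfolding Y inner_scaleR_left inner_scaleR_right M_def[symmetric] using M by simp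
   define y1 y2 where "y1 = y x\<bullet>e1" and "y2 = y x\<bullet>e2"
   have yf: "y x = y1 *R e1 + y2 *R e2 + K *R e3" unfolding y1_def y2_def y3[OF x, symmetric] by (rule e(6))
   have "y x\<bullet>y x = y1*y1 + y2*y2 + K*K"
   proof -
    have "y x\<bullet>y x = y x\<bullet>(y1 *R e1 + y2 *R e2 + K *R e3)" using yf by simp
    also have "... = y1*(y x\<bullet>e1) + y2*(y x\<bullet>e2) + K*(y x\<bullet>e3)" unfolding inner_add_right by simp
    finally show ?thesis unfolding y1_def[symmetric] y2_def[symmetric] y3[OF x] .
   qed
   then have iM: "inverse M = y1\<^sup>2 + y2\<^sup>2 + K\<^sup>2" unfolding yyM by (simp add: power2_eq_square)
   have Hy: "H\<bullet>y x = y1*(H\<bullet>e1) + y2*(H\<bullet>e2) + K*(H\<bullet>e3)"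
   proof -
    show ?thesis using yf by (simp add: ring_sq)
   qed
   have "x \<in> G \<longleftrightarrow> X*M + H\<bullet>(x - p0) + E = 0" using XH[of x] x unfolding M_def by blast
   also have "... \<longleftrightarrow> M*(X + H\<bullet>y x + E*inverse M) = 0" unfolding xp using M by (simp add: algebra_simps)
   also have "... \<longleftrightarrow> X + H\<bullet>y x + E*inverse M = 0" using M by simp
   also have "... \<longleftrightarrow> E*(y1\<^sup>2 + y2\<^sup>2 + ((H\<bullet>e1/E)*y1 + (H\<bullet>e2/E)*y2) + c) = 0"
   proof -
    have g: "F*(a\<^sup>2 + b\<^sup>2 + ((h1/F) * a + (h2/F) * b) + (k\<^sup>2 + (T + k*h3)/F)) = T + (a*h1 + b*h2 + k*h3) + F*(a\<^sup>2 + b\<^sup>2 + k\<^sup>2)"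
     if "F ~= 0" for F a b h1 h2 h3 k T :: real
     using that by (simp add: field_simps)
    show ?thesis unfolding Hy iM c_def g[OF E] by (rule refl)
   qed
   also have "... \<longleftrightarrow> f x \<in> zc (b, c)"
    using E by (simp add: zc_def pz_def f_def b_def inner_complex_def y1_def[symmetric] y2_def[symmetric] power2_eq_square)
   finally show ?thesis .
  qed
  then show "\<exists>w. \<forall>x\<in>S - {p0}. x \<in> G \<longleftrightarrow> f x \<in> zc w" by blast
 qed
qed

section \<open>Summing the planar bounds\<close>

text \<open>\<open>D0\<close> solves \<open>n*D = r*(m^2/D^2)\<close>, which makes
  \<open>n*D0\<close> equal to \<open>m powr (2/3)*n powr (2/3)*r powr (1/3)\<close>;
  \<open>r0\<close> then balances this against the lens term \<open>n * sqrt (n/r^3)*L\<close>.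
  Truncation at 1 produces the terms \<open>n\<close> and \<open>m powr (2/3)*n powr (2/3)\<close>.
  With all quantities written as exponentials of \<open>a\<close>, \<open>b\<close>,
  \<open>c\<close>, comparing exponents is linear arithmetic.\<close>

lemma planar_parameters:
 fixes n m :: real
 assumes n: "n \<ge> 1" and m: "m \<ge> 1"
 defines "L \<equiv> ln (max 2 (m^3/n))"
 shows "\<exists>D\<ge>1. \<exists>r\<ge>1. n*D + r*(m\<^sup>2/D\<^sup>2) + n * sqrt (n/r^3)*(1 + ln (1 + 4*(n/r^3))) + m
  \<le> 10*(n + m + m powr (2/3)*n powr (2/3) + m powr (6/11)*n powr (9/11)*L powr (2/11))"
proof -
 define X where "X = max 2 (m^3/n)"
 have X: "X \<ge> 2" "m^3/n \<le> X" by (simp_all add: X_def)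
 have "ln 2 \<le> L" unfolding L_def X_def[symmetric] using X by simp
 then have L2: "L \<ge> 1/2" using ln2_ge_two_thirds by linarith
 define a b c where "a = ln n" and "b = ln m" and "c = ln L"
 have e: "n = exp a" "m = exp b" "L = exp c" using n m L2 by (simp_all add: a_def b_def c_def)
 have pw: "n powr x = exp (x * a)" "m powr x = exp (x * b)" "L powr x = exp (x * c)" for x by (simp_all add: e powr_def)
 let ?A = "5/11 * a - 4/11 * b + 6/11 * c"
 define r0 where "r0 = exp ?A"
 define r where "r = max 1 r0"
 have r: "r \<ge> 1" "r \<ge> r0" "r0 > 0" by (simp_all add: r_def r0_def)
 define D0 where "D0 = (r*m\<^sup>2/n) powr (1/3)"
 define D where "D = max 1 D0"
 have pos: "r*m\<^sup>2/n > 0" using r n m by simp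
 have "D0 > 0" unfolding D0_def powr_gt_zero using pos by linarith
 then have D: "D \<ge> 1" "D \<ge> D0" "D0 > 0" by (simp_all add: D_def)
 have D03: "D0^3 = r*m\<^sup>2/n" unfolding D0_def using powr_powr[of "r*m\<^sup>2/n" "1/3" 3] pos r n by simp
 have "r*(m\<^sup>2/D\<^sup>2) \<le> r*(m\<^sup>2/D0\<^sup>2)" using D r n m by (intro mult_left_mono divide_left_mono power_mono) auto
 also have "... = n*D0^3/D0\<^sup>2" unfolding D03 using n by simp
 also have "... = n*D0" using D by (simp add: power3_eq_cube power2_eq_square)
 finally have 1: "r*(m\<^sup>2/D\<^sup>2) \<le> n*D0" .
 have "D \<le> 1 + D0" using D by (simp add: D_def)
 then have 2: "n*D \<le> n + n*D0" using n mult_left_mono[of D "1 + D0" n] by (simp add: algebra_simps)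
 have r3: "r powr (1/3) \<le> 1 + r0 powr (1/3)" by (simp add: r_def max_def)
 have mn: "m\<^sup>2/n = exp (2 * b - a)" by (simp add: e exp_diff exp_double)
 let ?D = "2/3 * b + 2/3 * a"
 have "n*D0 = exp a*(exp (1/3*(2 * b - a))*r powr (1/3))"
 proof -
  have "D0 = (m\<^sup>2/n*r) powr (1/3)" by (simp add: D0_def mult.commute)
  also have "... = (m\<^sup>2/n) powr (1/3)*r powr (1/3)" using r n by (subst powr_mult) auto
  also have "(m\<^sup>2/n) powr (1/3) = exp (1/3*(2 * b - a))" unfolding mn by (simp add: powr_def)
  finally show ?thesis by (simp add: e(1))
 qed
 also have "... = exp ?D*r powr (1/3)" unfolding mult.assoc[symmetric] exp_add[symmetric] by (simp add: field_simps)
 also have "... \<le> exp ?D*(1 + r0 powr (1/3))" by (rule mult_left_mono[OF r3]) simp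
 also have "... = m powr (2/3)*n powr (2/3) + exp ?D*exp (1/3*?A)" unfolding pw by (simp add: exp_add algebra_simps r0_def powr_def)
 also have "exp ?D*exp (1/3*?A) = m powr (6/11)*n powr (9/11)*L powr (2/11)" unfolding pw exp_add[symmetric] by (simp add: algebra_simps)
 finally have 3: "n*D0 \<le> m powr (2/3)*n powr (2/3) + m powr (6/11)*n powr (9/11)*L powr (2/11)" .
 define s0 where "s0 = n/r0^3"
 have "r0^3 \<le> r^3" "r0^3 > 0" "r^3 > 0" using r by (auto intro: power_mono)
 then have s: "n/r^3 \<le> s0" "n/r^3 > 0" using n by (auto simp: s0_def intro!: divide_left_mono)
 let ?E = "- 4/11 * a + 12/11 * b - 18/11 * c"
 have "r0^3 = exp (3*?A)" unfolding r0_def by (simp add: exp_of_nat_mult[symmetric])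
 then have s0: "s0 = exp ?E" unfolding s0_def e(1) by (simp add: exp_diff[symmetric] algebra_simps)
 have "n * sqrt s0*L = exp a*exp (?E/2)*exp c" using s0 powr_half_sqrt[symmetric] e by (simp add: powr_def)
 also have "... = m powr (6/11)*n powr (9/11)*L powr (2/11)" unfolding pw exp_add[symmetric] by (simp add: field_simps)
 finally have 4: "n * sqrt s0*L = m powr (6/11)*n powr (9/11)*L powr (2/11)" .
 let ?B = "1 + 4*(n/r^3)"
 let ?C = "4/11*(3 * b - a)"
 let ?F = "- 18/11 * c"
 \<comment> \<open>Needed for the logarithm only: up to the bounded factor from \<open>L\<close>,
   \<open>s0\<close> is the power 4/11 of \<open>m^3/n\<close>, so its logarithm is of order
   \<open>L\<close>.\<close>
 have "s0 \<le> 4*X"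
 proof -
  have "s0 = exp ?C*exp ?F" unfolding s0 exp_add[symmetric] by (simp add: algebra_simps)
  moreover have "exp ?C \<le> X"
  proof -
   have "m^3/n = exp (3 * b - a)" unfolding e by (simp add: exp_diff exp_of_nat_mult[symmetric])
   then have "3 * b - a \<le> ln X" using X by (simp add: ln_ge_iff)
   moreover have "ln X \<ge> 0" using X by simp
   ultimately have "4/11*(3 * b - a) \<le> ln X" by simp
   then have "exp ?C \<le> exp (ln X)" by (subst exp_le_cancel_iff)
   then show ?thesis using X by simp
  qed
  moreover have "exp ?F \<le> 4"
  proof -
   have "- c \<le> ln 2" using L2 unfolding c_def by (simp add: ln_inverse[symmetric] ln_div[symmetric] ln_le_cancel_iff field_simps flip: ln_inverse)
   moreover have "ln (4::real) = 2*ln 2" using ln_realpow[of 2 2] by simp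
   ultimately have "- 18/11 * c \<le> ln 4" using ln2_ge_two_thirds by linarith
   then have "exp ?F \<le> exp (ln 4)" by (subst exp_le_cancel_iff)
   then show ?thesis by simp
  qed
  ultimately show ?thesis using X mult_mono[of "exp ?C" X "exp ?F" 4] by simp
 qed
 then have "1 + 4*(n/r^3) \<le> 17*X" using s X by linarith
 also have "... \<le> X^5*X" using X power_mono[of 2 X 5] by (intro mult_right_mono) auto
 finally have "ln ?B \<le> ln (X^5*X)" using s X by simp
 also have "... = 6*L" using X by (simp add: ln_mult ln_realpow L_def X_def[symmetric])
 finally have "1 + ln ?B \<le> 8*L" using L2 by linarith
 then have "n * sqrt (n/r^3)*(1 + ln ?B) \<le> n * sqrt s0*(8*L)" using s n L2 by (intro mult_mono) auto
 also have "... = 8*(n * sqrt s0*L)" by simp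
 finally have 5: "n * sqrt (n/r^3)*(1 + ln ?B) \<le> 8*(m powr (6/11)*n powr (9/11)*L powr (2/11))" unfolding 4 .
 have nn: "m powr (2/3)*n powr (2/3) \<ge> 0" "m powr (6/11)*n powr (9/11)*L powr (2/11) \<ge> 0" by simp_all
 show ?thesis
 proof (rule exI[of _ D], rule conjI[OF D(1)], rule exI[of _ r], rule conjI[OF r(1)])
  have g: "x1 + x2 + x3 + m \<le> 10*(n + m + y + z)"
   if "x1 \<le> n + t" "x2 \<le> t" "t \<le> y + z" "x3 \<le> 8*z" "y \<ge> 0" "z \<ge> 0" for x1 x2 x3 y z t :: real
   using that n m by argo
  show "n*D + r*(m\<^sup>2/D\<^sup>2) + n * sqrt (n/r^3)*(1 + ln (1 + 4*(n/r^3))) + m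
   \<le> 10*(n + m + m powr (2/3)*n powr (2/3) + m powr (6/11)*n powr (9/11)*L powr (2/11))"
   by (rule g[OF 2 1 3 5 nn])
 qed
qed

section \<open>From one plane or sphere to the sum over all of them\<close>

lemma Holder_sum:
 fixes f g :: "'i => real"
 assumes I: "finite I" and f: "!!i. i \<in> I ==> f i \<ge> 0" and g: "!!i. i \<in> I ==> g i \<ge> 0" and a: "a > 0" "b > 0" "a + b = 1"
 shows "(\<Sum>i\<in>I. f i powr a*g i powr b) \<le> sum f I powr a * sum g I powr b"
proof (cases "sum f I = 0 \<or> sum g I = 0")
 case True
 then have "f i powr a*g i powr b = 0" if "i \<in> I" for i using that sum_nonneg_eq_0_iff[OF I, of f] sum_nonneg_eq_0_iff[OF I, of g] f g by auto
 then have "(\<Sum>i\<in>I. f i powr a*g i powr b) = 0" by (intro sum.neutral) blast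
 then show ?thesis by simp
next
 case False
 define F G where "F = sum f I" and "G = sum g I"
 have FG: "F > 0" "G > 0" using False f g sum_nonneg[of I f] sum_nonneg[of I g] by (auto simp: F_def G_def order_less_le)
 have "f i powr a*g i powr b \<le> F powr a*G powr b*(a*(f i/F) + b*(g i/G))" if "i \<in> I" for i
 proof -
  have "(f i/F) powr a*(g i/G) powr b \<le> a*(f i/F) + b*(g i/G)"
  proof (cases "f i = 0 \<or> g i = 0")
   case True
   then show ?thesis using a f[OF that] g[OF that] FG by auto
  next
   case False
   then have "f i/F > 0" "g i/G > 0" using f[OF that] g[OF that] FG by auto
   then show ?thesis using Youngs_inequality_0[of a b "f i/F" "g i/G"] a by simp
  qed
  then show ?thesis using FG powr_divide by (simp add: field_sq)
 qed
 then have "(\<Sum>i\<in>I. f i powr a*g i powr b) \<le> (\<Sum>i\<in>I. F powr a*G powr b*(a*(f i/F) + b*(g i/G)))" by (rule sum_mono)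
 also have "... = F powr a*G powr b*(a*(F/F) + b*(G/G))"
  by (simp add: F_def G_def sum_distrib_left[symmetric] sum.distrib sum_divide_distrib[symmetric])
 finally show ?thesis using FG a by (simp add: F_def G_def)
qed

definition planar_bound :: "real => real => real" where
 "planar_bound m n = n + m + m powr (2/3)*n powr (2/3) + m powr (6/11)*n powr (9/11)*ln (max 2 (m^3/n)) powr (2/11)"

lemma planar_bound_nonneg: "m \<ge> 0 ==> n \<ge> 0 ==> planar_bound m n \<ge> 0"
 by (simp add: planar_bound_def)

lemma planar_incidences:
 obtains K :: real where "K > 0" "!!P W. [|finite P; finite W|] ==>
  real (\<Sum>w\<in>W. card (P\<inter>zc w)) \<le> K*planar_bound (real (card P)) (real (card W))"
proof -
 obtain K where K: "K > 0" "!!P W D r. [|finite P; finite W; D \<ge> 1; r \<ge> 1|] ==>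
  real (\<Sum>w\<in>W. card (P\<inter>zc w)) \<le> K*(real (card W)*D + r*((real (card P))\<^sup>2/D\<^sup>2)
   + real (card W) * sqrt (real (card W)/r^3)*(1 + ln (1 + 4*(real (card W)/r^3))) + real (card P))"
  by (rule planar_parametric) (rule that)
 have "real (\<Sum>w\<in>W. card (P\<inter>zc w)) \<le> 10*K*planar_bound (real (card P)) (real (card W))" if f: "finite P" "finite W" for P W
 proof (cases "P = {} \<or> W = {}")
  case True
  then show ?thesis using K(1) planar_bound_nonneg by auto
 next
  case False
  then have c: "real (card W) \<ge> 1" "real (card P) \<ge> 1" using f by (simp_all add: Suc_le_eq card_gt_0_iff)
  obtain D r where D: "D \<ge> 1" "r \<ge> 1" and le: "real (card W)*D + r*((real (card P))\<^sup>2/D\<^sup>2)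
   + real (card W) * sqrt (real (card W)/r^3)*(1 + ln (1 + 4*(real (card W)/r^3))) + real (card P)
   \<le> 10*planar_bound (real (card P)) (real (card W))"
   using planar_parameters[OF c] unfolding planar_bound_def by blast
  show ?thesis using order_trans[OF K(2)[OF f D] mult_left_mono[OF le less_imp_le[OF K(1)]]] by (simp add: mult_ac)
 qed
 then show ?thesis using that[of "10*K"] K(1) by simp
qed

lemma card_incidences:
 assumes "finite P" "finite C"
 shows "card (flags P C) = (\<Sum>g\<in>C. card (P\<inter>g))"
proof -
 have "bij_betw prod.swap (flags P C) (SIGMA g:C. P\<inter>g)" by (rule bij_betwI[of _ _ _ prod.swap]) auto
 then have "card (flags P C) = card (SIGMA g:C. P\<inter>g)" by (rule bij_betw_same_card)
 then show ?thesis using assms by simp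
qed

lemma surface_incidence_bound:
 obtains K :: real where "K > 0" "!!S P C. [|is_plane S \<or> is_sphere S; finite P; P \<subseteq> S; finite C; !!c. c \<in> C ==> is_circle c \<and> c \<subseteq> S|] ==>
  real (card (flags P C)) \<le> K*planar_bound (real (card P)) (real (card C))"
proof -
 obtain K where K: "K > 0" "!!P W. [|finite P; finite W|] ==>
  real (\<Sum>w\<in>W. card (P\<inter>zc w)) \<le> K*planar_bound (real (card P)) (real (card W))"
  by (rule planar_incidences) (rule that)
 have "real (card (flags P C)) \<le> K*planar_bound (real (card P)) (real (card C))"
  if S: "is_plane S \<or> is_sphere S" and P: "finite P" "P \<subseteq> S" and C: "finite C" "!!c. c \<in> C ==> is_circle c \<and> c \<subseteq> S" for S P C
 proof (cases "P = {}")
  case True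
  then show ?thesis using K(1) by (simp add: planar_bound_nonneg)
 next
  case False
  then obtain p where p: "p \<in> S" using P by blast
  have Cc: "is_circle c" "c \<subseteq> S" if "c \<in> C" for c using C(2)[OF that] by simp_all
  obtain p0 where p0: "p0 \<in> S" "p0 \<notin> P" "!!c. c \<in> C ==> p0 \<notin> c" using point_off_circles[OF S p P(1) C(1) Cc(1)] by blast
  obtain F :: "real^3 => complex" where inj: "inj_on F (S - {p0})" and
   cr: "!!c. [|is_circle c; c \<subseteq> S; p0 \<notin> c|] ==> \<exists>w. \<forall>x\<in>S - {p0}. x \<in> c \<longleftrightarrow> F x \<in> zc w"
   by (rule sphere_coordinates[OF S p0(1)]) (rule that)
  have "\<forall>c\<in>C. \<exists>w. \<forall>x\<in>S - {p0}. x \<in> c \<longleftrightarrow> F x \<in> zc w" using cr Cc p0(3) by blast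
  from bchoice[OF this] obtain w where w: "!!c x. c \<in> C ==> x \<in> S - {p0} ==> x \<in> c \<longleftrightarrow> F x \<in> zc (w c)" by blast
  have injw: "inj_on w C"
  proof (rule inj_onI)
   fix c c' assume g: "c \<in> C" "c' \<in> C" "w c = w c'"
   have "x \<in> c \<longleftrightarrow> x \<in> c'" if "x \<in> S - {p0}" for x using w[OF g(1) that] w[OF g(2) that] g(3) by simp
   moreover have "c \<subseteq> S - {p0}" "c' \<subseteq> S - {p0}" using Cc(2)[OF g(1)] Cc(2)[OF g(2)] p0(3)[OF g(1)] p0(3)[OF g(2)] by blast+
   ultimately show "c = c'" by blast
  qed
  have PS: "P \<subseteq> S - {p0}" using P(2) p0(2) by blast
  have injP: "inj_on F P" by (rule inj_on_subset[OF inj PS])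
  have "card (P \<inter> c) \<le> card (F ` P\<inter>zc (w c))" if g: "c \<in> C" for c
  proof -
   have "card (P \<inter> c) = card (F ` (P \<inter> c))" by (rule card_image[symmetric, OF inj_on_subset[OF injP]]) simp
   also have "... \<le> card (F ` P\<inter>zc (w c))" using w[OF g] PS P(1) by (intro card_mono) auto
   finally show ?thesis .
  qed
  then have "(\<Sum>c\<in>C. card (P \<inter> c)) \<le> (\<Sum>c\<in>C. card (F ` P\<inter>zc (w c)))" by (rule sum_mono)
  also have "... = (\<Sum>u\<in>w ` C. card (F ` P\<inter>zc u))" by (simp add: sum.reindex[OF injw])
  finally have "real (card (flags P C)) \<le> real (\<Sum>u\<in>w ` C. card (F ` P\<inter>zc u))"
   unfolding card_incidences[OF P(1) C(1)] by (rule of_nat_mono)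
  also have "... \<le> K*planar_bound (real (card (F ` P))) (real (card (w ` C)))" using P(1) C(1) by (intro K(2)) simp_all
  finally show ?thesis unfolding card_image[OF injP] card_image[OF injw] .
 qed
 then show ?thesis using that[of K] K(1) by blast
qed

lemma space_parameter:
 fixes n m :: real
 assumes n: "n \<ge> 1" and m: "m \<ge> 1"
 shows "\<exists>D\<ge>1. D*n + m + m^3/D^6 \<le> 2*(m powr (3/7)*n powr (6/7)) + m + n"
proof -
 \<comment> \<open>The solution of \<open>D*n = m^3/D^6\<close>.\<close>
 define D0 where "D0 = (m^3/n) powr (1/7)"
 define D where "D = max 1 D0"
 have "D0 > 0" using n m by (simp add: D0_def)
 then have D: "D \<ge> 1" "D \<ge> D0" "D0 > 0" "D \<le> 1 + D0" by (simp_all add: D_def)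
 have nD: "n*D0 = m powr (3/7)*n powr (6/7)"
 proof -
  have e: "n = exp (ln n)" "m = exp (ln m)" using n m by simp_all
  have "m^3/n = exp (3*ln m - ln n)" by (subst e(1), subst e(2)) (simp add: exp_diff exp_of_nat_mult[symmetric])
  then have "n*D0 = exp (ln n)*exp (1/7*(3*ln m - ln n))" unfolding D0_def by (simp add: powr_def e(1)[symmetric])
  also have "... = exp (3/7*ln m)*exp (6/7*ln n)" unfolding exp_add[symmetric] by (simp add: field_simps)
  finally show ?thesis using n m by (simp add: powr_def)
 qed
 have "D0^7 = m^3/n" unfolding D0_def using powr_powr[of "m^3/n" "1/7" 7] n m by simp
 then have m3: "m^3 = n*D0^7" using n by simp
 have "m^3/D^6 \<le> m^3/D0^6" using D m by (intro divide_left_mono power_mono) auto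
 also have "... = n*D0*(D0^6/D0^6)" unfolding m3 by (simp add: power_numeral_reduce)
 also have "... = n*D0" using D by simp
 finally have 1: "m^3/D^6 \<le> n*D0" .
 have "D*n \<le> n + n*D0" using mult_right_mono[OF D(4), of n] n by (simp add: algebra_simps)
 then show ?thesis using D(1) 1 unfolding nD by (intro exI[of _ D]) simp
qed

text \<open>The logarithm belongs to one surface and must be replaced by a common one. It grows by
  at most \<open>ln (q/N)\<close>, hence by at most \<open>q/N\<close>, when \<open>q\<close> is put
  for \<open>N\<close>, and the spare factor \<open>N powr (4/11)\<close> compensates:
  \<open>N^2*l \<le> 3*(q^2*L)\<close>, raised to the power 2/11. The 2 bounds
  \<open>3 powr (2/11)\<close>.\<close>

lemma logarithmic_term:
 fixes M N m q :: real
 assumes N: "N = 0 \<or> N \<ge> 1" "N \<le> q" and M: "0 \<le> M" "M \<le> m"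
 shows "M powr (6/11)*N powr (9/11)*ln (max 2 (M^3/N)) powr (2/11)
  \<le> 2*q powr (4/11)*ln (max 2 (m^3/q)) powr (2/11)*(M powr (6/11)*N powr (5/11))"
proof (cases "N = 0")
 case False
 then have N1: "N \<ge> 1" "q \<ge> 1" using N by simp_all
 define l L where "l = ln (max 2 (M^3/N))" and "L = ln (max 2 (m^3/q))"
 have L: "L \<ge> 1/2"
 proof -
  have "ln 2 \<le> L" unfolding L_def by simp
  then show ?thesis using ln2_ge_two_thirds by linarith
 qed
 have "max 2 (M^3/N) \<le> max 2 (m^3/q)*(q/N)"
 proof -
  have "2*1 \<le> max 2 (m^3/q)*(q/N)" using N N1 by (intro mult_mono) auto
  moreover have "M^3/N \<le> m^3/q*(q/N)" using power_mono[OF M(2) M(1), of 3] N1 by (simp add: divide_right_mono)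
  moreover have "m^3/q*(q/N) \<le> max 2 (m^3/q)*(q/N)" using N1 by (intro mult_right_mono) auto
  ultimately show ?thesis by simp
 qed
 then have "l \<le> ln (max 2 (m^3/q)*(q/N))" unfolding l_def by (intro ln_mono) auto
 also have "... = L + ln (q/N)" unfolding L_def using N1 by (intro ln_mult_pos) auto
 also have "... \<le> L + q/N" using ln_le_minus_one[of "q/N"] N1 by simp
 finally have "N\<^sup>2*l \<le> N\<^sup>2*(L + q/N)" by (intro mult_left_mono) auto
 also have "... = N\<^sup>2*L + N*q" using N1 by (simp add: field_sq)
 also have "... \<le> q\<^sup>2*L + q\<^sup>2*(2*L)"
 proof (rule add_mono)
  show "N\<^sup>2*L \<le> q\<^sup>2*L" using N N1 L by (intro mult_right_mono power_mono) auto
  have "N*q \<le> q\<^sup>2*1" using N N1 by (simp add: power2_eq_square mult_right_mono)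
  also have "... \<le> q\<^sup>2*(2*L)" using L by (intro mult_left_mono) auto
  finally show "N*q \<le> q\<^sup>2*(2*L)" .
 qed
 also have "... = 3*(q\<^sup>2*L)" by simp
 finally have nl: "N\<^sup>2*l \<le> 3*(q\<^sup>2*L)" .
 have l0: "l \<ge> 0" unfolding l_def by simp
 let ?A = "q powr (4/11)*L powr (2/11)"
 have "(N\<^sup>2*l) powr (2/11) \<le> (3*(q\<^sup>2*L)) powr (2/11)" using nl l0 N1 by (intro powr_mono2) auto
 moreover have "(N\<^sup>2*l) powr (2/11) = N powr (4/11)*l powr (2/11)" using N1 l0 powr_powr[of N 2 "2/11"] by (simp add: powr_mult)
 moreover have "(3*(q\<^sup>2*L)) powr (2/11) = 3 powr (2/11)*?A" using N1 L powr_powr[of q 2 "2/11"] by (simp add: powr_mult)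
 moreover have "3 powr (2/11) \<le> (2::real)"
 proof -
  have "3 powr (2/11) \<le> (32 :: real) powr (2/11)" by (intro powr_mono2) auto
  also have "... \<le> 32 powr (1/5)" by (intro powr_mono) auto
  also have "... = 2" using powr_powr[of 2 5 "1/5"] by simp
  finally show ?thesis .
 qed
 ultimately have "N powr (4/11)*l powr (2/11) \<le> 2*?A" using mult_right_mono[of "3 powr (2/11)" 2 "q powr (4/11)*L powr (2/11)"] by simp
 then have "(M powr (6/11)*N powr (5/11))*(N powr (4/11)*l powr (2/11)) \<le> (M powr (6/11)*N powr (5/11))*(2*?A)" by (intro mult_left_mono) auto
 moreover have "N powr (9/11) = N powr (5/11)*N powr (4/11)" using N1 by (simp add: powr_add[symmetric])
 ultimately show ?thesis unfolding l_def[symmetric] L_def[symmetric] by (simp add: mult_ac)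
qed simp

lemma sum_card_fibres:
 assumes "finite P" "finite T"
 shows "(\<Sum>S\<in>T. card {p \<in> P. f p = S \<and> Q p S}) \<le> card P"
proof -
 have "(\<Sum>S\<in>T. card {p \<in> P. f p = S \<and> Q p S}) = card (\<Union>S\<in>T. {p \<in> P. f p = S \<and> Q p S})"
  using assms by (intro card_UN_disjoint[symmetric]) auto
 also have "... \<le> card P" using assms by (intro card_mono) auto
 finally show ?thesis .
qed

text \<open>The exponents of \<open>planar_bound\<close> add up to more than 1. Splitting off
  \<open>N powr (1/3)\<close> and \<open>N powr (4/11)\<close>, which are bounded by powers of
  \<open>q\<close>, leaves exponents 2/3 + 1/3 and 6/11 + 5/11, to which Hoelder's inequality
  applies.\<close>

lemma sum_planar_bound:
 fixes M N :: "'s => nat"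
 assumes T: "finite T" and M: "(\<Sum>S\<in>T. M S) \<le> m" and N: "(\<Sum>S\<in>T. N S) \<le> n" and q: "!!S. S \<in> T ==> N S \<le> q"
 shows "(\<Sum>S\<in>T. planar_bound (real (M S)) (real (N S))) \<le> 2*incidence_bound (real m) (real n) (real q)"
proof -
 have Ms: "(\<Sum>S\<in>T. real (M S)) \<le> real m" "(\<Sum>S\<in>T. real (N S)) \<le> real n" using M N by (simp_all flip: of_nat_sum)
 have h: "(\<Sum>S\<in>T. real (M S) powr a*real (N S) powr b) \<le> real m powr a*real n powr b" if ab: "a > 0" "b > 0" "a + b = 1" for a b
 proof -
  have "(\<Sum>S\<in>T. real (M S) powr a*real (N S) powr b) \<le> (\<Sum>S\<in>T. real (M S)) powr a*(\<Sum>S\<in>T. real (N S)) powr b"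
   using T ab by (intro Holder_sum) auto
  also have "... \<le> real m powr a*real n powr b" using Ms ab by (intro mult_mono powr_mono2 sum_nonneg) auto
  finally show ?thesis .
 qed
 define L where "L = ln (max 2 (real m^3/real q)) powr (2/11)"
 have "planar_bound (real (M S)) (real (N S)) \<le> real (N S) + real (M S) + real q powr (1/3)*(real (M S) powr (2/3)*real (N S) powr (1/3))
   + 2*real q powr (4/11)*L*(real (M S) powr (6/11)*real (N S) powr (5/11))" if S: "S \<in> T" for S
 proof -
  have "M S \<le> m" using member_le_sum[of S T M] S T M by simp
  then have "real (M S) powr (6/11)*real (N S) powr (9/11)*ln (max 2 (real (M S)^3/real (N S))) powr (2/11)
   \<le> 2*real q powr (4/11)*L*(real (M S) powr (6/11)*real (N S) powr (5/11))"
   unfolding L_def using q[OF S] by (intro logarithmic_term) auto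
  moreover have "real (M S) powr (2/3)*real (N S) powr (2/3) \<le> real q powr (1/3)*(real (M S) powr (2/3)*real (N S) powr (1/3))"
  proof -
   have "real (N S) powr (2/3) = real (N S) powr (1/3)*real (N S) powr (1/3)" by (simp add: powr_add[symmetric])
   also have "... \<le> real q powr (1/3)*real (N S) powr (1/3)" using q[OF S] by (intro mult_right_mono powr_mono2) auto
   finally have "real (M S) powr (2/3)*real (N S) powr (2/3) \<le> real (M S) powr (2/3)*(real q powr (1/3)*real (N S) powr (1/3))" by (intro mult_left_mono) auto
   then show ?thesis by (simp add: mult_ac)
  qed
  ultimately show ?thesis unfolding planar_bound_def by linarith
 qed
 then have "(\<Sum>S\<in>T. planar_bound (real (M S)) (real (N S))) \<le> (\<Sum>S\<in>T. real (N S) + real (M S)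
   + real q powr (1/3)*(real (M S) powr (2/3)*real (N S) powr (1/3)) + 2*real q powr (4/11)*L*(real (M S) powr (6/11)*real (N S) powr (5/11)))"
  by (rule sum_mono)
 also have "... = (\<Sum>S\<in>T. real (N S)) + (\<Sum>S\<in>T. real (M S)) + real q powr (1/3)*(\<Sum>S\<in>T. real (M S) powr (2/3)*real (N S) powr (1/3))
   + 2*real q powr (4/11)*L*(\<Sum>S\<in>T. real (M S) powr (6/11)*real (N S) powr (5/11))"
  unfolding sum.distrib sum_distrib_left ..
 also have "... \<le> real n + real m + real q powr (1/3)*(real m powr (2/3)*real n powr (1/3)) + 2*real q powr (4/11)*L*(real m powr (6/11)*real n powr (5/11))"
  using Ms h by (intro add_mono mult_left_mono) (auto simp: L_def)
 also have "... \<le> 2*incidence_bound (real m) (real n) (real q)"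
 proof -
  have g: "n' + m' + x*(y*z) + 2*u*L*(v * w) \<le> 2*(s + y*z*x + v * w*u*L + m' + n')"
   if "s \<ge> 0" "n' \<ge> 0" "m' \<ge> 0" "y*z*x \<ge> 0" for n' m' x y z u v w s :: real
   using that by (simp add: mult_ac)
  show ?thesis unfolding incidence_bound_def L_def[symmetric] by (rule g) simp_all
 qed
 finally show ?thesis .
qed

theorem theorem1p6:
 shows "\<exists>K::real. \<forall>(P :: (real^3) set) (C :: (real^3) set set) (m::nat) (n::nat) (q::nat).
  finite P \<and> card P = m \<and>
  finite C \<and> card C = n \<and> (\<forall>\<gamma>\<in>C. is_circle \<gamma>) \<and>
  q \<ge> 1 \<and>
  (\<forall>S. is_plane S \<or> is_sphere S \<longrightarrow> card {\<gamma> \<in> C. \<gamma> \<subseteq> S} \<le> q)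
  \<longrightarrow> real (incidences P C) \<le> K * incidence_bound (real m) (real n) (real q)"
proof -
 obtain A where A: "A > 0" "!!P C D. [|finite P; finite C; !!\<gamma>. \<gamma> \<in> C ==> is_circle \<gamma>; D \<ge> (1::real)|] ==>
  \<exists>Inc \<sigma> \<tau>. (surface_flags P C Inc \<sigma> \<tau>) \<and>
   real (card ((flags P C) - Inc)) \<le> A*(D*real (card C) + real (card P) + real (card P)^3/D^6)"
 proof (rule space_reduction, goal_cases)
  case (1 K)
  show ?case by (rule that[OF 1(2)]) (rule 1(3), blast+)
 qed
 obtain B where B: "B > 0" "!!S P C. [|is_plane S \<or> is_sphere S; finite P; P \<subseteq> S; finite C; !!\<gamma>. \<gamma> \<in> C ==> is_circle \<gamma> \<and> \<gamma> \<subseteq> S|] ==>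
  real (card (flags P C)) \<le> B*planar_bound (real (card P)) (real (card C))"
 proof (rule surface_incidence_bound, goal_cases)
  case (1 K)
  show ?case by (rule that[OF 1(2)]) (rule 1(3), blast+)
 qed
 have "real (incidences P C) \<le> (2*A + 2*B)*incidence_bound (real (card P)) (real (card C)) (real q)"
  if P: "finite P" and C: "finite C" "\<forall>\<gamma>\<in>C. is_circle \<gamma>" and q: "\<forall>S. is_plane S \<or> is_sphere S --> card {\<gamma> \<in> C. \<gamma> \<subseteq> S} \<le> q"
  for P :: "(real^3) set" and C :: "(real^3) set set" and q :: nat
 proof (cases "P = {} \<or> C = {}")
  case True
  then show ?thesis using A(1) B(1) by (auto simp: incidences_def incidence_bound_def)
 next
  case False
  then have c: "real (card C) \<ge> 1" "real (card P) \<ge> 1" using P C by (simp_all add: Suc_le_eq card_gt_0_iff)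
  define I where "I = (flags P C)"
  have Ifin: "finite I" using P C(1) unfolding I_def by (rule finite_subset[rotated, OF finite_cartesian_product]) auto
  obtain D where D: "D \<ge> 1" and Dle: "D*real (card C) + real (card P) + real (card P)^3/D^6
    \<le> 2*(real (card P) powr (3/7)*real (card C) powr (6/7)) + real (card P) + real (card C)"
   using space_parameter[OF c] by blast
  have Cc: "is_circle \<gamma>" if "\<gamma> \<in> C" for \<gamma> using C(2) that by blast
  have "\<exists>Inc \<sigma> \<tau>. (surface_flags P C Inc \<sigma> \<tau>) \<and>
   real (card ((flags P C) - Inc)) \<le> A*(D*real (card C) + real (card P) + real (card P)^3/D^6)"
   by (rule A(2)[OF P C(1) _ D]) (rule Cc)
  then obtain Inc \<sigma> \<tau> where
   Inc0: "(surface_flags P C Inc \<sigma> \<tau>) \<and>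
    real (card ((flags P C) - Inc)) \<le> A*(D*real (card C) + real (card P) + real (card P)^3/D^6)"
   by (elim exE) (rule that)
  note Inc = conjunct1[OF Inc0, rule_format] and rest = conjunct2[OF Inc0, folded I_def]
  have IncI: "Inc \<subseteq> I"
  proof (rule subrelI)
   fix p \<gamma> assume "(p, \<gamma>) \<in> Inc"
   from Inc[OF this] show "(p, \<gamma>) \<in> I" by (simp add: I_def)
  qed
  \<comment> \<open>Surfaces are indexed by the values of \<open>\<tau>\<close>. Each point and each
    circle belongs to the group of its own surface only, so the group sizes add up to at most
    \<open>card P\<close> and \<open>card C\<close>.\<close>
  define T where "T = {S \<in> \<tau> ` C. is_plane S \<or> is_sphere S}"
  have T: "finite T" using C(1) by (simp add: T_def)
  define Pg where "Pg S = {p \<in> P. \<sigma> p = S \<and> p \<in> S}" for S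
  define Cg where "Cg S = {\<gamma> \<in> C. \<tau> \<gamma> = S \<and> \<gamma> \<subseteq> S}" for S
  define J where "J S = {(p, \<gamma>) \<in> Pg S\<times>Cg S. p \<in> \<gamma>}" for S
  have fin: "finite (Pg S)" "finite (Cg S)" for S using P C(1) by (simp_all add: Pg_def Cg_def)
  have JI: "J S \<subseteq> I" for S unfolding J_def I_def Pg_def Cg_def by blast
  have "Inc \<subseteq> (\<Union>S\<in>T. J S)"
  proof (rule subrelI)
   fix p \<gamma> assume "(p, \<gamma>) \<in> Inc"
   note i = Inc[OF this]
   have "p \<in> \<tau> \<gamma>" using i by blast
   then have "\<tau> \<gamma> \<in> T" "(p, \<gamma>) \<in> J (\<tau> \<gamma>)" using i by (simp_all add: T_def J_def Pg_def Cg_def)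
   then show "(p, \<gamma>) \<in> (\<Union>S\<in>T. J S)" by blast
  qed
  then have "card Inc \<le> card (\<Union>S\<in>T. J S)" using T Ifin JI by (intro card_mono finite_UN_I) (auto intro: rev_finite_subset)
  also have "... \<le> (\<Sum>S\<in>T. card (J S))" by (rule card_UN_le[OF T])
  finally have "real (card Inc) \<le> (\<Sum>S\<in>T. real (card (J S)))" by (simp flip: of_nat_sum)
  also have "... \<le> (\<Sum>S\<in>T. B*planar_bound (real (card (Pg S))) (real (card (Cg S))))"
  proof (rule sum_mono)
   fix S assume "S \<in> T"
   then have S: "is_plane S \<or> is_sphere S" by (simp add: T_def)
   show "real (card (J S)) \<le> B*planar_bound (real (card (Pg S))) (real (card (Cg S)))" unfolding J_def
    by (rule B(2)[OF S fin(1) _ fin(2)]) (use Cc in \<open>auto simp: Pg_def Cg_def\<close>)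
  qed
  also have "... = B*(\<Sum>S\<in>T. planar_bound (real (card (Pg S))) (real (card (Cg S))))" by (simp add: sum_distrib_left)
  also have "... \<le> B*(2*incidence_bound (real (card P)) (real (card C)) (real q))"
  proof (rule mult_left_mono)
   show "(\<Sum>S\<in>T. planar_bound (real (card (Pg S))) (real (card (Cg S)))) \<le> 2*incidence_bound (real (card P)) (real (card C)) (real q)"
   proof (rule sum_planar_bound[OF T])
    show "(\<Sum>S\<in>T. card (Pg S)) \<le> card P" unfolding Pg_def by (rule sum_card_fibres[OF P T])
    show "(\<Sum>S\<in>T. card (Cg S)) \<le> card C" unfolding Cg_def by (rule sum_card_fibres[OF C(1) T])
    fix S assume S: "S \<in> T"
    have "card (Cg S) \<le> card {\<gamma> \<in> C. \<gamma> \<subseteq> S}" using C(1) by (intro card_mono) (auto simp: Cg_def)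
    then show "card (Cg S) \<le> q" using q S unfolding T_def by (blast intro: order_trans)
   qed
  qed (use B(1) in simp)
  finally have 1: "real (card Inc) \<le> 2*B*incidence_bound (real (card P)) (real (card C)) (real q)" by simp
  have "A*(D*real (card C) + real (card P) + real (card P)^3/D^6) \<le> A*(2*incidence_bound (real (card P)) (real (card C)) (real q))"
  proof (rule mult_left_mono[OF order_trans[OF Dle]])
   have g: "2 * s + m' + n' \<le> 2*(s + x + y + m' + n')" if "s \<ge> 0" "n' \<ge> 0" "m' \<ge> 0" "x \<ge> 0" "y \<ge> 0" for n' m' x y s :: real
    using that by simp
   show "2*(real (card P) powr (3/7)*real (card C) powr (6/7)) + real (card P) + real (card C) \<le> 2*incidence_bound (real (card P)) (real (card C)) (real q)"
    unfolding incidence_bound_def by (rule g) simp_all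
  qed (use A(1) in simp)
  then have 2: "real (card (I - Inc)) \<le> 2*A*incidence_bound (real (card P)) (real (card C)) (real q)" using rest by simp
  have "I = (I - Inc)\<union>Inc" using IncI by blast
  then have "card I \<le> card (I - Inc) + card Inc" using card_Un_le[of "I - Inc" Inc] by simp
  then have "real (card I) \<le> real (card (I - Inc)) + real (card Inc)" by linarith
  then show ?thesis using 1 2 unfolding incidences_def I_def[symmetric] by (simp add: distrib_right)
 qed
 then show ?thesis by blast
qed

end
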